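(* Let $(\alpha,\beta)$ and $(\tilde\alpha,\tilde\beta)$ be Thoma parameters and let $\lambda,\tilde\lambda$ be Young diagrams. Suppose $\sum\alpha_i+\sum\beta_i=1$. Then the representations $\Pi_{\alpha\beta}^\lambda$ and $\Pi_{\tilde\alpha\tilde\beta}^{\tilde\lambda}$ of $\mathfrak{S}_{\mathbb{N}}$ are quasi-equivalent if and only if $\alpha_i=\tilde\alpha_i$ and $\beta_i=\tilde\beta_i$ for all $i$, and $\lambda=\tilde\lambda$.
   Context: $\mathfrak{S}_{\mathbb{N}}$ is the (discrete) group of all finite permutations of $\mathbb{N}=\{1,2,\dots\}$; $\mathfrak{S}_n$ is the subgroup of elements fixing every $i>n$; $\mathfrak{S}_{\mathbb{N}\setminus n}$ is the subgroup of elements fixing $1,2,\dots,n$ ($\mathfrak{S}_{\mathbb{N}\setminus0}=\mathfrak{S}_{\mathbb{N}}$). $\mathfrak{S}_n\mathfrak{S}_{\mathbb{N}\setminus n}\cong\mathfrak{S}_n\times\mathfrak{S}_{\mathbb{N}\setminus n}$. Thoma parameters are pairs of sequences $\alpha_1\ge\alpha_2\ge\dots\ge0$, $\beta_1\ge\beta_2\ge\dots\ge0$ with $\sum\alpha_i+\sum\beta_i\le1$; the corresponding Thoma character is $\chi_{\alpha\,\beta}(s)=\prod_{c}\left(\sum_i\alpha_i^{|c|}+(-1)^{|c|-1}\sum_i\beta_i^{|c|}\right)$, the product being over the nontrivial cycles $c$ of $s$, with $|c|$ the length of $c$; by cycle structure this also defines a character of $\mathfrak{S}_{\mathbb{N}\setminus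 n}$. For a Young diagram $\lambda\vdash n$, $T_\lambda$ is the corresponding irreducible representation of $\mathfrak{S}_n$, $\pi_{\alpha\beta}$ is the GNS representation of $\mathfrak{S}_{\mathbb{N}\setminus n}$ corresponding to $\chi_{\alpha\,\beta}$, and $\Pi_{\alpha\beta}^\lambda={\rm Ind}_{\mathfrak{S}_n\mathfrak{S}_{\mathbb{N}\setminus n}}^{\mathfrak{S}_{\mathbb{N}}}T_\lambda\otimes\pi_{\alpha\beta}$ (unitarily induced representation). The diagrams $\lambda$ and $\tilde\lambda$ may have different numbers of boxes. *)

theory Defs
  imports "HOL-Analysis.Analysis" "HOL-Combinatorics.Combinatorics"
begin

section \<open>Finite permutations\<close>

text \<open>Permutations of a set \<open>X\<close> of natural numbers are total functions fixing everything
  outside \<open>X\<close>, so that subgroups of the group of finite permutations are literally subsets.\<close>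

definition finsym :: "nat set \<Rightarrow> (nat \<Rightarrow> nat) set" where
  "finsym X = {p. p permutes X \<and> finite {i. p i \<noteq> i}}"

abbreviation SN :: "(nat \<Rightarrow> nat) set" where "SN \<equiv> finsym {1..}"

abbreviation Sfin :: "nat \<Rightarrow> (nat \<Rightarrow> nat) set" where "Sfin n \<equiv> finsym {1..n}"

abbreviation Scofin :: "nat \<Rightarrow> (nat \<Rightarrow> nat) set" where "Scofin n \<equiv> finsym {n<..}"

definition young_subgroup :: "nat \<Rightarrow> (nat \<Rightarrow> nat) set" where
  "young_subgroup n = {s \<circ> t | s t. s \<in> Sfin n \<and> t \<in> Scofin n}"

text \<open>For \<open>g = s \<circ> t\<close> in \<open>young_subgroup n\<close>, the factors are
  \<open>s = perm_part {1..n} g\<close> and \<open>t = perm_part {n<..} g\<close>.\<close>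

definition perm_part :: "nat set \<Rightarrow> (nat \<Rightarrow> nat) \<Rightarrow> nat \<Rightarrow> nat" where
  "perm_part X g = (\<lambda>i. if i \<in> X then g i else i)"


section \<open>Unitary representations on Hilbert spaces of functions\<close>

text \<open>All Hilbert spaces occurring below consist of complex functions on some set, with pointwise
  linear structure. Inner products are linear in the first argument. \<open>inprod\<close> and \<open>act\<close> are
  meaningful only on \<open>hspace\<close>.\<close>

record ('g, 'x) urep =
  hspace :: "('x \<Rightarrow> complex) set"
  inprod :: "('x \<Rightarrow> complex) \<Rightarrow> ('x \<Rightarrow> complex) \<Rightarrow> complex"
  act :: "'g \<Rightarrow> ('x \<Rightarrow> complex) \<Rightarrow> ('x \<Rightarrow> complex)"

definition hnorm :: "('g, 'x) urep \<Rightarrow> ('x \<Rightarrow> complex) \<Rightarrow> real" where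
  "hnorm R v = sqrt (Re (inprod R v v))"

type_synonym 'x oper = "('x \<Rightarrow> complex) \<Rightarrow> ('x \<Rightarrow> complex)"

text \<open>Operators are \<open>extensional\<close>, so that equality of operators is equality on the Hilbert space.\<close>

definition bounded_ops :: "('g, 'x) urep \<Rightarrow> 'x oper set" where
  "bounded_ops R = {T \<in> hspace R \<rightarrow>\<^sub>E hspace R.
     (\<forall>u\<in>hspace R. \<forall>v\<in>hspace R. T (\<lambda>x. u x + v x) = (\<lambda>x. T u x + T v x)) \<and>
     (\<forall>c. \<forall>v\<in>hspace R. T (\<lambda>x. c * v x) = (\<lambda>x. c * T v x)) \<and>
     (\<exists>K. \<forall>v\<in>hspace R. hnorm R (T v) \<le> K * hnorm R v)}"

definition is_adjoint :: "('g, 'x) urep \<Rightarrow> 'x oper \<Rightarrow> 'x oper \<Rightarrow> bool" where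
  "is_adjoint R A B \<longleftrightarrow>
     (\<forall>u\<in>hspace R. \<forall>v\<in>hspace R. inprod R (A u) v = inprod R u (B v))"

definition commutant :: "('g, 'x) urep \<Rightarrow> 'x oper set \<Rightarrow> 'x oper set" where
  "commutant R M = {T \<in> bounded_ops R. \<forall>A\<in>M. compose (hspace R) T A = compose (hspace R) A T}"

definition rep_op :: "('g, 'x) urep \<Rightarrow> 'g \<Rightarrow> 'x oper" where
  "rep_op R g = restrict (act R g) (hspace R)"

definition vn_algebra :: "'g set \<Rightarrow> ('g, 'x) urep \<Rightarrow> 'x oper set" where
  "vn_algebra G R = commutant R (commutant R (rep_op R ` G))"

definition op_add :: "('g, 'x) urep \<Rightarrow> 'x oper \<Rightarrow> 'x oper \<Rightarrow> 'x oper" where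
  "op_add R A B = (\<lambda>v\<in>hspace R. \<lambda>x. A v x + B v x)"

definition op_scale :: "('g, 'x) urep \<Rightarrow> complex \<Rightarrow> 'x oper \<Rightarrow> 'x oper" where
  "op_scale R c A = (\<lambda>v\<in>hspace R. \<lambda>x. c * A v x)"

text \<open>Quasi-equivalence: the correspondence of the operators of the two representations extends to a
  *-isomorphism of the generated von Neumann algebras (such an isomorphism is automatically normal).\<close>

definition vn_iso ::
  "('g, 'x) urep \<Rightarrow> ('g, 'y) urep \<Rightarrow> 'x oper set \<Rightarrow> 'y oper set \<Rightarrow> ('x oper \<Rightarrow> 'y oper) \<Rightarrow> bool"
where
  "vn_iso R R' M M' \<Phi> \<longleftrightarrow> bij_betw \<Phi> M M' \<and>
     (\<forall>A\<in>M. \<forall>B\<in>M. \<Phi> (op_add R A B) = op_add R' (\<Phi> A) (\<Phi> B)) \<and>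
     (\<forall>c. \<forall>A\<in>M. \<Phi> (op_scale R c A) = op_scale R' c (\<Phi> A)) \<and>
     (\<forall>A\<in>M. \<forall>B\<in>M. \<Phi> (compose (hspace R) A B) = compose (hspace R') (\<Phi> A) (\<Phi> B)) \<and>
     (\<forall>A\<in>M. \<forall>B\<in>M. is_adjoint R A B \<longrightarrow> is_adjoint R' (\<Phi> A) (\<Phi> B))"

definition quasi_equivalent :: "'g set \<Rightarrow> ('g, 'x) urep \<Rightarrow> ('g, 'y) urep \<Rightarrow> bool" where
  "quasi_equivalent G R R' \<longleftrightarrow>
     (\<exists>\<Phi>. vn_iso R R' (vn_algebra G R) (vn_algebra G R') \<Phi> \<and>
          (\<forall>g\<in>G. \<Phi> (rep_op R g) = rep_op R' g))"


section \<open>Thoma characters\<close>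

text \<open>Sequences are indexed from 0: \<open>\<alpha> i\<close> is the parameter usually written with index \<open>i + 1\<close>.\<close>

definition thoma_params :: "(nat \<Rightarrow> real) \<Rightarrow> (nat \<Rightarrow> real) \<Rightarrow> bool" where
  "thoma_params \<alpha> \<beta> \<longleftrightarrow> decseq \<alpha> \<and> decseq \<beta> \<and> (\<forall>i. 0 \<le> \<alpha> i) \<and> (\<forall>i. 0 \<le> \<beta> i) \<and>
     summable \<alpha> \<and> summable \<beta> \<and> (\<Sum>i. \<alpha> i) + (\<Sum>i. \<beta> i) \<le> 1"

text \<open>The nontrivial cycles of \<open>s\<close> are represented by their underlying sets.\<close>

definition thoma_character :: "(nat \<Rightarrow> real) \<Rightarrow> (nat \<Rightarrow> real) \<Rightarrow> (nat \<Rightarrow> nat) \<Rightarrow> complex" where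
  "thoma_character \<alpha> \<beta> s = complex_of_real (\<Prod>c \<in> orbit s ` {i. s i \<noteq> i}.
     (\<Sum>i. \<alpha> i ^ card c) + (-1) ^ (card c - 1) * (\<Sum>i. \<beta> i ^ card c))"


section \<open>The GNS representation of a positive definite function\<close>

definition group_algebra :: "(nat \<Rightarrow> nat) set \<Rightarrow> ((nat \<Rightarrow> nat) \<Rightarrow> complex) set" where
  "group_algebra S = {f. finite {s. f s \<noteq> 0} \<and> {s. f s \<noteq> 0} \<subseteq> S}"

definition gns_form :: "((nat \<Rightarrow> nat) \<Rightarrow> complex) \<Rightarrow>
    ((nat \<Rightarrow> nat) \<Rightarrow> complex) \<Rightarrow> ((nat \<Rightarrow> nat) \<Rightarrow> complex) \<Rightarrow> complex" where
  "gns_form \<phi> f h =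
     (\<Sum>s | f s \<noteq> 0. \<Sum>t | h t \<noteq> 0. f s * cnj (h t) * \<phi> (inv t \<circ> s))"

definition gns_cauchy :: "(nat \<Rightarrow> nat) set \<Rightarrow> ((nat \<Rightarrow> nat) \<Rightarrow> complex) \<Rightarrow>
    (nat \<Rightarrow> (nat \<Rightarrow> nat) \<Rightarrow> complex) set" where
  "gns_cauchy S \<phi> = {X. (\<forall>n. X n \<in> group_algebra S) \<and>
     (\<forall>e>0. \<exists>N. \<forall>m\<ge>N. \<forall>n\<ge>N.
        Re (gns_form \<phi> (\<lambda>s. X m s - X n s) (\<lambda>s. X m s - X n s)) < e)}"

text \<open>The GNS space is the completion of the group algebra modulo the null vectors of
  \<open>gns_form \<phi>\<close>. The element of the completion given by a Cauchy sequence \<open>X\<close> is encoded by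
  its inner products with the images of the group elements \<open>g \<in> S\<close>; these images span a dense
  subspace, so two Cauchy sequences have the same code iff their difference tends to 0 in the
  seminorm. In this encoding the cyclic vector is \<open>g \<mapsto> \<phi> (inv g)\<close> on \<open>S\<close>, and left
  multiplication in the group algebra becomes left translation of codes.\<close>

definition gns_point :: "(nat \<Rightarrow> nat) set \<Rightarrow> ((nat \<Rightarrow> nat) \<Rightarrow> complex) \<Rightarrow>
    (nat \<Rightarrow> (nat \<Rightarrow> nat) \<Rightarrow> complex) \<Rightarrow> (nat \<Rightarrow> nat) \<Rightarrow> complex" where
  "gns_point S \<phi> X = (\<lambda>g. if g \<in> S
     then lim (\<lambda>n. gns_form \<phi> (X n) (\<lambda>t. if t = g then 1 else 0)) else 0)"

definition gns_approx :: "(nat \<Rightarrow> nat) set \<Rightarrow> ((nat \<Rightarrow> nat) \<Rightarrow> complex) \<Rightarrow>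
    ((nat \<Rightarrow> nat) \<Rightarrow> complex) \<Rightarrow> nat \<Rightarrow> (nat \<Rightarrow> nat) \<Rightarrow> complex" where
  "gns_approx S \<phi> v = (SOME X. X \<in> gns_cauchy S \<phi> \<and> gns_point S \<phi> X = v)"

definition gns_rep :: "(nat \<Rightarrow> nat) set \<Rightarrow> ((nat \<Rightarrow> nat) \<Rightarrow> complex) \<Rightarrow>
    (nat \<Rightarrow> nat, nat \<Rightarrow> nat) urep" where
  "gns_rep S \<phi> = \<lparr>
     hspace = gns_point S \<phi> ` gns_cauchy S \<phi>,
     inprod = (\<lambda>v w. lim (\<lambda>n. gns_form \<phi> (gns_approx S \<phi> v n) (gns_approx S \<phi> w n))),
     act = (\<lambda>s v g. v (inv s \<circ> g))\<rparr>"


section \<open>Irreducible representations of the finite symmetric groups\<close>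

definition is_young :: "nat list \<Rightarrow> bool" where
  "is_young la \<longleftrightarrow> sorted_wrt (\<ge>) la \<and> 0 \<notin> set la"

text \<open>Boxes are pairs (row, column) counted from 0; \<open>entry la\<close> is the standard tableau filled with
  1, 2, ... row by row.\<close>

definition boxes :: "nat list \<Rightarrow> (nat \<times> nat) set" where
  "boxes la = {(r, c). r < length la \<and> c < la ! r}"

definition entry :: "nat list \<Rightarrow> nat \<times> nat \<Rightarrow> nat" where
  "entry la = (\<lambda>(r, c). sum_list (take r la) + c + 1)"

definition row_group :: "nat list \<Rightarrow> (nat \<Rightarrow> nat) set" where
  "row_group la = {p \<in> Sfin (sum_list la).
     \<forall>(r, c)\<in>boxes la. \<exists>c'. (r, c') \<in> boxes la \<and> p (entry la (r, c)) = entry la (r, c')}"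

definition column_group :: "nat list \<Rightarrow> (nat \<Rightarrow> nat) set" where
  "column_group la = {p \<in> Sfin (sum_list la).
     \<forall>(r, c)\<in>boxes la. \<exists>r'. (r', c) \<in> boxes la \<and> p (entry la (r, c)) = entry la (r', c)}"

definition young_symmetrizer :: "nat list \<Rightarrow> (nat \<Rightarrow> nat) \<Rightarrow> complex" where
  "young_symmetrizer la = (\<lambda>s. \<Sum>(p, q) \<in> row_group la \<times> column_group la.
     if s = p \<circ> q then of_int (sign q) else 0)"

definition convolution :: "nat \<Rightarrow> ((nat \<Rightarrow> nat) \<Rightarrow> complex) \<Rightarrow>
    ((nat \<Rightarrow> nat) \<Rightarrow> complex) \<Rightarrow> (nat \<Rightarrow> nat) \<Rightarrow> complex" where
  "convolution n f h = (\<lambda>t. \<Sum>s\<in>Sfin n. f s * h (inv s \<circ> t))"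

text \<open>The left ideal of the group algebra generated by the Young symmetrizer, with the invariant
  inner product inherited from the \<open>\<ell>\<^sup>2\<close> space of the finite group.\<close>

definition young_rep :: "nat list \<Rightarrow> (nat \<Rightarrow> nat, nat \<Rightarrow> nat) urep" where
  "young_rep la = (let n = sum_list la in \<lparr>
     hspace = {convolution n f (young_symmetrizer la) | f. f \<in> group_algebra (Sfin n)},
     inprod = (\<lambda>u v. \<Sum>s\<in>Sfin n. u s * cnj (v s)),
     act = (\<lambda>s u t. u (inv s \<circ> t))\<rparr>)"


section \<open>Tensor products and induction\<close>

text \<open>Tensor product with a finite-dimensional space of functions on a finite set \<open>A\<close>, carrying the
  \<open>\<ell>\<^sup>2\<close> inner product of \<open>A\<close>. The algebraic tensor product is then complete, \<open>f \<otimes> h\<close> is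
  \<open>\<lambda>(x, y). f x * h y\<close>, and tensors are functions from \<open>A\<close> to the second space.\<close>

definition tensor_rep :: "'x set \<Rightarrow> ('k \<Rightarrow> 'g) \<Rightarrow> ('g, 'x) urep \<Rightarrow> ('k \<Rightarrow> 'h) \<Rightarrow> ('h, 'y) urep \<Rightarrow>
    ('k, 'x \<times> 'y) urep" where
  "tensor_rep A pr1 R1 pr2 R2 = \<lparr>
     hspace = {(\<lambda>(x, y). \<Sum>i<k. f i x * h i y) | (k::nat) f h.
                 \<forall>i<k. f i \<in> hspace R1 \<and> h i \<in> hspace R2},
     inprod = (\<lambda>u v. \<Sum>x\<in>A. inprod R2 (\<lambda>y. u (x, y)) (\<lambda>y. v (x, y))),
     act = (\<lambda>g u (x, y).
              act R2 (pr2 g) (\<lambda>y'. act R1 (pr1 g) (\<lambda>x'. u (x', y')) x) y)\<rparr>"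

definition left_cosets :: "('a \<Rightarrow> 'a) set \<Rightarrow> ('a \<Rightarrow> 'a) set \<Rightarrow> ('a \<Rightarrow> 'a) set set" where
  "left_cosets G H = (\<lambda>g. (\<circ>) g ` H) ` G"

text \<open>Unitary induction from a subgroup \<open>H\<close> of the discrete permutation group \<open>G\<close>: the space
  consists of the functions \<open>F\<close> from \<open>G\<close> to the space of \<open>R\<close> with
  \<open>F (g \<circ> k) = act R (inv k) (F g)\<close> for \<open>k \<in> H\<close> and square summable norm over \<open>G / H\<close>.
  Functions of two variables are uncurried, and the norms and inner products of values do not depend
  on the chosen coset representatives.\<close>

definition induced_rep :: "('a \<Rightarrow> 'a) set \<Rightarrow> ('a \<Rightarrow> 'a) set \<Rightarrow> ('a \<Rightarrow> 'a, 'x) urep \<Rightarrow>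
    ('a \<Rightarrow> 'a, ('a \<Rightarrow> 'a) \<times> 'x) urep" where
  "induced_rep G H R = \<lparr>
     hspace = {F. (\<forall>g\<in>G. (\<lambda>x. F (g, x)) \<in> hspace R) \<and>
                  (\<forall>g x. g \<notin> G \<longrightarrow> F (g, x) = 0) \<and>
                  (\<forall>g\<in>G. \<forall>k\<in>H. (\<lambda>x. F (g \<circ> k, x)) = act R (inv k) (\<lambda>x. F (g, x))) \<and>
                  (\<lambda>C. (hnorm R (\<lambda>x. F (SOME g. g \<in> C, x)))\<^sup>2) summable_on left_cosets G H},
     inprod = (\<lambda>F F'. \<Sum>\<^sub>\<infinity>C\<in>left_cosets G H.
                  inprod R (\<lambda>x. F (SOME g. g \<in> C, x)) (\<lambda>x. F' (SOME g. g \<in> C, x))),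
     act = (\<lambda>s F (g, x). F (inv s \<circ> g, x))\<rparr>"

definition Pi_rep :: "nat list \<Rightarrow> (nat \<Rightarrow> real) \<Rightarrow> (nat \<Rightarrow> real) \<Rightarrow>
    (nat \<Rightarrow> nat, (nat \<Rightarrow> nat) \<times> (nat \<Rightarrow> nat) \<times> (nat \<Rightarrow> nat)) urep" where
  "Pi_rep la \<alpha> \<beta> = (let n = sum_list la in
     induced_rep SN (young_subgroup n)
       (tensor_rep (Sfin n)
          (perm_part {1..n}) (young_rep la)
          (perm_part {n<..}) (gns_rep (Scofin n) (thoma_character \<alpha> \<beta>))))"

end

theory Submission
  imports Defs "HOL-Library.Function_Algebras"
begin

text \<open>
  Let \<open>Y\<^sub>k\<close> be elements of the group algebra and \<open>v \<noteq> 0\<close> a vector of one representation with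
  \<open>\<Sum>k. \<parallel>Y\<^sub>k v\<parallel>\<^sup>2 < \<infinity>\<close>. Then \<open>T = (1 + \<Sum>k. Y\<^sub>k\<^sup>* Y\<^sub>k)\<^sup>-\<^sup>1\<close> is a nonzero operator of the von Neumann
  algebra with \<open>\<parallel>Y\<^sub>k T\<parallel> \<le> 1\<close>, so a quasi-equivalent representation contains some \<open>w \<noteq> 0\<close> with
  \<open>\<parallel>Y\<^sub>k w\<parallel>\<close> bounded in \<open>k\<close>. This is applied to the vector of the induced representation
  that is supported on the identity coset, where it is the Young symmetrizer tensored with the cyclic
  vector.

  With \<open>Y\<^sub>k\<close> a multiple of an average of \<open>8 ^ k\<close> disjoint far away \<open>l\<close>-cycles minus its mean
  \<open>p\<^sub>l = \<Sum>i. \<alpha>\<^sub>i\<^sup>l \<plusminus> \<beta>\<^sub>i\<^sup>l\<close> one finds that both representations have the same \<open>p\<^sub>l\<close> for all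
  \<open>l \<ge> 2\<close>, and these moments determine the parameters.

  Next let \<open>Y\<^sub>k\<close> be a multiple of an average of \<open>8 ^ k\<close> far away transpositions \<open>(a j)\<close>. It tends to 0 on
  the identity coset for \<open>a \<le> n\<close>, since the \<open>(a j)\<close> lie in different cosets of the Young subgroup, whereas
  for \<open>a > n\<close> its limit is the Okounkov operator of \<open>a\<close>, which is injective because the parameters sum
  to 1. Hence \<open>n\<close> is at most the number of boxes of the other diagram. If the numbers are equal, \<open>w\<close>
  can moreover be chosen invariant under the row group of \<open>\<lambda>\<close>, so the other diagram dominates \<open>\<lambda>\<close>.
  By symmetry the diagrams coincide.
\<close>

section \<open>Hilbert spaces of functions\<close>

text \<open>The isomorphism carries neither vectors nor limits of operators. The proof transports
  only algebraic identities and, through resolvents, the bound 1 on operator norms; this is why a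
  summability condition at one vector is first turned into uniform bounds on the products of all the
  \<open>Y\<close>s with a single operator \<open>T\<close>. The averages run off to infinity
  because a vector of the induced representation is studied through its value at one fixed
  \<open>g\<close>. Beyond the finite support of \<open>g\<close>, conjugation by \<open>g\<close>
  changes at most the point \<open>a\<close>, and the elements then act on that value through the
  infinite factor alone. The constants balance two demands. The character is multiplicative over
  disjoint cycles, and a product of two different transpositions \<open>(a j)\<close> leaves the
  Young subgroup, so after removal of the mean the \<open>8 ^ k\<close> terms are orthogonal and
  their average has squared norm of order \<open>1 / 8 ^ k\<close>. The factor \<open>2 ^ k\<close>
  multiplies this by \<open>4 ^ k\<close>, which leaves a convergent geometric series, while a bound
  on the amplified norms at \<open>w\<close> still forces the plain norms to 0.\<close>

definition smul :: "complex \<Rightarrow> ('x \<Rightarrow> complex) \<Rightarrow> 'x \<Rightarrow> complex" where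
  "smul c v = (\<lambda>x. c * v x)"

lemma smul_apply [simp]: "smul c v x = c * v x"
  by (simp add: smul_def)

lemma smul_one [simp]: "smul 1 v = v"
  by (simp add: fun_eq_iff)

lemma smul_zero [simp]: "smul 0 v = 0" "smul c 0 = 0"
  by (simp_all add: fun_eq_iff)

lemma smul_smul [simp]: "smul c (smul d v) = smul (c * d) v"
  by (simp add: fun_eq_iff)

lemma smul_add: "smul c (u + v) = smul c u + smul c v"
  by (simp add: fun_eq_iff algebra_simps)

lemma smul_diff: "smul c (u - v) = smul c u - smul c v"
  by (simp add: fun_eq_iff algebra_simps)

lemma smul_minus_one: "smul (-1) u = - u"
  by (simp add: fun_eq_iff)

lemma sum_fun_apply: "(\<Sum>i\<in>I. f i) x = (\<Sum>i\<in>I. f i x)" for f :: "'i \<Rightarrow> 'x \<Rightarrow> complex"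
  by (induction I rule: infinite_finite_induct) auto

section \<open>Possibly degenerate inner products on spaces of functions\<close>

locale semi_ip =
  fixes H :: "('x \<Rightarrow> complex) set" and ip :: "('x \<Rightarrow> complex) \<Rightarrow> ('x \<Rightarrow> complex) \<Rightarrow> complex"
  assumes zero_mem [simp, intro]: "0 \<in> H"
    and add_mem [simp, intro]: "u \<in> H \<Longrightarrow> v \<in> H \<Longrightarrow> u + v \<in> H"
    and smul_mem [simp, intro]: "u \<in> H \<Longrightarrow> smul c u \<in> H"
    and ip_add_left: "u \<in> H \<Longrightarrow> v \<in> H \<Longrightarrow> w \<in> H \<Longrightarrow> ip (u + v) w = ip u w + ip v w"
    and ip_smul_left: "u \<in> H \<Longrightarrow> v \<in> H \<Longrightarrow> ip (smul c u) v = c * ip u v"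
    and ip_sym: "u \<in> H \<Longrightarrow> v \<in> H \<Longrightarrow> ip v u = cnj (ip u v)"
    and ip_nonneg [simp]: "u \<in> H \<Longrightarrow> 0 \<le> Re (ip u u)"
begin

definition nrm :: "('x \<Rightarrow> complex) \<Rightarrow> real" where
  "nrm u = sqrt (Re (ip u u))"

lemma minus_mem [simp, intro]: "u \<in> H \<Longrightarrow> - u \<in> H"
  using smul_mem[of u "-1"] by (simp add: smul_minus_one)

lemma diff_mem [simp, intro]: "u \<in> H \<Longrightarrow> v \<in> H \<Longrightarrow> u - v \<in> H"
  using add_mem[of u "- v"] by simp

lemma sum_mem: "(\<And>i. i \<in> I \<Longrightarrow> f i \<in> H) \<Longrightarrow> (\<Sum>i\<in>I. f i) \<in> H"
  by (induction I rule: infinite_finite_induct) auto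

lemma ip_add_right: "u \<in> H \<Longrightarrow> v \<in> H \<Longrightarrow> w \<in> H \<Longrightarrow> ip w (u + v) = ip w u + ip w v"
  by (metis add_mem complex_cnj_add ip_add_left ip_sym)

lemma ip_smul_right: "u \<in> H \<Longrightarrow> v \<in> H \<Longrightarrow> ip v (smul c u) = cnj c * ip v u"
  by (metis complex_cnj_mult ip_smul_left ip_sym smul_mem)

lemma ip_minus_left: "u \<in> H \<Longrightarrow> w \<in> H \<Longrightarrow> ip (- u) w = - ip u w"
  using ip_smul_left[of u w "-1"] by (simp add: smul_minus_one)

lemma ip_minus_right: "u \<in> H \<Longrightarrow> w \<in> H \<Longrightarrow> ip w (- u) = - ip w u"
  using ip_smul_right[of u w "-1"] by (simp add: smul_minus_one)

lemma ip_diff_left: "u \<in> H \<Longrightarrow> v \<in> H \<Longrightarrow> w \<in> H \<Longrightarrow> ip (u - v) w = ip u w - ip v w"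
  using ip_add_left[of u "- v" w] by (simp add: ip_minus_left)

lemma ip_diff_right: "u \<in> H \<Longrightarrow> v \<in> H \<Longrightarrow> w \<in> H \<Longrightarrow> ip w (u - v) = ip w u - ip w v"
  using ip_add_right[of u "- v" w] by (simp add: ip_minus_right)

lemma ip_zero_left [simp]: "w \<in> H \<Longrightarrow> ip 0 w = 0"
  using ip_smul_left[of 0 w 0] by simp

lemma ip_zero_right [simp]: "w \<in> H \<Longrightarrow> ip w 0 = 0"
  using ip_smul_right[of 0 w 0] by simp

lemma ip_sum_left: "(\<And>i. i \<in> I \<Longrightarrow> f i \<in> H) \<Longrightarrow> w \<in> H \<Longrightarrow> ip (\<Sum>i\<in>I. f i) w = (\<Sum>i\<in>I. ip (f i) w)"
  by (induction I rule: infinite_finite_induct) (auto simp: ip_add_left sum_mem)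

lemma ip_sum_right: "(\<And>i. i \<in> I \<Longrightarrow> f i \<in> H) \<Longrightarrow> w \<in> H \<Longrightarrow> ip w (\<Sum>i\<in>I. f i) = (\<Sum>i\<in>I. ip w (f i))"
  by (induction I rule: infinite_finite_induct) (auto simp: ip_add_right sum_mem)

lemma nrm_sq: "u \<in> H \<Longrightarrow> (nrm u)\<^sup>2 = Re (ip u u)"
  by (simp add: nrm_def)

lemma nrm_nonneg [simp]: "u \<in> H \<Longrightarrow> 0 \<le> nrm u"
  by (simp add: nrm_def)

lemma nrm_zero [simp]: "nrm 0 = 0"
  by (simp add: nrm_def)

lemma nrm_smul: "u \<in> H \<Longrightarrow> nrm (smul c u) = cmod c * nrm u"
proof -
  assume u: "u \<in> H"
  have "ip (smul c u) (smul c u) = of_real ((cmod c)\<^sup>2) * ip u u"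
    using u by (simp add: ip_smul_left ip_smul_right complex_norm_square mult.assoc mult.left_commute
        del: of_real_power)
  then have "Re (ip (smul c u) (smul c u)) = (cmod c)\<^sup>2 * Re (ip u u)"
    by simp
  then show ?thesis
    by (simp add: nrm_def real_sqrt_mult)
qed

lemma nrm_minus: "u \<in> H \<Longrightarrow> nrm (- u) = nrm u"
  using nrm_smul[of u "-1"] by (simp add: smul_minus_one)

lemma nrm_diff_commute: "u \<in> H \<Longrightarrow> v \<in> H \<Longrightarrow> nrm (u - v) = nrm (v - u)"
  using nrm_minus[of "u - v"] by simp

lemma nrm_sq_add:
  assumes "u \<in> H" "v \<in> H"
  shows "(nrm (u + v))\<^sup>2 = (nrm u)\<^sup>2 + 2 * Re (ip u v) + (nrm v)\<^sup>2"
  using assms ip_sym[of u v] by (simp add: nrm_sq ip_add_left ip_add_right)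

lemma nrm_sq_diff:
  assumes "u \<in> H" "v \<in> H"
  shows "(nrm (u - v))\<^sup>2 = (nrm u)\<^sup>2 - 2 * Re (ip u v) + (nrm v)\<^sup>2"
  using assms ip_sym[of u v] by (simp add: nrm_sq ip_diff_left ip_diff_right)

lemma cauchy_schwarz:
  assumes u: "u \<in> H" and v: "v \<in> H"
  shows "cmod (ip u v) \<le> nrm u * nrm v"
proof -
  define z where "z = ip u v"
  \<comment> \<open>The squared norm of \<open>u - c v\<close> with \<open>c = t z\<close>: the
    phase of \<open>z\<close> makes the cross term real. The real number \<open>t\<close> is kept
    free because \<open>nrm v\<close> may vanish for a nonzero \<open>v\<close>.\<close>
  have key: "0 \<le> (nrm u)\<^sup>2 - 2 * t * (cmod z)\<^sup>2 + t\<^sup>2 * (cmod z)\<^sup>2 * (nrm v)\<^sup>2" for t :: real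
  proof -
    define c where "c = of_real t * z"
    have "(nrm (u - smul c v))\<^sup>2 = (nrm u)\<^sup>2 - 2 * Re (cnj c * z) + (cmod c)\<^sup>2 * (nrm v)\<^sup>2"
      using u v by (simp add: nrm_sq_diff ip_smul_right nrm_smul z_def power_mult_distrib)
    moreover have "Re (cnj c * z) = t * (cmod z)\<^sup>2"
      by (simp add: c_def cmod_power2) (simp add: power2_eq_square algebra_simps)
    moreover have "(cmod c)\<^sup>2 = t\<^sup>2 * (cmod z)\<^sup>2"
      by (simp add: c_def norm_mult power_mult_distrib)
    ultimately show ?thesis
      by (metis (no_types, lifting) mult.assoc zero_le_power2)
  qed
  have "(cmod z)\<^sup>2 \<le> (nrm u)\<^sup>2 * (nrm v)\<^sup>2"
  proof (cases "nrm v = 0")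
    case True
    show ?thesis
    proof (rule ccontr)
      assume "\<not> ?thesis"
      then have z: "(cmod z)\<^sup>2 > 0" using True by simp
      \<comment> \<open>Chosen so that the linear term exceeds \<open>(nrm u)^2\<close> by 1, which
        \<open>key\<close> forbids once the quadratic term is gone.\<close>
      define t where "t = ((nrm u)\<^sup>2 + 1) / (2 * (cmod z)\<^sup>2)"
      have "2 * t * (cmod z)\<^sup>2 = (nrm u)\<^sup>2 + 1"
        using z by (simp add: t_def)
      then show False
        using key[of t] True by simp
    qed
  next
    case False
    then have n: "(nrm v)\<^sup>2 > 0" by simp
    have "0 \<le> ((nrm u)\<^sup>2 - 2 * (1 / (nrm v)\<^sup>2) * (cmod z)\<^sup>2 + (1 / (nrm v)\<^sup>2)\<^sup>2 * (cmod z)\<^sup>2 * (nrm v)\<^sup>2) * (nrm v)\<^sup>2"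
      using key[of "1 / (nrm v)\<^sup>2"] by simp
    also have "\<dots> = (nrm u)\<^sup>2 * (nrm v)\<^sup>2 - (cmod z)\<^sup>2"
      using False by (simp add: field_simps power2_eq_square)
    finally show ?thesis by simp
  qed
  then have "(cmod z)\<^sup>2 \<le> (nrm u * nrm v)\<^sup>2"
    by (simp add: power_mult_distrib)
  then have "cmod z \<le> nrm u * nrm v"
    by (rule power2_le_imp_le) (simp add: u v)
  then show ?thesis by (simp only: z_def)
qed

lemma nrm_triangle:
  assumes "u \<in> H" "v \<in> H"
  shows "nrm (u + v) \<le> nrm u + nrm v"
proof (rule power2_le_imp_le)
  have "Re (ip u v) \<le> nrm u * nrm v"
    using cauchy_schwarz[OF assms] complex_Re_le_cmod order_trans by blast
  then show "(nrm (u + v))\<^sup>2 \<le> (nrm u + nrm v)\<^sup>2"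
    using assms by (simp add: nrm_sq_add power2_sum)
qed (use assms in auto)

lemma nrm_triangle_diff:
  assumes "u \<in> H" "v \<in> H" "w \<in> H"
  shows "nrm (u - w) \<le> nrm (u - v) + nrm (v - w)"
  using nrm_triangle[of "u - v" "v - w"] assms by simp

lemma nrm_diff_abs:
  assumes "u \<in> H" "v \<in> H"
  shows "\<bar>nrm u - nrm v\<bar> \<le> nrm (u - v)"
  using nrm_triangle[of "u - v" v] nrm_triangle[of "v - u" u] assms nrm_diff_commute[of u v] by simp

lemma nrm_sum: "(\<And>i. i \<in> I \<Longrightarrow> f i \<in> H) \<Longrightarrow> nrm (\<Sum>i\<in>I. f i) \<le> (\<Sum>i\<in>I. nrm (f i))"
proof (induction I rule: infinite_finite_induct)
  case (insert i I)
  have "nrm (f i + (\<Sum>i\<in>I. f i)) \<le> nrm (f i) + nrm (\<Sum>i\<in>I. f i)"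
    using insert by (intro nrm_triangle sum_mem) auto
  also have "\<dots> \<le> nrm (f i) + (\<Sum>i\<in>I. nrm (f i))"
    using insert by simp
  finally show ?case
    by (simp only: sum.insert[OF insert(1,2)])
qed auto

lemma parallelogram:
  assumes "u \<in> H" "v \<in> H"
  shows "(nrm (u + v))\<^sup>2 + (nrm (u - v))\<^sup>2 = 2 * (nrm u)\<^sup>2 + 2 * (nrm v)\<^sup>2"
  using assms by (simp add: nrm_sq_add nrm_sq_diff)

lemma ip_tendsto:
  assumes X: "\<And>n. X n \<in> H" "x \<in> H" "(\<lambda>n. nrm (X n - x)) \<longlonglongrightarrow> 0" and v: "v \<in> H"
  shows "(\<lambda>n. ip (X n) v) \<longlonglongrightarrow> ip x v"
proof (rule LIM_zero_cancel, rule Lim_null_comparison)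
  show "\<forall>\<^sub>F n in sequentially. cmod (ip (X n) v - ip x v) \<le> nrm (X n - x) * nrm v"
    using X v cauchy_schwarz[of "X _ - x" v] by (intro always_eventually) (simp add: ip_diff_left)
  show "(\<lambda>n. nrm (X n - x) * nrm v) \<longlonglongrightarrow> 0"
    using tendsto_mult_left_zero[OF X(3)] by simp
qed

lemma nrm_tendsto:
  assumes X: "\<And>n. X n \<in> H" "x \<in> H" "(\<lambda>n. nrm (X n - x)) \<longlonglongrightarrow> 0"
  shows "(\<lambda>n. nrm (X n)) \<longlonglongrightarrow> nrm x"
proof (rule LIM_zero_cancel, rule Lim_null_comparison)
  show "\<forall>\<^sub>F n in sequentially. norm (nrm (X n) - nrm x) \<le> nrm (X n - x)"
    using X by (intro always_eventually) (simp add: nrm_diff_abs)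
qed (rule X)

end

section \<open>Hilbert spaces of functions and the representation of functionals\<close>

locale hfs = semi_ip +
  assumes definite: "u \<in> H \<Longrightarrow> Re (ip u u) = 0 \<Longrightarrow> u = 0"
    and complete: "(\<And>n. X n \<in> H) \<Longrightarrow> (\<And>e. e > 0 \<Longrightarrow> \<exists>N. \<forall>m\<ge>N. \<forall>n\<ge>N. Re (ip (X m - X n) (X m - X n)) < e)
      \<Longrightarrow> \<exists>x\<in>H. (\<lambda>n. Re (ip (X n - x) (X n - x))) \<longlonglongrightarrow> 0"
begin

lemma nrm_eq_0_iff: "u \<in> H \<Longrightarrow> nrm u = 0 \<longleftrightarrow> u = 0"
  using definite by (auto simp: nrm_def)

lemma nrm_pos: "u \<in> H \<Longrightarrow> u \<noteq> 0 \<Longrightarrow> nrm u > 0"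
  by (metis less_eq_real_def nrm_eq_0_iff nrm_nonneg)

lemma complete_nrm:
  assumes X: "\<And>n. X n \<in> H" and C: "\<And>e. e > 0 \<Longrightarrow> \<exists>N. \<forall>m\<ge>N. \<forall>n\<ge>N. nrm (X m - X n) < e"
  shows "\<exists>x\<in>H. (\<lambda>n. nrm (X n - x)) \<longlonglongrightarrow> 0"
proof -
  have "\<exists>N. \<forall>m\<ge>N. \<forall>n\<ge>N. Re (ip (X m - X n) (X m - X n)) < e" if "e > 0" for e
    using C[of "sqrt e"] that by (simp add: nrm_def)
  from complete[OF X this] obtain x where x: "x \<in> H" "(\<lambda>n. Re (ip (X n - x) (X n - x))) \<longlonglongrightarrow> 0"
    by blast
  have "(\<lambda>n. sqrt (Re (ip (X n - x) (X n - x)))) \<longlonglongrightarrow> sqrt 0"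
    by (intro tendsto_real_sqrt x)
  then show ?thesis using x by (auto simp: nrm_def)
qed

text \<open>The representing vector minimises \<open>(nrm u)\<^sup>2 - 2 * Re (f u)\<close>.\<close>

lemma riesz:
  assumes add: "\<And>u v. u \<in> H \<Longrightarrow> v \<in> H \<Longrightarrow> f (u + v) = f u + f v"
    and smul: "\<And>u c. u \<in> H \<Longrightarrow> f (smul c u) = c * f u"
    and bnd: "\<And>u. u \<in> H \<Longrightarrow> cmod (f u) \<le> K * nrm u"
  shows "\<exists>z\<in>H. \<forall>u\<in>H. f u = ip u z"
proof -
  define J where "J u = (nrm u)\<^sup>2 - 2 * Re (f u)" for u
  have J_ge: "J u \<ge> - K\<^sup>2" if "u \<in> H" for u
  proof -
    have "Re (f u) \<le> K * nrm u"
      using bnd[OF that] complex_Re_le_cmod order_trans by blast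
    moreover have "0 \<le> (nrm u - K)\<^sup>2" by simp
    ultimately show ?thesis
      by (simp add: J_def power2_diff algebra_simps)
  qed
  define m where "m = Inf (J ` H)"
  have bdd: "bdd_below (J ` H)"
    using J_ge by (intro bdd_belowI2) auto
  have m_le: "m \<le> J u" if "u \<in> H" for u
    unfolding m_def using bdd that by (intro cInf_lower) auto
  have "\<exists>u\<in>H. J u < m + 1 / real (Suc n)" for n
  proof -
    have "Inf (J ` H) < m + 1 / real (Suc n)"
      by (simp add: m_def)
    then show ?thesis
      using cInf_lessD[of "J ` H"] by (force intro: zero_mem)
  qed
  then obtain X where X: "\<And>n. X n \<in> H" "\<And>n. J (X n) < m + 1 / real (Suc n)"
    by metis
  \<comment> \<open>The value of \<open>J\<close> at the midpoint of \<open>u\<close> and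
    \<open>v\<close> is at least \<open>m\<close>, so by the parallelogram law two near-minimisers
    are close to each other.\<close>
  have mid: "(nrm (u - v))\<^sup>2 \<le> 2 * (J u - m) + 2 * (J v - m)" if "u \<in> H" "v \<in> H" for u v
  proof -
    define w where "w = smul (1/2) (u + v)"
    have "w \<in> H" using that by (auto simp: w_def)
    then have "m \<le> J w" by (rule m_le)
    also have "J w = (1/4) * (nrm (u + v))\<^sup>2 - Re (f u) - Re (f v)"
      using that by (simp add: J_def w_def nrm_smul smul add power_mult_distrib power2_eq_square
          add_divide_distrib)
    also have "(nrm (u + v))\<^sup>2 = 2 * (nrm u)\<^sup>2 + 2 * (nrm v)\<^sup>2 - (nrm (u - v))\<^sup>2"
      using parallelogram[of u v] that by simp
    finally show ?thesis unfolding J_def by argo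
  qed
  have "\<exists>N. \<forall>i\<ge>N. \<forall>j\<ge>N. nrm (X i - X j) < e" if "e > 0" for e
  proof -
    obtain N where N: "4 / real (Suc N) < e\<^sup>2"
      using \<open>e > 0\<close> nat_approx_posE[of "e\<^sup>2 / 4"] by (auto simp: field_simps)
    show ?thesis
    proof (intro exI allI impI)
      fix i j assume ij: "N \<le> i" "N \<le> j"
      have "1 / real (Suc i) \<le> 1 / real (Suc N)" "1 / real (Suc j) \<le> 1 / real (Suc N)"
        using ij by (simp_all add: frac_le)
      then have "(nrm (X i - X j))\<^sup>2 < e\<^sup>2"
        using mid[of "X i" "X j"] X(1)[of i] X(1)[of j] X(2)[of i] X(2)[of j] N by simp
      then show "nrm (X i - X j) < e"
        using \<open>e > 0\<close> by (simp add: power2_less_imp_less)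
    qed
  qed
  from complete_nrm[OF X(1) this] obtain z where z: "z \<in> H" "(\<lambda>n. nrm (X n - z)) \<longlonglongrightarrow> 0"
    by blast
  have fdiff: "f (u - v) = f u - f v" if "u \<in> H" "v \<in> H" for u v
    using add[of u "smul (-1) v"] smul[of v "-1"] that by (simp add: smul_minus_one)
  have "(\<lambda>n. f (X n)) \<longlonglongrightarrow> f z"
  proof (rule LIM_zero_cancel, rule Lim_null_comparison)
    show "\<forall>\<^sub>F n in sequentially. cmod (f (X n) - f z) \<le> K * nrm (X n - z)"
      using bnd[of "X _ - z"] X z by (intro always_eventually) (simp add: fdiff)
    show "(\<lambda>n. K * nrm (X n - z)) \<longlonglongrightarrow> 0"
      using tendsto_mult_right_zero[OF z(2)] by simp
  qed
  then have "(\<lambda>n. J (X n)) \<longlonglongrightarrow> J z"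
    unfolding J_def by (intro tendsto_intros nrm_tendsto X z)
  moreover have "(\<lambda>n. m + 1 / real (Suc n)) \<longlonglongrightarrow> m + 0"
    by (intro tendsto_intros LIMSEQ_Suc lim_1_over_n)
  ultimately have Jz: "J z \<le> m"
    using X(2) by (intro LIMSEQ_le[of "\<lambda>n. J (X n)" _ "\<lambda>n. m + 1 / real (Suc n)"]) (auto intro: less_imp_le)
  have re: "Re (f u) = Re (ip u z)" if u: "u \<in> H" for u
  proof (rule ccontr)
    define d where "d = Re (ip u z) - Re (f u)"
    assume "Re (f u) \<noteq> Re (ip u z)"
    then have d: "d \<noteq> 0" by (simp add: d_def)
    have J_var: "J (z + smul (of_real t) u) = J z + 2 * t * d + t\<^sup>2 * (nrm u)\<^sup>2" for t
      using u z ip_sym[of z u] by (simp add: J_def nrm_sq_add ip_smul_right nrm_smul power_mult_distrib d_def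
          add smul algebra_simps)
    have ge: "0 \<le> 2 * t * d + t\<^sup>2 * (nrm u)\<^sup>2" for t
      using J_var[of t] m_le[of "z + smul (of_real t) u"] Jz u z by simp
    \<comment> \<open>A step of size \<open>s * d\<close> against the gradient: since
      \<open>s * (nrm u)^2 < 1\<close>, the linear gain outweighs the quadratic term. The summand 1
      keeps the denominator positive when \<open>nrm u = 0\<close>.\<close>
    define s where "s = 1 / ((nrm u)\<^sup>2 + 1)"
    have s: "s > 0" "s * (nrm u)\<^sup>2 < 1"
      by (simp_all add: s_def field_simps add_pos_nonneg)
    have "0 \<le> 2 * (- s * d) * d + (- s * d)\<^sup>2 * (nrm u)\<^sup>2" by (rule ge)
    also have "\<dots> = s * d\<^sup>2 * (s * (nrm u)\<^sup>2 - 2)"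
      by (simp add: power2_eq_square algebra_simps)
    also have "\<dots> < 0"
      using s d by (intro mult_pos_neg) auto
    finally show False by simp
  qed
  have "f u = ip u z" if u: "u \<in> H" for u
  proof (rule complex_eqI)
    show "Re (f u) = Re (ip u z)" using u by (rule re)
    \<comment> \<open>Complex linearity recovers the imaginary part at \<open>u\<close> as the real
      part at \<open>- \<i> u\<close>.\<close>
    have "Re (f (smul (- \<i>) u)) = Re (ip (smul (- \<i>) u) z)" using u by (intro re) auto
    then show "Im (f u) = Im (ip u z)"
      using u z by (simp add: smul ip_smul_left)
  qed
  then show ?thesis using z by blast
qed

end

section \<open>Square summable families of vectors\<close>

definition slice :: "('i \<times> 'x \<Rightarrow> complex) \<Rightarrow> 'i \<Rightarrow> 'x \<Rightarrow> complex" where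
  "slice F i = (\<lambda>x. F (i, x))"

lemma slice_simps [simp]:
  "slice 0 i = 0" "slice (F + F') i = slice F i + slice F' i" "slice (F - F') i = slice F i - slice F' i"
  "slice (smul c F) i = smul c (slice F i)"
  by (simp_all add: slice_def fun_eq_iff)

text \<open>Values off \<open>I\<close> are forced to be 0, so that a family is determined by its
  slices over \<open>I\<close> and definiteness holds for plain functions.\<close>

definition l2_space :: "'i set \<Rightarrow> ('x \<Rightarrow> complex) set \<Rightarrow>
    (('x \<Rightarrow> complex) \<Rightarrow> ('x \<Rightarrow> complex) \<Rightarrow> complex) \<Rightarrow> ('i \<times> 'x \<Rightarrow> complex) set" where
  "l2_space I H ip = {F. (\<forall>i\<in>I. slice F i \<in> H) \<and> (\<forall>i x. i \<notin> I \<longrightarrow> F (i, x) = 0) \<and>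
     (\<lambda>i. Re (ip (slice F i) (slice F i))) summable_on I}"

definition l2_ip :: "'i set \<Rightarrow> (('x \<Rightarrow> complex) \<Rightarrow> ('x \<Rightarrow> complex) \<Rightarrow> complex) \<Rightarrow>
    ('i \<times> 'x \<Rightarrow> complex) \<Rightarrow> ('i \<times> 'x \<Rightarrow> complex) \<Rightarrow> complex" where
  "l2_ip I ip F F' = (\<Sum>\<^sub>\<infinity>i\<in>I. ip (slice F i) (slice F' i))"

context hfs
begin

lemma l2_summable:
  assumes "F \<in> l2_space I H ip" "F' \<in> l2_space I H ip"
  shows "(\<lambda>i. ip (slice F i) (slice F' i)) summable_on I"
proof (rule abs_summable_summable)
  have "(\<lambda>i. Re (ip (slice F i) (slice F i)) + Re (ip (slice F' i) (slice F' i))) summable_on I"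
    using assms by (intro summable_on_add) (auto simp: l2_space_def)
  then show "(\<lambda>i. norm (ip (slice F i) (slice F' i))) summable_on I"
  proof (rule summable_on_comparison_test)
    fix i assume "i \<in> I"
    then have s: "slice F i \<in> H" "slice F' i \<in> H"
      using assms by (auto simp: l2_space_def)
    have "cmod (ip (slice F i) (slice F' i)) \<le> nrm (slice F i) * nrm (slice F' i)"
      by (rule cauchy_schwarz[OF s])
    also have "\<dots> \<le> (nrm (slice F i))\<^sup>2 + (nrm (slice F' i))\<^sup>2"
      using sum_squares_bound[of "nrm (slice F i)" "nrm (slice F' i)"]
        mult_nonneg_nonneg[OF nrm_nonneg[OF s(1)] nrm_nonneg[OF s(2)]] by linarith
    finally show "norm (ip (slice F i) (slice F' i))
        \<le> Re (ip (slice F i) (slice F i)) + Re (ip (slice F' i) (slice F' i))"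
      using s by (simp add: nrm_sq)
  qed simp
qed

lemma l2_Re:
  assumes "F \<in> l2_space I H ip"
  shows "Re (l2_ip I ip F F) = (\<Sum>\<^sub>\<infinity>i\<in>I. Re (ip (slice F i) (slice F i)))"
  unfolding l2_ip_def using infsum_Re[OF l2_summable[OF assms assms]] by simp

lemma l2_semi: "semi_ip (l2_space I H ip) (l2_ip I ip)"
proof
  show "0 \<in> l2_space I H ip"
    by (simp add: l2_space_def)
next
  fix F F' assume F: "F \<in> l2_space I H ip" "F' \<in> l2_space I H ip"
  have "(\<lambda>i. 2 * (Re (ip (slice F i) (slice F i)) + Re (ip (slice F' i) (slice F' i)))) summable_on I"
    using F by (intro summable_on_cmult_right summable_on_add) (auto simp: l2_space_def)
  then have "(\<lambda>i. Re (ip (slice (F + F') i) (slice (F + F') i))) summable_on I"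
  proof (rule summable_on_comparison_test)
    fix i assume "i \<in> I"
    then have s: "slice F i \<in> H" "slice F' i \<in> H"
      using F by (auto simp: l2_space_def)
    have "(nrm (slice F i + slice F' i))\<^sup>2 \<le> 2 * (nrm (slice F i))\<^sup>2 + 2 * (nrm (slice F' i))\<^sup>2"
      using parallelogram[OF s] zero_le_power2[of "nrm (slice F i - slice F' i)"] by linarith
    then show "Re (ip (slice (F + F') i) (slice (F + F') i))
        \<le> 2 * (Re (ip (slice F i) (slice F i)) + Re (ip (slice F' i) (slice F' i)))"
      using s by (simp add: nrm_sq)
    show "0 \<le> Re (ip (slice (F + F') i) (slice (F + F') i))"
      using s by simp
  qed
  then show "F + F' \<in> l2_space I H ip"
    using F by (auto simp: l2_space_def)
next
  fix F c assume F: "F \<in> l2_space I H ip"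
  have "(\<lambda>i. (cmod c)\<^sup>2 * Re (ip (slice F i) (slice F i))) summable_on I"
    using F by (intro summable_on_cmult_right) (auto simp: l2_space_def)
  also have "?this \<longleftrightarrow> (\<lambda>i. Re (ip (slice (smul c F) i) (slice (smul c F) i))) summable_on I"
  proof (rule summable_on_cong)
    fix i assume "i \<in> I"
    then have s: "slice F i \<in> H"
      using F by (auto simp: l2_space_def)
    show "(cmod c)\<^sup>2 * Re (ip (slice F i) (slice F i)) = Re (ip (slice (smul c F) i) (slice (smul c F) i))"
      using nrm_smul[OF s, of c] nrm_sq[OF s] nrm_sq[OF smul_mem[OF s, of c]]
      by (simp add: power_mult_distrib)
  qed
  finally show "smul c F \<in> l2_space I H ip"
    using F by (auto simp: l2_space_def)
next
  fix F F' F'' assume F: "F \<in> l2_space I H ip" "F' \<in> l2_space I H ip" "F'' \<in> l2_space I H ip"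
  have "(\<Sum>\<^sub>\<infinity>i\<in>I. ip (slice (F + F') i) (slice F'' i))
      = (\<Sum>\<^sub>\<infinity>i\<in>I. ip (slice F i) (slice F'' i) + ip (slice F' i) (slice F'' i))"
    using F by (intro infsum_cong) (simp add: l2_space_def ip_add_left)
  then show "l2_ip I ip (F + F') F'' = l2_ip I ip F F'' + l2_ip I ip F' F''"
    using F by (simp add: l2_ip_def infsum_add l2_summable)
next
  fix F F' c assume F: "F \<in> l2_space I H ip" "F' \<in> l2_space I H ip"
  have "(\<Sum>\<^sub>\<infinity>i\<in>I. ip (slice (smul c F) i) (slice F' i)) = (\<Sum>\<^sub>\<infinity>i\<in>I. c * ip (slice F i) (slice F' i))"
    using F by (intro infsum_cong) (simp add: l2_space_def ip_smul_left)
  then show "l2_ip I ip (smul c F) F' = c * l2_ip I ip F F'"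
    using F by (simp add: l2_ip_def infsum_cmult_right l2_summable)
next
  fix F F' assume F: "F \<in> l2_space I H ip" "F' \<in> l2_space I H ip"
  have "(\<Sum>\<^sub>\<infinity>i\<in>I. ip (slice F' i) (slice F i)) = (\<Sum>\<^sub>\<infinity>i\<in>I. cnj (ip (slice F i) (slice F' i)))"
    using F by (intro infsum_cong ip_sym) (auto simp: l2_space_def)
  then show "l2_ip I ip F' F = cnj (l2_ip I ip F F')"
    by (simp add: l2_ip_def infsum_cnj)
next
  fix F assume F: "F \<in> l2_space I H ip"
  show "0 \<le> Re (l2_ip I ip F F)"
    using F by (auto simp: l2_Re l2_space_def intro!: infsum_nonneg)
qed

lemma l2_slice_le:
  assumes "F \<in> l2_space I H ip" "i \<in> I"
  shows "Re (ip (slice F i) (slice F i)) \<le> Re (l2_ip I ip F F)"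
proof -
  have "(\<Sum>j\<in>{i}. Re (ip (slice F j) (slice F j))) \<le> (\<Sum>\<^sub>\<infinity>j\<in>I. Re (ip (slice F j) (slice F j)))"
    using assms by (intro finite_sum_le_infsum) (auto simp: l2_space_def)
  then show ?thesis
    using assms by (simp add: l2_Re)
qed

lemma l2_hfs: "hfs (l2_space I H ip) (l2_ip I ip)"
proof -
  interpret L: semi_ip "l2_space I H ip" "l2_ip I ip" by (rule l2_semi)
  show ?thesis
  proof
    fix F assume F: "F \<in> l2_space I H ip" and z: "Re (l2_ip I ip F F) = 0"
    have "slice F i = 0" if i: "i \<in> I" for i
    proof -
      have "slice F i \<in> H" using F i by (simp add: l2_space_def)
      moreover from this have "Re (ip (slice F i) (slice F i)) = 0"
        using l2_slice_le[OF F i] z ip_nonneg[of "slice F i"] by linarith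
      ultimately show ?thesis by (rule definite)
    qed
    then show "F = 0"
      using F by (fastforce simp: fun_eq_iff l2_space_def slice_def)
  next
    fix X :: "nat \<Rightarrow> 'b \<times> 'a \<Rightarrow> complex"
    assume X: "\<And>n. X n \<in> l2_space I H ip"
      and C: "\<And>e. e > 0 \<Longrightarrow> \<exists>N. \<forall>m\<ge>N. \<forall>n\<ge>N. Re (l2_ip I ip (X m - X n) (X m - X n)) < e"
    have sX: "slice (X n) i \<in> H" if "i \<in> I" for n i
      using X that by (auto simp: l2_space_def)
    have "\<exists>x\<in>H. (\<lambda>n. nrm (slice (X n) i - x)) \<longlonglongrightarrow> 0" if i: "i \<in> I" for i
    proof (rule complete_nrm)
      fix e :: real assume e: "e > 0"
      obtain N where N: "\<forall>m\<ge>N. \<forall>n\<ge>N. Re (l2_ip I ip (X m - X n) (X m - X n)) < e\<^sup>2"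
        using C[of "e\<^sup>2"] e by auto
      have "nrm (slice (X m) i - slice (X n) i) < e" if "m \<ge> N" "n \<ge> N" for m n
      proof -
        have "(nrm (slice (X m) i - slice (X n) i))\<^sup>2 < e\<^sup>2"
          using l2_slice_le[OF L.diff_mem[OF X X] i, of m n] N that i sX
          by (fastforce simp: nrm_sq)
        then show ?thesis using e by (simp add: power2_less_imp_less)
      qed
      then show "\<exists>N. \<forall>m\<ge>N. \<forall>n\<ge>N. nrm (slice (X m) i - slice (X n) i) < e" by blast
    qed (rule sX[OF i])
    then obtain f where f: "\<And>i. i \<in> I \<Longrightarrow> f i \<in> H"
      "\<And>i. i \<in> I \<Longrightarrow> (\<lambda>n. nrm (slice (X n) i - f i)) \<longlonglongrightarrow> 0"
      by metis
    define F where "F = (\<lambda>(i, x). if i \<in> I then f i x else 0)"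
    have sF: "slice F i = f i" if "i \<in> I" for i
      using that by (simp add: F_def slice_def)
    \<comment> \<open>Fatou's argument: for a finite \<open>J\<close> the partial sums for
      \<open>X m - X n\<close> are at most \<open>e\<close>, and \<open>n\<close> may tend to
      infinity in each of the finitely many slices. The bound over all finite \<open>J\<close> gives
      membership and the norm estimate at once.\<close>
    have D: "X m - F \<in> l2_space I H ip \<and> Re (l2_ip I ip (X m - F) (X m - F)) \<le> e"
      if N: "\<forall>m\<ge>N. \<forall>n\<ge>N. Re (l2_ip I ip (X m - X n) (X m - X n)) < e" and m: "m \<ge> N" for N m e
    proof -
      have fin: "(\<Sum>i\<in>J. Re (ip (slice (X m - F) i) (slice (X m - F) i))) \<le> e"
        if J: "finite J" "J \<subseteq> I" for J
      proof (rule LIMSEQ_le_const2)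
        have "(\<lambda>n. nrm (slice (X m - X n) i)) \<longlonglongrightarrow> nrm (slice (X m - F) i)" if "i \<in> J" for i
        proof (rule nrm_tendsto)
          have i: "i \<in> I" using that J by auto
          show "\<And>n. slice (X m - X n) i \<in> H" "slice (X m - F) i \<in> H"
            using i sX f by (auto simp: sF)
          have "slice (X m - X n) i - slice (X m - F) i = - (slice (X n) i - f i)" for n
            using i by (simp add: sF)
          then show "(\<lambda>n. nrm (slice (X m - X n) i - slice (X m - F) i)) \<longlonglongrightarrow> 0"
            using f(2)[OF i] nrm_minus[of "slice (X _) i - f i"] f(1)[OF i] sX[OF i] by simp
        qed
        then have "(\<lambda>n. \<Sum>i\<in>J. (nrm (slice (X m - X n) i))\<^sup>2) \<longlonglongrightarrow> (\<Sum>i\<in>J. (nrm (slice (X m - F) i))\<^sup>2)"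
          by (intro tendsto_sum tendsto_power)
        moreover have "(nrm (slice (X m - F) i))\<^sup>2 = Re (ip (slice (X m - F) i) (slice (X m - F) i))"
          if "i \<in> J" for i using that J f sX by (intro nrm_sq) (auto simp: sF)
        ultimately show "(\<lambda>n. \<Sum>i\<in>J. (nrm (slice (X m - X n) i))\<^sup>2)
            \<longlonglongrightarrow> (\<Sum>i\<in>J. Re (ip (slice (X m - F) i) (slice (X m - F) i)))"
          by simp
        show "\<exists>N. \<forall>n\<ge>N. (\<Sum>i\<in>J. (nrm (slice (X m - X n) i))\<^sup>2) \<le> e"
        proof (intro exI allI impI)
          fix n assume n: "n \<ge> N"
          have "(\<Sum>i\<in>J. (nrm (slice (X m - X n) i))\<^sup>2) = (\<Sum>i\<in>J. Re (ip (slice (X m - X n) i) (slice (X m - X n) i)))"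
            using J sX by (intro sum.cong refl nrm_sq) auto
          also have "\<dots> \<le> (\<Sum>\<^sub>\<infinity>i\<in>I. Re (ip (slice (X m - X n) i) (slice (X m - X n) i)))"
            using J L.diff_mem[OF X X, of m n] by (intro finite_sum_le_infsum) (auto simp: l2_space_def)
          also have "\<dots> = Re (l2_ip I ip (X m - X n) (X m - X n))"
            using L.diff_mem[OF X X, of m n] by (simp only: l2_Re)
          also have "\<dots> \<le> e" using N m n by (auto intro: less_imp_le)
          finally show "(\<Sum>i\<in>J. (nrm (slice (X m - X n) i))\<^sup>2) \<le> e" .
        qed
      qed
      have nn: "0 \<le> Re (ip (slice (X m - F) i) (slice (X m - F) i))" if "i \<in> I" for i
        using that f sX by (auto simp: sF)
      have "(\<lambda>i. Re (ip (slice (X m - F) i) (slice (X m - F) i))) summable_on I"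
        using nn fin by (intro nonneg_bdd_above_summable_on bdd_aboveI2[where M = e]) auto
      then have mem: "X m - F \<in> l2_space I H ip"
        using X[of m] f sX by (auto simp: l2_space_def sF) (simp add: F_def)
      moreover have "Re (l2_ip I ip (X m - F) (X m - F)) \<le> e"
        unfolding l2_Re[OF mem]
        using mem fin by (intro infsum_le_finite_sums) (auto simp: l2_space_def)
      ultimately show ?thesis by simp
    qed
    obtain N1 where N1: "\<forall>m\<ge>N1. \<forall>n\<ge>N1. Re (l2_ip I ip (X m - X n) (X m - X n)) < 1"
      using C[of 1] by auto
    have F: "F \<in> l2_space I H ip"
      using L.diff_mem[OF X[of N1] conjunct1[OF D[OF N1, of N1]]] by simp
    moreover have "(\<lambda>n. Re (l2_ip I ip (X n - F) (X n - F))) \<longlonglongrightarrow> 0"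
    proof (rule LIMSEQ_I)
      fix r :: real assume r: "r > 0"
      obtain N where N: "\<forall>m\<ge>N. \<forall>n\<ge>N. Re (l2_ip I ip (X m - X n) (X m - X n)) < r / 2"
        using C[of "r / 2"] r by auto
      have "norm (Re (l2_ip I ip (X n - F) (X n - F)) - 0) < r" if "n \<ge> N" for n
        using D[OF N that] r L.ip_nonneg[of "X n - F"] by auto
      then show "\<exists>no. \<forall>n\<ge>no. norm (Re (l2_ip I ip (X n - F) (X n - F)) - 0) < r" by blast
    qed
    ultimately show "\<exists>x\<in>l2_space I H ip. (\<lambda>n. Re (l2_ip I ip (X n - x) (X n - x))) \<longlonglongrightarrow> 0"
      by blast
  qed
qed

text \<open>An isometric embedding with closed image pulls completeness back. It serves the domain
  of a closed form, the tensor product (with the identity as \<open>j\<close>) and the induced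
  space.\<close>

lemma hfs_pullback:
  fixes H1 :: "('y \<Rightarrow> complex) set" and j :: "('y \<Rightarrow> complex) \<Rightarrow> 'a \<Rightarrow> complex"
  assumes zero: "0 \<in> H1"
    and add: "\<And>u v. u \<in> H1 \<Longrightarrow> v \<in> H1 \<Longrightarrow> u + v \<in> H1"
    and smul: "\<And>c u. u \<in> H1 \<Longrightarrow> smul c u \<in> H1"
    and j_mem: "\<And>u. u \<in> H1 \<Longrightarrow> j u \<in> H"
    and j_add: "\<And>u v. u \<in> H1 \<Longrightarrow> v \<in> H1 \<Longrightarrow> j (u + v) = j u + j v"
    and j_smul: "\<And>c u. u \<in> H1 \<Longrightarrow> j (smul c u) = smul c (j u)"
    and ip1: "\<And>u v. u \<in> H1 \<Longrightarrow> v \<in> H1 \<Longrightarrow> ip1 u v = ip (j u) (j v)"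
    and inj: "\<And>u. u \<in> H1 \<Longrightarrow> j u = 0 \<Longrightarrow> u = 0"
    and clos: "\<And>X z. (\<And>n. X n \<in> H1) \<Longrightarrow> z \<in> H \<Longrightarrow> (\<lambda>n. nrm (j (X n) - z)) \<longlonglongrightarrow> 0 \<Longrightarrow> \<exists>u\<in>H1. j u = z"
  shows "hfs H1 ip1"
proof -
  interpret S: semi_ip H1 ip1
    by unfold_locales
      (auto simp: zero add smul j_mem j_add j_smul ip1 ip_add_left ip_smul_left intro: ip_sym)
  have j_diff: "j (u - v) = j u - j v" if "u \<in> H1" "v \<in> H1" for u v
    using j_add[of u "smul (-1) v"] j_smul[of v "-1"] that by (simp add: smul_minus_one smul)
  show ?thesis
  proof
    fix u assume "u \<in> H1" "Re (ip1 u u) = 0"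
    then show "u = 0" using definite[of "j u"] inj j_mem by (simp add: ip1)
  next
    fix X :: "nat \<Rightarrow> 'y \<Rightarrow> complex"
    assume X: "\<And>n. X n \<in> H1"
      and C: "\<And>e. e > 0 \<Longrightarrow> \<exists>N. \<forall>m\<ge>N. \<forall>n\<ge>N. Re (ip1 (X m - X n) (X m - X n)) < e"
    have "\<exists>x\<in>H. (\<lambda>n. Re (ip (j (X n) - x) (j (X n) - x))) \<longlonglongrightarrow> 0"
    proof (rule complete)
      show "\<And>n. j (X n) \<in> H" using X j_mem by auto
      show "\<exists>N. \<forall>m\<ge>N. \<forall>n\<ge>N. Re (ip (j (X m) - j (X n)) (j (X m) - j (X n))) < e" if "e > 0" for e
        using C[OF that] X by (simp add: ip1 j_diff)
    qed
    then obtain z where z: "z \<in> H" "(\<lambda>n. Re (ip (j (X n) - z) (j (X n) - z))) \<longlonglongrightarrow> 0" by blast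
    have "(\<lambda>n. sqrt (Re (ip (j (X n) - z) (j (X n) - z)))) \<longlonglongrightarrow> sqrt 0"
      by (intro tendsto_real_sqrt z)
    then obtain u where u: "u \<in> H1" "j u = z"
      using clos[where X = X, OF X z(1)] by (auto simp: nrm_def)
    then show "\<exists>x\<in>H1. (\<lambda>n. Re (ip1 (X n - x) (X n - x))) \<longlonglongrightarrow> 0"
      using z X by (intro bexI[of _ u]) (simp_all add: ip1 j_diff)
  qed
qed

end

section \<open>Unitary representations and their von Neumann algebras\<close>

locale perm_group =
  fixes G :: "('a \<Rightarrow> 'a) set"
  assumes id_mem [simp, intro]: "id \<in> G"
    and comp_mem [simp, intro]: "g \<in> G \<Longrightarrow> h \<in> G \<Longrightarrow> g \<circ> h \<in> G"
    and inv_mem [simp, intro]: "g \<in> G \<Longrightarrow> inv g \<in> G"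
    and bij_mem: "g \<in> G \<Longrightarrow> bij g"
begin

lemma inv_comp [simp]: "g \<in> G \<Longrightarrow> inv g \<circ> g = id" "g \<in> G \<Longrightarrow> g \<circ> inv g = id"
  using bij_mem by (auto simp: bij_is_inj bij_is_surj surj_iff[symmetric] inv_o_cancel)

lemma inv_comp_assoc [simp]:
  "g \<in> G \<Longrightarrow> inv g \<circ> (g \<circ> h) = h" "g \<in> G \<Longrightarrow> g \<circ> (inv g \<circ> h) = h"
  by (simp_all add: o_assoc)

lemma inv_distrib: "g \<in> G \<Longrightarrow> h \<in> G \<Longrightarrow> inv (g \<circ> h) = inv h \<circ> inv g"
  using bij_mem o_inv_distrib by blast

lemma inv_inv [simp]: "g \<in> G \<Longrightarrow> inv (inv g) = g"
  using bij_mem inv_inv_eq by blast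

end

text \<open>Elements of the group algebra are kept as lists of terms, so that one and the same
  element acts in two representations and induction on the list shows that an isomorphism respects
  it.\<close>

fun gact :: "('g, 'x) urep \<Rightarrow> (complex \<times> 'g) list \<Rightarrow> ('x \<Rightarrow> complex) \<Rightarrow> 'x \<Rightarrow> complex" where
  "gact R [] v = 0"
| "gact R ((c, g) # xs) v = smul c (act R g v) + gact R xs v"

definition gop :: "('g, 'x) urep \<Rightarrow> (complex \<times> 'g) list \<Rightarrow> 'x oper" where
  "gop R xs = restrict (gact R xs) (hspace R)"

lemma compose_apply: "v \<in> H \<Longrightarrow> compose H A B v = A (B v)"
  by (simp add: compose_def)

locale unitary_rep = perm_group G + hfs "hspace R" "inprod R"
  for G :: "('a \<Rightarrow> 'a) set" and R :: "('a \<Rightarrow> 'a, 'x) urep" +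
  assumes act_mem [simp, intro]: "g \<in> G \<Longrightarrow> v \<in> hspace R \<Longrightarrow> act R g v \<in> hspace R"
    and act_add: "g \<in> G \<Longrightarrow> u \<in> hspace R \<Longrightarrow> v \<in> hspace R \<Longrightarrow> act R g (u + v) = act R g u + act R g v"
    and act_smul: "g \<in> G \<Longrightarrow> v \<in> hspace R \<Longrightarrow> act R g (smul c v) = smul c (act R g v)"
    and act_ip: "g \<in> G \<Longrightarrow> u \<in> hspace R \<Longrightarrow> v \<in> hspace R \<Longrightarrow>
      inprod R (act R g u) (act R g v) = inprod R u v"
    and act_comp: "g \<in> G \<Longrightarrow> h \<in> G \<Longrightarrow> v \<in> hspace R \<Longrightarrow> act R (g \<circ> h) v = act R g (act R h v)"
    and act_id: "v \<in> hspace R \<Longrightarrow> act R id v = v"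
begin

abbreviation "H \<equiv> hspace R"
abbreviation "ip \<equiv> inprod R"

lemma hnorm_nrm: "hnorm R = nrm"
  by (simp add: fun_eq_iff hnorm_def nrm_def)

lemma act_nrm: "g \<in> G \<Longrightarrow> v \<in> H \<Longrightarrow> nrm (act R g v) = nrm v"
  by (simp add: nrm_def act_ip)

lemma act_inv: "g \<in> G \<Longrightarrow> u \<in> H \<Longrightarrow> v \<in> H \<Longrightarrow> ip (act R g u) v = ip u (act R (inv g) v)"
proof -
  assume g: "g \<in> G" "u \<in> H" "v \<in> H"
  have "ip (act R g u) v = ip (act R (inv g) (act R g u)) (act R (inv g) v)"
    using g by (subst act_ip) auto
  also have "act R (inv g) (act R g u) = u"
    using g act_comp[of "inv g" g u] by (simp add: act_id)
  finally show ?thesis .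
qed

lemma bounded_ops_iff:
  "T \<in> bounded_ops R \<longleftrightarrow> T \<in> extensional H \<and> (\<forall>v\<in>H. T v \<in> H) \<and>
     (\<forall>u\<in>H. \<forall>v\<in>H. T (u + v) = T u + T v) \<and> (\<forall>c. \<forall>v\<in>H. T (smul c v) = smul c (T v)) \<and>
     (\<exists>K. \<forall>v\<in>H. nrm (T v) \<le> K * nrm v)"
  by (auto simp: bounded_ops_def PiE_def Pi_def hnorm_nrm plus_fun_def smul_def)

lemma bop_mem: "T \<in> bounded_ops R \<Longrightarrow> v \<in> H \<Longrightarrow> T v \<in> H"
  and bop_add: "T \<in> bounded_ops R \<Longrightarrow> u \<in> H \<Longrightarrow> v \<in> H \<Longrightarrow> T (u + v) = T u + T v"
  and bop_smul: "T \<in> bounded_ops R \<Longrightarrow> v \<in> H \<Longrightarrow> T (smul c v) = smul c (T v)"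
  and bop_ext: "T \<in> bounded_ops R \<Longrightarrow> T \<in> extensional H"
  by (auto simp: bounded_ops_iff)

lemma bop_diff: "T \<in> bounded_ops R \<Longrightarrow> u \<in> H \<Longrightarrow> v \<in> H \<Longrightarrow> T (u - v) = T u - T v"
  using bop_add[of T u "smul (-1) v"] bop_smul[of T v "-1"] by (simp add: smul_minus_one)

lemma bop_bound: "T \<in> bounded_ops R \<Longrightarrow> \<exists>K>0. \<forall>v\<in>H. nrm (T v) \<le> K * nrm v"
proof -
  assume "T \<in> bounded_ops R"
  then obtain K where K: "\<forall>v\<in>H. nrm (T v) \<le> K * nrm v"
    by (auto simp: bounded_ops_iff)
  have "nrm (T v) \<le> (\<bar>K\<bar> + 1) * nrm v" if "v \<in> H" for v
    using K that mult_right_mono[of K "\<bar>K\<bar> + 1" "nrm v"] by fastforce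
  then show ?thesis by (intro exI[of _ "\<bar>K\<bar> + 1"]) auto
qed

lemma ip_eqI: "x \<in> H \<Longrightarrow> y \<in> H \<Longrightarrow> (\<And>u. u \<in> H \<Longrightarrow> ip u x = ip u y) \<Longrightarrow> x = y"
proof -
  assume a: "x \<in> H" "y \<in> H" "\<And>u. u \<in> H \<Longrightarrow> ip u x = ip u y"
  then have "ip (x - y) (x - y) = 0" by (simp add: ip_diff_right)
  then show "x = y" using definite[of "x - y"] a by simp
qed

section \<open>The commutant of the group operators and its own commutant\<close>

definition Comm :: "'x oper set" where
  "Comm = {C \<in> bounded_ops R. \<forall>g\<in>G. \<forall>v\<in>H. C (act R g v) = act R g (C v)}"

lemma compose_eq_iff:
  "compose H A B = compose H C D \<longleftrightarrow> (\<forall>v\<in>H. A (B v) = C (D v))"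
  by (auto simp: compose_def fun_eq_iff restrict_def)

lemma commutant_rep: "commutant R (rep_op R ` G) = Comm"
  unfolding commutant_def Comm_def by (auto simp: compose_eq_iff rep_op_def bop_mem)

lemma vn_iff: "T \<in> vn_algebra G R \<longleftrightarrow> T \<in> bounded_ops R \<and> (\<forall>C\<in>Comm. \<forall>v\<in>H. T (C v) = C (T v))"
  by (simp add: vn_algebra_def commutant_rep) (simp add: commutant_def compose_eq_iff)

lemma vnI:
  "T \<in> bounded_ops R \<Longrightarrow> (\<And>C v. C \<in> Comm \<Longrightarrow> v \<in> H \<Longrightarrow> T (C v) = C (T v)) \<Longrightarrow> T \<in> vn_algebra G R"
  by (simp add: vn_iff)

lemma vn_comm: "T \<in> vn_algebra G R \<Longrightarrow> C \<in> Comm \<Longrightarrow> v \<in> H \<Longrightarrow> T (C v) = C (T v)"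
  by (simp add: vn_iff)

lemma vn_bop: "T \<in> vn_algebra G R \<Longrightarrow> T \<in> bounded_ops R"
  by (simp add: vn_iff)

lemma Comm_bop: "C \<in> Comm \<Longrightarrow> C \<in> bounded_ops R"
  by (simp add: Comm_def)

lemma adjoint_exists:
  assumes T: "T \<in> bounded_ops R"
  shows "\<exists>S\<in>bounded_ops R. \<forall>u\<in>H. \<forall>v\<in>H. ip (T u) v = ip u (S v)"
proof -
  obtain K where K: "\<forall>v\<in>H. nrm (T v) \<le> K * nrm v" "K > 0"
    using bop_bound[OF T] by auto
  have "\<exists>z\<in>H. \<forall>u\<in>H. ip (T u) v = ip u z" if v: "v \<in> H" for v
  proof (rule riesz[of _ "K * nrm v"])
    fix u assume u: "u \<in> H"
    have "cmod (ip (T u) v) \<le> nrm (T u) * nrm v"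
      using T u v by (intro cauchy_schwarz) (auto simp: bop_mem)
    also have "\<dots> \<le> (K * nrm u) * nrm v"
      using K u v by (intro mult_right_mono) auto
    finally show "cmod (ip (T u) v) \<le> K * nrm v * nrm u" by (simp add: mult_ac)
  qed (use v in \<open>simp_all add: bop_add[OF T] bop_smul[OF T] ip_add_left ip_smul_left bop_mem[OF T]\<close>)
  then obtain S' where S': "\<And>v. v \<in> H \<Longrightarrow> S' v \<in> H"
    "\<And>u v. v \<in> H \<Longrightarrow> u \<in> H \<Longrightarrow> ip (T u) v = ip u (S' v)" by metis
  have "restrict S' H \<in> bounded_ops R"
    unfolding bounded_ops_iff
  proof (intro conjI ballI allI exI[of _ K])
    fix u v assume u: "u \<in> H" and v: "v \<in> H"
    show "restrict S' H (u + v) = restrict S' H u + restrict S' H v"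
    proof (rule ip_eqI)
      fix w assume w: "w \<in> H"
      then have "ip w (S' (u + v)) = ip w (S' u) + ip w (S' v)"
        using u v T bop_mem by (simp flip: S'(2) add: ip_add_right)
      then show "ip w (restrict S' H (u + v)) = ip w (restrict S' H u + restrict S' H v)"
        using u v w S' by (simp add: ip_add_right)
    qed (use u v S' in auto)
  next
    fix v c assume v: "v \<in> H"
    show "restrict S' H (smul c v) = smul c (restrict S' H v)"
    proof (rule ip_eqI)
      fix w assume w: "w \<in> H"
      then have "ip w (S' (smul c v)) = cnj c * ip w (S' v)"
        using v T bop_mem by (simp flip: S'(2) add: ip_smul_right)
      then show "ip w (restrict S' H (smul c v)) = ip w (smul c (restrict S' H v))"
        using v w S' by (simp add: ip_smul_right)
    qed (use v S' in auto)
  next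
    fix v assume v: "v \<in> H"
    have "(nrm (S' v))\<^sup>2 = Re (ip (T (S' v)) v)"
      using v S' by (simp add: nrm_sq)
    also have "\<dots> \<le> nrm (T (S' v)) * nrm v"
      using cauchy_schwarz[of "T (S' v)" v] complex_Re_le_cmod[of "ip (T (S' v)) v"] v S' T bop_mem
      by force
    also have "\<dots> \<le> K * nrm (S' v) * nrm v"
      using K v S' by (intro mult_right_mono) auto
    finally have "nrm (S' v) * nrm (S' v) \<le> nrm (S' v) * (K * nrm v)"
      by (simp add: power2_eq_square mult_ac)
    then have "nrm (S' v) \<le> K * nrm v"
      by (metis S'(1) K(2) less_eq_real_def mult_le_cancel_left mult_nonneg_nonneg not_le nrm_nonneg v)
    then show "nrm (restrict S' H v) \<le> K * nrm v"
      using v by simp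
  qed (use S' in auto)
  then show ?thesis using S' by (intro bexI[of _ "restrict S' H"]) auto
qed

lemma adj_sym:
  assumes "\<forall>u\<in>H. \<forall>v\<in>H. ip (T u) v = ip u (S v)" "T \<in> bounded_ops R" "S \<in> bounded_ops R" "u \<in> H" "v \<in> H"
  shows "ip (S u) v = ip u (T v)"
  using assms ip_sym[of "T v" u] ip_sym[of v "S u"] by (simp add: bop_mem)

text \<open>The adjoint of a group operator belongs to the inverse element, so commuting with all of
  them is stable under adjoints. The adjoint inside \<open>Comm\<close> is what later moves elements
  of the commutant from one side of a form to the other.\<close>

lemma Comm_adjoint:
  assumes C: "C \<in> Comm"
  shows "\<exists>S\<in>Comm. \<forall>u\<in>H. \<forall>v\<in>H. ip (C u) v = ip u (S v)"
proof -
  have Cb: "C \<in> bounded_ops R" using C by (simp add: Comm_def)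
  obtain S where S: "S \<in> bounded_ops R" "\<forall>u\<in>H. \<forall>v\<in>H. ip (C u) v = ip u (S v)"
    using adjoint_exists[OF Cb] by blast
  have "S (act R g v) = act R g (S v)" if g: "g \<in> G" and v: "v \<in> H" for g v
  proof (rule ip_eqI)
    fix u assume u: "u \<in> H"
    have "ip u (S (act R g v)) = ip (C u) (act R g v)"
      using u g v S by simp
    also have "\<dots> = ip (act R (inv g) (C u)) v"
      using u g v bop_mem[OF Cb] by (simp add: act_inv)
    also have "act R (inv g) (C u) = C (act R (inv g) u)"
      using C u g by (simp add: Comm_def)
    also have "ip \<dots> v = ip (act R (inv g) u) (S v)"
      using S u g v by simp
    also have "\<dots> = ip u (act R g (S v))"
      using u g v bop_mem[OF S(1)] by (simp add: act_inv)
    finally show "ip u (S (act R g v)) = ip u (act R g (S v))" .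
  qed (use S g v bop_mem in auto)
  then show ?thesis using S by (auto simp: Comm_def)
qed

lemma vn_adjoint:
  assumes T: "T \<in> vn_algebra G R"
  shows "\<exists>S\<in>vn_algebra G R. is_adjoint R T S"
proof -
  obtain S where S: "S \<in> bounded_ops R" "\<forall>u\<in>H. \<forall>v\<in>H. ip (T u) v = ip u (S v)"
    using adjoint_exists[OF vn_bop[OF T]] by blast
  have "S (C v) = C (S v)" if C: "C \<in> Comm" and v: "v \<in> H" for C v
  proof -
    obtain C' where C': "C' \<in> Comm" "\<forall>u\<in>H. \<forall>v\<in>H. ip (C u) v = ip u (C' v)"
      using Comm_adjoint[OF C] by blast
    note m = bop_mem[OF S(1)] bop_mem[OF Comm_bop[OF C]] bop_mem[OF Comm_bop[OF C'(1)]] bop_mem[OF vn_bop[OF T]]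
    note a = adj_sym[OF C'(2) Comm_bop[OF C] Comm_bop[OF C'(1)]]
    show ?thesis
    proof (rule ip_eqI)
      fix u assume u: "u \<in> H"
      have "ip u (S (C v)) = ip (T u) (C v)"
        using S u v m by simp
      also have "\<dots> = ip (C' (T u)) v"
        using u v m by (simp add: a)
      also have "C' (T u) = T (C' u)"
        using T C' u by (simp add: vn_iff)
      also have "ip \<dots> v = ip u (C (S v))"
        using S u v m by (simp add: a)
      finally show "ip u (S (C v)) = ip u (C (S v))" .
    qed (use m v in auto)
  qed
  then show ?thesis
    using S by (auto simp: vn_iff is_adjoint_def)
qed

lemma bopI:
  assumes "\<And>v. v \<in> H \<Longrightarrow> T v \<in> H" "\<And>u v. u \<in> H \<Longrightarrow> v \<in> H \<Longrightarrow> T (u + v) = T u + T v"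
    "\<And>c v. v \<in> H \<Longrightarrow> T (smul c v) = smul c (T v)" "\<And>v. v \<in> H \<Longrightarrow> nrm (T v) \<le> K * nrm v"
  shows "restrict T H \<in> bounded_ops R"
  unfolding bounded_ops_iff using assms by (intro conjI exI[of _ K]) auto

lemma vn_add:
  assumes "A \<in> vn_algebra G R" "B \<in> vn_algebra G R"
  shows "op_add R A B \<in> vn_algebra G R"
proof -
  note m = bop_mem[OF vn_bop[OF assms(1)]] bop_mem[OF vn_bop[OF assms(2)]]
  note l = bop_add[OF vn_bop[OF assms(1)]] bop_add[OF vn_bop[OF assms(2)]]
    bop_smul[OF vn_bop[OF assms(1)]] bop_smul[OF vn_bop[OF assms(2)]]
  obtain K L where K: "\<forall>v\<in>H. nrm (A v) \<le> K * nrm v" "\<forall>v\<in>H. nrm (B v) \<le> L * nrm v"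
    using bop_bound[OF vn_bop[OF assms(1)]] bop_bound[OF vn_bop[OF assms(2)]] by blast
  have e: "op_add R A B = restrict (\<lambda>v. A v + B v) H"
    by (simp add: op_add_def plus_fun_def)
  have "nrm (A v + B v) \<le> (K + L) * nrm v" if "v \<in> H" for v
    using nrm_triangle[of "A v" "B v"] K m that by (fastforce simp: distrib_right)
  then have "op_add R A B \<in> bounded_ops R"
    unfolding e by (intro bopI[where K = "K + L"]) (simp_all add: m l smul_add)
  then show ?thesis
  proof (rule vnI)
    fix C v assume Cv: "C \<in> Comm" "v \<in> H"
    then show "op_add R A B (C v) = C (op_add R A B v)"
      using m vn_comm[OF assms(1) Cv] vn_comm[OF assms(2) Cv]
      by (simp add: e bop_mem[OF Comm_bop[OF Cv(1)]] bop_add[OF Comm_bop[OF Cv(1)]])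
  qed
qed

lemma vn_scale:
  assumes "A \<in> vn_algebra G R"
  shows "op_scale R c A \<in> vn_algebra G R"
proof -
  note m = bop_mem[OF vn_bop[OF assms(1)]]
  note l = bop_add[OF vn_bop[OF assms(1)]] bop_smul[OF vn_bop[OF assms(1)]]
  obtain K where K: "\<forall>v\<in>H. nrm (A v) \<le> K * nrm v"
    using bop_bound[OF vn_bop[OF assms(1)]] by blast
  have e: "op_scale R c A = restrict (\<lambda>v. smul c (A v)) H"
    by (simp add: op_scale_def smul_def)
  have "nrm (smul c (A v)) \<le> (cmod c * K) * nrm v" if "v \<in> H" for v
    using K m that by (simp add: nrm_smul mult.assoc mult_left_mono)
  then have "op_scale R c A \<in> bounded_ops R"
    unfolding e by (intro bopI[where K = "cmod c * K"]) (simp_all add: m l smul_add mult.commute)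
  then show ?thesis
  proof (rule vnI)
    fix C v assume Cv: "C \<in> Comm" "v \<in> H"
    then show "op_scale R c A (C v) = C (op_scale R c A v)"
      using m vn_comm[OF assms(1) Cv]
      by (simp add: e bop_mem[OF Comm_bop[OF Cv(1)]] bop_smul[OF Comm_bop[OF Cv(1)]])
  qed
qed

lemma vn_compose:
  assumes "A \<in> vn_algebra G R" "B \<in> vn_algebra G R"
  shows "compose H A B \<in> vn_algebra G R"
proof -
  note m = bop_mem[OF vn_bop[OF assms(1)]] bop_mem[OF vn_bop[OF assms(2)]]
  note l = bop_add[OF vn_bop[OF assms(1)]] bop_add[OF vn_bop[OF assms(2)]]
    bop_smul[OF vn_bop[OF assms(1)]] bop_smul[OF vn_bop[OF assms(2)]]
  obtain K L where K: "\<forall>v\<in>H. nrm (A v) \<le> K * nrm v" "\<forall>v\<in>H. nrm (B v) \<le> L * nrm v" "K > 0"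
    using bop_bound[OF vn_bop[OF assms(1)]] bop_bound[OF vn_bop[OF assms(2)]] by blast
  have "nrm (A (B v)) \<le> (K * L) * nrm v" if "v \<in> H" for v
  proof -
    have "nrm (A (B v)) \<le> K * nrm (B v)" using K m that by blast
    also have "\<dots> \<le> K * (L * nrm v)" using K that by simp
    finally show ?thesis by (simp add: mult.assoc)
  qed
  then have "compose H A B \<in> bounded_ops R"
    unfolding compose_def by (intro bopI[where K = "K * L"]) (simp_all add: m l)
  then show ?thesis
  proof (rule vnI)
    fix C v assume Cv: "C \<in> Comm" "v \<in> H"
    then show "compose H A B (C v) = C (compose H A B v)"
      using m vn_comm[OF assms(2) Cv] vn_comm[OF assms(1) Cv(1)]
      by (simp add: compose_apply bop_mem[OF Comm_bop[OF Cv(1)]])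
  qed
qed

lemma vn_rep: "g \<in> G \<Longrightarrow> rep_op R g \<in> vn_algebra G R"
proof -
  assume g: "g \<in> G"
  have "rep_op R g \<in> bounded_ops R"
    unfolding rep_op_def using g by (intro bopI[where K = 1]) (auto simp: act_add act_smul act_nrm)
  then show ?thesis
    using g by (intro vnI) (auto simp: rep_op_def bop_mem[OF Comm_bop] Comm_def)
qed

lemma rep_id: "v \<in> H \<Longrightarrow> rep_op R id v = v"
  by (simp add: rep_op_def act_id)

text \<open>Writing the zero operator as a multiple of the identity brings it under the clauses of
  \<open>vn_iso\<close>.\<close>

lemma gop_Nil: "gop R [] = op_scale R 0 (rep_op R id)"
  by (simp add: gop_def op_scale_def zero_fun_def restrict_def fun_eq_iff)

lemma gop_Cons: "gop R ((c, g) # xs) = op_add R (op_scale R c (rep_op R g)) (gop R xs)"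
  by (simp add: gop_def op_add_def op_scale_def rep_op_def plus_fun_def smul_def restrict_def fun_eq_iff)

lemma gop_vn: "snd ` set xs \<subseteq> G \<Longrightarrow> gop R xs \<in> vn_algebra G R"
proof (induction xs)
  case Nil
  then show ?case by (simp add: gop_Nil vn_scale vn_rep)
next
  case (Cons a xs)
  then show ?case by (cases a) (auto simp: gop_Cons intro!: vn_add vn_scale vn_rep)
qed

text \<open>The operator \<open>T\<close> represents the inner product of \<open>R\<close> in the form \<open>q\<close>; the invariance of
  \<open>q\<close> under the commutant puts it into the von Neumann algebra.\<close>

lemma form_operator:
  assumes q: "hfs D q" and D: "D \<subseteq> H"
    and le: "\<And>u. u \<in> D \<Longrightarrow> (nrm u)\<^sup>2 \<le> K * Re (q u u)"
    and K: "K \<ge> 0"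
    and inv: "\<And>C u. C \<in> Comm \<Longrightarrow> u \<in> D \<Longrightarrow> C u \<in> D"
    and adj: "\<And>C S u v. C \<in> Comm \<Longrightarrow> S \<in> Comm \<Longrightarrow> \<forall>u\<in>H. \<forall>v\<in>H. ip (C u) v = ip u (S v) \<Longrightarrow>
      u \<in> D \<Longrightarrow> v \<in> D \<Longrightarrow> q (C u) v = q u (S v)"
  shows "\<exists>T\<in>vn_algebra G R. \<forall>v\<in>H. T v \<in> D \<and> (\<forall>u\<in>D. q u (T v) = ip u v)"
proof -
  interpret Q: hfs D q by (rule q)
  have DH: "u \<in> D \<Longrightarrow> u \<in> H" for u using D by auto
  have bd: "nrm u \<le> sqrt K * Q.nrm u" if "u \<in> D" for u
    using real_sqrt_le_mono[OF le[OF that]] DH[OF that] by (simp add: real_sqrt_mult Q.nrm_def)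
  have "\<exists>z\<in>D. \<forall>u\<in>D. ip u v = q u z" if v: "v \<in> H" for v
  proof (rule Q.riesz[of _ "sqrt K * nrm v"])
    fix u assume u: "u \<in> D"
    have "cmod (ip u v) \<le> nrm u * nrm v"
      using u v DH by (intro cauchy_schwarz) auto
    also have "\<dots> \<le> (sqrt K * Q.nrm u) * nrm v"
      using bd u v by (intro mult_right_mono) auto
    finally show "cmod (ip u v) \<le> sqrt K * nrm v * Q.nrm u" by (simp add: mult_ac)
  qed (use v DH in \<open>auto simp: ip_add_left ip_smul_left\<close>)
  then obtain T' where T': "\<And>v. v \<in> H \<Longrightarrow> T' v \<in> D" "\<And>u v. v \<in> H \<Longrightarrow> u \<in> D \<Longrightarrow> q u (T' v) = ip u v"
    by metis
  have eqI: "x = y" if "x \<in> D" "y \<in> D" "\<And>u. u \<in> D \<Longrightarrow> q u x = q u y" for x y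
  proof -
    have "q (x - y) (x - y) = 0"
      using that by (simp add: Q.ip_diff_right)
    then show ?thesis
      using Q.definite[of "x - y"] that by simp
  qed
  have "restrict T' H \<in> bounded_ops R"
  proof (rule bopI[where K = K])
    fix u v assume uv: "u \<in> H" "v \<in> H"
    then show "T' (u + v) = T' u + T' v"
      using T' DH by (intro eqI) (auto simp: Q.ip_add_right ip_add_right)
  next
    fix c v assume v: "v \<in> H"
    then show "T' (smul c v) = smul c (T' v)"
      using T' DH by (intro eqI) (auto simp: Q.ip_smul_right ip_smul_right)
  next
    fix v assume v: "v \<in> H"
    have "(nrm (T' v))\<^sup>2 \<le> K * Re (ip (T' v) v)"
      using le[of "T' v"] T' v by simp
    also have "\<dots> \<le> K * (nrm (T' v) * nrm v)"
      using cauchy_schwarz[of "T' v" v] complex_Re_le_cmod[of "ip (T' v) v"] K v T' DH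
      by (intro mult_left_mono) force+
    finally have "nrm (T' v) * nrm (T' v) \<le> nrm (T' v) * (K * nrm v)"
      by (simp add: power2_eq_square mult_ac)
    then show "nrm (T' v) \<le> K * nrm v"
      by (metis DH K T'(1) less_eq_real_def mult_le_cancel_left mult_nonneg_nonneg not_le nrm_nonneg v)
  qed (use T' DH in auto)
  moreover have "T' (C v) = C (T' v)" if C: "C \<in> Comm" and v: "v \<in> H" for C v
  proof -
    obtain S where S: "S \<in> Comm" "\<forall>u\<in>H. \<forall>v\<in>H. ip (C u) v = ip u (S v)"
      using Comm_adjoint[OF C] by blast
    note m = bop_mem[OF Comm_bop[OF C]] bop_mem[OF Comm_bop[OF S(1)]]
    note a = adj_sym[OF S(2) Comm_bop[OF C] Comm_bop[OF S(1)]]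
    show ?thesis
    proof (rule eqI)
      fix u assume u: "u \<in> D"
      have "q u (T' (C v)) = ip (S u) v"
        using u v m DH T' by (simp add: a)
      also have "\<dots> = q (S u) (T' v)"
        using u v S inv T' by simp
      also have "\<dots> = q u (C (T' v))"
        using adj[OF S(1) C _ u T'(1)[OF v]] a by blast
      finally show "q u (T' (C v)) = q u (C (T' v))" .
    qed (use T' m v inv C in auto)
  qed
  ultimately have "restrict T' H \<in> vn_algebra G R"
    by (simp add: vn_iff bop_mem[OF Comm_bop])
  then show ?thesis
    using T' by (intro bexI[of _ "restrict T' H"]) auto
qed

text \<open>\<open>T = (1 + \<Sum>i. A\<^sub>i\<^sup>* A\<^sub>i)\<^sup>-\<^sup>1\<close>, where the sum need only converge on \<open>v\<^sub>0\<close>.\<close>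

lemma damping_operator:
  fixes A :: "'i \<Rightarrow> 'x oper"
  assumes A: "\<And>i. i \<in> I \<Longrightarrow> A i \<in> vn_algebra G R"
    and v0: "v0 \<in> H" "v0 \<noteq> 0" "(\<lambda>i. (nrm (A i v0))\<^sup>2) summable_on I"
  shows "\<exists>T\<in>vn_algebra G R. T v0 \<noteq> 0 \<and> (\<forall>i\<in>I. \<forall>v\<in>H. nrm (A i (T v)) \<le> nrm v)"
proof -
  \<comment> \<open>The extra index \<open>None\<close> carries the identity operator. It
    contributes the summand 1 and makes the form \<open>q\<close> dominate the inner product of
    \<open>H\<close>. The space \<open>D\<close> is the domain of the closed form given by the whole
    family.\<close>
  define J where "J = insert None (Some ` I)"
  define B where "B k = (case k of None \<Rightarrow> id | Some i \<Rightarrow> A i)" for k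
  define j where "j u = (\<lambda>(k, x). if k \<in> J then B k u x else 0)" for u
  note Am = bop_mem[OF vn_bop[OF A]]
  have Bm: "B k u \<in> H" if "k \<in> J" "u \<in> H" for k u
    using that by (auto simp: B_def J_def Am)
  have Badd: "B k (u + v) = B k u + B k v" if "k \<in> J" "u \<in> H" "v \<in> H" for k u v
    using that by (auto simp: B_def J_def bop_add[OF vn_bop[OF A]])
  have Bdiff: "B k (u - v) = B k u - B k v" if "k \<in> J" "u \<in> H" "v \<in> H" for k u v
    using that by (auto simp: B_def J_def bop_diff[OF vn_bop[OF A]])
  have Bsmul: "B k (smul c u) = smul c (B k u)" if "k \<in> J" "u \<in> H" for k u c
    using that by (auto simp: B_def J_def bop_smul[OF vn_bop[OF A]])
  have Bbound: "\<exists>K. \<forall>v\<in>H. nrm (B k v) \<le> K * nrm v" if "k \<in> J" for k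
  proof (cases k)
    case None
    then show ?thesis by (intro exI[of _ 1]) (auto simp: B_def)
  next
    case (Some i)
    then show ?thesis using bop_bound[OF vn_bop[OF A[of i]]] that by (auto simp: B_def J_def)
  qed
  have BC: "B k (C u) = C (B k u)" if "k \<in> J" "C \<in> Comm" "u \<in> H" for k C u
    using that A by (auto simp: B_def J_def vn_iff)
  have sl: "slice (j u) k = B k u" if "k \<in> J" for u k
    using that by (simp add: j_def slice_def)
  define L where "L = l2_space J H ip"
  interpret L: hfs L "l2_ip J ip"
    unfolding L_def by (rule l2_hfs)
  define D where "D = {u \<in> H. j u \<in> L}"
  define q where "q u v = l2_ip J ip (j u) (j v)" for u v
  have mem_L: "F \<in> L \<longleftrightarrow> (\<forall>i\<in>J. slice F i \<in> H) \<and> (\<forall>i x. i \<notin> J \<longrightarrow> F (i, x) = 0) \<and>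
     (\<lambda>i. Re (ip (slice F i) (slice F i))) summable_on J" for F
    by (simp add: L_def l2_space_def)
  have jadd: "j (u + v) = j u + j v" if "u \<in> H" "v \<in> H" for u v
    using that by (auto simp: j_def fun_eq_iff Badd)
  have jsmul: "j (smul c u) = smul c (j u)" if "u \<in> H" for u c
    using that by (auto simp: j_def fun_eq_iff Bsmul)
  have j0: "j 0 = 0"
    using jsmul[of 0 0] by simp
  have None: "None \<in> J" by (simp add: J_def)
  have hD: "hfs D q"
  proof (rule L.hfs_pullback[where j = j])
    fix u assume u: "u \<in> D" "j u = 0"
    then have "slice (j u) None = 0" by simp
    then show "u = 0" by (simp add: sl[OF None]) (simp add: B_def)
  next
    fix X z assume X: "\<And>n. X n \<in> D" and z: "z \<in> L" and lim: "(\<lambda>n. L.nrm (j (X n) - z)) \<longlonglongrightarrow> 0"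
    have lim_k: "(\<lambda>n. nrm (B k (X n) - slice z k)) \<longlonglongrightarrow> 0" if k: "k \<in> J" for k
    proof (rule Lim_null_comparison[OF always_eventually lim], rule allI)
      fix n
      have "j (X n) - z \<in> L" using X z by (auto simp: D_def)
      from l2_slice_le[OF this[unfolded L_def] k]
      have "nrm (slice (j (X n) - z) k) \<le> L.nrm (j (X n) - z)"
        by (simp add: nrm_def L.nrm_def)
      then show "norm (nrm (B k (X n) - slice z k)) \<le> L.nrm (j (X n) - z)"
        using k X z Bm[OF k, of "X n"] by (simp add: sl mem_L D_def)
    qed
    define u where "u = slice z None"
    have uH: "u \<in> H" using z None by (simp add: u_def mem_L)
    have XH: "X n \<in> H" for n using X by (simp add: D_def)
    have lu: "(\<lambda>n. nrm (X n - u)) \<longlonglongrightarrow> 0"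
      using lim_k[OF None] by (simp add: B_def u_def)
    \<comment> \<open>The graph is closed because each single \<open>B k\<close> is bounded, even
      though the family as a whole may only be densely or partially defined.\<close>
    have sz: "slice z k = B k u" if k: "k \<in> J" for k
    proof -
      obtain K where K: "\<forall>v\<in>H. nrm (B k v) \<le> K * nrm v" using Bbound[OF k] by blast
      have zk: "slice z k \<in> H" using z k by (simp add: mem_L)
      have "(\<lambda>n. nrm (B k (X n) - slice z k) + K * nrm (X n - u)) \<longlonglongrightarrow> 0 + K * 0"
        by (intro tendsto_intros lim_k k lu)
      moreover have "nrm (slice z k - B k u) \<le> nrm (B k (X n) - slice z k) + K * nrm (X n - u)" for n
      proof -
        have "nrm (slice z k - B k u) \<le> nrm (slice z k - B k (X n)) + nrm (B k (X n) - B k u)"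
          using zk Bm[OF k] XH uH by (intro nrm_triangle_diff) auto
        also have "B k (X n) - B k u = B k (X n - u)"
          using k XH uH by (simp add: Bdiff)
        also have "nrm (slice z k - B k (X n)) = nrm (B k (X n) - slice z k)"
          using zk Bm[OF k XH] by (simp add: nrm_diff_commute)
        finally show ?thesis
          using K XH uH by (smt (verit) diff_mem)
      qed
      ultimately have "nrm (slice z k - B k u) \<le> 0"
        by (intro LIMSEQ_le_const) auto
      then have "nrm (slice z k - B k u) = 0"
        using zk Bm[OF k uH] by (intro antisym) auto
      then show ?thesis
        using zk Bm[OF k uH] by (subst (asm) nrm_eq_0_iff) auto
    qed
    have "j u = z"
    proof
      fix p
      show "j u p = z p"
        using z sz[of "fst p"] by (cases p) (auto simp: j_def mem_L slice_def fun_eq_iff)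
    qed
    then show "\<exists>u\<in>D. j u = z" using uH z by (intro bexI[of _ u]) (auto simp: D_def)
  qed (auto simp: D_def q_def jadd jsmul j0 simp del: slice_simps)
  interpret Q: hfs D q by (rule hD)
  have summ: "(\<lambda>k. (nrm (B k u))\<^sup>2) summable_on J \<longleftrightarrow> (\<lambda>k. Re (ip (slice (j u) k) (slice (j u) k))) summable_on J"
    if "u \<in> H" for u using that Bm by (intro summable_on_cong) (simp add: sl nrm_sq)
  have DI: "u \<in> D" if "u \<in> H" "(\<lambda>k. (nrm (B k u))\<^sup>2) summable_on J" for u
    using that Bm by (auto simp: D_def mem_L sl summ) (auto simp: j_def)
  have Dsum: "(\<lambda>k. (nrm (B k u))\<^sup>2) summable_on J" if "u \<in> D" for u
    using that by (simp add: D_def mem_L summ)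
  have q_ge: "(nrm (B k u))\<^sup>2 \<le> Re (q u u)" if "k \<in> J" "u \<in> D" for k u
    using l2_slice_le[of "j u" J k] that Bm[of k u] by (simp add: D_def L_def q_def sl nrm_sq)
  have "\<exists>T\<in>vn_algebra G R. \<forall>v\<in>H. T v \<in> D \<and> (\<forall>u\<in>D. q u (T v) = ip u v)"
  proof (rule form_operator[OF hD, where K = 1])
    show "(nrm u)\<^sup>2 \<le> 1 * Re (q u u)" if "u \<in> D" for u
      using q_ge[OF None that] by (simp add: B_def)
    show "C u \<in> D" if C: "C \<in> Comm" and u: "u \<in> D" for C u
    proof (rule DI)
      obtain K where K: "\<forall>v\<in>H. nrm (C v) \<le> K * nrm v"
        using bop_bound[OF Comm_bop[OF C]] by blast
      have uH: "u \<in> H" using u by (simp add: D_def)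
      show "C u \<in> H" using uH bop_mem[OF Comm_bop[OF C]] by simp
      have "(\<lambda>k. K\<^sup>2 * (nrm (B k u))\<^sup>2) summable_on J"
        using Dsum[OF u] by (intro summable_on_cmult_right)
      then show "(\<lambda>k. (nrm (B k (C u)))\<^sup>2) summable_on J"
      proof (rule summable_on_comparison_test)
        fix k assume k: "k \<in> J"
        have "nrm (B k (C u)) \<le> K * nrm (B k u)"
          using K Bm[OF k uH] BC[OF k C uH] by simp
        then have "(nrm (B k (C u)))\<^sup>2 \<le> (K * nrm (B k u))\<^sup>2"
          using Bm[OF k] bop_mem[OF Comm_bop[OF C] uH] by (intro power_mono) auto
        then show "(nrm (B k (C u)))\<^sup>2 \<le> K\<^sup>2 * (nrm (B k u))\<^sup>2"
          by (simp add: power_mult_distrib)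
      qed simp
    qed
    show "q (C u) v = q u (S v)"
      if CS: "C \<in> Comm" "S \<in> Comm" "\<forall>u\<in>H. \<forall>v\<in>H. ip (C u) v = ip u (S v)" and "u \<in> D" "v \<in> D" for C S u v
      unfolding q_def l2_ip_def
    proof (rule infsum_cong)
      fix k assume k: "k \<in> J"
      have "u \<in> H" "v \<in> H" using that by (auto simp: D_def)
      then show "ip (slice (j (C u)) k) (slice (j v) k) = ip (slice (j u) k) (slice (j (S v)) k)"
        using k CS Bm by (simp add: sl BC)
    qed
  qed (auto simp: D_def)
  then obtain T where T: "T \<in> vn_algebra G R" "\<And>v. v \<in> H \<Longrightarrow> T v \<in> D"
    "\<And>u v. v \<in> H \<Longrightarrow> u \<in> D \<Longrightarrow> q u (T v) = ip u v" by blast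
  \<comment> \<open>For every index \<open>l\<close> the square of \<open>nrm (B l (T v))\<close> is
    at most \<open>q (T v) (T v)\<close>, which is the inner product of \<open>T v\<close> and
    \<open>v\<close>. The index \<open>None\<close> first yields that \<open>T\<close> is a
    contraction, and then the other indices follow.\<close>
  have Tb: "nrm (B k (T v)) \<le> nrm v" if k: "k \<in> J" and v: "v \<in> H" for k v
  proof -
    have *: "(nrm (B l (T v)))\<^sup>2 \<le> nrm (T v) * nrm v" if "l \<in> J" for l
    proof -
      have "(nrm (B l (T v)))\<^sup>2 \<le> Re (ip (T v) v)"
        using q_ge[OF that T(2)[OF v]] T v by simp
      also have "\<dots> \<le> nrm (T v) * nrm v"
        using cauchy_schwarz[of "T v" v] complex_Re_le_cmod[of "ip (T v) v"] v T by (force simp: D_def)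
      finally show ?thesis .
    qed
    have TH: "T v \<in> H" using T(2)[OF v] by (simp add: D_def)
    have "nrm (T v) * nrm (T v) \<le> nrm (T v) * nrm v"
      using *[OF None] by (simp add: B_def power2_eq_square)
    then have "nrm (T v) \<le> nrm v"
      by (metis TH less_eq_real_def mult_le_cancel_left nrm_nonneg not_le v)
    then have "nrm (T v) * nrm v \<le> (nrm v)\<^sup>2"
      using v by (simp add: power2_eq_square mult_right_mono)
    with *[OF k] have "(nrm (B k (T v)))\<^sup>2 \<le> (nrm v)\<^sup>2" by simp
    then show ?thesis by (rule power2_le_imp_le) (use v in simp)
  qed
  \<comment> \<open>Here the summability at \<open>v0\<close> enters. As \<open>v0\<close> lies in
    the form domain, \<open>q v0 (T v0)\<close> equals the squared norm of \<open>v0\<close>, which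
    excludes \<open>T v0 = 0\<close>.\<close>
  have "v0 \<in> D"
  proof (rule DI[OF v0(1)])
    have "(\<lambda>k. (nrm (B k v0))\<^sup>2) summable_on Some ` I"
      using v0(3) summable_on_reindex[of Some I "\<lambda>k. (nrm (B k v0))\<^sup>2"] by (simp add: o_def B_def)
    then show "(\<lambda>k. (nrm (B k v0))\<^sup>2) summable_on J"
      unfolding J_def by (simp only: summable_on_insert_iff)
  qed
  then have "q v0 (T v0) = ip v0 v0"
    using T(3) v0 by simp
  moreover have "Re (ip v0 v0) \<noteq> 0"
    using definite v0 by blast
  ultimately have "T v0 \<noteq> 0"
    using Q.ip_zero_right[OF \<open>v0 \<in> D\<close>] by auto
  moreover have "nrm (A i (T v)) \<le> nrm v" if "i \<in> I" "v \<in> H" for i v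
    using Tb[of "Some i" v] that by (simp add: B_def J_def)
  ultimately show ?thesis using T(1) by blast
qed

text \<open>For \<open>s > 1\<close> the form \<open>s * ip u v - ip (A u) (A v)\<close> is an inner
  product equivalent to \<open>ip\<close>, and the operator that represents \<open>ip\<close> in it
  inverts \<open>s - B A\<close>. The left inverse is what bounds \<open>s - B A\<close> from below
  after transport.\<close>

lemma resolvent:
  assumes A: "A \<in> vn_algebra G R" and B: "B \<in> vn_algebra G R" and adj: "is_adjoint R A B"
    and contr: "\<And>v. v \<in> H \<Longrightarrow> nrm (A v) \<le> nrm v" and s: "s > 1"
  shows "\<exists>S\<in>vn_algebra G R. \<forall>v\<in>H. S (smul (of_real s) v - B (A v)) = v"
proof -
  define q where "q u v = of_real s * ip u v - ip (A u) (A v)" for u v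
  note m = bop_mem[OF vn_bop[OF A]] bop_mem[OF vn_bop[OF B]]
  note l = bop_add[OF vn_bop[OF A]] bop_smul[OF vn_bop[OF A]] bop_diff[OF vn_bop[OF A]]
  have q_ge: "(s - 1) * (nrm u)\<^sup>2 \<le> Re (q u u)" if "u \<in> H" for u
  proof -
    have "(nrm (A u))\<^sup>2 \<le> (nrm u)\<^sup>2"
      using contr[OF that] that m by (intro power_mono) auto
    then show ?thesis
      using that m by (simp add: q_def nrm_sq algebra_simps)
  qed
  have q_le: "Re (q u u) \<le> s * (nrm u)\<^sup>2" if "u \<in> H" for u
    using that m s by (simp add: q_def nrm_sq)
  have sq: "semi_ip H q"
  proof
    fix u v assume "u \<in> H" "v \<in> H"
    then show "q v u = cnj (q u v)"
      using ip_sym[of u v] ip_sym[of "A u" "A v"] m by (simp add: q_def)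
  next
    fix u assume u: "u \<in> H"
    have "0 \<le> (s - 1) * (nrm u)\<^sup>2" using s by simp
    then show "0 \<le> Re (q u u)" using q_ge[OF u] by linarith
  qed (auto simp: q_def ip_add_left ip_smul_left l m algebra_simps)
  interpret Q: semi_ip H q by (rule sq)
  have hq: "hfs H q"
  proof
    fix u assume u: "u \<in> H" "Re (q u u) = 0"
    have "(s - 1) * (nrm u)\<^sup>2 \<le> 0" using q_ge[OF u(1)] u(2) by simp
    then have "(nrm u)\<^sup>2 \<le> 0" using s by (simp add: mult_le_0_iff)
    then show "u = 0" using u nrm_eq_0_iff[of u] by simp
  next
    fix X :: "nat \<Rightarrow> 'x \<Rightarrow> complex"
    assume X: "\<And>n. X n \<in> H" and C: "\<And>e. e > 0 \<Longrightarrow> \<exists>N. \<forall>m\<ge>N. \<forall>n\<ge>N. Re (q (X m - X n) (X m - X n)) < e"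
    have "\<exists>N. \<forall>m\<ge>N. \<forall>n\<ge>N. Re (ip (X m - X n) (X m - X n)) < e" if e: "e > 0" for e
    proof -
      obtain N where N: "\<forall>m\<ge>N. \<forall>n\<ge>N. Re (q (X m - X n) (X m - X n)) < (s - 1) * e"
        using C[of "(s - 1) * e"] e s by auto
      have "Re (ip (X m - X n) (X m - X n)) < e" if "m \<ge> N" "n \<ge> N" for m n
      proof -
        have "(s - 1) * (nrm (X m - X n))\<^sup>2 < (s - 1) * e"
          using N that q_ge[of "X m - X n"] X by fastforce
        then show ?thesis using s X by (simp add: nrm_sq)
      qed
      then show ?thesis by blast
    qed
    from complete[OF X this] obtain x where x: "x \<in> H" "(\<lambda>n. Re (ip (X n - x) (X n - x))) \<longlonglongrightarrow> 0"
      by blast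
    have l0: "(\<lambda>n. s * Re (ip (X n - x) (X n - x))) \<longlonglongrightarrow> 0"
      using tendsto_mult_right_zero[OF x(2)] by simp
    have "(\<lambda>n. Re (q (X n - x) (X n - x))) \<longlonglongrightarrow> 0"
    proof (rule Lim_null_comparison[OF always_eventually l0], rule allI)
      fix n
      have d: "X n - x \<in> H" using X x by auto
      show "norm (Re (q (X n - x) (X n - x))) \<le> s * Re (ip (X n - x) (X n - x))"
        using q_le[OF d] Q.ip_nonneg[OF d] nrm_sq[OF d] by simp
    qed
    then show "\<exists>x\<in>H. (\<lambda>n. Re (q (X n - x) (X n - x))) \<longlonglongrightarrow> 0" using x by blast
  qed
  interpret Q: hfs H q by (rule hq)
  have "\<exists>T\<in>vn_algebra G R. \<forall>v\<in>H. T v \<in> H \<and> (\<forall>u\<in>H. q u (T v) = ip u v)"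
  proof (rule form_operator[OF hq, where K = "1 / (s - 1)"])
    show "(nrm u)\<^sup>2 \<le> 1 / (s - 1) * Re (q u u)" if "u \<in> H" for u
      using q_ge[OF that] s by (simp add: field_simps)
    show "q (C u) v = q u (S v)"
      if "C \<in> Comm" "S \<in> Comm" "\<forall>u\<in>H. \<forall>v\<in>H. ip (C u) v = ip u (S v)" "u \<in> H" "v \<in> H" for C S u v
      using that A m by (simp add: q_def vn_iff)
  qed (use s bop_mem[OF Comm_bop] in auto)
  then obtain T where T: "T \<in> vn_algebra G R" "\<And>v. v \<in> H \<Longrightarrow> T v \<in> H"
    "\<And>u v. v \<in> H \<Longrightarrow> u \<in> H \<Longrightarrow> q u (T v) = ip u v" by blast
  have "T (smul (of_real s) v - B (A v)) = v" if v: "v \<in> H" for v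
  proof -
    let ?z = "smul (of_real s) v - B (A v)"
    have z: "?z \<in> H" using v m by auto
    have "q u (T ?z - v) = 0" if u: "u \<in> H" for u
    proof -
      have "ip u ?z = q u v"
        using u v m adj by (simp add: q_def ip_diff_right ip_smul_right is_adjoint_def)
      then show ?thesis
        using u v z T by (simp add: Q.ip_diff_right)
    qed
    then have "q (T ?z - v) (T ?z - v) = 0"
      using T z v by simp
    then show ?thesis
      using Q.definite[of "T ?z - v"] T z v by simp
  qed
  then show ?thesis using T(1) by blast
qed

end

section \<open>Isomorphisms of von Neumann algebras and the transport of bounds\<close>

locale vn_isomorphism = R1: unitary_rep G R + R2: unitary_rep G R'
  for G :: "('a \<Rightarrow> 'a) set" and R :: "('a \<Rightarrow> 'a, 'x) urep" and R' :: "('a \<Rightarrow> 'a, 'y) urep" +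
  fixes \<Phi> :: "'x oper \<Rightarrow> 'y oper"
  assumes iso: "vn_iso R R' (vn_algebra G R) (vn_algebra G R') \<Phi>"
    and rep: "g \<in> G \<Longrightarrow> \<Phi> (rep_op R g) = rep_op R' g"
begin

abbreviation "M \<equiv> vn_algebra G R"

lemma bij: "bij_betw \<Phi> M (vn_algebra G R')"
  using iso by (simp add: vn_iso_def)

lemma Phi_mem: "A \<in> M \<Longrightarrow> \<Phi> A \<in> vn_algebra G R'"
  using bij by (auto simp: bij_betw_def)

lemma Phi_add: "A \<in> M \<Longrightarrow> B \<in> M \<Longrightarrow> \<Phi> (op_add R A B) = op_add R' (\<Phi> A) (\<Phi> B)"
  and Phi_scale: "A \<in> M \<Longrightarrow> \<Phi> (op_scale R c A) = op_scale R' c (\<Phi> A)"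
  and Phi_compose: "A \<in> M \<Longrightarrow> B \<in> M \<Longrightarrow>
    \<Phi> (compose (hspace R) A B) = compose (hspace R') (\<Phi> A) (\<Phi> B)"
  and Phi_adjoint: "A \<in> M \<Longrightarrow> B \<in> M \<Longrightarrow> is_adjoint R A B \<Longrightarrow> is_adjoint R' (\<Phi> A) (\<Phi> B)"
  using iso by (simp_all add: vn_iso_def)

lemma Phi_gop: "snd ` set xs \<subseteq> G \<Longrightarrow> \<Phi> (gop R xs) = gop R' xs"
proof (induction xs)
  case Nil
  then show ?case
    by (simp add: R1.gop_Nil R2.gop_Nil Phi_scale R1.vn_rep rep)
next
  case (Cons a xs)
  then show ?case
    by (cases a) (simp add: R1.gop_Cons R2.gop_Cons Phi_add Phi_scale R1.vn_rep R1.vn_scale R1.gop_vn rep)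
qed

text \<open>If \<open>A\<close> is a contraction but the norm \<open>m\<close> of \<open>\<Phi> A\<^sup>* \<Phi> A\<close> exceeds 1, then the image of the
  resolvent of \<open>A\<^sup>* A\<close> at \<open>m\<close> contradicts the existence of approximate eigenvectors for \<open>m\<close>.\<close>

lemma Phi_contraction:
  assumes A: "A \<in> M" and contr: "\<And>v. v \<in> hspace R \<Longrightarrow> R1.nrm (A v) \<le> R1.nrm v" and w: "w \<in> hspace R'"
  shows "R2.nrm (\<Phi> A w) \<le> R2.nrm w"
proof (rule ccontr)
  assume gt: "\<not> ?thesis"
  define A' where "A' = \<Phi> A"
  obtain B where B: "B \<in> M" "is_adjoint R A B"
    using R1.vn_adjoint[OF A] by blast
  define B' where "B' = \<Phi> B"
  have adj: "is_adjoint R' A' B'"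
    using A B by (simp add: A'_def B'_def Phi_adjoint)
  have A'M: "A' \<in> vn_algebra G R'" and B'M: "B' \<in> vn_algebra G R'"
    using A B by (simp_all add: A'_def B'_def Phi_mem)
  note m' = R2.bop_mem[OF R2.vn_bop[OF A'M]] R2.bop_mem[OF R2.vn_bop[OF B'M]]
  have wn: "R2.nrm w > 0"
    using gt w m' R2.nrm_pos[OF w] R2.bop_smul[OF R2.vn_bop[OF A'M] w, of 0]
    by (cases "w = 0") (auto simp: A'_def)
  \<comment> \<open>The supremum \<open>m\<close> of these values is the squared operator norm of
    \<open>A'\<close>.\<close>
  define V where "V = (\<lambda>v. (R2.nrm (A' v))\<^sup>2) ` {v \<in> hspace R'. R2.nrm v \<le> 1}"
  define m where "m = Sup V"
  obtain K where K: "K > 0" "\<forall>v\<in>hspace R'. R2.nrm (A' v) \<le> K * R2.nrm v"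
    using R2.bop_bound[OF R2.vn_bop[OF A'M]] by blast
  have bdd: "bdd_above V"
  proof (rule bdd_aboveI)
    fix x assume "x \<in> V"
    then obtain v where v: "v \<in> hspace R'" "R2.nrm v \<le> 1" "x = (R2.nrm (A' v))\<^sup>2"
      by (auto simp: V_def)
    have "R2.nrm (A' v) \<le> K * 1"
      using K v by (meson mult_left_mono less_imp_le order_trans)
    then show "x \<le> K\<^sup>2"
      using v m' by (simp add: power_mono)
  qed
  have le_m: "(R2.nrm (A' v))\<^sup>2 \<le> m" if "v \<in> hspace R'" "R2.nrm v \<le> 1" for v
    unfolding m_def using bdd that by (intro cSup_upper) (auto simp: V_def)
  have bd: "(R2.nrm (A' v))\<^sup>2 \<le> m * (R2.nrm v)\<^sup>2" if v: "v \<in> hspace R'" for v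
  proof (cases "v = 0")
    case True
    then show ?thesis
      using R2.bop_smul[OF R2.vn_bop[OF A'M] v, of 0] by simp
  next
    case False
    then have n: "R2.nrm v > 0" using v by (rule R2.nrm_pos[rotated])
    have "(R2.nrm (A' (smul (of_real (1 / R2.nrm v)) v)))\<^sup>2 \<le> m"
      using v n by (intro le_m) (auto simp: R2.nrm_smul norm_divide)
    then show ?thesis
      using v n m' by (simp add: R2.bop_smul[OF R2.vn_bop[OF A'M]] R2.nrm_smul norm_divide
          power_divide field_simps)
  qed
  have m1: "m > 1"
  proof (rule ccontr)
    assume "\<not> m > 1"
    then have "m * (R2.nrm w)\<^sup>2 \<le> 1 * (R2.nrm w)\<^sup>2"
      by (intro mult_right_mono) auto
    then have "(R2.nrm (A' w))\<^sup>2 \<le> (R2.nrm w)\<^sup>2"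
      using bd[OF w] by simp
    then have "R2.nrm (A' w) \<le> R2.nrm w"
      by (rule power2_le_imp_le) (use w in simp)
    then show False using gt by (simp add: A'_def)
  qed
  obtain S where S: "S \<in> M" "\<forall>v\<in>hspace R. S (smul (of_real m) v - B (A v)) = v"
    using R1.resolvent[OF A B contr m1] by blast
  define S' where "S' = \<Phi> S"
  have S'M: "S' \<in> vn_algebra G R'"
    using S by (simp add: S'_def Phi_mem)
  \<comment> \<open>The operator \<open>m - B A\<close>, spelled with the operations that
    \<open>vn_iso\<close> transports.\<close>
  define X where "X = op_add R (op_scale R (of_real m) (rep_op R id)) (op_scale R (-1) (compose (hspace R) B A))"
  note mA = R1.bop_mem[OF R1.vn_bop[OF A]] R1.bop_mem[OF R1.vn_bop[OF B(1)]]
  have X: "X v = smul (of_real m) v - B (A v)" if "v \<in> hspace R" for v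
    using that mA by (simp add: X_def op_add_def op_scale_def compose_apply R1.rep_id fun_eq_iff)
  have XM: "X \<in> M"
    unfolding X_def by (intro R1.vn_add R1.vn_scale R1.vn_compose R1.vn_rep A B) auto
  have "compose (hspace R) S X = rep_op R id"
    unfolding compose_def rep_op_def by (rule restrict_ext) (use S X R1.act_id in simp)
  then have "compose (hspace R') S' (\<Phi> X) = rep_op R' id"
    using Phi_compose[OF S(1) XM] rep[OF R1.id_mem] by (simp add: S'_def)
  moreover have "\<Phi> X = op_add R' (op_scale R' (of_real m) (rep_op R' id)) (op_scale R' (-1) (compose (hspace R') B' A'))"
    using A B by (simp add: X_def Phi_add Phi_scale Phi_compose R1.vn_scale R1.vn_compose R1.vn_rep rep
        A'_def B'_def)
  ultimately have S'X: "S' (smul (of_real m) v - B' (A' v)) = v" if "v \<in> hspace R'" for v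
  proof -
    assume 1: "compose (hspace R') S' (\<Phi> X) = rep_op R' id"
      and 2: "\<Phi> X = op_add R' (op_scale R' (of_real m) (rep_op R' id)) (op_scale R' (-1) (compose (hspace R') B' A'))"
    have "\<Phi> X v = smul (of_real m) v - B' (A' v)"
      using that m' by (simp add: 2 op_add_def op_scale_def compose_apply R2.rep_id fun_eq_iff)
    then show ?thesis
      using fun_cong[OF 1, of v] that by (simp add: compose_apply R2.rep_id)
  qed
  obtain k where k: "k > 0" "\<forall>v\<in>hspace R'. R2.nrm (S' v) \<le> k * R2.nrm v"
    using R2.bop_bound[OF R2.vn_bop[OF S'M]] by blast
  \<comment> \<open>The estimate below reads \<open>a \<le> k^2 m^2 (m - a)\<close> for the value
    \<open>a\<close> of \<open>(nrm (A' v))^2\<close>. Solving it for \<open>a\<close> gives this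
    number, which is strictly below \<open>m\<close>.\<close>
  define \<theta> where "\<theta> = m * (k\<^sup>2 * m\<^sup>2 / (1 + k\<^sup>2 * m\<^sup>2))"
  have est: "(R2.nrm (A' v))\<^sup>2 \<le> \<theta>" if v: "v \<in> hspace R'" "R2.nrm v \<le> 1" for v
  proof -
    define a where "a = (R2.nrm (A' v))\<^sup>2"
    let ?z = "smul (of_real m) v - B' (A' v)"
    have vB: "B' (A' v) \<in> hspace R'" using v m' by simp
    \<comment> \<open>The adjoint obeys the same bound as \<open>A'\<close>: the squared norm of
      \<open>B' x\<close> is the inner product of \<open>A' (B' x)\<close> and \<open>x\<close>, and
      applying \<open>bd\<close> at \<open>B' x\<close> lets one factor cancel.\<close>
    have B'bd: "(R2.nrm (B' x))\<^sup>2 \<le> m * (R2.nrm x)\<^sup>2" if x: "x \<in> hspace R'" for x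
    proof -
      have "(R2.nrm (B' x))\<^sup>2 = Re (inprod R' (A' (B' x)) x)"
        using x m' adj by (simp add: R2.nrm_sq is_adjoint_def)
      also have "\<dots> \<le> R2.nrm (A' (B' x)) * R2.nrm x"
        using R2.cauchy_schwarz[of "A' (B' x)" x] complex_Re_le_cmod[of "inprod R' (A' (B' x)) x"] x m'
        by force
      finally have *: "(R2.nrm (B' x))\<^sup>2 \<le> R2.nrm (A' (B' x)) * R2.nrm x" .
      have "((R2.nrm (B' x))\<^sup>2)\<^sup>2 \<le> (R2.nrm (A' (B' x)) * R2.nrm x)\<^sup>2"
        using * by (intro power_mono) auto
      also have "\<dots> \<le> (m * (R2.nrm (B' x))\<^sup>2) * (R2.nrm x)\<^sup>2"
        unfolding power_mult_distrib using bd[of "B' x"] x m' by (intro mult_right_mono) auto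
      finally have *: "(R2.nrm (B' x))\<^sup>2 * (R2.nrm (B' x))\<^sup>2 \<le> (R2.nrm (B' x))\<^sup>2 * (m * (R2.nrm x)\<^sup>2)"
        by (simp add: power2_eq_square mult_ac)
      then show ?thesis
      proof (cases "R2.nrm (B' x) = 0")
        case False
        then have "(R2.nrm (B' x))\<^sup>2 > 0" by simp
        from mult_left_le_imp_le[OF * this] show ?thesis .
      qed (use m1 in simp)
    qed
    have ip: "inprod R' v (B' (A' v)) = inprod R' (A' v) (A' v)"
      using adj v m' by (simp add: is_adjoint_def)
    have "(R2.nrm ?z)\<^sup>2 = m\<^sup>2 * (R2.nrm v)\<^sup>2 - 2 * m * a + (R2.nrm (B' (A' v)))\<^sup>2"
      using v vB m' m1 ip by (simp add: R2.nrm_sq_diff R2.nrm_smul power_mult_distrib R2.ip_smul_left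
          R2.nrm_sq[symmetric] a_def)
    also have "\<dots> \<le> m\<^sup>2 * 1 - 2 * m * a + m * a"
    proof -
      have "(R2.nrm v)\<^sup>2 \<le> 1" using v by (simp add: power_le_one)
      then have "m\<^sup>2 * (R2.nrm v)\<^sup>2 \<le> m\<^sup>2 * 1" by (intro mult_left_mono) auto
      moreover have "(R2.nrm (B' (A' v)))\<^sup>2 \<le> m * a"
        using B'bd[of "A' v"] v m' by (simp add: a_def)
      ultimately show ?thesis by linarith
    qed
    \<comment> \<open>If \<open>a\<close> is near \<open>m\<close>, then \<open>v\<close> is almost
      an eigenvector of \<open>B' A'\<close> for the value \<open>m\<close>; the transported left
      inverse \<open>S'\<close> does not allow this.\<close>
    finally have z: "(R2.nrm ?z)\<^sup>2 \<le> m * (m - a)" by (simp add: power2_eq_square algebra_simps)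
    have zH: "?z \<in> hspace R'" using v vB by auto
    have "R2.nrm v \<le> k * R2.nrm ?z"
      using k(2) zH S'X[OF v(1)] by metis
    then have "(R2.nrm v)\<^sup>2 \<le> k\<^sup>2 * (R2.nrm ?z)\<^sup>2"
      using v by (metis R2.nrm_nonneg power_mono power_mult_distrib)
    also have "\<dots> \<le> k\<^sup>2 * (m * (m - a))"
      using z by (intro mult_left_mono) auto
    finally have "m * (R2.nrm v)\<^sup>2 \<le> m * (k\<^sup>2 * (m * (m - a)))"
      using m1 by (intro mult_left_mono) auto
    then have "a \<le> m * (k\<^sup>2 * (m * (m - a)))"
      using bd[OF v(1)] by (simp add: a_def)
    then have "a * (1 + k\<^sup>2 * m\<^sup>2) \<le> m * (k\<^sup>2 * m\<^sup>2)"
      by (simp add: power2_eq_square algebra_simps)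
    moreover have "1 + k\<^sup>2 * m\<^sup>2 > 0"
      by (simp add: add_pos_nonneg)
    ultimately show ?thesis
      by (simp add: a_def \<theta>_def pos_le_divide_eq)
  qed
  have "0 \<in> hspace R'" by simp
  then have "V \<noteq> {}" by (force simp: V_def)
  then have "m \<le> \<theta>"
    unfolding m_def by (rule cSup_least) (use est in \<open>auto simp: V_def\<close>)
  moreover have "k\<^sup>2 * m\<^sup>2 / (1 + k\<^sup>2 * m\<^sup>2) < 1"
    by (simp add: add_pos_nonneg)
  then have "\<theta> < m * 1"
    unfolding \<theta>_def using m1 by (intro mult_strict_left_mono) auto
  ultimately show False by simp
qed

text \<open>The wanted vector is an image under \<open>\<Phi> T\<close>, where \<open>T\<close> is a
  damping operator for \<open>v0\<close>. Injectivity of \<open>\<Phi>\<close> keeps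
  \<open>\<Phi> T\<close> nonzero, and the contractions obtained by composing the \<open>Y i\<close>
  with \<open>T\<close> stay contractions by \<open>Phi_contraction\<close>.\<close>

lemma transport:
  fixes Y :: "'i \<Rightarrow> (complex \<times> ('a \<Rightarrow> 'a)) list"
  assumes Y: "\<And>i. i \<in> I \<Longrightarrow> snd ` set (Y i) \<subseteq> G"
    and v0: "v0 \<in> hspace R" "v0 \<noteq> 0" "(\<lambda>i. (hnorm R (gact R (Y i) v0))\<^sup>2) summable_on I"
  shows "\<exists>w\<in>hspace R'. w \<noteq> 0 \<and> (\<exists>K. \<forall>i\<in>I. hnorm R' (gact R' (Y i) w) \<le> K)"
proof -
  have "\<exists>T\<in>M. T v0 \<noteq> 0 \<and> (\<forall>i\<in>I. \<forall>v\<in>hspace R. R1.nrm (gop R (Y i) (T v)) \<le> R1.nrm v)"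
  proof (rule R1.damping_operator)
    show "(\<lambda>i. (R1.nrm (gop R (Y i) v0))\<^sup>2) summable_on I"
      using v0 by (simp add: gop_def R1.hnorm_nrm)
  qed (use Y v0 R1.gop_vn in auto)
  then obtain T where T: "T \<in> M" "T v0 \<noteq> 0"
    "\<And>i v. i \<in> I \<Longrightarrow> v \<in> hspace R \<Longrightarrow> R1.nrm (gop R (Y i) (T v)) \<le> R1.nrm v" by blast
  have "\<exists>w\<in>hspace R'. \<Phi> T w \<noteq> 0"
  proof (rule ccontr)
    assume "\<not> ?thesis"
    then have 0: "\<And>w. w \<in> hspace R' \<Longrightarrow> \<Phi> T w = 0" by blast
    \<comment> \<open>The zero operator enters as 0 times \<open>T\<close>: if
      \<open>\<Phi> T\<close> vanished on the space, both would have the same image, and injectivity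
      would give \<open>T v0 = 0\<close>.\<close>
    have "\<Phi> (op_scale R 0 T) = op_scale R' 0 (\<Phi> T)"
      using T by (simp add: Phi_scale)
    also have "\<dots> = \<Phi> T"
    proof
      fix w show "op_scale R' 0 (\<Phi> T) w = \<Phi> T w"
        using 0 R2.bop_ext[OF R2.vn_bop[OF Phi_mem[OF T(1)]]]
        by (cases "w \<in> hspace R'") (auto simp: op_scale_def extensional_def)
    qed
    finally have "op_scale R 0 T = T"
      using bij T by (meson R1.vn_scale bij_betw_def inj_onD)
    then have "T v0 = op_scale R 0 T v0" by simp
    also have "\<dots> = 0" using v0 by (simp add: op_scale_def fun_eq_iff)
    finally show False using T by simp
  qed
  then obtain w where w: "w \<in> hspace R'" "\<Phi> T w \<noteq> 0" by blast
  have Tw: "\<Phi> T w \<in> hspace R'"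
    using w R2.bop_mem[OF R2.vn_bop[OF Phi_mem[OF T(1)]]] by blast
  have "R2.nrm (gact R' (Y i) (\<Phi> T w)) \<le> R2.nrm w" if i: "i \<in> I" for i
  proof -
    have "R2.nrm (\<Phi> (compose (hspace R) (gop R (Y i)) T) w) \<le> R2.nrm w"
      using T i Y R1.gop_vn w
      by (intro Phi_contraction R1.vn_compose) (auto simp: compose_apply)
    also have "\<Phi> (compose (hspace R) (gop R (Y i)) T) = compose (hspace R') (gop R' (Y i)) (\<Phi> T)"
      using T i Y R1.gop_vn by (simp add: Phi_compose Phi_gop)
    also have "\<dots> w = gact R' (Y i) (\<Phi> T w)"
      using w Tw by (simp add: compose_apply gop_def)
    finally show ?thesis .
  qed
  then show ?thesis using w Tw by (auto simp: R2.hnorm_nrm)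
qed

end

lemma quasi_equivalent_transport:
  fixes Y :: "'i \<Rightarrow> (complex \<times> ('a \<Rightarrow> 'a)) list"
  assumes "unitary_rep G R" "unitary_rep G R'" "quasi_equivalent G R R'"
    and Y: "\<And>i. i \<in> I \<Longrightarrow> snd ` set (Y i) \<subseteq> G"
    and v0: "v0 \<in> hspace R" "v0 \<noteq> 0" "(\<lambda>i. (hnorm R (gact R (Y i) v0))\<^sup>2) summable_on I"
  shows "\<exists>w\<in>hspace R'. w \<noteq> 0 \<and> (\<exists>K. \<forall>i\<in>I. hnorm R' (gact R' (Y i) w) \<le> K)"
proof -
  obtain \<Phi> where Phi: "vn_iso R R' (vn_algebra G R) (vn_algebra G R') \<Phi>"
    "\<And>g. g \<in> G \<Longrightarrow> \<Phi> (rep_op R g) = rep_op R' g"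
    using assms by (auto simp: quasi_equivalent_def)
  interpret R1: unitary_rep G R by fact
  interpret R2: unitary_rep G R' by fact
  interpret vn_isomorphism G R R' \<Phi>
    by unfold_locales (use Phi in auto)
  show ?thesis using transport[of I Y v0] Y v0 by simp
qed

text \<open>Only the adjoint clause needs an argument, since \<open>vn_iso\<close> states it in one
  direction. The adjoint of \<open>\<Psi> A\<close> exists in the algebra, its image is an adjoint
  of \<open>A\<close>, and adjoints are unique among extensional operators.\<close>

lemma quasi_equivalent_sym:
  assumes "unitary_rep G R" "unitary_rep G R'" "quasi_equivalent G R R'"
  shows "quasi_equivalent G R' R"
proof -
  obtain \<Phi> where Phi: "vn_iso R R' (vn_algebra G R) (vn_algebra G R') \<Phi>"
    "\<And>g. g \<in> G \<Longrightarrow> \<Phi> (rep_op R g) = rep_op R' g"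
    using assms by (auto simp: quasi_equivalent_def)
  interpret R1: unitary_rep G R by fact
  interpret R2: unitary_rep G R' by fact
  interpret vn_isomorphism G R R' \<Phi>
    by unfold_locales (use Phi in auto)
  define \<Psi> where "\<Psi> = inv_into M \<Phi>"
  have bij': "bij_betw \<Psi> (vn_algebra G R') M"
    unfolding \<Psi>_def by (rule bij_betw_inv_into[OF bij])
  have PhiPsi: "\<Phi> (\<Psi> A) = A" if "A \<in> vn_algebra G R'" for A
    unfolding \<Psi>_def using that bij by (metis bij_betw_inv_into_right)
  have PsiPhi: "\<Psi> (\<Phi> A) = A" if "A \<in> M" for A
    unfolding \<Psi>_def using that bij by (metis bij_betw_inv_into_left)
  have Psi_mem: "\<Psi> A \<in> M" if "A \<in> vn_algebra G R'" for A
    using that bij' by (auto simp: bij_betw_def)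
  have "vn_iso R' R (vn_algebra G R') (vn_algebra G R) \<Psi>"
    unfolding vn_iso_def
  proof (intro conjI ballI allI impI bij')
    fix A B assume AB: "A \<in> vn_algebra G R'" "B \<in> vn_algebra G R'"
    show "\<Psi> (op_add R' A B) = op_add R (\<Psi> A) (\<Psi> B)"
      using AB Psi_mem Phi_add PhiPsi PsiPhi R1.vn_add by metis
    show "\<Psi> (compose (hspace R') A B) = compose (hspace R) (\<Psi> A) (\<Psi> B)"
      using AB Psi_mem Phi_compose PhiPsi PsiPhi R1.vn_compose by metis
    assume adj: "is_adjoint R' A B"
    obtain C where C: "C \<in> M" "is_adjoint R (\<Psi> A) C"
      using R1.vn_adjoint[OF Psi_mem[OF AB(1)]] by blast
    have adjC: "is_adjoint R' A (\<Phi> C)"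
      using Phi_adjoint[OF Psi_mem[OF AB(1)] C] AB by (simp add: PhiPsi)
    have "B = \<Phi> C"
    proof (rule extensionalityI)
      show "B \<in> extensional (hspace R')" "\<Phi> C \<in> extensional (hspace R')"
        using AB C Phi_mem R2.bop_ext R2.vn_bop by blast+
      fix v assume v: "v \<in> hspace R'"
      show "B v = \<Phi> C v"
        using v adj adjC R2.bop_mem[OF R2.vn_bop[OF AB(2)] v]
          R2.bop_mem[OF R2.vn_bop[OF Phi_mem[OF C(1)]] v]
        by (intro R2.ip_eqI) (auto simp: is_adjoint_def)
    qed
    then show "is_adjoint R (\<Psi> A) (\<Psi> B)"
      using C by (simp add: PsiPhi)
  next
    fix c A assume A: "A \<in> vn_algebra G R'"
    show "\<Psi> (op_scale R' c A) = op_scale R c (\<Psi> A)"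
      using A Psi_mem Phi_scale PhiPsi PsiPhi R1.vn_scale by metis
  qed
  moreover have "\<Psi> (rep_op R' g) = rep_op R g" if "g \<in> G" for g
    using that Phi(2) PsiPhi R1.vn_rep by metis
  ultimately show ?thesis by (auto simp: quasi_equivalent_def)
qed

lemma quasi_equivalent_refl: "quasi_equivalent G R R"
  unfolding quasi_equivalent_def vn_iso_def by (rule exI[of _ id]) auto

abbreviation swp :: "'a \<Rightarrow> 'a \<Rightarrow> 'a \<Rightarrow> 'a" where "swp \<equiv> Transposition.transpose"

section \<open>Class functions of cycle type\<close>

text \<open>The product sends the predecessor of \<open>a\<close> to \<open>j\<close> and
  \<open>j\<close> to \<open>a\<close>, so \<open>j\<close> is spliced into the cycle just before
  \<open>a\<close>. This is how averaged transpositions lengthen cycles in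
  \<open>star_moment\<close>.\<close>

lemma cyclic_on_transpose_insert:
  assumes c: "cyclic_on c S" "c permutes S" and a: "a \<in> S" and j: "j \<notin> S"
  shows "cyclic_on (swp a j \<circ> c) (insert j S)"
proof -
  define s where "s = swp a j \<circ> c"
  have fin: "finite S" using c finite_cyclic_on by blast
  have sp: "s permutes insert j S"
    unfolding s_def using a c
    by (intro permutes_compose permutes_swap_id) (auto intro: permutes_subset)
  have cj: "c j = j" using c j by (simp add: permutes_def)
  have sy: "s y = c y" if "y \<in> S" "c y \<noteq> a" for y
    using that j c cyclic_on_inI[OF c(1) that(1)] by (auto simp: s_def Transposition.transpose_def)
  have sj: "s j = a" using cj by (simp add: s_def)
  have "y \<in> orbit s j" if "y \<in> orbit c a" for y
    using that
  proof induction
    case base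
    then show ?case
      using sj sy[OF a] by (metis orbit.simps)
  next
    case (step y)
    have "y \<in> S" using step c a by (simp add: orbit_cyclic_eq3)
    then show ?case
      using sj sy[of y] step.IH by (metis orbit.simps)
  qed
  then have "S \<subseteq> orbit s j"
    using c a by (metis orbit_cyclic_eq3 subsetI)
  moreover have "j \<in> orbit s j"
    using sp fin by (intro permutation_self_in_orbit) (auto simp: permutation_permutes)
  moreover have "orbit s j \<subseteq> insert j S"
    by (intro permutes_orbit_subset[OF sp]) auto
  ultimately show ?thesis
    unfolding s_def[symmetric] by (intro cyclic_on_singleI[of j]) auto
qed

text \<open>The product fixes \<open>j\<close> and sends the predecessor of \<open>j\<close>
  straight to \<open>s j\<close>, so the cycle is short-circuited at \<open>j\<close>.\<close>

lemma cyclic_on_transpose_delete: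
  assumes s: "cyclic_on s S" "s permutes S" and j: "j \<in> S" "s j \<noteq> j"
  shows "cyclic_on (swp (s j) j \<circ> s) (S - {j})" "(swp (s j) j \<circ> s) permutes (S - {j})"
proof -
  define t where "t = swp (s j) j \<circ> s"
  have "t permutes S"
    unfolding t_def using s j cyclic_on_inI[OF s(1) j(1)] by (intro permutes_compose permutes_swap_id) auto
  then have tp: "t permutes (S - {j})"
    by (rule permutes_superset) (auto simp: t_def)
  have inj: "s x = s y \<longleftrightarrow> x = y" for x y
    using permutes_inj[OF s(2)] by (auto dest: injD)
  have tx: "t x = (if s x = j then s j else s x)" if "x \<noteq> j" for x
    using that inj by (auto simp: t_def Transposition.transpose_def)
  \<comment> \<open>The orbit under \<open>t\<close> follows the orbit under \<open>s\<close> and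
    jumps over \<open>j\<close>. The second clause records where \<open>t\<close> stands at the
    moment when \<open>s\<close> stands on \<open>j\<close>.\<close>
  have *: "(y \<noteq> j \<longrightarrow> y \<in> orbit t x) \<and> (y = j \<longrightarrow> s j \<in> orbit t x)"
    if "y \<in> orbit s x" and x: "x \<noteq> j" for x y
    using that(1)
  proof induction
    case base
    then show ?case using tx[OF x] orbit.base[of t x] by auto
  next
    case (step y)
    show ?case
    proof (cases "y = j")
      case True
      then show ?thesis using step j by auto
    next
      case False
      then have "t y \<in> orbit t x" using step by (auto intro: orbit.step)
      then show ?thesis using tx[OF False] by auto
    qed
  qed
  have x0: "s j \<in> S - {j}" using j cyclic_on_inI[OF s(1) j(1)] by auto
  have "S - {j} \<subseteq> orbit t (s j)"
    using *[of _ "s j"] orbit_cyclic_eq3[OF s(1), of "s j"] x0 by auto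
  moreover have "orbit t (s j) \<subseteq> S - {j}"
    using x0 by (intro permutes_orbit_subset[OF tp])
  ultimately show "cyclic_on (swp (s j) j \<circ> s) (S - {j})"
    unfolding t_def[symmetric] using x0 by (intro cyclic_on_singleI[of "s j"]) auto
  show "(swp (s j) j \<circ> s) permutes (S - {j})" using tp by (simp add: t_def)
qed

text \<open>Deleting a point costs one transposition and hence one change of sign, until a single
  point is left.\<close>

lemma sign_cyclic_on:
  assumes "cyclic_on s S" "s permutes S"
  shows "sign s = (- 1) ^ (card S - 1)"
  using assms
proof (induction "card S" arbitrary: s S)
  case 0
  then show ?case using finite_cyclic_on[of s S] by (auto simp: cyclic_on_alldef)
next
  case (Suc n)
  obtain j where j: "j \<in> S" using Suc by (auto simp: cyclic_on_alldef)
  have fin: "finite S" using Suc finite_cyclic_on by blast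
  show ?case
  proof (cases "s j = j")
    case True
    then have "S = {j}"
      using Suc j by (metis orbit_cyclic_eq3 orbit_eq_singleton_iff)
    then show ?thesis using Suc by auto
  next
    case False
    let ?t = "swp (s j) j \<circ> s"
    have ne: "S - {j} \<noteq> {}" using False j cyclic_on_inI[OF Suc(3) j] by auto
    have "sign ?t = (- 1) ^ (card (S - {j}) - 1)"
      using Suc j False fin by (intro Suc(1) cyclic_on_transpose_delete) auto
    moreover have "sign ?t = - sign s"
      using False Suc fin permutation_permutes by (subst sign_compose) (auto simp: sign_swap_id permutation_swap_id)
    moreover have "card S = Suc (Suc (card (S - {j}) - 1))"
    proof -
      have "card (S - {j}) > 0" using fin ne by (simp add: card_gt_0_iff del: Diff_eq_empty_iff)
      then show ?thesis using j fin by simp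
    qed
    ultimately show ?thesis by (simp add: minus_equation_iff)
  qed
qed

text \<open>The shape of \<open>thoma_character\<close> for an arbitrary weight on each cycle
  length, so that the character and its finite approximations are handled together.\<close>

definition cycle_fun :: "(nat \<Rightarrow> real) \<Rightarrow> ('a \<Rightarrow> 'a) \<Rightarrow> real" where
  "cycle_fun p s = (\<Prod>c \<in> orbit s ` {i. s i \<noteq> i}. p (card c))"

lemma cycle_fun_id [simp]: "cycle_fun p id = 1"
  by (simp add: cycle_fun_def)

lemma finite_moved: "s permutes A \<Longrightarrow> finite A \<Longrightarrow> finite {i. s i \<noteq> i}"
  by (erule rev_finite_subset) (auto simp: permutes_def)

text \<open>Permutations with disjoint supports have disjoint sets of cycles. This multiplicativity
  is the source of the independence of far away cycles.\<close>

lemma cycle_fun_comp: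
  assumes s: "s permutes A" "finite A" and t: "t permutes B" "finite B" and AB: "A \<inter> B = {}"
  shows "cycle_fun p (s \<circ> t) = cycle_fun p s * cycle_fun p t"
proof -
  have tA: "t x = x" if "x \<in> A" for x using t that AB by (auto simp: permutes_def)
  have sB: "s x = x" if "x \<in> B" for x using s that AB by (auto simp: permutes_def)
  have inA: "s x \<in> A" if "x \<in> A" for x using s that by (simp add: permutes_in_image)
  have inB: "t x \<in> B" if "x \<in> B" for x using t that by (simp add: permutes_in_image)
  have oA: "orbit (s \<circ> t) x = orbit s x" if "x \<in> A" for x
    by (rule orbit_cong0[OF that]) (auto simp: tA inA)
  have oB: "orbit (s \<circ> t) x = orbit t x" if "x \<in> B" for x
    by (rule orbit_cong0[OF that]) (auto simp: sB inB)
  have mA: "{i. s i \<noteq> i} \<subseteq> A" and mB: "{i. t i \<noteq> i} \<subseteq> B"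
    using s t by (auto simp: permutes_def)
  have split: "{i. (s \<circ> t) i \<noteq> i} = {i. s i \<noteq> i} \<union> {i. t i \<noteq> i}"
  proof -
    have "(s \<circ> t) i = (if i \<in> A then s i else t i)" for i
      using tA sB inB permutes_not_in[OF s(1), of i] permutes_not_in[OF t(1), of i]
      by (cases "i \<in> A"; cases "i \<in> B") simp_all
    then show ?thesis using AB mA mB by auto
  qed
  have img: "orbit (s \<circ> t) ` {i. (s \<circ> t) i \<noteq> i} = orbit s ` {i. s i \<noteq> i} \<union> orbit t ` {i. t i \<noteq> i}"
    unfolding split image_Un using mA mB oA oB
    by (intro arg_cong2[of _ _ _ _ "(\<union>)"] image_cong refl) auto
  have "orbit s ` {i. s i \<noteq> i} \<inter> orbit t ` {i. t i \<noteq> i} = {}"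
  proof -
    have "orbit s x \<noteq> orbit t y" if "x \<in> A" "y \<in> B" for x y
      using permutes_orbit_subset[OF s(1) that(1)] permutes_orbit_subset[OF t(1) that(2)] AB
        orbit_nonempty[of s x] by auto
    then show ?thesis using mA mB by blast
  qed
  then show ?thesis
    unfolding cycle_fun_def img
    using finite_moved[OF s] finite_moved[OF t] by (intro prod.union_disjoint) auto
qed

lemma orbit_conj:
  fixes s g :: "'a \<Rightarrow> 'a"
  assumes g: "bij g"
  shows "orbit (g \<circ> s \<circ> inv g) (g x) = g ` orbit s x"
proof -
  have gi: "inv g (g y) = y" for y using g by (simp add: bij_is_inj)
  have "((g \<circ> s \<circ> inv g) ^^ n) (g x) = g ((s ^^ n) x)" for n
    by (induction n) (auto simp: gi)
  then show ?thesis by (auto simp: orbit_altdef)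
qed

lemma cycle_fun_conj:
  fixes s g :: "'a \<Rightarrow> 'a"
  assumes g: "bij g"
  shows "cycle_fun p (g \<circ> s \<circ> inv g) = cycle_fun p s"
proof -
  have gi: "inv g (g y) = y" "g (inv g y) = y" for y using g by (simp_all add: bij_is_inj bij_is_surj surj_f_inv_f)
  have "{i. (g \<circ> s \<circ> inv g) i \<noteq> i} = g ` {i. s i \<noteq> i}"
    using gi by (auto simp: image_iff) (metis gi)+
  then have "orbit (g \<circ> s \<circ> inv g) ` {i. (g \<circ> s \<circ> inv g) i \<noteq> i} = (`) g ` orbit s ` {i. s i \<noteq> i}"
    by (simp add: image_image orbit_conj[OF g])
  moreover have "inj_on ((`) g) X" for X
    using inj_image_eq_iff[OF bij_is_inj[OF g]] by (simp add: inj_on_def)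
  moreover have "card (g ` c) = card c" for c
    using inj_on_subset[OF bij_is_inj[OF g]] by (intro card_image) auto
  ultimately show ?thesis
    by (simp add: cycle_fun_def prod.reindex)
qed

lemma cycle_fun_inv:
  assumes "permutation s"
  shows "cycle_fun p (inv s) = cycle_fun p s"
proof -
  have b: "bij s" using assms permutation_bijective by blast
  have "inv s i = i \<longleftrightarrow> s i = i" for i
    using b by (metis bij_inv_eq_iff)
  moreover have "orbit (inv s) = orbit s"
    using orbit_inv_eq[OF assms] by (simp add: fun_eq_iff)
  ultimately show ?thesis by (simp add: cycle_fun_def)
qed

lemma cycle_fun_cyclic:
  assumes s: "cyclic_on s S" "s permutes S" and c: "card S \<ge> 2"
  shows "cycle_fun p s = p (card S)"
proof -
  have "s i \<noteq> i" if "i \<in> S" for i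
    using that c s orbit_cyclic_eq3[OF s(1) that] orbit_eq_singleton_iff[of s i] by auto
  then have "{i. s i \<noteq> i} = S"
    using s by (auto simp: permutes_def)
  moreover have "orbit s ` S = {S}"
    using s by (auto simp: cyclic_on_alldef)
  ultimately show ?thesis by (simp add: cycle_fun_def)
qed

section \<open>Positive definiteness through traces on tensor powers of superspaces\<close>

lemma permutes_perm_restrict:
  assumes s: "s permutes X" "finite X" and E: "E \<subseteq> X" "\<And>x. x \<in> E \<Longrightarrow> s x \<in> E"
  shows "perm_restrict s E permutes E"
proof (rule bij_imp_permutes)
  have inj: "inj_on s E" using permutes_inj[OF s(1)] by (rule inj_on_subset) simp
  have "s ` E = E"
    using E s by (intro card_subset_eq) (auto simp: card_image[OF inj] intro: finite_subset)
  then have "bij_betw s E E" using inj by (simp add: bij_betw_def)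
  then show "bij_betw (perm_restrict s E) E E"
    using bij_betw_cong[of E s "perm_restrict s E" E] by (simp add: perm_restrict_def)
qed (simp add: perm_restrict_def)

text \<open>The trace of \<open>s\<close> on the tensor power over \<open>X\<close> of a superspace with basis \<open>L\<close>, odd part
  \<open>{i. e i}\<close> and diagonal weights \<open>w\<close>.\<close>

definition stable_labels :: "'l set \<Rightarrow> 'a set \<Rightarrow> ('a \<Rightarrow> 'a) \<Rightarrow> ('a \<Rightarrow> 'l) set" where
  "stable_labels L X s = {l \<in> X \<rightarrow>\<^sub>E L. \<forall>x\<in>X. l (s x) = l x}"

definition label_trace :: "'l set \<Rightarrow> ('l \<Rightarrow> real) \<Rightarrow> ('l \<Rightarrow> bool) \<Rightarrow> 'a set \<Rightarrow> ('a \<Rightarrow> 'a) \<Rightarrow> real" where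
  "label_trace L w e X s = (\<Sum>l \<in> stable_labels L X s.
     (\<Prod>x\<in>X. w (l x)) * of_int (sign (perm_restrict s {x \<in> X. e (l x)})))"

definition power_sum :: "'l set \<Rightarrow> ('l \<Rightarrow> real) \<Rightarrow> ('l \<Rightarrow> bool) \<Rightarrow> nat \<Rightarrow> real" where
  "power_sum L w e k = (\<Sum>i\<in>L. w i ^ k * (if e i then (- 1) ^ (k - 1) else 1))"

text \<open>A labelling that is stable under \<open>s\<close> is constant on cycles, so the trace
  factors over them. A cycle \<open>c\<close> with label \<open>i\<close> contributes the power
  \<open>w i ^ card c\<close>, with sign \<open>(-1)^(card c - 1)\<close> for an odd label. Fixed
  points contribute the total weight 1, in accordance with \<open>cycle_fun\<close>.\<close>

lemma label_trace_eq:
  fixes s :: "'a \<Rightarrow> 'a" and L :: "'l set"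
  assumes "finite X" "s permutes X" and w: "sum w L = 1"
  shows "label_trace L w e X s = cycle_fun (power_sum L w e) s"
  using assms(1,2)
proof (induction "card X" arbitrary: X s rule: less_induct)
  case less
  show ?case
  proof (cases "X = {}")
    case True
    then have "s = id" using less by simp
    then show ?thesis
      using True by (simp add: label_trace_def stable_labels_def perm_restrict_def id_def[symmetric])
  next
    case False
    then obtain x where x: "x \<in> X" by blast
    define c where "c = orbit s x"
    define Y where "Y = X - c"
    have ps: "permutation s" using less by (auto simp: permutation_permutes)
    have cyc: "cyclic_on s c" unfolding c_def by (rule cyclic_on_orbit'[OF ps])
    have cX: "c \<subseteq> X" unfolding c_def by (rule permutes_orbit_subset[OF less(3) x])
    have xc: "x \<in> c" unfolding c_def by (rule permutation_self_in_orbit[OF ps])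
    have finc: "finite c" using cX less finite_subset by blast
    have finY: "finite Y" using less by (simp add: Y_def)
    have sc: "s y \<in> c \<longleftrightarrow> y \<in> c" for y
      using cyclic_on_inI[OF cyc] cyclic_on_f_in[OF less(3) cyc] by blast
    have sX: "s y \<in> X \<longleftrightarrow> y \<in> X" for y
      using less by (simp add: permutes_in_image)
    have sY: "s y \<in> Y \<longleftrightarrow> y \<in> Y" for y using sc sX by (auto simp: Y_def)
    define s1 where "s1 = perm_restrict s c"
    define s2 where "s2 = perm_restrict s Y"
    have p1: "s1 permutes c" unfolding s1_def
      by (rule permutes_perm_restrict[OF less(3,2) cX]) (simp add: sc)
    have p2: "s2 permutes Y" unfolding s2_def
      by (rule permutes_perm_restrict[OF less(3,2)]) (auto simp: Y_def sc sX)
    have cyc1: "cyclic_on s1 c" unfolding s1_def cyclic_on_perm_restrict by (rule cyc)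
    have s_eq: "s = s1 \<circ> s2"
    proof
      fix y
      show "s y = (s1 \<circ> s2) y"
        using sY[of y] less(3) cX
        by (cases "y \<in> c"; cases "y \<in> Y")
          (auto simp: s1_def s2_def perm_restrict_def Y_def permutes_def)
    qed
    have "card Y < card X"
      using x xc less by (intro psubset_card_mono) (auto simp: Y_def)
    then have IH: "label_trace L w e Y s2 = cycle_fun (power_sum L w e) s2"
      using less(1) finY p2 by blast
    \<comment> \<open>A stable labelling of \<open>X\<close> amounts to one label for the cycle
      \<open>c\<close> and a stable labelling of the rest.\<close>
    define J where "J il y = (if y \<in> c then fst il else snd il y)" for il :: "'l \<times> ('a \<Rightarrow> 'l)" and y
    have constc: "l y = l x" if "l \<in> stable_labels L X s" "y \<in> c" for l y
      using that(2) unfolding c_def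
    proof induction
      case base
      then show ?case using that x by (simp add: stable_labels_def)
    next
      case (step z)
      then have "z \<in> X" using cX by (auto simp: c_def)
      then show ?case using that step by (simp add: stable_labels_def)
    qed
    have bij: "bij_betw J (L \<times> stable_labels L Y s2) (stable_labels L X s)"
    proof (rule bij_betw_byWitness[where f' = "\<lambda>l. (l x, restrict l Y)"])
      show "\<forall>a\<in>L \<times> stable_labels L Y s2. (\<lambda>l. (l x, restrict l Y)) (J a) = a"
        using xc by (auto simp: J_def Y_def stable_labels_def fun_eq_iff PiE_def extensional_def)
      show "\<forall>l\<in>stable_labels L X s. J ((\<lambda>l. (l x, restrict l Y)) l) = l"
      proof
        fix l assume l: "l \<in> stable_labels L X s"
        then have "l y = undefined" if "y \<notin> X" for y
          using that by (auto simp: stable_labels_def)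
        then show "J ((\<lambda>l. (l x, restrict l Y)) l) = l"
          using constc[OF l] cX by (auto simp: J_def Y_def fun_eq_iff)
      qed
      show "J ` (L \<times> stable_labels L Y s2) \<subseteq> stable_labels L X s"
      proof safe
        fix i l assume il: "i \<in> L" "l \<in> stable_labels L Y s2"
        then show "J (i, l) \<in> stable_labels L X s"
          using cX sY by (auto simp: stable_labels_def J_def PiE_def extensional_def Y_def sc s2_def perm_restrict_def)
      qed
      show "(\<lambda>l. (l x, restrict l Y)) ` stable_labels L X s \<subseteq> L \<times> stable_labels L Y s2"
        using x sY by (auto simp: stable_labels_def PiE_def Y_def s2_def perm_restrict_def)
    qed
    have term_eq: "(\<Prod>y\<in>X. w (J (i, l) y)) * of_int (sign (perm_restrict s {y \<in> X. e (J (i, l) y)}))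
      = (w i ^ card c * (if e i then (- 1) ^ (card c - 1) else 1)) *
        ((\<Prod>y\<in>Y. w (l y)) * of_int (sign (perm_restrict s2 {y \<in> Y. e (l y)})))"
      if l: "l \<in> stable_labels L Y s2" for i l
    proof -
      have "(\<Prod>y\<in>X. w (J (i, l) y)) = (\<Prod>y\<in>c. w (J (i, l) y)) * (\<Prod>y\<in>Y. w (J (i, l) y))"
        using less cX unfolding Y_def by (subst mult.commute, intro prod.subset_diff) auto
      also have "(\<Prod>y\<in>c. w (J (i, l) y)) = w i ^ card c"
        by (simp add: J_def)
      also have "(\<Prod>y\<in>Y. w (J (i, l) y)) = (\<Prod>y\<in>Y. w (l y))"
        by (intro prod.cong) (auto simp: J_def Y_def)
      finally have P: "(\<Prod>y\<in>X. w (J (i, l) y)) = w i ^ card c * (\<Prod>y\<in>Y. w (l y))" .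
      define E where "E = {y \<in> Y. e (l y)}"
      have pE: "perm_restrict s2 E permutes E"
      proof (rule permutes_perm_restrict[OF p2 finY])
        show "s2 y \<in> E" if "y \<in> E" for y
          using that l p2 by (auto simp: E_def stable_labels_def permutes_in_image)
      qed (auto simp: E_def)
      have finE: "finite E" using finY by (simp add: E_def)
      have S: "sign (perm_restrict s {y \<in> X. e (J (i, l) y)}) =
        (if e i then (- 1) ^ (card c - 1) else 1) * sign (perm_restrict s2 E)"
      proof (cases "e i")
        case True
        have "{y \<in> X. e (J (i, l) y)} = c \<union> E"
          using cX True by (auto simp: J_def E_def Y_def)
        moreover have "perm_restrict s (c \<union> E) = s1 \<circ> perm_restrict s2 E"
        proof
          fix y
          have "s2 y \<in> E" if "y \<in> E" using pE that by (metis perm_restrict_simps(1) permutes_in_image)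
          then show "perm_restrict s (c \<union> E) y = (s1 \<circ> perm_restrict s2 E) y"
            by (auto simp: perm_restrict_def s1_def s2_def E_def Y_def)
        qed
        moreover have "sign (s1 \<circ> perm_restrict s2 E) = sign s1 * sign (perm_restrict s2 E)"
          using p1 pE finc finE by (intro sign_compose) (auto simp: permutation_permutes)
        ultimately show ?thesis
          using True sign_cyclic_on[OF cyc1 p1] by simp
      next
        case False
        then have "{y \<in> X. e (J (i, l) y)} = E"
          by (auto simp: J_def E_def Y_def)
        moreover have "perm_restrict s E = perm_restrict s2 E"
          by (auto simp: perm_restrict_def s2_def E_def fun_eq_iff)
        ultimately show ?thesis using False by simp
      qed
      show ?thesis using P S by (simp add: E_def)
    qed
    have "label_trace L w e X s = (\<Sum>il\<in>L \<times> stable_labels L Y s2.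
        (\<Prod>y\<in>X. w (J il y)) * of_int (sign (perm_restrict s {y \<in> X. e (J il y)})))"
      unfolding label_trace_def by (rule sum.reindex_bij_betw[OF bij, symmetric])
    also have "\<dots> = (\<Sum>il\<in>L \<times> stable_labels L Y s2.
        (w (fst il) ^ card c * (if e (fst il) then (- 1) ^ (card c - 1) else 1)) *
        ((\<Prod>y\<in>Y. w (snd il y)) * of_int (sign (perm_restrict s2 {y \<in> Y. e (snd il y)}))))"
      by (intro sum.cong refl) (use term_eq in auto)
    also have "\<dots> = power_sum L w e (card c) * label_trace L w e Y s2"
      unfolding power_sum_def label_trace_def sum_product sum.cartesian_product
      by (intro sum.cong) auto
    also have "power_sum L w e (card c) = cycle_fun (power_sum L w e) s1"
    proof (cases "card c \<ge> 2")
      case True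
      then show ?thesis using cycle_fun_cyclic[OF cyc1 p1] by simp
    next
      case False
      moreover have "card c > 0" using finc xc by (auto simp: card_gt_0_iff)
      ultimately have c1: "card c = 1" by simp
      then have "c = {x}" using xc by (metis card_1_singletonE singletonD)
      then have "s1 = id" using p1 by simp
      moreover have "power_sum L w e 1 = 1"
        using w by (simp add: power_sum_def cong: if_cong)
      ultimately show ?thesis using c1 by simp
    qed
    also have "cycle_fun (power_sum L w e) s1 * label_trace L w e Y s2 = cycle_fun (power_sum L w e) s"
      unfolding IH s_eq by (rule cycle_fun_comp[OF p1 finc p2 finY, symmetric]) (auto simp: Y_def)
    finally show ?thesis .
  qed
qed

text \<open>The kernel that is 1 on pairs in a common fibre of \<open>k\<close> and 0 elsewhere is a
  sum of kernels of rank one, one for each fibre.\<close>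

lemma kernel_group_nonneg:
  fixes g :: "'s \<Rightarrow> complex" and k :: "'s \<Rightarrow> 'm"
  assumes "finite F"
  shows "(\<Sum>s\<in>F. \<Sum>t\<in>F. if k s = k t then g s * cnj (g t) else 0)
     = of_real (\<Sum>m\<in>k ` F. (cmod (\<Sum>s\<in>{s\<in>F. k s = m}. g s))\<^sup>2)"
proof -
  have "(\<Sum>s\<in>F. \<Sum>t\<in>F. if k s = k t then g s * cnj (g t) else 0)
    = (\<Sum>m\<in>k ` F. \<Sum>s\<in>{s\<in>F. k s = m}. \<Sum>t\<in>F. if k s = k t then g s * cnj (g t) else 0)"
    using assms by (rule sum.image_gen)
  also have "\<dots> = (\<Sum>m\<in>k ` F. of_real ((cmod (\<Sum>s\<in>{s\<in>F. k s = m}. g s))\<^sup>2))"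
  proof (rule sum.cong[OF refl])
    fix m
    have "(\<Sum>s\<in>{s\<in>F. k s = m}. \<Sum>t\<in>F. if k s = k t then g s * cnj (g t) else 0)
      = (\<Sum>s\<in>{s\<in>F. k s = m}. \<Sum>t\<in>{t\<in>F. k t = m}. g s * cnj (g t))"
      using assms by (intro sum.cong refl sum.mono_neutral_cong_right) auto
    also have "\<dots> = (\<Sum>s\<in>{s\<in>F. k s = m}. g s) * cnj (\<Sum>s\<in>{s\<in>F. k s = m}. g s)"
      by (simp add: sum_product)
    also have "\<dots> = of_real ((cmod (\<Sum>s\<in>{s\<in>F. k s = m}. g s))\<^sup>2)"
      by (simp only: complex_norm_square)
    finally show "(\<Sum>s\<in>{s\<in>F. k s = m}. \<Sum>t\<in>F. if k s = k t then g s * cnj (g t) else 0)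
      = of_real ((cmod (\<Sum>s\<in>{s\<in>F. k s = m}. g s))\<^sup>2)" .
  qed
  finally show ?thesis by simp
qed

text \<open>For a fixed labelling the kernel is a character of its stabiliser extended by zero, hence
  splits over the cosets of the stabiliser into kernels of rank one.\<close>

lemma label_trace_posdef:
  fixes f :: "('a \<Rightarrow> 'a) \<Rightarrow> complex" and L :: "'l set"
  assumes X: "finite X" and F: "finite F" "\<And>s. s \<in> F \<Longrightarrow> s permutes X"
    and L: "finite L" and w: "\<And>i. i \<in> L \<Longrightarrow> w i \<ge> 0"
  shows "0 \<le> Re (\<Sum>s\<in>F. \<Sum>t\<in>F. f s * cnj (f t) * of_real (label_trace L w e X (inv t \<circ> s)))"
proof -
  define W where "W l = (\<Prod>x\<in>X. w (l x))" for l
  define E where "E l = {x \<in> X. e (l x)}" for l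
  define ker where "ker l s t = (if \<forall>x\<in>X. l ((inv t \<circ> s) x) = l x
    then of_int (sign (perm_restrict (inv t \<circ> s) (E l))) else (0::real))" for l :: "'a \<Rightarrow> 'l" and s t :: "'a \<Rightarrow> 'a"
  have finP: "finite (X \<rightarrow>\<^sub>E L)" using X L by (rule finite_PiE)
  have tr: "label_trace L w e X (inv t \<circ> s) = (\<Sum>l\<in>X \<rightarrow>\<^sub>E L. W l * ker l s t)" for s t
    unfolding label_trace_def stable_labels_def ker_def W_def E_def
    using finP by (intro sum.mono_neutral_cong_left) auto
  have nonneg: "0 \<le> Re (\<Sum>s\<in>F. \<Sum>t\<in>F. f s * cnj (f t) * of_real (ker l s t))" for l
  proof -
    \<comment> \<open>The labelling moved by \<open>s\<close>: two permutations agree in it exactly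
      if they lie in one left coset of the stabiliser of \<open>l\<close>. The number
      \<open>u s\<close> is the sign of \<open>s\<close> relative to the representative
      \<open>r (k s)\<close> of its coset, so that the kernel becomes \<open>u s * u t\<close>
      within each coset.\<close>
    define k where "k s = restrict (l \<circ> inv s) X" for s
    define r where "r m = (SOME s. s \<in> F \<and> k s = m)" for m
    have r: "r (k s) \<in> F" "k (r (k s)) = k s" if "s \<in> F" for s
      using someI[of "\<lambda>r. r \<in> F \<and> k r = k s" s] that by (auto simp: r_def)
    define u where "u s = (of_int (sign (perm_restrict (inv (r (k s)) \<circ> s) (E l))) :: real)" for s
    have perm: "inv t \<circ> s permutes X" if "s \<in> F" "t \<in> F" for s t
      using F that by (intro permutes_compose permutes_inv)
    have stab: "(\<forall>x\<in>X. l ((inv t \<circ> s) x) = l x) \<longleftrightarrow> k s = k t" if "s \<in> F" "t \<in> F" for s t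
    proof
      assume *: "\<forall>x\<in>X. l ((inv t \<circ> s) x) = l x"
      have "l (inv s x) = l (inv t x)" if "x \<in> X" for x
        using *[rule_format, of "inv s x"] that \<open>s \<in> F\<close> F(2)[of s]
        by (simp add: permutes_inverses permutes_in_image[OF permutes_inv])
      then show "k s = k t" by (auto simp: k_def fun_eq_iff)
    next
      assume *: "k s = k t"
      have "l (inv t (s x)) = l x" if "x \<in> X" for x
        using fun_cong[OF *, of "s x"] that \<open>s \<in> F\<close> F(2)[of s]
        by (simp add: k_def permutes_inverses permutes_in_image)
      then show "\<forall>x\<in>X. l ((inv t \<circ> s) x) = l x" by simp
    qed
    have finE: "finite (E l)" using X by (simp add: E_def)
    have permE: "perm_restrict (inv t \<circ> s) (E l) permutes E l" if "s \<in> F" "t \<in> F" "k s = k t" for s t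
    proof (rule permutes_perm_restrict[OF perm[OF that(1,2)] X])
      fix x assume x: "x \<in> E l"
      then show "(inv t \<circ> s) x \<in> E l"
        using stab[OF that(1,2)] that(3) permutes_in_image[OF perm[OF that(1,2)], of x]
        by (auto simp: E_def)
    qed (auto simp: E_def)
    have ker: "ker l s t = (if k s = k t then u s * u t else 0)" if st: "s \<in> F" "t \<in> F" for s t
    proof (cases "k s = k t")
      case True
      let ?r = "r (k t)"
      have rr: "?r \<in> F" "k ?r = k t" using r st by auto
      have p: "perm_restrict (inv ?r \<circ> s) (E l) permutes E l" "perm_restrict (inv ?r \<circ> t) (E l) permutes E l"
        using st rr True by (auto intro!: permE)
      have "perm_restrict (inv ?r \<circ> s) (E l) = perm_restrict (inv ?r \<circ> t) (E l) \<circ> perm_restrict (inv t \<circ> s) (E l)"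
      proof
        fix x
        show "perm_restrict (inv ?r \<circ> s) (E l) x = (perm_restrict (inv ?r \<circ> t) (E l) \<circ> perm_restrict (inv t \<circ> s) (E l)) x"
        proof (cases "x \<in> E l")
          case x: True
          have "(inv t \<circ> s) x \<in> E l"
            using permutes_in_image[OF permE[OF st True], of x] x by (simp add: perm_restrict_simps)
          then show ?thesis
            using x permutes_inverses(1)[OF F(2)[OF st(2)]] by (simp add: perm_restrict_def)
        qed (simp add: perm_restrict_def)
      qed
      then have "sign (perm_restrict (inv ?r \<circ> s) (E l))
        = sign (perm_restrict (inv ?r \<circ> t) (E l)) * sign (perm_restrict (inv t \<circ> s) (E l))"
        using p permE[OF st True] finE by (simp add: sign_compose permutation_permutes) (metis permutation_permutes sign_compose)
      then have "sign (perm_restrict (inv t \<circ> s) (E l))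
        = sign (perm_restrict (inv ?r \<circ> s) (E l)) * sign (perm_restrict (inv ?r \<circ> t) (E l))"
        by (simp add: mult.commute mult.left_commute)
      then show ?thesis
        using True stab[OF st] by (simp add: ker_def u_def)
    next
      case False
      then show ?thesis using stab[OF st] by (auto simp: ker_def)
    qed
    have "(\<Sum>s\<in>F. \<Sum>t\<in>F. f s * cnj (f t) * of_real (ker l s t))
      = (\<Sum>s\<in>F. \<Sum>t\<in>F. if k s = k t then (f s * of_real (u s)) * cnj (f t * of_real (u t)) else 0)"
      by (intro sum.cong refl) (auto simp: ker)
    also have "\<dots> = of_real (\<Sum>m\<in>k ` F. (cmod (\<Sum>s\<in>{s\<in>F. k s = m}. f s * of_real (u s)))\<^sup>2)"
      by (rule kernel_group_nonneg[OF F(1)])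
    finally show ?thesis by (simp add: sum_nonneg)
  qed
  have "(\<Sum>s\<in>F. \<Sum>t\<in>F. f s * cnj (f t) * of_real (label_trace L w e X (inv t \<circ> s)))
    = (\<Sum>s\<in>F. \<Sum>t\<in>F. \<Sum>l\<in>X \<rightarrow>\<^sub>E L. of_real (W l) * (f s * cnj (f t) * of_real (ker l s t)))"
    unfolding tr of_real_sum sum_distrib_left by (intro sum.cong refl) (simp add: mult_ac)
  also have "\<dots> = (\<Sum>s\<in>F. \<Sum>l\<in>X \<rightarrow>\<^sub>E L. \<Sum>t\<in>F. of_real (W l) * (f s * cnj (f t) * of_real (ker l s t)))"
    by (intro sum.cong refl sum.swap)
  also have "\<dots> = (\<Sum>l\<in>X \<rightarrow>\<^sub>E L. \<Sum>s\<in>F. \<Sum>t\<in>F. of_real (W l) * (f s * cnj (f t) * of_real (ker l s t)))"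
    by (rule sum.swap)
  also have "\<dots> = (\<Sum>l\<in>X \<rightarrow>\<^sub>E L. of_real (W l) * (\<Sum>s\<in>F. \<Sum>t\<in>F. f s * cnj (f t) * of_real (ker l s t)))"
    by (simp only: sum_distrib_left)
  finally have "Re (\<Sum>s\<in>F. \<Sum>t\<in>F. f s * cnj (f t) * of_real (label_trace L w e X (inv t \<circ> s)))
    = (\<Sum>l\<in>X \<rightarrow>\<^sub>E L. W l * Re (\<Sum>s\<in>F. \<Sum>t\<in>F. f s * cnj (f t) * of_real (ker l s t)))"
    by simp
  also have "\<dots> \<ge> 0"
    using nonneg w by (intro sum_nonneg mult_nonneg_nonneg) (auto simp: W_def intro!: prod_nonneg)
  finally show ?thesis .
qed

text \<open>The supersymmetric power sums of the parameters. For \<open>k \<ge> 2\<close> this is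
  the value of the character at a \<open>k\<close>-cycle.\<close>

definition thoma_moment :: "(nat \<Rightarrow> real) \<Rightarrow> (nat \<Rightarrow> real) \<Rightarrow> nat \<Rightarrow> real" where
  "thoma_moment \<alpha> \<beta> k = (\<Sum>i. \<alpha> i ^ k) + (-1) ^ (k - 1) * (\<Sum>i. \<beta> i ^ k)"

lemma thoma_character_cycle_fun:
  "thoma_character \<alpha> \<beta> s = of_real (cycle_fun (thoma_moment \<alpha> \<beta>) s)"
  by (simp add: thoma_character_def cycle_fun_def thoma_moment_def)

lemma thoma_params_le_1:
  assumes "thoma_params \<alpha> \<beta>"
  shows "\<alpha> i \<le> 1" "\<beta> i \<le> 1"
proof -
  have s: "summable \<alpha>" "summable \<beta>" "\<And>i. 0 \<le> \<alpha> i" "\<And>i. 0 \<le> \<beta> i" "(\<Sum>i. \<alpha> i) + (\<Sum>i. \<beta> i) \<le> 1"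
    using assms by (auto simp: thoma_params_def)
  have "sum \<alpha> {i} \<le> (\<Sum>i. \<alpha> i)" "sum \<beta> {i} \<le> (\<Sum>i. \<beta> i)"
    using s by (intro sum_le_suminf; simp)+
  moreover have "0 \<le> (\<Sum>i. \<alpha> i)" "0 \<le> (\<Sum>i. \<beta> i)"
    using s by (auto intro: suminf_nonneg)
  ultimately show "\<alpha> i \<le> 1" "\<beta> i \<le> 1" using s(5) by auto
qed

lemma summable_power_le_1:
  fixes a :: "nat \<Rightarrow> real"
  assumes "summable a" "\<And>i. 0 \<le> a i" "\<And>i. a i \<le> 1" "k \<ge> 1"
  shows "summable (\<lambda>i. a i ^ k)"
proof (rule summable_comparison_test'[OF assms(1)])
  fix i
  have "a i ^ k \<le> a i ^ 1" using assms by (intro power_decreasing) auto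
  then show "norm (a i ^ k) \<le> a i" using assms by simp
qed

text \<open>The character is a limit of the traces \<open>label_trace\<close> with \<open>3K\<close> labels; the missing mass
  \<open>1 - (\<Sum>i<K. \<alpha> i + \<beta> i)\<close> is spread over \<open>K\<close> even labels.\<close>

lemma thoma_moment_limit:
  assumes T: "thoma_params \<alpha> \<beta>"
  obtains w :: "nat \<Rightarrow> nat \<times> nat \<Rightarrow> real"
  where "\<And>K i. w K i \<ge> 0" "\<And>K. K \<ge> 1 \<Longrightarrow> sum (w K) ({0,1,2} \<times> {..<K}) = 1"
    "\<And>k. k \<ge> 2 \<Longrightarrow> (\<lambda>K. power_sum ({0,1,2} \<times> {..<K}) (w K) (\<lambda>i. fst i = 1) k) \<longlonglongrightarrow> thoma_moment \<alpha> \<beta> k"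
proof -
  have s: "summable \<alpha>" "summable \<beta>" "\<And>i. 0 \<le> \<alpha> i" "\<And>i. 0 \<le> \<beta> i" "(\<Sum>i. \<alpha> i) + (\<Sum>i. \<beta> i) \<le> 1"
    using T by (auto simp: thoma_params_def)
  define g where "g K = 1 - (\<Sum>i<K. \<alpha> i + \<beta> i)" for K
  have g: "0 \<le> g K" "g K \<le> 1" for K
  proof -
    have "(\<Sum>i<K. \<alpha> i) \<le> (\<Sum>i. \<alpha> i)" "(\<Sum>i<K. \<beta> i) \<le> (\<Sum>i. \<beta> i)"
      using s by (intro sum_le_suminf; simp)+
    moreover have "0 \<le> (\<Sum>i<K. \<alpha> i)" "0 \<le> (\<Sum>i<K. \<beta> i)"
      using s by (intro sum_nonneg; simp)+
    ultimately show "0 \<le> g K" "g K \<le> 1"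
      using s(5) unfolding g_def sum.distrib by linarith+
  qed
  define w where "w K i = (if fst i = 0 then \<alpha> (snd i) else if fst i = 1 then \<beta> (snd i) else g K / real K)"
    for K and i :: "nat \<times> nat"
  have sum3: "(\<Sum>i\<in>{0,1,2} \<times> {..<K}. f i) = (\<Sum>i<K. f (0, i)) + (\<Sum>i<K. f (1, i)) + (\<Sum>i<K. f (2, i))"
    for f :: "nat \<times> nat \<Rightarrow> real" and K
  proof -
    have "(\<Sum>i\<in>{0,1,2} \<times> {..<K}. f i) = (\<Sum>a\<in>{0,1,2}. \<Sum>b<K. f (a, b))"
      by (subst sum.cartesian_product) simp
    then show ?thesis by simp
  qed
  show thesis
  proof
    show "w K i \<ge> 0" for K i using s g by (simp add: w_def)
    show "sum (w K) ({0,1,2} \<times> {..<K}) = 1" if "K \<ge> 1" for K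
      unfolding sum3 using that by (simp add: w_def g_def sum.distrib)
    fix k :: nat assume k: "k \<ge> 2"
    have "power_sum ({0,1,2} \<times> {..<K}) (w K) (\<lambda>i. fst i = 1) k
      = (\<Sum>i<K. \<alpha> i ^ k) + (-1) ^ (k - 1) * (\<Sum>i<K. \<beta> i ^ k) + real K * (g K / real K) ^ k" for K
      unfolding power_sum_def sum3 by (simp add: w_def sum_distrib_left mult.commute)
    moreover have lims: "(\<lambda>K. (\<Sum>i<K. \<alpha> i ^ k)) \<longlonglongrightarrow> (\<Sum>i. \<alpha> i ^ k)" "(\<lambda>K. (\<Sum>i<K. \<beta> i ^ k)) \<longlonglongrightarrow> (\<Sum>i. \<beta> i ^ k)"
      using s k thoma_params_le_1[OF T] by (intro summable_LIMSEQ summable_power_le_1; simp)+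
    \<comment> \<open>The \<open>K\<close> auxiliary labels have weight at most \<open>1 / K\<close>
      each, so for \<open>k \<ge> 2\<close> they contribute at most
      \<open>K * (1 / K)^2\<close>.\<close>
    moreover have lim0: "(\<lambda>K. real K * (g K / real K) ^ k) \<longlonglongrightarrow> 0"
    proof (rule Lim_null_comparison)
      show "\<forall>\<^sub>F K in sequentially. norm (real K * (g K / real K) ^ k) \<le> 1 / real K"
        using eventually_ge_at_top[of 1]
      proof eventually_elim
        case (elim K)
        have "(g K / real K) ^ k \<le> (1 / real K) ^ k"
          using g elim by (intro power_mono divide_right_mono) auto
        also have "\<dots> \<le> (1 / real K) ^ 2"
          using elim k by (intro power_decreasing) auto
        finally have "real K * (g K / real K) ^ k \<le> real K * (1 / real K) ^ 2"
          by (intro mult_left_mono) auto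
        then show ?case
          using elim g by (simp add: power2_eq_square)
      qed
    qed (rule lim_1_over_n)
    ultimately show "(\<lambda>K. power_sum ({0,1,2} \<times> {..<K}) (w K) (\<lambda>i. fst i = 1) k) \<longlonglongrightarrow> thoma_moment \<alpha> \<beta> k"
      using tendsto_add[OF tendsto_add[OF lims(1) tendsto_mult[OF tendsto_const lims(2)]] lim0]
      by (simp only: thoma_moment_def add_0_right)
  qed
qed

lemma permutes_moved:
  assumes "p permutes X" "{i. p i \<noteq> i} \<subseteq> Y"
  shows "p permutes Y"
  using assms by (auto simp: permutes_def)

lemma finsym_permutation: "p \<in> finsym X \<Longrightarrow> permutation p"
  by (auto simp: finsym_def permutation permutes_bij)

text \<open>A nontrivial cycle has at least two points. Convergence at \<open>k = 1\<close> cannot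
  be expected: there the approximating power sums equal 1, while the moment is the possibly smaller
  sum of the parameters.\<close>

lemma cycle_fun_tendsto:
  fixes s :: "'a \<Rightarrow> 'a"
  assumes s: "permutation s" and p: "\<And>k. k \<ge> 2 \<Longrightarrow> (\<lambda>K. P K k) \<longlonglongrightarrow> p k"
  shows "(\<lambda>K. cycle_fun (P K) s) \<longlonglongrightarrow> cycle_fun p s"
  unfolding cycle_fun_def
proof (intro tendsto_prod p)
  fix c assume "c \<in> orbit s ` {i. s i \<noteq> i}"
  then obtain i where i: "s i \<noteq> i" "c = orbit s i" by auto
  have "{i, s i} \<subseteq> c"
    using i permutation_self_in_orbit[OF s] by (auto intro: orbit.base)
  moreover have "finite c"
    using i permutation_self_in_orbit[OF s] by (simp add: finite_orbit)
  ultimately have "card {i, s i} \<le> card c" by (intro card_mono)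
  then show "2 \<le> card c" using i by simp
qed

text \<open>All members of \<open>F\<close> move points of one finite set, on which the
  approximating traces are positive definite; the inequality passes to the limit.\<close>

lemma thoma_posdef:
  assumes T: "thoma_params \<alpha> \<beta>" and F: "finite F" "F \<subseteq> finsym X"
  shows "0 \<le> Re (\<Sum>s\<in>F. \<Sum>t\<in>F. f s * cnj (f t) * thoma_character \<alpha> \<beta> (inv t \<circ> s))"
proof -
  obtain w :: "nat \<Rightarrow> nat \<times> nat \<Rightarrow> real" where
    w: "\<And>K i. w K i \<ge> 0" "\<And>K. K \<ge> 1 \<Longrightarrow> sum (w K) ({0,1,2} \<times> {..<K}) = 1"
      "\<And>k. k \<ge> 2 \<Longrightarrow> (\<lambda>K. power_sum ({0,1,2} \<times> {..<K}) (w K) (\<lambda>i. fst i = 1) k) \<longlonglongrightarrow> thoma_moment \<alpha> \<beta> k"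
    by (rule thoma_moment_limit[OF T]) (rule that)
  define P where "P K = power_sum ({0,1,2} \<times> {..<K}) (w K) (\<lambda>i. fst i = 1)" for K
  define Y where "Y = (\<Union>s\<in>F. {i. s i \<noteq> i})"
  have finY: "finite Y" using F by (auto simp: Y_def finsym_def)
  have perm: "s permutes Y" if "s \<in> F" for s
    using that F by (rule_tac permutes_moved[of s X]) (auto simp: Y_def finsym_def)
  have perm2: "inv t \<circ> s permutes Y" if "s \<in> F" "t \<in> F" for s t
    using that perm by (intro permutes_compose permutes_inv)
  show ?thesis
  proof (rule tendsto_lowerbound)
    have "(\<lambda>K. \<Sum>s\<in>F. \<Sum>t\<in>F. f s * cnj (f t) * of_real (cycle_fun (P K) (inv t \<circ> s)))
      \<longlonglongrightarrow> (\<Sum>s\<in>F. \<Sum>t\<in>F. f s * cnj (f t) * thoma_character \<alpha> \<beta> (inv t \<circ> s))"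
      unfolding thoma_character_cycle_fun
    proof (intro tendsto_sum tendsto_mult tendsto_const tendsto_of_real cycle_fun_tendsto)
      fix s t assume "s \<in> F" "t \<in> F"
      then show "permutation (inv t \<circ> s)"
        using perm2 finY permutation_permutes by blast
    qed (use w in \<open>auto simp: P_def\<close>)
    then show "(\<lambda>K. Re (\<Sum>s\<in>F. \<Sum>t\<in>F. f s * cnj (f t) * of_real (cycle_fun (P K) (inv t \<circ> s))))
      \<longlonglongrightarrow> Re (\<Sum>s\<in>F. \<Sum>t\<in>F. f s * cnj (f t) * thoma_character \<alpha> \<beta> (inv t \<circ> s))"
      by (rule tendsto_Re)
    show "\<forall>\<^sub>F K in sequentially. 0 \<le> Re (\<Sum>s\<in>F. \<Sum>t\<in>F. f s * cnj (f t) * of_real (cycle_fun (P K) (inv t \<circ> s)))"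
      using eventually_ge_at_top[of 1]
    proof eventually_elim
      case (elim K)
      have "0 \<le> Re (\<Sum>s\<in>F. \<Sum>t\<in>F. f s * cnj (f t) *
          of_real (label_trace ({0,1,2} \<times> {..<K}) (w K) (\<lambda>i. fst i = 1) Y (inv t \<circ> s)))"
        using F finY perm w by (intro label_trace_posdef) auto
      also have "(\<Sum>s\<in>F. \<Sum>t\<in>F. f s * cnj (f t) *
          of_real (label_trace ({0,1,2} \<times> {..<K}) (w K) (\<lambda>i. fst i = 1) Y (inv t \<circ> s)))
        = (\<Sum>s\<in>F. \<Sum>t\<in>F. f s * cnj (f t) * of_real (cycle_fun (P K) (inv t \<circ> s)))"
        unfolding P_def using label_trace_eq[OF finY perm2 w(2)[OF elim]]
        by (intro sum.cong refl) simp
      finally show ?case .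
    qed
  qed simp
qed

lemma finsym_perm_group: "perm_group (finsym X)"
proof
  show "id \<in> finsym X" by (simp add: finsym_def permutes_id)
next
  fix g h assume gh: "g \<in> finsym X" "h \<in> finsym X"
  have "{i. (g \<circ> h) i \<noteq> i} \<subseteq> {i. g i \<noteq> i} \<union> {i. h i \<noteq> i}" by auto
  then show "g \<circ> h \<in> finsym X"
    using gh by (auto simp: finsym_def permutes_compose intro: finite_subset)
next
  fix g assume g: "g \<in> finsym X"
  then have b: "bij g" unfolding finsym_def using permutes_bij by blast
  then show "bij g" .
  have "inv g i = i \<longleftrightarrow> g i = i" for i using b by (metis bij_inv_eq_iff)
  then show "inv g \<in> finsym X"
    using g by (simp add: finsym_def permutes_inv)
qed

lemma thoma_id: "thoma_character \<alpha> \<beta> id = 1"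
  by (simp add: thoma_character_cycle_fun)

lemma thoma_inv: "permutation s \<Longrightarrow> thoma_character \<alpha> \<beta> (inv s) = thoma_character \<alpha> \<beta> s"
  by (simp add: thoma_character_cycle_fun cycle_fun_inv)

lemma thoma_cnj: "cnj (thoma_character \<alpha> \<beta> s) = thoma_character \<alpha> \<beta> s"
  by (simp add: thoma_character_cycle_fun)

lemma thoma_conj: "bij g \<Longrightarrow> thoma_character \<alpha> \<beta> (g \<circ> s \<circ> inv g) = thoma_character \<alpha> \<beta> s"
  by (simp add: thoma_character_cycle_fun cycle_fun_conj)

lemma thoma_comp:
  "s permutes A \<Longrightarrow> finite A \<Longrightarrow> t permutes B \<Longrightarrow> finite B \<Longrightarrow> A \<inter> B = {} \<Longrightarrow>
    thoma_character \<alpha> \<beta> (s \<circ> t) = thoma_character \<alpha> \<beta> s * thoma_character \<alpha> \<beta> t"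
  by (simp add: thoma_character_cycle_fun cycle_fun_comp)

lemma thoma_cyclic:
  "cyclic_on s S \<Longrightarrow> s permutes S \<Longrightarrow> card S \<ge> 2 \<Longrightarrow>
    thoma_character \<alpha> \<beta> s = of_real (thoma_moment \<alpha> \<beta> (card S))"
  by (simp add: thoma_character_cycle_fun cycle_fun_cyclic)

section \<open>The GNS representation\<close>

locale gns_data = perm_group S for S :: "(nat \<Rightarrow> nat) set" +
  fixes \<phi> :: "(nat \<Rightarrow> nat) \<Rightarrow> complex"
  assumes posdef: "finite F \<Longrightarrow> F \<subseteq> S \<Longrightarrow>
      0 \<le> Re (\<Sum>s\<in>F. \<Sum>t\<in>F. f s * cnj (f t) * \<phi> (inv t \<circ> s))"
    and herm: "s \<in> S \<Longrightarrow> \<phi> (inv s) = cnj (\<phi> s)"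
begin

abbreviation "A \<equiv> group_algebra S"

definition delta :: "(nat \<Rightarrow> nat) \<Rightarrow> (nat \<Rightarrow> nat) \<Rightarrow> complex" where
  "delta g = (\<lambda>t. if t = g then 1 else 0)"

lemma form_eq:
  assumes "finite F" "{s. f s \<noteq> 0} \<subseteq> F" "finite F'" "{t. h t \<noteq> 0} \<subseteq> F'"
  shows "gns_form \<phi> f h = (\<Sum>s\<in>F. \<Sum>t\<in>F'. f s * cnj (h t) * \<phi> (inv t \<circ> s))"
proof -
  have "(\<Sum>t | h t \<noteq> 0. f s * cnj (h t) * \<phi> (inv t \<circ> s)) = (\<Sum>t\<in>F'. f s * cnj (h t) * \<phi> (inv t \<circ> s))" for s
    using assms by (intro sum.mono_neutral_left) auto
  then show ?thesis
    unfolding gns_form_def using assms by (auto intro!: sum.mono_neutral_left)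
qed

lemma finA: "f \<in> A \<Longrightarrow> finite {s. f s \<noteq> 0}" and subA: "f \<in> A \<Longrightarrow> {s. f s \<noteq> 0} \<subseteq> S"
  by (auto simp: group_algebra_def)

lemma phi_swap: "s \<in> S \<Longrightarrow> t \<in> S \<Longrightarrow> \<phi> (inv s \<circ> t) = cnj (\<phi> (inv t \<circ> s))"
  using herm[of "inv t \<circ> s"] by (simp add: inv_distrib)

sublocale P: semi_ip A "gns_form \<phi>"
proof
  show "0 \<in> A" by (simp add: group_algebra_def)
next
  fix u v assume uv: "u \<in> A" "v \<in> A"
  have "{s. (u + v) s \<noteq> 0} \<subseteq> {s. u s \<noteq> 0} \<union> {s. v s \<noteq> 0}" by auto
  then show "u + v \<in> A"
    using finA[OF uv(1)] finA[OF uv(2)] subA[OF uv(1)] subA[OF uv(2)]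
    by (auto simp: group_algebra_def intro: finite_subset)
next
  fix u c assume u: "u \<in> A"
  have "{s. (smul c u) s \<noteq> 0} \<subseteq> {s. u s \<noteq> 0}" by auto
  then show "smul c u \<in> A"
    using u by (auto simp: group_algebra_def intro: finite_subset)
next
  fix u v w assume uvw: "u \<in> A" "v \<in> A" "w \<in> A"
  define F where "F = {s. u s \<noteq> 0} \<union> {s. v s \<noteq> 0}"
  define F' where "F' = {s. w s \<noteq> 0}"
  have fin: "finite F" "finite F'" using uvw finA by (auto simp: F_def F'_def)
  have "gns_form \<phi> (u + v) w = (\<Sum>s\<in>F. \<Sum>t\<in>F'. (u + v) s * cnj (w t) * \<phi> (inv t \<circ> s))"
    "gns_form \<phi> u w = (\<Sum>s\<in>F. \<Sum>t\<in>F'. u s * cnj (w t) * \<phi> (inv t \<circ> s))"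
    "gns_form \<phi> v w = (\<Sum>s\<in>F. \<Sum>t\<in>F'. v s * cnj (w t) * \<phi> (inv t \<circ> s))"
    using fin by (intro form_eq; auto simp: F_def F'_def)+
  then show "gns_form \<phi> (u + v) w = gns_form \<phi> u w + gns_form \<phi> v w"
    by (simp add: algebra_simps sum.distrib)
next
  fix u v c assume uv: "u \<in> A" "v \<in> A"
  define F where "F = {s. u s \<noteq> 0}"
  define F' where "F' = {s. v s \<noteq> 0}"
  have fin: "finite F" "finite F'" using uv finA by (auto simp: F_def F'_def)
  have "gns_form \<phi> (smul c u) v = (\<Sum>s\<in>F. \<Sum>t\<in>F'. (smul c u) s * cnj (v t) * \<phi> (inv t \<circ> s))"
    "gns_form \<phi> u v = (\<Sum>s\<in>F. \<Sum>t\<in>F'. u s * cnj (v t) * \<phi> (inv t \<circ> s))"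
    using fin by (intro form_eq; auto simp: F_def F'_def)+
  then show "gns_form \<phi> (smul c u) v = c * gns_form \<phi> u v"
    by (simp add: sum_distrib_left mult.assoc)
next
  fix u v assume uv: "u \<in> A" "v \<in> A"
  have "gns_form \<phi> v u = (\<Sum>s | u s \<noteq> 0. \<Sum>t | v t \<noteq> 0. v t * cnj (u s) * \<phi> (inv s \<circ> t))"
    unfolding gns_form_def by (rule sum.swap)
  also have "\<dots> = (\<Sum>s | u s \<noteq> 0. \<Sum>t | v t \<noteq> 0. cnj (u s * cnj (v t) * \<phi> (inv t \<circ> s)))"
  proof (intro sum.cong refl)
    fix s t assume st: "s \<in> {s. u s \<noteq> 0}" "t \<in> {t. v t \<noteq> 0}"
    then have "s \<in> S" "t \<in> S" using subA[OF uv(1)] subA[OF uv(2)] by auto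
    then show "v t * cnj (u s) * \<phi> (inv s \<circ> t) = cnj (u s * cnj (v t) * \<phi> (inv t \<circ> s))"
      using phi_swap[of s t] by simp
  qed
  finally show "gns_form \<phi> v u = cnj (gns_form \<phi> u v)"
    by (simp add: gns_form_def)
next
  fix u assume u: "u \<in> A"
  show "0 \<le> Re (gns_form \<phi> u u)"
    unfolding gns_form_def by (rule posdef[OF finA[OF u] subA[OF u]])
qed

lemma delta_A: "g \<in> S \<Longrightarrow> delta g \<in> A"
  by (simp add: delta_def group_algebra_def)

lemma form_delta: "f \<in> A \<Longrightarrow> g \<in> S \<Longrightarrow> gns_form \<phi> f (delta g) = (\<Sum>s | f s \<noteq> 0. f s * \<phi> (inv g \<circ> s))"
  using form_eq[of "{s. f s \<noteq> 0}" f "{g}" "delta g"] finA[of f] by (simp add: delta_def)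

lemma form_right_delta: "f \<in> A \<Longrightarrow> h \<in> A \<Longrightarrow>
  gns_form \<phi> f h = (\<Sum>t | h t \<noteq> 0. cnj (h t) * gns_form \<phi> f (delta t))"
proof -
  assume fh: "f \<in> A" "h \<in> A"
  have "gns_form \<phi> f h = (\<Sum>t | h t \<noteq> 0. \<Sum>s | f s \<noteq> 0. f s * cnj (h t) * \<phi> (inv t \<circ> s))"
    unfolding gns_form_def by (rule sum.swap)
  also have "\<dots> = (\<Sum>t | h t \<noteq> 0. cnj (h t) * gns_form \<phi> f (delta t))"
    using fh subA[OF fh(2)] by (intro sum.cong refl) (auto simp: form_delta sum_distrib_left mult_ac)
  finally show ?thesis .
qed

abbreviation "C \<equiv> gns_cauchy S \<phi>"
abbreviation "point \<equiv> gns_point S \<phi>"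

lemma C_mem: "X \<in> C \<Longrightarrow> X n \<in> A"
  by (simp add: gns_cauchy_def)

lemma C_iff: "X \<in> C \<longleftrightarrow> (\<forall>n. X n \<in> A) \<and> (\<forall>e>0. \<exists>N. \<forall>m\<ge>N. \<forall>n\<ge>N. P.nrm (X m - X n) < e)"
proof -
  have "(\<exists>N. \<forall>m\<ge>N. \<forall>n\<ge>N. Re (gns_form \<phi> (X m - X n) (X m - X n)) < e\<^sup>2) \<longleftrightarrow>
    (\<exists>N. \<forall>m\<ge>N. \<forall>n\<ge>N. P.nrm (X m - X n) < e)" if "e > 0" for e
    using that real_sqrt_less_iff[of _ "e\<^sup>2"] by (simp add: P.nrm_def)
  moreover have "(\<forall>e>0. \<exists>N. \<forall>m\<ge>N. \<forall>n\<ge>N. Re (gns_form \<phi> (X m - X n) (X m - X n)) < e) \<longleftrightarrow>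
    (\<forall>e>0. \<exists>N. \<forall>m\<ge>N. \<forall>n\<ge>N. Re (gns_form \<phi> (X m - X n) (X m - X n)) < e\<^sup>2)" (is "?l \<longleftrightarrow> ?r")
  proof
    assume ?r
    show ?l
    proof (intro allI impI)
      fix e :: real assume "e > 0"
      then show "\<exists>N. \<forall>m\<ge>N. \<forall>n\<ge>N. Re (gns_form \<phi> (X m - X n) (X m - X n)) < e"
        using \<open>?r\<close>[rule_format, of "sqrt e"] by simp
    qed
  qed simp
  ultimately show ?thesis
    by (auto simp: gns_cauchy_def fun_diff_def)
qed

lemma C_bounded: "X \<in> C \<Longrightarrow> \<exists>K>0. \<forall>n. P.nrm (X n) \<le> K"
proof -
  assume X: "X \<in> C"
  then obtain N where N: "\<forall>m\<ge>N. \<forall>n\<ge>N. P.nrm (X m - X n) < 1"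
    by (metis C_iff zero_less_one)
  define K where "K = 1 + (\<Sum>n\<le>N. P.nrm (X n))"
  have "P.nrm (X n) \<le> K" for n
  proof (cases "n \<le> N")
    case True
    then have "P.nrm (X n) \<le> (\<Sum>n\<le>N. P.nrm (X n))"
      using X C_mem by (intro member_le_sum) auto
    then show ?thesis by (simp add: K_def)
  next
    case False
    have "P.nrm (X n) \<le> P.nrm (X n - X N) + P.nrm (X N)"
      using P.nrm_triangle[of "X n - X N" "X N"] X C_mem by simp
    moreover have "P.nrm (X n - X N) < 1" using N False by simp
    moreover have "P.nrm (X N) \<le> (\<Sum>n\<le>N. P.nrm (X n))"
      using X C_mem by (intro member_le_sum) auto
    ultimately show ?thesis by (simp add: K_def)
  qed
  moreover have "K > 0"
    using X C_mem unfolding K_def by (intro add_pos_nonneg sum_nonneg) auto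
  ultimately show ?thesis by blast
qed

lemma C_add: "X \<in> C \<Longrightarrow> Y \<in> C \<Longrightarrow> (\<lambda>n. X n + Y n) \<in> C"
proof -
  assume X: "X \<in> C" and Y: "Y \<in> C"
  have "\<exists>N. \<forall>m\<ge>N. \<forall>n\<ge>N. P.nrm ((X m + Y m) - (X n + Y n)) < e" if e: "e > 0" for e
  proof -
    obtain N1 N2 where N: "\<forall>m\<ge>N1. \<forall>n\<ge>N1. P.nrm (X m - X n) < e/2" "\<forall>m\<ge>N2. \<forall>n\<ge>N2. P.nrm (Y m - Y n) < e/2"
      using X Y e by (metis C_iff half_gt_zero)
    have "P.nrm ((X m + Y m) - (X n + Y n)) < e" if "m \<ge> max N1 N2" "n \<ge> max N1 N2" for m n
    proof -
      have eq: "(X m + Y m) - (X n + Y n) = (X m - X n) + (Y m - Y n)" by simp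
      have "P.nrm ((X m + Y m) - (X n + Y n)) \<le> P.nrm (X m - X n) + P.nrm (Y m - Y n)"
        unfolding eq using X Y C_mem by (intro P.nrm_triangle) auto
      moreover have "P.nrm (X m - X n) < e/2" "P.nrm (Y m - Y n) < e/2" using N that by auto
      ultimately show ?thesis by linarith
    qed
    then show ?thesis by blast
  qed
  then show ?thesis using X Y C_mem by (auto simp: C_iff)
qed

lemma C_smul: "X \<in> C \<Longrightarrow> (\<lambda>n. smul c (X n)) \<in> C"
proof -
  assume X: "X \<in> C"
  have "\<exists>N. \<forall>m\<ge>N. \<forall>n\<ge>N. P.nrm (smul c (X m) - smul c (X n)) < e" if e: "e > 0" for e
  proof -
    have pos: "e / (cmod c + 1) > 0" using e by (simp add: add_nonneg_pos)
    obtain N where N: "\<forall>m\<ge>N. \<forall>n\<ge>N. P.nrm (X m - X n) < e / (cmod c + 1)"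
      using X pos unfolding C_iff by meson
    have "P.nrm (smul c (X m) - smul c (X n)) < e" if "m \<ge> N" "n \<ge> N" for m n
    proof -
      have "P.nrm (smul c (X m) - smul c (X n)) = cmod c * P.nrm (X m - X n)"
        using X C_mem by (simp flip: smul_diff add: P.nrm_smul)
      also have "\<dots> \<le> cmod c * (e / (cmod c + 1))"
        using N that by (intro mult_left_mono) (auto intro: less_imp_le)
      also have "\<dots> < e"
        using e by (simp add: pos_divide_less_eq add_nonneg_pos distrib_left mult.commute)
      finally show ?thesis .
    qed
    then show ?thesis by blast
  qed
  then show ?thesis using X C_mem by (auto simp: C_iff)
qed

lemma C_const: "f \<in> A \<Longrightarrow> (\<lambda>n. f) \<in> C"
  unfolding C_iff by simp

definition L :: "(nat \<Rightarrow> (nat \<Rightarrow> nat) \<Rightarrow> complex) \<Rightarrow> (nat \<Rightarrow> (nat \<Rightarrow> nat) \<Rightarrow> complex) \<Rightarrow> complex" where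
  "L X Y = lim (\<lambda>n. gns_form \<phi> (X n) (Y n))"

lemma L_lim:
  assumes X: "X \<in> C" and Y: "Y \<in> C"
  shows "(\<lambda>n. gns_form \<phi> (X n) (Y n)) \<longlonglongrightarrow> L X Y"
proof -
  obtain K K' where K: "K > 0" "\<And>n. P.nrm (X n) \<le> K" and K': "K' > 0" "\<And>n. P.nrm (Y n) \<le> K'"
    using C_bounded[OF X] C_bounded[OF Y] by blast
  have "Cauchy (\<lambda>n. gns_form \<phi> (X n) (Y n))"
  proof (rule CauchyI)
    fix e :: real assume e: "e > 0"
    have pos: "e / (2 * K') > 0" "e / (2 * K) > 0" using e K K' by auto
    obtain N1 where N1: "\<forall>m\<ge>N1. \<forall>n\<ge>N1. P.nrm (X m - X n) < e / (2 * K')"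
      using X pos unfolding C_iff by meson
    obtain N2 where N2: "\<forall>m\<ge>N2. \<forall>n\<ge>N2. P.nrm (Y m - Y n) < e / (2 * K)"
      using Y pos unfolding C_iff by meson
    have "norm (gns_form \<phi> (X m) (Y m) - gns_form \<phi> (X n) (Y n)) < e"
      if "m \<ge> max N1 N2" "n \<ge> max N1 N2" for m n
    proof -
      have d: "gns_form \<phi> (X m) (Y m) - gns_form \<phi> (X n) (Y n)
        = gns_form \<phi> (X m - X n) (Y m) + gns_form \<phi> (X n) (Y m - Y n)"
        using X Y C_mem by (simp add: P.ip_diff_left P.ip_diff_right)
      have dX: "X m - X n \<in> A" and dY: "Y m - Y n \<in> A" using X Y C_mem by auto
      have "cmod (gns_form \<phi> (X m - X n) (Y m)) \<le> P.nrm (X m - X n) * P.nrm (Y m)"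
        by (rule P.cauchy_schwarz[OF dX C_mem[OF Y]])
      moreover have "P.nrm (X m - X n) * P.nrm (Y m) \<le> P.nrm (X m - X n) * K'"
        using K' P.nrm_nonneg[OF dX] by (rule_tac mult_left_mono)
      moreover have "P.nrm (X m - X n) * K' < e / (2 * K') * K'"
        using N1 that K' by (rule_tac mult_strict_right_mono) auto
      moreover have "cmod (gns_form \<phi> (X n) (Y m - Y n)) \<le> P.nrm (X n) * P.nrm (Y m - Y n)"
        by (rule P.cauchy_schwarz[OF C_mem[OF X] dY])
      moreover have "P.nrm (X n) * P.nrm (Y m - Y n) \<le> K * P.nrm (Y m - Y n)"
        using K P.nrm_nonneg[OF dY] by (rule_tac mult_right_mono)
      moreover have "K * P.nrm (Y m - Y n) < K * (e / (2 * K))"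
        using N2 that K by (rule_tac mult_strict_left_mono) auto
      moreover have "e / (2 * K') * K' = e / 2" "K * (e / (2 * K)) = e / 2" using K K' by simp_all
      moreover have "norm (gns_form \<phi> (X m - X n) (Y m) + gns_form \<phi> (X n) (Y m - Y n))
        \<le> cmod (gns_form \<phi> (X m - X n) (Y m)) + cmod (gns_form \<phi> (X n) (Y m - Y n))"
        by (rule norm_triangle_ineq)
      ultimately show ?thesis unfolding d by linarith
    qed
    then show "\<exists>M. \<forall>m\<ge>M. \<forall>n\<ge>M. norm (gns_form \<phi> (X m) (Y m) - gns_form \<phi> (X n) (Y n)) < e" by blast
  qed
  then have "convergent (\<lambda>n. gns_form \<phi> (X n) (Y n))" by (rule Cauchy_convergent)
  then show ?thesis by (simp add: L_def convergent_LIMSEQ_iff)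
qed

lemma point_L: "X \<in> C \<Longrightarrow> g \<in> S \<Longrightarrow> point X g = L X (\<lambda>n. delta g)"
  by (simp add: gns_point_def L_def delta_def)

lemma point_out: "g \<notin> S \<Longrightarrow> point X g = 0"
  by (simp add: gns_point_def)

lemma L_add_left: "X \<in> C \<Longrightarrow> Y \<in> C \<Longrightarrow> Z \<in> C \<Longrightarrow> L (\<lambda>n. X n + Y n) Z = L X Z + L Y Z"
proof -
  assume a: "X \<in> C" "Y \<in> C" "Z \<in> C"
  have "(\<lambda>n. gns_form \<phi> (X n) (Z n) + gns_form \<phi> (Y n) (Z n)) \<longlonglongrightarrow> L X Z + L Y Z"
    using a by (intro tendsto_add L_lim)
  moreover have "gns_form \<phi> (X n) (Z n) + gns_form \<phi> (Y n) (Z n) = gns_form \<phi> (X n + Y n) (Z n)" for n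
    using a C_mem by (simp add: P.ip_add_left)
  ultimately have "(\<lambda>n. gns_form \<phi> (X n + Y n) (Z n)) \<longlonglongrightarrow> L X Z + L Y Z" by simp
  then show ?thesis
    by (rule LIMSEQ_unique[OF L_lim[OF C_add[OF a(1,2)] a(3)]])
qed

lemma L_smul_left: "X \<in> C \<Longrightarrow> Z \<in> C \<Longrightarrow> L (\<lambda>n. smul c (X n)) Z = c * L X Z"
proof -
  assume a: "X \<in> C" "Z \<in> C"
  have "(\<lambda>n. c * gns_form \<phi> (X n) (Z n)) \<longlonglongrightarrow> c * L X Z"
    using a by (intro tendsto_mult_left L_lim)
  moreover have "c * gns_form \<phi> (X n) (Z n) = gns_form \<phi> (smul c (X n)) (Z n)" for n
    using a C_mem by (simp add: P.ip_smul_left)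
  ultimately have "(\<lambda>n. gns_form \<phi> (smul c (X n)) (Z n)) \<longlonglongrightarrow> c * L X Z" by simp
  then show ?thesis
    by (rule LIMSEQ_unique[OF L_lim[OF C_smul[OF a(1)] a(2)]])
qed

lemma L_sym: "X \<in> C \<Longrightarrow> Y \<in> C \<Longrightarrow> L Y X = cnj (L X Y)"
proof -
  assume a: "X \<in> C" "Y \<in> C"
  have "(\<lambda>n. cnj (gns_form \<phi> (X n) (Y n))) \<longlonglongrightarrow> cnj (L X Y)"
    using a by (intro tendsto_cnj L_lim)
  moreover have "cnj (gns_form \<phi> (X n) (Y n)) = gns_form \<phi> (Y n) (X n)" for n
    using P.ip_sym[of "X n" "Y n"] a C_mem by simp
  ultimately have "(\<lambda>n. gns_form \<phi> (Y n) (X n)) \<longlonglongrightarrow> cnj (L X Y)" by simp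
  then show ?thesis
    by (rule LIMSEQ_unique[OF L_lim[OF a(2,1)]])
qed

lemma point_add: "X \<in> C \<Longrightarrow> Y \<in> C \<Longrightarrow> point (\<lambda>n. X n + Y n) = point X + point Y"
proof
  fix g assume a: "X \<in> C" "Y \<in> C"
  then show "point (\<lambda>n. X n + Y n) g = (point X + point Y) g"
    by (cases "g \<in> S") (simp_all add: point_L point_out C_add L_add_left C_const delta_A)
qed

lemma point_smul: "X \<in> C \<Longrightarrow> point (\<lambda>n. smul c (X n)) = smul c (point X)"
proof
  fix g assume a: "X \<in> C"
  then show "point (\<lambda>n. smul c (X n)) g = smul c (point X) g"
    by (cases "g \<in> S") (simp_all add: point_L point_out C_smul L_smul_left C_const delta_A)
qed

lemma nrm_L:
  assumes "X \<in> C" shows "(\<lambda>n. (P.nrm (X n))\<^sup>2) \<longlonglongrightarrow> Re (L X X)"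
  using tendsto_Re[OF L_lim[OF assms assms]] by (simp add: P.nrm_sq[OF C_mem[OF assms]])

text \<open>A vanishing code means that the inner products with all group elements tend to 0, which
  is weak convergence to 0. For a Cauchy sequence this is convergence in norm, since the squared
  norm of \<open>X n\<close> splits into its product with a fixed \<open>X N\<close> and its product
  with the small \<open>X n - X N\<close>.\<close>

lemma point_zero_null:
  assumes X: "X \<in> C" and p: "point X = 0"
  shows "(\<lambda>n. P.nrm (X n)) \<longlonglongrightarrow> 0"
proof -
  have "(\<lambda>n. gns_form \<phi> (X n) h) \<longlonglongrightarrow> 0" if h: "h \<in> A" for h
  proof -
    have "(\<lambda>n. \<Sum>t | h t \<noteq> 0. cnj (h t) * gns_form \<phi> (X n) (delta t)) \<longlonglongrightarrow> (\<Sum>t | h t \<noteq> 0. cnj (h t) * point X t)"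
    proof (intro tendsto_sum tendsto_mult_left)
      fix t assume "t \<in> {t. h t \<noteq> 0}"
      then have "t \<in> S" using subA[OF h] by auto
      then show "(\<lambda>n. gns_form \<phi> (X n) (delta t)) \<longlonglongrightarrow> point X t"
        using L_lim[OF X C_const[OF delta_A]] X by (simp add: point_L)
    qed
    moreover have "(\<Sum>t | h t \<noteq> 0. cnj (h t) * gns_form \<phi> (X n) (delta t)) = gns_form \<phi> (X n) h" for n
      using form_right_delta[OF C_mem[OF X] h] by simp
    ultimately show ?thesis using p by simp
  qed
  then have weak: "(\<lambda>n. gns_form \<phi> (X n) (X m)) \<longlonglongrightarrow> 0" for m using X C_mem by blast
  obtain K where K: "K > 0" "\<And>n. P.nrm (X n) \<le> K" using C_bounded[OF X] by blast
  have "(\<lambda>n. (P.nrm (X n))\<^sup>2) \<longlonglongrightarrow> 0"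
  proof (rule LIMSEQ_I)
    fix e :: real assume e: "e > 0"
    obtain N where N: "\<forall>m\<ge>N. \<forall>n\<ge>N. P.nrm (X m - X n) < e / (2 * K)"
      using X e K unfolding C_iff by (meson divide_pos_pos mult_pos_pos zero_less_numeral)
    obtain N' where N': "\<forall>n\<ge>N'. norm (gns_form \<phi> (X n) (X N) - 0) < e / 2"
      using LIMSEQ_D[OF weak[of N], of "e / 2"] e by auto
    have "norm ((P.nrm (X n))\<^sup>2 - 0) < e" if n: "n \<ge> max N N'" for n
    proof -
      have "(P.nrm (X n))\<^sup>2 = Re (gns_form \<phi> (X n) (X N)) + Re (gns_form \<phi> (X n) (X n - X N))"
        using X C_mem by (simp add: P.nrm_sq P.ip_diff_right)
      also have "\<dots> \<le> cmod (gns_form \<phi> (X n) (X N)) + cmod (gns_form \<phi> (X n) (X n - X N))"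
        by (intro add_mono complex_Re_le_cmod)
      also have "cmod (gns_form \<phi> (X n) (X n - X N)) \<le> P.nrm (X n) * P.nrm (X n - X N)"
        using X C_mem by (intro P.cauchy_schwarz) auto
      also have "\<dots> \<le> K * P.nrm (X n - X N)"
        using X C_mem K by (intro mult_right_mono) auto
      also have "\<dots> \<le> K * (e / (2 * K))"
        using N n K by (intro mult_left_mono) (auto intro: less_imp_le)
      also have "\<dots> = e / 2" using K by simp
      also have "cmod (gns_form \<phi> (X n) (X N)) < e / 2" using N' n by simp
      finally show ?thesis by simp
    qed
    then show "\<exists>no. \<forall>n\<ge>no. norm ((P.nrm (X n))\<^sup>2 - 0) < e" by blast
  qed
  then have "(\<lambda>n. sqrt ((P.nrm (X n))\<^sup>2)) \<longlonglongrightarrow> sqrt 0" by (rule tendsto_real_sqrt)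
  then show ?thesis using X C_mem by simp
qed

lemma L_null:
  assumes X: "X \<in> C" "(\<lambda>n. P.nrm (X n)) \<longlonglongrightarrow> 0" and Y: "Y \<in> C"
  shows "L X Y = 0"
proof -
  obtain K where K: "K > 0" "\<And>n. P.nrm (Y n) \<le> K" using C_bounded[OF Y] by blast
  have "(\<lambda>n. gns_form \<phi> (X n) (Y n)) \<longlonglongrightarrow> 0"
  proof (rule Lim_null_comparison[OF always_eventually])
    show "\<forall>n. cmod (gns_form \<phi> (X n) (Y n)) \<le> P.nrm (X n) * K"
    proof
      fix n
      have "cmod (gns_form \<phi> (X n) (Y n)) \<le> P.nrm (X n) * P.nrm (Y n)"
        using X Y C_mem by (intro P.cauchy_schwarz)
      also have "\<dots> \<le> P.nrm (X n) * K"
        using X C_mem K by (intro mult_left_mono) auto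
      finally show "cmod (gns_form \<phi> (X n) (Y n)) \<le> P.nrm (X n) * K" .
    qed
    show "(\<lambda>n. P.nrm (X n) * K) \<longlonglongrightarrow> 0" using tendsto_mult_left_zero[OF X(2)] by simp
  qed
  then show ?thesis using LIMSEQ_unique L_lim[OF X(1) Y] by blast
qed

lemma C_diff:
  assumes "X \<in> C" "Y \<in> C"
  shows "(\<lambda>n. X n - Y n) \<in> C"
  using C_add[OF assms(1) C_smul[OF assms(2), of "-1"]] by (simp add: smul_minus_one)

text \<open>Sequences with equal codes differ by a null sequence. Hence the arbitrary choice in
  \<open>gns_approx\<close> does not affect the inner product.\<close>

lemma L_cong_left:
  assumes "X \<in> C" "X' \<in> C" "point X = point X'" "Y \<in> C"
  shows "L X Y = L X' Y"
proof -
  have m: "(\<lambda>n. smul (-1) (X' n)) \<in> C" using assms by (intro C_smul)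
  let ?Z = "\<lambda>n. X n + smul (-1) (X' n)"
  have Z: "?Z \<in> C" using assms m by (intro C_add)
  have "point ?Z = 0"
    using assms m by (simp only: point_add point_smul) (simp add: smul_minus_one)
  then have "L ?Z Y = 0" using L_null[OF Z point_zero_null[OF Z]] assms by blast
  then show ?thesis
    using assms m by (simp add: L_add_left L_smul_left)
qed

abbreviation "R \<equiv> gns_rep S \<phi>"

lemma hspace_gns: "hspace R = point ` C"
  by (simp add: gns_rep_def)

lemma approx: "X \<in> C \<Longrightarrow> gns_approx S \<phi> (point X) \<in> C \<and> point (gns_approx S \<phi> (point X)) = point X"
  unfolding gns_approx_def by (rule someI[of _ X]) simp

lemma inprod_point:
  assumes "X \<in> C" "Y \<in> C"
  shows "inprod R (point X) (point Y) = L X Y"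
proof -
  define X' where "X' = gns_approx S \<phi> (point X)"
  define Y' where "Y' = gns_approx S \<phi> (point Y)"
  have X': "X' \<in> C" "point X' = point X" and Y': "Y' \<in> C" "point Y' = point Y"
    using approx assms by (auto simp: X'_def Y'_def)
  have "inprod R (point X) (point Y) = L X' Y'"
    by (simp add: gns_rep_def L_def X'_def Y'_def)
  also have "\<dots> = L X Y'"
    using assms X' Y' by (intro L_cong_left)
  also have "\<dots> = cnj (L Y' X)" using assms Y' by (intro L_sym)
  also have "L Y' X = L Y X" using assms Y' by (intro L_cong_left)
  also have "cnj (L Y X) = L X Y" using L_sym[of Y X] assms by simp
  finally show ?thesis .
qed

lemma gns_semi: "semi_ip (hspace R) (inprod R)"
proof
  have "point (\<lambda>n. smul 0 0) = smul 0 (point (\<lambda>n. 0))"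
    by (intro point_smul C_const) simp
  then have "point (\<lambda>n. 0) = 0" by simp
  then show "0 \<in> hspace R"
    using C_const[of 0] by (auto simp: hspace_gns image_iff)
next
  fix u v assume "u \<in> hspace R" "v \<in> hspace R"
  then obtain X Y where X: "X \<in> C" "u = point X" "Y \<in> C" "v = point Y"
    by (auto simp: hspace_gns)
  have eq: "u + v = point (\<lambda>n. X n + Y n)"
    unfolding X(2,4) by (rule point_add[OF X(1,3), symmetric])
  then show "u + v \<in> hspace R"
    using C_add[OF X(1,3)] by (simp add: hspace_gns)
  fix w assume "w \<in> hspace R"
  then obtain Z where Z: "Z \<in> C" "w = point Z" by (auto simp: hspace_gns)
  have "inprod R (u + v) w = L (\<lambda>n. X n + Y n) Z"
    unfolding eq Z(2) by (rule inprod_point[OF C_add[OF X(1,3)] Z(1)])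
  also have "\<dots> = L X Z + L Y Z" by (rule L_add_left[OF X(1,3) Z(1)])
  finally show "inprod R (u + v) w = inprod R u w + inprod R v w"
    using X Z by (simp add: inprod_point)
next
  fix u c assume "u \<in> hspace R"
  then obtain X where X: "X \<in> C" "u = point X" by (auto simp: hspace_gns)
  have eq: "smul c u = point (\<lambda>n. smul c (X n))"
    unfolding X(2) by (rule point_smul[OF X(1), symmetric])
  then show "smul c u \<in> hspace R"
    using C_smul[OF X(1)] by (simp add: hspace_gns)
  fix w assume "w \<in> hspace R"
  then obtain Z where Z: "Z \<in> C" "w = point Z" by (auto simp: hspace_gns)
  have "inprod R (smul c u) w = L (\<lambda>n. smul c (X n)) Z"
    unfolding eq Z(2) by (rule inprod_point[OF C_smul[OF X(1)] Z(1)])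
  also have "\<dots> = c * L X Z" by (rule L_smul_left[OF X(1) Z(1)])
  finally show "inprod R (smul c u) w = c * inprod R u w"
    using X Z by (simp add: inprod_point)
next
  fix u v assume "u \<in> hspace R" "v \<in> hspace R"
  then show "inprod R v u = cnj (inprod R u v)"
    unfolding hspace_gns by (auto simp: inprod_point intro: L_sym)
next
  fix u assume "u \<in> hspace R"
  then obtain X where X: "X \<in> C" "u = point X" by (auto simp: hspace_gns)
  have "0 \<le> Re (L X X)" by (rule LIMSEQ_le_const[OF nrm_L[OF X(1)]]) auto
  then show "0 \<le> Re (inprod R u u)" using X by (simp add: inprod_point)
qed

text \<open>A diagonal argument: each \<open>V m\<close> lies within \<open>1 / (m + 1)\<close> of
  the image of a single element \<open>x m\<close> of the group algebra. These elements form a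
  Cauchy sequence there, and its point is the limit of \<open>V\<close>.\<close>

lemma gns_hfs: "hfs (hspace R) (inprod R)"
proof -
  interpret H: semi_ip "hspace R" "inprod R" by (rule gns_semi)
  have dpt: "point X - point Y = point (\<lambda>n. X n - Y n)" if "X \<in> C" "Y \<in> C" for X Y
    using point_add[OF that(1) C_smul[OF that(2)], of "-1"] point_smul[OF that(2), of "-1"]
    by (simp add: smul_minus_one)
  have nrm_pt: "(\<lambda>n. P.nrm (X n)) \<longlonglongrightarrow> H.nrm (point X)" if "X \<in> C" for X
  proof -
    have "(\<lambda>n. sqrt ((P.nrm (X n))\<^sup>2)) \<longlonglongrightarrow> sqrt (Re (L X X))"
      by (intro tendsto_real_sqrt nrm_L that)
    then show ?thesis using that C_mem by (simp add: H.nrm_def inprod_point)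
  qed
  have nrm_const: "H.nrm (point (\<lambda>n. f)) = P.nrm f" if "f \<in> A" for f
    using LIMSEQ_unique[OF nrm_pt[OF C_const[OF that]] tendsto_const] by simp
  show ?thesis
  proof
    fix u assume u: "u \<in> hspace R" "Re (inprod R u u) = 0"
    then obtain X where X: "X \<in> C" "u = point X" by (auto simp: hspace_gns)
    have "H.nrm (point X) = 0" using u X by (simp add: H.nrm_def)
    then have "(\<lambda>n. P.nrm (X n)) \<longlonglongrightarrow> 0" using nrm_pt[OF X(1)] by simp
    then have L0: "L X Y = 0" if "Y \<in> C" for Y
      using L_null[OF X(1) _ that] by blast
    have "point X g = 0" for g
      using L0[OF C_const[OF delta_A]] X(1) by (cases "g \<in> S") (simp_all add: point_L point_out)
    then show "u = 0"
      unfolding X(2) by (simp add: fun_eq_iff)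
  next
    fix V :: "nat \<Rightarrow> (nat \<Rightarrow> nat) \<Rightarrow> complex"
    assume V: "\<And>n. V n \<in> hspace R"
      and Cau: "\<And>e. e > 0 \<Longrightarrow> \<exists>N. \<forall>m\<ge>N. \<forall>n\<ge>N. Re (inprod R (V m - V n) (V m - V n)) < e"
    have "\<forall>m. \<exists>X. X \<in> C \<and> V m = point X"
      using V by (auto simp: hspace_gns)
    from choice[OF this] obtain X where X: "\<And>m. X m \<in> C" "\<And>m. V m = point (X m)"
      by blast
    have "\<exists>k. H.nrm (V m - point (\<lambda>n. X m k)) < 1 / real (Suc m)" for m
    proof -
      have "0 < 1 / (2 * real (Suc m))" by simp
      then obtain N where N: "\<forall>k\<ge>N. \<forall>l\<ge>N. P.nrm (X m k - X m l) < 1 / (2 * real (Suc m))"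
        using X(1)[of m] unfolding C_iff by blast
      have XN: "(\<lambda>n. X m N) \<in> C" using X C_mem by (intro C_const) auto
      have "H.nrm (V m - point (\<lambda>n. X m N)) \<le> 1 / (2 * real (Suc m))"
        unfolding X(2) dpt[OF X(1) XN]
        by (rule LIMSEQ_le_const2[OF nrm_pt[OF C_diff[OF X(1) XN]]], rule exI[of _ N])
          (use N less_imp_le in blast)
      also have "\<dots> < 1 / real (Suc m)" by (simp add: field_simps)
      finally show ?thesis by blast
    qed
    then obtain k where k: "\<And>m. H.nrm (V m - point (\<lambda>n. X m (k m))) < 1 / real (Suc m)" by metis
    define x where "x m = X m (k m)" for m
    have xA: "x m \<in> A" for m using X C_mem by (auto simp: x_def)
    define p where "p m = point (\<lambda>n. x m)" for m
    have pH: "p m \<in> hspace R" for m using C_const[OF xA] by (auto simp: p_def hspace_gns)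
    have Vp: "H.nrm (V m - p m) < 1 / real (Suc m)" for m using k by (simp add: p_def x_def)
    have pp: "H.nrm (p m - p n) = P.nrm (x m - x n)" for m n
      unfolding p_def dpt[OF C_const[OF xA] C_const[OF xA]] using xA by (intro nrm_const) auto
    have xC: "x \<in> C"
      unfolding C_iff
    proof (intro conjI allI impI xA)
      fix e :: real assume e: "e > 0"
      obtain N1 where N1: "\<forall>m\<ge>N1. \<forall>n\<ge>N1. Re (inprod R (V m - V n) (V m - V n)) < (e/3)\<^sup>2"
        using Cau[of "(e/3)\<^sup>2"] e by auto
      obtain N2 where N2: "1 / real (Suc N2) < e/3"
        using nat_approx_posE[of "e/3"] e by auto
      have "P.nrm (x m - x n) < e" if mn: "m \<ge> max N1 N2" "n \<ge> max N1 N2" for m n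
      proof -
        have "(H.nrm (V m - V n))\<^sup>2 < (e/3)\<^sup>2" using N1 mn V by (simp add: H.nrm_sq)
        then have "H.nrm (V m - V n) < e/3" by (rule power2_less_imp_less) (use e in simp)
        moreover have "1 / real (Suc m) \<le> 1 / real (Suc N2)" "1 / real (Suc n) \<le> 1 / real (Suc N2)"
          using mn by (simp_all add: frac_le)
        moreover have "H.nrm (p m - p n) \<le> H.nrm (p m - V m) + H.nrm (V m - p n)"
          using pH V by (intro H.nrm_triangle_diff) auto
        moreover have "H.nrm (V m - p n) \<le> H.nrm (V m - V n) + H.nrm (V n - p n)"
          using pH V by (intro H.nrm_triangle_diff) auto
        moreover have "H.nrm (p m - V m) = H.nrm (V m - p m)"
          using pH V by (simp add: H.nrm_diff_commute)
        ultimately have "H.nrm (p m - p n) < e" using Vp[of m] Vp[of n] N2 by linarith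
        then show ?thesis by (simp add: pp)
      qed
      then show "\<exists>N. \<forall>m\<ge>N. \<forall>n\<ge>N. P.nrm (x m - x n) < e" by blast
    qed
    define v where "v = point x"
    have vH: "v \<in> hspace R" using xC by (auto simp: v_def hspace_gns)
    have lim: "(\<lambda>n. H.nrm (V n - v)) \<longlonglongrightarrow> 0"
    proof (rule LIMSEQ_I)
      fix e :: real assume e: "e > 0"
      obtain N1 where N1: "\<forall>m\<ge>N1. \<forall>n\<ge>N1. P.nrm (x m - x n) < e/2"
        using xC half_gt_zero[OF e] unfolding C_iff by blast
      obtain N2 where N2: "1 / real (Suc N2) < e/2"
        using nat_approx_posE[of "e/2"] e by auto
      have "norm (H.nrm (V n - v) - 0) < e" if n: "n \<ge> max N1 N2" for n
      proof -
        have "P.nrm (x n - x k) \<le> e/2" if "k \<ge> N1" for k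
          using N1 n that by (simp add: less_imp_le)
        then have le: "\<exists>N. \<forall>k\<ge>N. P.nrm (x n - x k) \<le> e/2" by blast
        have "H.nrm (p n - v) \<le> e/2"
          unfolding p_def v_def dpt[OF C_const[OF xA] xC]
          by (rule LIMSEQ_le_const2[OF nrm_pt[OF C_diff[OF C_const[OF xA] xC]] le])
        moreover have "H.nrm (V n - p n) < e/2"
        proof -
          have "1 / real (Suc n) \<le> 1 / real (Suc N2)" using n by (simp add: frac_le)
          then show ?thesis using Vp[of n] N2 by linarith
        qed
        moreover have "H.nrm (V n - v) \<le> H.nrm (V n - p n) + H.nrm (p n - v)"
          using pH V vH by (intro H.nrm_triangle_diff) auto
        moreover have "0 \<le> H.nrm (V n - v)" using V vH by auto
        ultimately show ?thesis by simp
      qed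
      then show "\<exists>no. \<forall>n\<ge>no. norm (H.nrm (V n - v) - 0) < e" by blast
    qed
    have "(\<lambda>n. (H.nrm (V n - v))\<^sup>2) \<longlonglongrightarrow> 0\<^sup>2" by (intro tendsto_power lim)
    then have "(\<lambda>n. Re (inprod R (V n - v) (V n - v))) \<longlonglongrightarrow> 0"
      using V vH by (simp add: H.nrm_sq)
    then show "\<exists>x\<in>hspace R. (\<lambda>n. Re (inprod R (V n - x) (V n - x))) \<longlonglongrightarrow> 0"
      using vH by blast
  qed
qed

definition translate :: "(nat \<Rightarrow> nat) \<Rightarrow> ((nat \<Rightarrow> nat) \<Rightarrow> complex) \<Rightarrow> (nat \<Rightarrow> nat) \<Rightarrow> complex" where
  "translate s f = (\<lambda>t. f (inv s \<circ> t))"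

lemma act_gns: "act R s v = translate s v"
  by (simp add: gns_rep_def translate_def)

lemma support_translate: "s \<in> S \<Longrightarrow> {t. translate s f t \<noteq> 0} = (\<circ>) s ` {t. f t \<noteq> 0}"
proof safe
  fix t assume "s \<in> S" "translate s f t \<noteq> 0"
  then show "t \<in> (\<circ>) s ` {t. f t \<noteq> 0}"
    by (intro image_eqI[of _ _ "inv s \<circ> t"]) (simp_all add: translate_def)
next
  fix t assume "s \<in> S" "f t \<noteq> 0" "translate s f (s \<circ> t) = 0"
  then show False by (simp add: translate_def)
qed

lemma inj_left: "s \<in> S \<Longrightarrow> inj_on ((\<circ>) s) X"
  by (rule inj_on_inverseI[where g = "(\<circ>) (inv s)"]) simp

lemma translate_A: "s \<in> S \<Longrightarrow> f \<in> A \<Longrightarrow> translate s f \<in> A"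
proof -
  assume s: "s \<in> S" and f: "f \<in> A"
  have "(\<circ>) s ` {t. f t \<noteq> 0} \<subseteq> S" using s subA[OF f] by auto
  then show ?thesis
    unfolding group_algebra_def mem_Collect_eq support_translate[OF s] using finA[OF f] by simp
qed

lemma translate_form:
  assumes s: "s \<in> S" and f: "f \<in> A" "h \<in> A"
  shows "gns_form \<phi> (translate s f) (translate s h) = gns_form \<phi> f h"
  unfolding gns_form_def support_translate[OF s] sum.reindex[OF inj_left[OF s]] o_def
proof (intro sum.cong refl)
  fix u t assume ut: "u \<in> {s. f s \<noteq> 0}" "t \<in> {t. h t \<noteq> 0}"
  have "inv (s \<circ> t) \<circ> (s \<circ> u) = inv t \<circ> u"
    using ut s subA[OF f(2)] by (auto simp: inv_distrib o_assoc[symmetric])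
  then show "translate s f (\<lambda>x. s (u x)) * cnj (translate s h (\<lambda>x. s (t x))) * \<phi> (\<lambda>x. inv (\<lambda>x. s (t x)) (s (u x)))
     = f u * cnj (h t) * \<phi> (\<lambda>x. inv t (u x))"
    using s inv_comp_assoc(1)[OF s, of u] inv_comp_assoc(1)[OF s, of t]
    by (simp add: translate_def o_def)
qed

lemma translate_diff: "translate s (f - h) = translate s f - translate s h"
  by (simp add: translate_def fun_eq_iff)

lemma translate_nrm: "s \<in> S \<Longrightarrow> f \<in> A \<Longrightarrow> P.nrm (translate s f) = P.nrm f"
  by (simp add: P.nrm_def translate_form)

lemma translate_C: "s \<in> S \<Longrightarrow> X \<in> C \<Longrightarrow> (\<lambda>n. translate s (X n)) \<in> C"
proof -
  assume s: "s \<in> S" and X: "X \<in> C"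
  have "P.nrm (translate s (X m) - translate s (X n)) = P.nrm (X m - X n)" for m n
    using translate_nrm[OF s P.diff_mem[OF C_mem[OF X] C_mem[OF X]]] by (simp only: translate_diff)
  then show ?thesis
    using X translate_A[OF s C_mem[OF X]] by (simp add: C_iff)
qed

lemma translate_delta: "s \<in> S \<Longrightarrow> translate s (delta g) = delta (s \<circ> g)"
proof
  fix t assume s: "s \<in> S"
  have "inv s \<circ> t = g \<longleftrightarrow> t = s \<circ> g" using inv_comp_assoc[OF s] by metis
  then show "translate s (delta g) t = delta (s \<circ> g) t" by (simp add: translate_def delta_def)
qed

lemma translate_point: "s \<in> S \<Longrightarrow> X \<in> C \<Longrightarrow> translate s (point X) = point (\<lambda>n. translate s (X n))"
proof
  fix g assume s: "s \<in> S" and X: "X \<in> C"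
  show "translate s (point X) g = point (\<lambda>n. translate s (X n)) g"
  proof (cases "g \<in> S")
    case True
    have "translate s (point X) g = L X (\<lambda>n. delta (inv s \<circ> g))"
      using s X True by (simp add: translate_def point_L)
    also have "\<dots> = L (\<lambda>n. translate s (X n)) (\<lambda>n. delta g)"
    proof -
      have "gns_form \<phi> (X n) (delta (inv s \<circ> g)) = gns_form \<phi> (translate s (X n)) (delta g)" for n
        using translate_form[OF s C_mem[OF X, of n] delta_A[of "inv s \<circ> g"]] s True
        by (simp add: translate_delta)
      then show ?thesis by (simp add: L_def)
    qed
    finally show ?thesis using s X True by (simp add: point_L translate_C)
  next
    case False
    have "inv s \<circ> g \<notin> S"
    proof
      assume "inv s \<circ> g \<in> S"
      then have "s \<circ> (inv s \<circ> g) \<in> S" by (rule comp_mem[OF s])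
      then show False using False s by simp
    qed
    then show ?thesis using False by (simp add: translate_def point_out)
  qed
qed

sublocale U: unitary_rep S R
proof (intro unitary_rep.intro unitary_rep_axioms.intro gns_hfs perm_group_axioms)
  fix g u v assume g: "g \<in> S" and uv: "u \<in> hspace R" "v \<in> hspace R"
  then obtain X Y where "X \<in> C" "u = point X" "Y \<in> C" "v = point Y" by (auto simp: hspace_gns)
  then show "inprod R (act R g u) (act R g v) = inprod R u v"
    using g C_mem by (simp add: act_gns translate_point inprod_point translate_C)
      (simp add: L_def translate_form)
  show "act R g (u + v) = act R g u + act R g v" by (simp add: act_gns translate_def fun_eq_iff)
next
  fix g v c assume g: "g \<in> S" and v: "v \<in> hspace R"
  then show "act R g v \<in> hspace R"
    by (auto simp: act_gns hspace_gns translate_point intro: translate_C)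
  show "act R g (smul c v) = smul c (act R g v)" by (simp add: act_gns translate_def fun_eq_iff)
next
  fix g h v assume "g \<in> S" "h \<in> S"
  then show "act R (g \<circ> h) v = act R g (act R h v)"
    by (simp add: act_gns translate_def inv_distrib o_assoc)
next
  fix v show "act R id v = v" by (simp add: act_gns translate_def inv_id)
qed

definition vec :: "(nat \<Rightarrow> nat) \<Rightarrow> (nat \<Rightarrow> nat) \<Rightarrow> complex" where
  "vec g = point (\<lambda>n. delta g)"

lemma vec_mem: "g \<in> S \<Longrightarrow> vec g \<in> hspace R"
  unfolding vec_def hspace_gns by (rule imageI[OF C_const[OF delta_A]])

text \<open>The codes form a reproducing kernel space: evaluation at \<open>g\<close> is the inner
  product with \<open>vec g\<close>. Therefore convergence in norm implies pointwise
  convergence.\<close>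

lemma eval:
  assumes "v \<in> hspace R" "g \<in> S"
  shows "v g = inprod R v (vec g)"
proof -
  obtain X where X: "X \<in> C" "v = point X" using assms by (auto simp: hspace_gns)
  show ?thesis
    unfolding X(2) vec_def inprod_point[OF X(1) C_const[OF delta_A[OF assms(2)]]]
    by (rule point_L[OF X(1) assms(2)])
qed

lemma eval_out: "v \<in> hspace R \<Longrightarrow> g \<notin> S \<Longrightarrow> v g = 0"
  by (auto simp: hspace_gns point_out)

lemma ip_vec: "g \<in> S \<Longrightarrow> h \<in> S \<Longrightarrow> inprod R (vec g) (vec h) = \<phi> (inv h \<circ> g)"
proof -
  assume gh: "g \<in> S" "h \<in> S"
  have "inprod R (vec g) (vec h) = L (\<lambda>n. delta g) (\<lambda>n. delta h)"
    using gh by (simp add: vec_def inprod_point C_const delta_A)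
  also have "\<dots> = gns_form \<phi> (delta g) (delta h)" by (simp add: L_def)
  also have "\<dots> = (\<Sum>s | delta g s \<noteq> 0. delta g s * \<phi> (inv h \<circ> s))"
    by (rule form_delta[OF delta_A[OF gh(1)] gh(2)])
  also have "{s. delta g s \<noteq> 0} = {g}" by (auto simp: delta_def)
  finally show ?thesis by (simp add: delta_def comp_def)
qed

lemma act_vec: "s \<in> S \<Longrightarrow> g \<in> S \<Longrightarrow> act R s (vec g) = vec (s \<circ> g)"
  by (simp add: act_gns vec_def translate_point C_const delta_A translate_delta)

end

section \<open>Induced representations\<close>

locale induction_data = unitary_rep K R + G: perm_group G
  for G K :: "('a \<Rightarrow> 'a) set" and R :: "('a \<Rightarrow> 'a, 'x) urep" +
  assumes sub: "K \<subseteq> G"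
begin

definition coset :: "('a \<Rightarrow> 'a) \<Rightarrow> ('a \<Rightarrow> 'a) set" where
  "coset g = (\<circ>) g ` K"

abbreviation "cosets \<equiv> left_cosets G K"

text \<open>The same choice of representative as in \<open>induced_rep\<close>, so that the norm and
  the inner product defined there unfold to it.\<close>

definition rp :: "('a \<Rightarrow> 'a) set \<Rightarrow> 'a \<Rightarrow> 'a" where
  "rp C = (SOME g. g \<in> C)"

lemma KG: "k \<in> K \<Longrightarrow> k \<in> G"
  using sub by blast

lemma cosets_eq: "cosets = coset ` G"
  by (simp add: left_cosets_def coset_def)

lemma self_coset: "g \<in> coset g"
  unfolding coset_def by (rule image_eqI[of _ _ id]) auto

lemma coset_iff:
  assumes "g \<in> G" shows "h \<in> coset g \<longleftrightarrow> inv g \<circ> h \<in> K"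
proof
  assume "h \<in> coset g"
  then obtain k where "k \<in> K" "h = g \<circ> k" by (auto simp: coset_def)
  then show "inv g \<circ> h \<in> K" using assms by simp
next
  assume "inv g \<circ> h \<in> K"
  then show "h \<in> coset g"
    unfolding coset_def using assms by (intro image_eqI[of _ _ "inv g \<circ> h"]) simp_all
qed

lemma coset_mult: "k \<in> K \<Longrightarrow> coset (g \<circ> k) = coset g"
proof
  assume k: "k \<in> K"
  show "coset (g \<circ> k) \<subseteq> coset g"
    using k by (auto simp: coset_def o_assoc[symmetric])
  show "coset g \<subseteq> coset (g \<circ> k)"
  proof
    fix h assume "h \<in> coset g"
    then obtain l where l: "l \<in> K" "h = g \<circ> l" by (auto simp: coset_def)
    have "h = (g \<circ> k) \<circ> (inv k \<circ> l)"
      using l k by (simp add: o_assoc[symmetric])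
    then show "h \<in> coset (g \<circ> k)" using l k by (auto simp: coset_def)
  qed
qed

lemma coset_eq: "h \<in> coset g \<Longrightarrow> coset h = coset g"
proof -
  assume "h \<in> coset g"
  then obtain k where "k \<in> K" "h = g \<circ> k" by (auto simp: coset_def)
  then show ?thesis by (simp add: coset_mult)
qed

lemma rp_in: "C \<in> cosets \<Longrightarrow> rp C \<in> C"
proof -
  assume "C \<in> cosets"
  then obtain g where "C = coset g" by (auto simp: cosets_eq)
  then have "g \<in> C" by (simp add: self_coset)
  then show ?thesis unfolding rp_def by (rule someI[of "\<lambda>g. g \<in> C"])
qed

lemma coset_sub: "C \<in> cosets \<Longrightarrow> C \<subseteq> G"
  using KG by (auto simp: cosets_eq coset_def)

lemma rp_G: "C \<in> cosets \<Longrightarrow> rp C \<in> G"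
  using rp_in coset_sub by blast

lemma coset_rp: "C \<in> cosets \<Longrightarrow> coset (rp C) = C"
  using rp_in[of C] coset_eq by (auto simp: cosets_eq)

lemma coset_in: "g \<in> G \<Longrightarrow> coset g \<in> cosets"
  by (simp add: cosets_eq)

definition tail :: "('a \<Rightarrow> 'a) \<Rightarrow> 'a \<Rightarrow> 'a" where
  "tail g = inv (rp (coset g)) \<circ> g"

lemma tail: "g \<in> G \<Longrightarrow> tail g \<in> K" "g \<in> G \<Longrightarrow> g = rp (coset g) \<circ> tail g"
proof -
  assume g: "g \<in> G"
  have r: "rp (coset g) \<in> G" using g by (intro rp_G coset_in)
  have "g \<in> coset (rp (coset g))"
    using g by (simp add: coset_rp coset_in self_coset)
  then show "tail g \<in> K" using coset_iff[OF r] by (simp add: tail_def)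
  show "g = rp (coset g) \<circ> tail g" using r by (simp add: tail_def)
qed

abbreviation "I \<equiv> induced_rep G K R"

lemma mem_I: "F \<in> hspace I \<longleftrightarrow> (\<forall>g\<in>G. slice F g \<in> H) \<and> (\<forall>g x. g \<notin> G \<longrightarrow> F (g, x) = 0) \<and>
    (\<forall>g\<in>G. \<forall>k\<in>K. slice F (g \<circ> k) = act R (inv k) (slice F g)) \<and>
    (\<lambda>C. (nrm (slice F (rp C)))\<^sup>2) summable_on cosets"
  by (simp add: induced_rep_def slice_def hnorm_nrm rp_def)

lemma inprod_I: "inprod I F F' = (\<Sum>\<^sub>\<infinity>C\<in>cosets. ip (slice F (rp C)) (slice F' (rp C)))"
  by (simp add: induced_rep_def slice_def rp_def)

lemma slice_act: "slice (act I s F) g = slice F (inv s \<circ> g)"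
  by (simp add: induced_rep_def slice_def)

lemma slice_H: "F \<in> hspace I \<Longrightarrow> g \<in> G \<Longrightarrow> slice F g \<in> H"
  by (simp add: mem_I)

lemma equivariant: "F \<in> hspace I \<Longrightarrow> g \<in> G \<Longrightarrow> k \<in> K \<Longrightarrow> slice F (g \<circ> k) = act R (inv k) (slice F g)"
  by (simp add: mem_I)

lemma ip_coset:
  assumes "F \<in> hspace I" "F' \<in> hspace I" "g \<in> G"
  shows "ip (slice F (rp (coset g))) (slice F' (rp (coset g))) = ip (slice F g) (slice F' g)"
proof -
  let ?r = "rp (coset g)"
  have r: "?r \<in> G" using assms by (intro rp_G coset_in)
  have "ip (slice F (?r \<circ> tail g)) (slice F' (?r \<circ> tail g)) = ip (slice F ?r) (slice F' ?r)"
    using assms r tail(1)[OF assms(3)] by (simp add: equivariant act_ip slice_H)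
  then show ?thesis using tail(2)[OF assms(3)] by simp
qed

text \<open>Restriction to coset representatives identifies the induced space with a direct sum of
  copies of \<open>H\<close> over the cosets, from which completeness is pulled back.\<close>

definition embed :: "(('a \<Rightarrow> 'a) \<times> 'x \<Rightarrow> complex) \<Rightarrow> ('a \<Rightarrow> 'a) set \<times> 'x \<Rightarrow> complex" where
  "embed F = (\<lambda>(C, x). if C \<in> cosets then F (rp C, x) else 0)"

lemma slice_embed: "C \<in> cosets \<Longrightarrow> slice (embed F) C = slice F (rp C)"
  by (simp add: embed_def slice_def)

lemma embed_mem: "F \<in> hspace I \<Longrightarrow> embed F \<in> l2_space cosets H ip"
proof -
  assume F: "F \<in> hspace I"
  have "(\<lambda>C. (nrm (slice F (rp C)))\<^sup>2) summable_on cosets \<longleftrightarrow>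
    (\<lambda>C. Re (ip (slice (embed F) C) (slice (embed F) C))) summable_on cosets"
    using F by (intro summable_on_cong) (simp add: slice_embed nrm_sq slice_H rp_G)
  then show ?thesis
    using F by (auto simp: l2_space_def mem_I slice_embed rp_G) (simp add: embed_def)
qed

lemma embed_ip: "F \<in> hspace I \<Longrightarrow> F' \<in> hspace I \<Longrightarrow> inprod I F F' = l2_ip cosets ip (embed F) (embed F')"
  unfolding inprod_I l2_ip_def by (intro infsum_cong) (simp add: slice_embed)

lemma embed_inverse:
  assumes z: "z \<in> l2_space cosets H ip"
  shows "\<exists>F\<in>hspace I. embed F = z"
proof -
  define F where "F = (\<lambda>(g, x). if g \<in> G then act R (inv (tail g)) (slice z (coset g)) x else 0)"
  have zH: "slice z C \<in> H" if "C \<in> cosets" for C using z that by (auto simp: l2_space_def)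
  have sF: "slice F g = act R (inv (tail g)) (slice z (coset g))" if "g \<in> G" for g
    using that by (simp add: F_def slice_def)
  have FH: "slice F g \<in> H" if "g \<in> G" for g
    using that tail zH coset_in by (simp add: sF)
  have tail_rp: "tail (rp C) = id" if "C \<in> cosets" for C
    using that rp_G by (simp add: tail_def coset_rp)
  have F_rp: "slice F (rp C) = slice z C" if "C \<in> cosets" for C
    using that by (simp add: sF rp_G tail_rp coset_rp inv_id act_id zH)
  have eqv: "slice F (g \<circ> k) = act R (inv k) (slice F g)" if g: "g \<in> G" and k: "k \<in> K" for g k
  proof -
    have gk: "g \<circ> k \<in> G" using g k KG by auto
    have "tail (g \<circ> k) = tail g \<circ> k"
      using k by (simp add: tail_def coset_mult o_assoc)
    then have "slice F (g \<circ> k) = act R (inv (tail g \<circ> k)) (slice z (coset g))"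
      using gk k by (simp add: sF coset_mult)
    also have "inv (tail g \<circ> k) = inv k \<circ> inv (tail g)"
      using tail(1)[OF g] k by (intro inv_distrib)
    also have "act R (inv k \<circ> inv (tail g)) (slice z (coset g)) = act R (inv k) (slice F g)"
      using tail(1)[OF g] k g zH[OF coset_in[OF g]] by (simp add: act_comp sF)
    finally show ?thesis .
  qed
  have "(\<lambda>C. Re (ip (slice z C) (slice z C))) summable_on cosets"
    using z by (simp add: l2_space_def)
  also have "?this \<longleftrightarrow> (\<lambda>C. (nrm (slice F (rp C)))\<^sup>2) summable_on cosets"
    by (intro summable_on_cong) (simp add: F_rp nrm_sq zH)
  finally have "F \<in> hspace I"
    using FH eqv by (auto simp: mem_I F_def)
  moreover have "embed F = z"
  proof
    fix p show "embed F p = z p"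
      using F_rp[of "fst p"] z by (cases p) (auto simp: embed_def l2_space_def slice_def fun_eq_iff)
  qed
  ultimately show ?thesis by blast
qed

lemma summable_act:
  assumes g: "g \<in> G" and F: "\<forall>g\<in>G. slice F g \<in> H" "\<forall>g\<in>G. \<forall>k\<in>K. slice F (g \<circ> k) = act R (inv k) (slice F g)"
  shows "nrm (slice F (rp (coset g))) = nrm (slice F g)"
proof -
  let ?r = "rp (coset g)"
  have r: "?r \<in> G" using g by (intro rp_G coset_in)
  have "nrm (slice F (?r \<circ> tail g)) = nrm (slice F ?r)"
    using F r tail(1)[OF g] act_nrm by simp
  then show ?thesis using tail(2)[OF g] by simp
qed

lemma I_zero: "0 \<in> hspace I"
proof -
  have "act R (inv k) 0 = 0" if "k \<in> K" for k
    using act_smul[of "inv k" 0 0] that by simp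
  then show ?thesis by (simp add: mem_I)
qed

lemma I_hfs: "hfs (hspace I) (inprod I)"
proof -
  interpret L: hfs "l2_space cosets H ip" "l2_ip cosets ip" by (rule l2_hfs)
  have embed_add: "embed (F + F') = embed F + embed F'" for F F'
    by (simp add: embed_def fun_eq_iff)
  have embed_smul: "embed (smul c F) = smul c (embed F)" for F c
    by (simp add: embed_def fun_eq_iff)
  show ?thesis
  proof (rule L.hfs_pullback[where j = embed])
    fix F F' assume F: "F \<in> hspace I" "F' \<in> hspace I"
    have "embed F + embed F' \<in> l2_space cosets H ip" using F embed_mem by auto
    then have "(\<lambda>C. Re (ip (slice (embed (F + F')) C) (slice (embed (F + F')) C))) summable_on cosets"
      by (simp add: embed_add l2_space_def)
    also have "?this \<longleftrightarrow> (\<lambda>C. (nrm (slice (F + F') (rp C)))\<^sup>2) summable_on cosets"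
    proof (rule summable_on_cong)
      fix C assume C: "C \<in> cosets"
      have "slice F (rp C) + slice F' (rp C) \<in> H" using F C by (intro add_mem slice_H rp_G)
      then show "Re (ip (slice (embed (F + F')) C) (slice (embed (F + F')) C)) = (nrm (slice (F + F') (rp C)))\<^sup>2"
        using C by (simp add: slice_embed nrm_sq del: slice_simps) (simp add: nrm_sq)
    qed
    finally show "F + F' \<in> hspace I"
      using F by (auto simp: mem_I act_add)
  next
    fix F c assume F: "F \<in> hspace I"
    have "smul c (embed F) \<in> l2_space cosets H ip" using F embed_mem by auto
    then have "(\<lambda>C. Re (ip (slice (embed (smul c F)) C) (slice (embed (smul c F)) C))) summable_on cosets"
      by (simp add: embed_smul l2_space_def)
    also have "?this \<longleftrightarrow> (\<lambda>C. (nrm (slice (smul c F) (rp C)))\<^sup>2) summable_on cosets"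
    proof (rule summable_on_cong)
      fix C assume C: "C \<in> cosets"
      have "smul c (slice F (rp C)) \<in> H" using F C by (intro smul_mem slice_H rp_G)
      then show "Re (ip (slice (embed (smul c F)) C) (slice (embed (smul c F)) C)) = (nrm (slice (smul c F) (rp C)))\<^sup>2"
        using C by (simp add: slice_embed nrm_sq del: slice_simps) (simp add: nrm_sq)
    qed
    finally show "smul c F \<in> hspace I"
      using F by (auto simp: mem_I act_smul)
  next
    fix F assume F: "F \<in> hspace I" "embed F = 0"
    have "slice F g = 0" if g: "g \<in> G" for g
    proof -
      have "slice F (rp (coset g)) = 0"
        using F(2) g by (simp flip: slice_embed add: coset_in)
      then have "ip (slice F g) (slice F g) = 0"
        using ip_coset[OF F(1) F(1) g] by simp
      then show ?thesis using definite[OF slice_H[OF F(1) g]] by simp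
    qed
    show "F = 0"
    proof
      fix p show "F p = 0 p"
        using F(1) fun_cong[OF \<open>\<And>g. g \<in> G \<Longrightarrow> slice F g = 0\<close>, of "fst p" "snd p"]
        by (cases p; cases "fst p \<in> G") (simp_all add: mem_I slice_def)
    qed
  next
    fix X z assume "z \<in> l2_space cosets H ip"
    then show "\<exists>u\<in>hspace I. embed u = z" by (rule embed_inverse)
  qed (use I_zero embed_mem embed_ip in \<open>simp_all add: embed_add embed_smul\<close>)
qed

lemma coset_translate: "s \<in> G \<Longrightarrow> coset (s \<circ> g) = (\<circ>) s ` coset g"
  by (simp add: coset_def image_image o_assoc)

lemma bij_cosets: "s \<in> G \<Longrightarrow> bij_betw (\<lambda>C. (\<circ>) s ` C) cosets cosets"
proof (rule bij_betw_byWitness[where f' = "\<lambda>C. (\<circ>) (inv s) ` C"])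
  assume s: "s \<in> G"
  have *: "(\<circ>) s ` C \<in> cosets" if "s \<in> G" "C \<in> cosets" for s C
    using that by (auto simp: cosets_eq simp flip: coset_translate)
  show "\<forall>C\<in>cosets. (\<circ>) (inv s) ` (\<circ>) s ` C = C" "\<forall>C\<in>cosets. (\<circ>) s ` (\<circ>) (inv s) ` C = C"
    using s by (simp_all add: image_image)
  show "(\<lambda>C. (\<circ>) s ` C) ` cosets \<subseteq> cosets" "(\<lambda>C. (\<circ>) (inv s) ` C) ` cosets \<subseteq> cosets"
    using * s by auto
qed

lemma act_I_eqv:
  assumes s: "s \<in> G" and F: "F \<in> hspace I"
  shows "\<forall>g\<in>G. slice (act I s F) g \<in> H"
    "\<forall>g\<in>G. \<forall>k\<in>K. slice (act I s F) (g \<circ> k) = act R (inv k) (slice (act I s F) g)"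
proof -
  show "\<forall>g\<in>G. slice (act I s F) g \<in> H"
    using s by (auto simp: slice_act intro!: slice_H[OF F])
  show "\<forall>g\<in>G. \<forall>k\<in>K. slice (act I s F) (g \<circ> k) = act R (inv k) (slice (act I s F) g)"
  proof (intro ballI)
    fix g k assume g: "g \<in> G" and k: "k \<in> K"
    show "slice (act I s F) (g \<circ> k) = act R (inv k) (slice (act I s F) g)"
      unfolding slice_act o_assoc using s g k by (intro equivariant[OF F]) auto
  qed
qed

text \<open>Left translation permutes the cosets, and the norm of a slice depends only on its coset,
  so the square sum is merely rearranged.\<close>

lemma act_I_mem:
  assumes s: "s \<in> G" and F: "F \<in> hspace I"
  shows "act I s F \<in> hspace I"
proof -
  have "(\<lambda>C. (nrm (slice F (rp C)))\<^sup>2) summable_on cosets" using F by (simp add: mem_I)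
  also have "?this \<longleftrightarrow> (\<lambda>C. (nrm (slice F (rp ((\<circ>) (inv s) ` C))))\<^sup>2) summable_on cosets"
    using summable_on_reindex_bij_betw[OF bij_cosets[of "inv s"], of "\<lambda>C. (nrm (slice F (rp C)))\<^sup>2"] s
    by simp
  also have "\<dots> \<longleftrightarrow> (\<lambda>C. (nrm (slice (act I s F) (rp C)))\<^sup>2) summable_on cosets"
  proof (rule summable_on_cong)
    fix C assume C: "C \<in> cosets"
    have "nrm (slice F (rp (coset (inv s \<circ> rp C)))) = nrm (slice F (inv s \<circ> rp C))"
      using F s C rp_G by (intro summable_act) (auto simp: mem_I)
    also have "coset (inv s \<circ> rp C) = (\<circ>) (inv s) ` C"
      using s C by (simp add: coset_translate coset_rp)
    finally show "(nrm (slice F (rp ((\<circ>) (inv s) ` C))))\<^sup>2 = (nrm (slice (act I s F) (rp C)))\<^sup>2"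
      by (simp only: slice_act)
  qed
  finally have summ: "(\<lambda>C. (nrm (slice (act I s F) (rp C)))\<^sup>2) summable_on cosets" .
  have out: "act I s F (g, x) = 0" if "g \<notin> G" for g x
  proof -
    have "inv s \<circ> g \<notin> G"
    proof
      assume "inv s \<circ> g \<in> G"
      then have "s \<circ> (inv s \<circ> g) \<in> G" by (rule G.comp_mem[OF s])
      then show False using that s by simp
    qed
    then show ?thesis using F by (simp add: mem_I induced_rep_def)
  qed
  show ?thesis
    unfolding mem_I using act_I_eqv[OF s F] summ out by auto
qed

lemma act_I_ip:
  assumes s: "s \<in> G" and F: "F \<in> hspace I" "F' \<in> hspace I"
  shows "inprod I (act I s F) (act I s F') = inprod I F F'"
proof -
  have "inprod I F F' = (\<Sum>\<^sub>\<infinity>C\<in>cosets. ip (slice F (rp ((\<circ>) (inv s) ` C))) (slice F' (rp ((\<circ>) (inv s) ` C))))"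
    unfolding inprod_I
    using infsum_reindex_bij_betw[OF bij_cosets[of "inv s"], of "\<lambda>C. ip (slice F (rp C)) (slice F' (rp C))"] s
    by simp
  also have "\<dots> = inprod I (act I s F) (act I s F')"
    unfolding inprod_I
  proof (rule infsum_cong)
    fix C assume C: "C \<in> cosets"
    have "ip (slice F (rp (coset (inv s \<circ> rp C)))) (slice F' (rp (coset (inv s \<circ> rp C))))
      = ip (slice F (inv s \<circ> rp C)) (slice F' (inv s \<circ> rp C))"
      using F s C rp_G by (intro ip_coset) auto
    also have "coset (inv s \<circ> rp C) = (\<circ>) (inv s) ` C"
      using s C by (simp add: coset_translate coset_rp)
    finally show "ip (slice F (rp ((\<circ>) (inv s) ` C))) (slice F' (rp ((\<circ>) (inv s) ` C)))
      = ip (slice (act I s F) (rp C)) (slice (act I s F') (rp C))"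
      by (simp only: slice_act)
  qed
  finally show ?thesis by simp
qed

sublocale U: unitary_rep G I
proof (intro unitary_rep.intro unitary_rep_axioms.intro I_hfs G.perm_group_axioms act_I_mem act_I_ip)
  fix g h F assume "g \<in> G" "h \<in> G"
  then show "act I (g \<circ> h) F = act I g (act I h F)"
    by (simp add: induced_rep_def G.inv_distrib o_assoc fun_eq_iff)
next
  fix F show "act I id F = F" by (simp add: induced_rep_def fun_eq_iff inv_id)
qed (simp_all add: induced_rep_def fun_eq_iff)

lemma slice_nrm_le:
  assumes F: "F \<in> hspace I" and g: "g \<in> G"
  shows "nrm (slice F g) \<le> U.nrm F"
proof -
  have "Re (ip (slice (embed F) (coset g)) (slice (embed F) (coset g))) \<le> Re (l2_ip cosets ip (embed F) (embed F))"
    using F g by (intro l2_slice_le embed_mem coset_in)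
  then have "Re (ip (slice F g) (slice F g)) \<le> Re (inprod I F F)"
    using F g by (simp add: embed_ip slice_embed coset_in ip_coset)
  then show ?thesis by (simp add: nrm_def U.nrm_def)
qed

text \<open>The section supported on the identity coset with value \<open>v\<close> at the identity;
  equivariance dictates the other values on \<open>K\<close>.\<close>

definition ind_vec :: "('x \<Rightarrow> complex) \<Rightarrow> ('a \<Rightarrow> 'a) \<times> 'x \<Rightarrow> complex" where
  "ind_vec v = (\<lambda>(g, x). if g \<in> K then act R (inv g) v x else 0)"

lemma slice_ind_vec: "slice (ind_vec v) g = (if g \<in> K then act R (inv g) v else 0)"
  by (auto simp: slice_def ind_vec_def fun_eq_iff)

lemma mult_K: "k \<in> K \<Longrightarrow> g \<circ> k \<in> K \<longleftrightarrow> g \<in> K"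
proof
  assume k: "k \<in> K" and "g \<circ> k \<in> K"
  then have "(g \<circ> k) \<circ> inv k \<in> K" by auto
  then show "g \<in> K" using k by (simp add: o_assoc[symmetric])
qed auto

lemma coset_id: "coset id = K"
  by (simp add: coset_def)

lemma ind_vec_mem:
  assumes v: "v \<in> H"
  shows "ind_vec v \<in> hspace I"
proof -
  have z: "act R (inv k) 0 = 0" if "k \<in> K" for k
    using act_smul[of "inv k" 0 0] that by simp
  have "(\<lambda>C. (nrm (slice (ind_vec v) (rp C)))\<^sup>2) summable_on {K}" by simp
  also have "?this \<longleftrightarrow> (\<lambda>C. (nrm (slice (ind_vec v) (rp C)))\<^sup>2) summable_on cosets"
  proof (rule summable_on_cong_neutral)
    fix C assume "C \<in> cosets - {K}"
    moreover from this have "coset (rp C) = C" by (intro coset_rp) auto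
    ultimately have "rp C \<notin> K"
      using coset_eq[of "rp C" id] coset_id by auto
    then show "(nrm (slice (ind_vec v) (rp C)))\<^sup>2 = 0" by (simp add: slice_ind_vec)
  next
    fix C assume "C \<in> {K} - cosets"
    then show "(nrm (slice (ind_vec v) (rp C)))\<^sup>2 = 0"
      using coset_in[of id] coset_id by auto
  qed simp
  finally have summ: "(\<lambda>C. (nrm (slice (ind_vec v) (rp C)))\<^sup>2) summable_on cosets" .
  show ?thesis
    unfolding mem_I
  proof (intro conjI summ ballI allI impI)
    fix g k assume g: "g \<in> G" and k: "k \<in> K"
    show "slice (ind_vec v) (g \<circ> k) = act R (inv k) (slice (ind_vec v) g)"
      using k v by (auto simp: slice_ind_vec mult_K z inv_distrib act_comp)
  next
    fix g assume "g \<in> G"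
    then show "slice (ind_vec v) g \<in> H" using v by (auto simp: slice_ind_vec)
  next
    fix g x assume "g \<notin> G"
    then show "ind_vec v (g, x) = 0" using KG by (auto simp: ind_vec_def)
  qed
qed

text \<open>Elements outside \<open>K\<close> move the section to another coset, where it is
  orthogonal to the original one. This orthogonality is what \<open>star_deviation\<close> rests
  on.\<close>

lemma ind_vec_ip:
  assumes v: "v \<in> H" and s: "s \<in> G"
  shows "inprod I (act I s (ind_vec v)) (ind_vec v) = (if s \<in> K then ip (act R s v) v else 0)"
proof -
  have m: "ind_vec v \<in> hspace I" "act I s (ind_vec v) \<in> hspace I"
    using v s by (auto intro!: ind_vec_mem act_I_mem)
  have inv_K: "inv s \<in> K \<longleftrightarrow> s \<in> K"
    using s inv_mem by (metis G.inv_inv)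
  have "inprod I (act I s (ind_vec v)) (ind_vec v)
    = (\<Sum>\<^sub>\<infinity>C\<in>{K}. ip (slice (act I s (ind_vec v)) (rp C)) (slice (ind_vec v) (rp C)))"
    unfolding inprod_I
  proof (rule infsum_cong_neutral)
    fix C assume C: "C \<in> cosets - {K}"
    moreover from this have "coset (rp C) = C" by (intro coset_rp) auto
    ultimately have "rp C \<notin> K"
      using coset_eq[of "rp C" id] coset_id by auto
    then show "ip (slice (act I s (ind_vec v)) (rp C)) (slice (ind_vec v) (rp C)) = 0"
      using C m(2) by (simp add: slice_ind_vec slice_H rp_G)
  qed (use coset_in[of id] coset_id in auto)
  also have "\<dots> = ip (slice (act I s (ind_vec v)) (rp (coset id))) (slice (ind_vec v) (rp (coset id)))"
    by (simp add: coset_id)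
  also have "\<dots> = ip (slice (act I s (ind_vec v)) id) (slice (ind_vec v) id)"
    using m by (intro ip_coset) auto
  also have "\<dots> = (if s \<in> K then ip (act R s v) v else 0)"
    using v inv_K by (simp add: slice_act slice_ind_vec inv_id act_id)
  finally show ?thesis .
qed

lemma act_ind_vec:
  assumes v: "v \<in> H" and s: "s \<in> K"
  shows "act I s (ind_vec v) = ind_vec (act R s v)"
proof -
  have "inv s \<circ> g \<in> K \<longleftrightarrow> g \<in> K" for g
  proof
    assume "inv s \<circ> g \<in> K"
    then have "s \<circ> (inv s \<circ> g) \<in> K" by (rule comp_mem[OF s])
    then show "g \<in> K" using s by simp
  qed (use s in auto)
  then have "slice (act I s (ind_vec v)) g = slice (ind_vec (act R s v)) g" for g
    using s v by (auto simp: slice_act slice_ind_vec inv_distrib act_comp)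
  then show ?thesis by (auto simp: slice_def fun_eq_iff)
qed

end

declare One_nat_def [simp del]

section \<open>Outer tensor products with a Young representation\<close>

text \<open>The functions \<open>E x\<close> are the images of the unit vectors under a projection
  onto \<open>T\<close>, built by elimination, one point at a time. The coefficients are plain
  values of \<open>f\<close>, so the formula passes to pointwise limits and to slices of
  tensors.\<close>

lemma finite_function_space_basis:
  fixes T :: "('x \<Rightarrow> complex) set"
  assumes "finite A"
    and "0 \<in> T" "\<And>f h. f \<in> T \<Longrightarrow> h \<in> T \<Longrightarrow> f + h \<in> T" "\<And>c f. f \<in> T \<Longrightarrow> smul c f \<in> T"
    and "\<And>f x. f \<in> T \<Longrightarrow> x \<notin> A \<Longrightarrow> f x = 0"
  shows "\<exists>E. (\<forall>x\<in>A. E x \<in> T) \<and> (\<forall>f\<in>T. f = (\<Sum>x\<in>A. smul (f x) (E x)))"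
  using assms
proof (induction A arbitrary: T rule: finite_induct)
  case empty
  then show ?case by (auto simp: fun_eq_iff)
next
  case (insert a A)
  note T = insert.prems
  have Tsum: "(\<Sum>x\<in>X. f x) \<in> T" if "\<And>x. x \<in> X \<Longrightarrow> f x \<in> T" for f :: "'x \<Rightarrow> 'x \<Rightarrow> complex" and X
    using that T by (induction X rule: infinite_finite_induct) auto
  have Tdiff: "f - h \<in> T" if "f \<in> T" "h \<in> T" for f h
  proof -
    have "f - h = f + smul (-1) h" by (simp add: fun_eq_iff)
    show ?thesis
      unfolding \<open>f - h = f + smul (-1) h\<close> by (rule T(2)[OF that(1) T(3)[OF that(2)]])
  qed
  define T0 where "T0 = {f \<in> T. f a = 0}"
  have "\<exists>E. (\<forall>x\<in>A. E x \<in> T0) \<and> (\<forall>f\<in>T0. f = (\<Sum>x\<in>A. smul (f x) (E x)))"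
  proof (rule insert.IH)
    fix f x assume "f \<in> T0" "x \<notin> A"
    then show "f x = 0" using T(4)[of f x] by (cases "x = a") (auto simp: T0_def)
  qed (use T(1-3) in \<open>auto simp: T0_def\<close>)
  then obtain E0 where E0: "\<And>x. x \<in> A \<Longrightarrow> E0 x \<in> T0" "\<And>f. f \<in> T0 \<Longrightarrow> f = (\<Sum>x\<in>A. smul (f x) (E0 x))"
    by blast
  \<comment> \<open>A pivot at \<open>a\<close>: an element with value 1 there, or 0 when all of
    \<open>T\<close> vanishes at \<open>a\<close>.\<close>
  obtain e where e: "e \<in> T" "\<And>f. f \<in> T \<Longrightarrow> f - smul (f a) e \<in> T0"
  proof (cases "\<exists>e\<in>T. e a \<noteq> 0")
    case True
    then obtain e where e: "e \<in> T" "e a \<noteq> 0" by blast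
    have "smul (1 / e a) e \<in> T" by (rule T(3)[OF e(1)])
    moreover have "f - smul (f a) (smul (1 / e a) e) \<in> T0" if "f \<in> T" for f
      unfolding T0_def mem_Collect_eq
    proof
      show "f - smul (f a) (smul (1 / e a) e) \<in> T"
        by (intro Tdiff that T(3) e(1))
      show "(f - smul (f a) (smul (1 / e a) e)) a = 0" using e(2) by simp
    qed
    ultimately show ?thesis using that by blast
  next
    case False
    then show ?thesis using that[of 0] T by (auto simp: T0_def)
  qed
  \<comment> \<open>Expanding \<open>f - smul (f a) e\<close> in \<open>E0\<close> also subtracts
    the expansion of \<open>smul (f a) e\<close>; the correction of \<open>e\<close> absorbs these
    terms.\<close>
  define E where "E x = (if x = a then e - (\<Sum>y\<in>A. smul (e y) (E0 y)) else E0 x)" for x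
  have EA: "(\<Sum>x\<in>A. smul (h x) (E x)) = (\<Sum>x\<in>A. smul (h x) (E0 x))" for h
    using insert.hyps by (intro sum.cong) (auto simp: E_def)
  have "f = (\<Sum>x\<in>insert a A. smul (f x) (E x))" if f: "f \<in> T" for f
  proof
    fix z
    have "(f - smul (f a) e) z = (\<Sum>x\<in>A. (f - smul (f a) e) x * E0 x z)"
      using fun_cong[OF E0(2)[OF e(2)[OF f]], of z] by (simp add: sum_fun_apply)
    also have "\<dots> = (\<Sum>x\<in>A. f x * E0 x z) - f a * (\<Sum>x\<in>A. e x * E0 x z)"
      by (simp add: algebra_simps sum_subtractf sum_distrib_left)
    finally have "f z = f a * (e z - (\<Sum>x\<in>A. e x * E0 x z)) + (\<Sum>x\<in>A. f x * E0 x z)"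
      by (simp add: algebra_simps)
    also have "\<dots> = (smul (f a) (E a) + (\<Sum>x\<in>A. smul (f x) (E0 x))) z"
      by (simp add: E_def sum_fun_apply)
    also have "smul (f a) (E a) + (\<Sum>x\<in>A. smul (f x) (E0 x)) = (\<Sum>x\<in>insert a A. smul (f x) (E x))"
      unfolding sum.insert[OF insert.hyps] EA ..
    finally show "f z = (\<Sum>x\<in>insert a A. smul (f x) (E x)) z" .
  qed
  moreover have "E x \<in> T" if "x \<in> insert a A" for x
  proof -
    have E0T: "E0 y \<in> T" if "y \<in> A" for y using E0(1)[OF that] by (simp add: T0_def)
    have "e - (\<Sum>y\<in>A. smul (e y) (E0 y)) \<in> T"
      by (intro Tdiff e(1) Tsum T(3) E0T)
    then show ?thesis using that E0T by (auto simp: E_def)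
  qed
  ultimately show ?case by blast
qed

lemma Sfin_eq: "Sfin n = {p. p permutes {1..n}}"
proof -
  have "finite {i. p i \<noteq> i}" if "p permutes {1..n}" for p
    by (rule finite_subset[of _ "{1..n}"]) (use that permutes_not_in in force)+
  then show ?thesis by (auto simp: finsym_def)
qed

lemma finite_Sfin: "finite (Sfin n)"
  by (simp add: Sfin_eq finite_permutations)

interpretation fs: perm_group "finsym X" for X
  by (rule finsym_perm_group)

lemma finsym_mono: "X \<subseteq> Y \<Longrightarrow> finsym X \<subseteq> finsym Y"
  by (auto simp: finsym_def intro: permutes_subset)

lemma young_symmetrizer_out: "s \<notin> Sfin (sum_list la) \<Longrightarrow> young_symmetrizer la s = 0"
proof -
  assume s: "s \<notin> Sfin (sum_list la)"
  have "s \<noteq> p \<circ> q" if "p \<in> row_group la" "q \<in> column_group la" for p q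
    using that s fs.comp_mem[of p "{1..sum_list la}" q] by (auto simp: row_group_def column_group_def)
  then show ?thesis
    unfolding young_symmetrizer_def by (intro sum.neutral) auto
qed

abbreviation ideal :: "nat list \<Rightarrow> ((nat \<Rightarrow> nat) \<Rightarrow> complex) set" where
  "ideal la \<equiv> hspace (young_rep la)"

lemma ideal_eq: "ideal la = {convolution (sum_list la) f (young_symmetrizer la) | f. f \<in> group_algebra (Sfin (sum_list la))}"
  by (simp add: young_rep_def Let_def)

lemma fun_group_algebra_Sfin: "f \<in> group_algebra (Sfin n) \<longleftrightarrow> (\<forall>s. s \<notin> Sfin n \<longrightarrow> f s = 0)"
  unfolding group_algebra_def using finite_Sfin[of n] by (auto intro: finite_subset)

lemma ideal_zero: "0 \<in> ideal la"
  unfolding ideal_eq mem_Collect_eq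
  by (intro exI[of _ 0]) (simp add: convolution_def fun_eq_iff fun_group_algebra_Sfin)

lemma ideal_add: "u \<in> ideal la \<Longrightarrow> v \<in> ideal la \<Longrightarrow> u + v \<in> ideal la"
proof -
  assume "u \<in> ideal la" "v \<in> ideal la"
  then obtain f h where f: "u = convolution (sum_list la) f (young_symmetrizer la)" "f \<in> group_algebra (Sfin (sum_list la))"
    "v = convolution (sum_list la) h (young_symmetrizer la)" "h \<in> group_algebra (Sfin (sum_list la))"
    unfolding ideal_eq by auto
  have "u + v = convolution (sum_list la) (f + h) (young_symmetrizer la)"
    by (simp add: f convolution_def fun_eq_iff distrib_right sum.distrib)
  moreover have "f + h \<in> group_algebra (Sfin (sum_list la))"
    using f by (simp add: fun_group_algebra_Sfin)
  ultimately show ?thesis unfolding ideal_eq by blast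
qed

lemma ideal_smul: "u \<in> ideal la \<Longrightarrow> smul c u \<in> ideal la"
proof -
  assume "u \<in> ideal la"
  then obtain f where f: "u = convolution (sum_list la) f (young_symmetrizer la)" "f \<in> group_algebra (Sfin (sum_list la))"
    unfolding ideal_eq by auto
  have "smul c u = convolution (sum_list la) (smul c f) (young_symmetrizer la)"
    by (simp add: f convolution_def fun_eq_iff sum_distrib_left mult.assoc)
  moreover have "smul c f \<in> group_algebra (Sfin (sum_list la))"
    using f by (simp add: fun_group_algebra_Sfin)
  ultimately show ?thesis unfolding ideal_eq by blast
qed

lemma ideal_out:
  assumes u: "u \<in> ideal la" and t: "t \<notin> Sfin (sum_list la)"
  shows "u t = 0"
proof -
  obtain f where f: "u = convolution (sum_list la) f (young_symmetrizer la)"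
    using u unfolding ideal_eq by auto
  have "young_symmetrizer la (inv s \<circ> t) = 0" if s: "s \<in> Sfin (sum_list la)" for s
  proof (rule young_symmetrizer_out, rule notI)
    assume "inv s \<circ> t \<in> Sfin (sum_list la)"
    then have "s \<circ> (inv s \<circ> t) \<in> Sfin (sum_list la)" by (rule fs.comp_mem[OF s])
    then show False using t s by simp
  qed
  then show ?thesis
    unfolding f convolution_def by (intro sum.neutral) simp
qed

lemma ideal_translate:
  assumes u: "u \<in> ideal la" and r: "r \<in> Sfin (sum_list la)"
  shows "(\<lambda>t. u (r \<circ> t)) \<in> ideal la"
proof -
  let ?n = "sum_list la"
  obtain f where f: "u = convolution ?n f (young_symmetrizer la)" "f \<in> group_algebra (Sfin ?n)"
    using u unfolding ideal_eq by auto
  define h where "h s = f (r \<circ> s)" for s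
  have bij: "bij_betw ((\<circ>) r) (Sfin ?n) (Sfin ?n)"
    by (rule bij_betw_byWitness[where f' = "(\<circ>) (inv r)"]) (use r in auto)
  have "u (r \<circ> t) = convolution ?n h (young_symmetrizer la) t" for t
  proof -
    have "u (r \<circ> t) = (\<Sum>s\<in>Sfin ?n. f (r \<circ> s) * young_symmetrizer la (inv (r \<circ> s) \<circ> (r \<circ> t)))"
      unfolding f convolution_def by (rule sum.reindex_bij_betw[OF bij, symmetric])
    also have "\<dots> = (\<Sum>s\<in>Sfin ?n. h s * young_symmetrizer la (inv s \<circ> t))"
    proof (intro sum.cong refl)
      fix s assume s: "s \<in> Sfin ?n"
      have "inv (r \<circ> s) \<circ> (r \<circ> t) = inv s \<circ> t"
        unfolding fs.inv_distrib[OF r s] o_assoc[symmetric] fs.inv_comp_assoc(1)[OF r] ..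
      then show "f (r \<circ> s) * young_symmetrizer la (inv (r \<circ> s) \<circ> (r \<circ> t)) = h s * young_symmetrizer la (inv s \<circ> t)"
        by (simp only: h_def)
    qed
    finally show ?thesis by (simp add: convolution_def)
  qed
  moreover have "h \<in> group_algebra (Sfin ?n)"
    unfolding fun_group_algebra_Sfin
  proof (intro allI impI)
    fix s assume s: "s \<notin> Sfin ?n"
    have "r \<circ> s \<notin> Sfin ?n"
    proof
      assume "r \<circ> s \<in> Sfin ?n"
      then have "inv r \<circ> (r \<circ> s) \<in> Sfin ?n" by (rule fs.comp_mem[OF fs.inv_mem[OF r]])
      then show False using s r by simp
    qed
    then show "h s = 0" using f(2) by (simp add: h_def fun_group_algebra_Sfin)
  qed
  ultimately show ?thesis unfolding ideal_eq by (auto simp: fun_eq_iff)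
qed

lemma symmetrizer_ideal: "young_symmetrizer la \<in> ideal la"
proof -
  have "young_symmetrizer la t = convolution (sum_list la) (\<lambda>s. if s = id then 1 else 0) (young_symmetrizer la) t" for t
  proof -
    have "convolution (sum_list la) (\<lambda>s. if s = id then 1 else 0) (young_symmetrizer la) t
      = (\<Sum>s\<in>Sfin (sum_list la). if s = id then young_symmetrizer la t else 0)"
      unfolding convolution_def by (intro sum.cong) (auto simp: inv_id)
    then show ?thesis using finite_Sfin by (simp add: sum.delta)
  qed
  then show ?thesis
    unfolding ideal_eq mem_Collect_eq
  proof (intro exI[of _ "\<lambda>s. if s = id then 1 else 0"] conjI)
    show "young_symmetrizer la = convolution (sum_list la) (\<lambda>s. if s = id then 1 else 0) (young_symmetrizer la)"
      by (rule ext) fact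
    show "(\<lambda>s. if s = id then 1 else 0) \<in> group_algebra (Sfin (sum_list la))"
      unfolding fun_group_algebra_Sfin using fs.id_mem by auto
  qed
qed

subsection \<open>The Young subgroup\<close>

text \<open>A finite permutation mapping \<open>{1..n}\<close> into itself permutes it by counting,
  hence also preserves the complement and splits. Membership can thus be refuted at a single
  point.\<close>

lemma young_subgroup_iff:
  "k \<in> young_subgroup n \<longleftrightarrow> k \<in> SN \<and> k ` {1..n} \<subseteq> {1..n}"
proof
  assume "k \<in> young_subgroup n"
  then obtain s t where st: "s \<in> Sfin n" "t \<in> Scofin n" "k = s \<circ> t"
    by (auto simp: young_subgroup_def)
  have "{n<..} \<subseteq> {1..}" by auto
  then have "s \<in> SN" "t \<in> SN"
    using st finsym_mono[of "{1..n}" "{1..}"] finsym_mono[of "{n<..}" "{1..}"] by auto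
  then have "k \<in> SN" using st by simp
  moreover have "k i \<in> {1..n}" if "i \<in> {1..n}" for i
  proof -
    have "t i = i" using st that by (intro permutes_not_in[of t "{n<..}"]) (auto simp: finsym_def)
    then show ?thesis using st that permutes_in_image[of s "{1..n}" i] by (simp add: Sfin_eq)
  qed
  ultimately show "k \<in> SN \<and> k ` {1..n} \<subseteq> {1..n}" by blast
next
  assume k: "k \<in> SN \<and> k ` {1..n} \<subseteq> {1..n}"
  then have kp: "k permutes {1..}" and fin: "finite {i. k i \<noteq> i}" by (auto simp: finsym_def)
  have inj: "inj k" using kp by (rule permutes_inj)
  have img: "k ` {1..n} = {1..n}"
    using k inj by (intro card_subset_eq) (auto simp: card_image inj_on_subset)
  have out: "k i \<in> {n<..} \<longleftrightarrow> i \<in> {n<..}" for i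
  proof -
    have "k i \<in> {1..n} \<longleftrightarrow> i \<in> {1..n}" using img inj by (metis image_iff injD)
    moreover have "k i \<in> {1..} \<longleftrightarrow> i \<in> {1..}" using kp by (rule permutes_in_image)
    ultimately show ?thesis by auto
  qed
  define s where "s = perm_part {1..n} k"
  define t where "t = perm_part {n<..} k"
  have bij1: "bij_betw k {1..n} {1..n}"
    using img inj by (simp add: bij_betw_def inj_on_subset[OF inj])
  have "bij_betw s {1..n} {1..n}"
    using bij_betw_cong[of "{1..n}" s k "{1..n}"] bij1 by (simp add: s_def perm_part_def)
  then have s: "s permutes {1..n}"
    by (rule bij_imp_permutes) (auto simp: s_def perm_part_def)
  have img2: "k ` {n<..} = {n<..}"
  proof
    show "k ` {n<..} \<subseteq> {n<..}" using out by auto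
    show "{n<..} \<subseteq> k ` {n<..}"
    proof
      fix j assume j: "j \<in> {n<..}"
      obtain i where "j = k i" using permutes_surj[OF kp] by (metis surjD)
      then show "j \<in> k ` {n<..}" using out[of i] j by blast
    qed
  qed
  have "bij_betw k {n<..} {n<..}"
    using img2 inj by (simp add: bij_betw_def inj_on_subset[OF inj])
  then have "bij_betw t {n<..} {n<..}"
    using bij_betw_cong[of "{n<..}" t k "{n<..}"] by (simp add: t_def perm_part_def)
  then have t: "t permutes {n<..}"
    by (rule bij_imp_permutes) (simp add: t_def perm_part_def)
  have "{i. t i \<noteq> i} \<subseteq> {i. k i \<noteq> i}" by (auto simp: t_def perm_part_def)
  then have "t \<in> Scofin n" using t fin by (auto simp: finsym_def intro: finite_subset)
  moreover have "s \<in> Sfin n" using s by (simp add: Sfin_eq)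
  moreover have "k = s \<circ> t"
  proof
    fix i
    \<comment> \<open>The point 0 lies in neither \<open>{1..n}\<close> nor \<open>{n<..}\<close>,
      so both factors fix it; \<open>k\<close> fixes it as a permutation of
      \<open>{1..}\<close>.\<close>
    have "k 0 = 0" using kp by (intro permutes_not_in[of k "{1..}"]) auto
    then show "k i = (s \<circ> t) i"
      using out[of i] by (cases "i = 0"; cases "i \<le> n") (auto simp: s_def t_def perm_part_def)
  qed
  ultimately show "k \<in> young_subgroup n" by (auto simp: young_subgroup_def)
qed

lemma young_perm_group: "perm_group (young_subgroup n)"
proof
  show "id \<in> young_subgroup n" by (simp add: young_subgroup_iff)
next
  fix g h assume "g \<in> young_subgroup n" "h \<in> young_subgroup n"
  then show "g \<circ> h \<in> young_subgroup n" by (auto simp: young_subgroup_iff)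
next
  fix g assume g: "g \<in> young_subgroup n"
  then have gS: "g \<in> SN" by (simp add: young_subgroup_iff)
  then show b: "bij g" by (rule fs.bij_mem)
  have "card (g ` {1..n}) = card {1..n}"
    by (intro card_image inj_on_subset[OF bij_is_inj[OF b]]) simp
  then have "g ` {1..n} = {1..n}"
    using g by (intro card_subset_eq) (auto simp: young_subgroup_iff)
  then have "inv g ` {1..n} \<subseteq> {1..n}"
    using b by (metis bij_is_inj image_inv_f_f order_refl)
  then show "inv g \<in> young_subgroup n" using gS by (simp add: young_subgroup_iff)
qed

lemma perm_part_Sfin: "k \<in> young_subgroup n \<Longrightarrow> perm_part {1..n} k \<in> Sfin n"
  and perm_part_Scofin: "k \<in> young_subgroup n \<Longrightarrow> perm_part {n<..} k \<in> Scofin n"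
proof -
  assume k: "k \<in> young_subgroup n"
  then obtain s t where st: "s \<in> Sfin n" "t \<in> Scofin n" "k = s \<circ> t"
    by (auto simp: young_subgroup_def)
  have s: "s permutes {1..n}" and t: "t permutes {n<..}" using st by (auto simp: finsym_def)
  have "perm_part {1..n} k = s"
  proof
    fix i show "perm_part {1..n} k i = s i"
      using permutes_not_in[OF t, of i] permutes_not_in[OF s, of i] by (auto simp: perm_part_def st)
  qed
  moreover have "perm_part {n<..} k = t"
  proof
    fix i show "perm_part {n<..} k i = t i"
      using permutes_not_in[OF t, of i] permutes_not_in[OF s, of "t i"] permutes_in_image[OF t, of i]
      by (auto simp: perm_part_def st)
  qed
  ultimately show "perm_part {1..n} k \<in> Sfin n" "perm_part {n<..} k \<in> Scofin n" using st by auto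
qed

lemma perm_part_comp:
  assumes "k \<in> young_subgroup n" "l \<in> young_subgroup n"
  shows "perm_part {1..n} (k \<circ> l) = perm_part {1..n} k \<circ> perm_part {1..n} l"
    "perm_part {n<..} (k \<circ> l) = perm_part {n<..} k \<circ> perm_part {n<..} l"
proof -
  have "l i \<in> {1..n}" if "i \<in> {1..n}" for i using assms(2) that unfolding young_subgroup_iff by blast
  then show "perm_part {1..n} (k \<circ> l) = perm_part {1..n} k \<circ> perm_part {1..n} l"
    by (fastforce simp: perm_part_def fun_eq_iff)
  have p: "perm_part {n<..} l permutes {n<..}"
    using perm_part_Scofin[OF assms(2)] by (simp add: finsym_def)
  have "l i \<in> {n<..}" if "i \<in> {n<..}" for i
    using permutes_in_image[OF p, of i] that by (simp add: perm_part_def)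
  then show "perm_part {n<..} (k \<circ> l) = perm_part {n<..} k \<circ> perm_part {n<..} l"
    by (fastforce simp: perm_part_def fun_eq_iff)
qed

lemma Sfin_young: "s \<in> Sfin n \<Longrightarrow> s \<in> young_subgroup n"
  and Scofin_young: "s \<in> Scofin n \<Longrightarrow> s \<in> young_subgroup n"
  unfolding young_subgroup_def using fs.id_mem by (force intro: exI[of _ id])+

lemma perm_part_of_Sfin:
  assumes "s \<in> Sfin n" shows "perm_part {1..n} s = s" "perm_part {n<..} s = id"
  using assms permutes_not_in[of s "{1..n}"] by (auto simp: finsym_def perm_part_def fun_eq_iff)

lemma perm_part_of_Scofin:
  assumes "s \<in> Scofin n" shows "perm_part {1..n} s = id" "perm_part {n<..} s = s"
  using assms permutes_not_in[of s "{n<..}"] by (auto simp: finsym_def perm_part_def fun_eq_iff)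

locale tensor_data = gns_data "Scofin n" \<phi> for n and \<phi> :: "(nat \<Rightarrow> nat) \<Rightarrow> complex" +
  fixes la :: "nat list"
  assumes n_def: "n = sum_list la"
begin

abbreviation "GNS \<equiv> gns_rep (Scofin n) \<phi>"

abbreviation "TR \<equiv> tensor_rep (Sfin n) (perm_part {1..n}) (young_rep la) (perm_part {n<..}) GNS"

lemma ideal_vanish: "u \<in> ideal la \<Longrightarrow> t \<notin> Sfin n \<Longrightarrow> u t = 0"
  using ideal_out n_def by blast

lemma ideal_basis: "\<exists>E. (\<forall>x\<in>Sfin n. E x \<in> ideal la) \<and> (\<forall>f\<in>ideal la. f = (\<Sum>x\<in>Sfin n. smul (f x) (E x)))"
proof (rule finite_function_space_basis)
  fix f h assume "f \<in> ideal la" "h \<in> ideal la"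
  then show "f + h \<in> ideal la" by (rule ideal_add)
next
  fix f c assume "f \<in> ideal la"
  then show "smul c f \<in> ideal la" by (rule ideal_smul)
next
  fix f x assume "f \<in> ideal la" "x \<notin> Sfin n"
  then show "f x = 0" by (rule ideal_vanish)
qed (rule finite_Sfin ideal_zero)+

lemma ideal_sum: "(\<And>i. i \<in> I \<Longrightarrow> f i \<in> ideal la) \<Longrightarrow> (\<Sum>i\<in>I. f i) \<in> ideal la"
  by (induction I rule: infinite_finite_induct) (auto simp: ideal_zero ideal_add)

text \<open>Expanding in the first variable with the functions \<open>E x\<close>, whose
  coefficients are the slices of \<open>u\<close>, replaces the unspecified pure tensors by two
  conditions on slices.\<close>

lemma mem_TR: "u \<in> hspace TR \<longleftrightarrow> (\<forall>x. slice u x \<in> hspace GNS) \<and> (\<forall>y. (\<lambda>x. u (x, y)) \<in> ideal la)"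
proof
  assume "u \<in> hspace TR"
  then obtain k :: nat and f h where u: "u = (\<lambda>(x, y). \<Sum>i<k. f i x * h i y)"
    and fh: "\<forall>i<k. f i \<in> ideal la \<and> h i \<in> hspace GNS"
    by (auto simp: tensor_rep_def)
  have "slice u x = (\<Sum>i<k. smul (f i x) (h i))" for x
    by (simp add: u slice_def fun_eq_iff sum_fun_apply)
  then have "slice u x \<in> hspace GNS" for x
    using fh by (auto intro!: U.sum_mem)
  moreover have "(\<lambda>x. u (x, y)) = (\<Sum>i<k. smul (h i y) (f i))" for y
    by (simp add: u fun_eq_iff sum_fun_apply mult.commute)
  then have "(\<lambda>x. u (x, y)) \<in> ideal la" for y
    using fh by (auto intro!: ideal_sum ideal_smul)
  ultimately show "(\<forall>x. slice u x \<in> hspace GNS) \<and> (\<forall>y. (\<lambda>x. u (x, y)) \<in> ideal la)" by blast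
next
  assume u: "(\<forall>x. slice u x \<in> hspace GNS) \<and> (\<forall>y. (\<lambda>x. u (x, y)) \<in> ideal la)"
  obtain E where E: "\<And>x. x \<in> Sfin n \<Longrightarrow> E x \<in> ideal la"
    "\<And>f. f \<in> ideal la \<Longrightarrow> f = (\<Sum>x\<in>Sfin n. smul (f x) (E x))"
    using ideal_basis by blast
  define k where "k = card (Sfin n)"
  obtain b where b: "bij_betw b {..<k} (Sfin n)"
    using ex_bij_betw_nat_finite[OF finite_Sfin, of n] by (auto simp: k_def atLeast0LessThan)
  have "u (x, y) = (\<Sum>i<k. E (b i) x * slice u (b i) y)" for x y
  proof -
    have "u (x, y) = (\<Sum>x'\<in>Sfin n. u (x', y) * E x' x)"
      using fun_cong[OF E(2)[of "\<lambda>x. u (x, y)"], of x] u by (simp add: sum_fun_apply)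
    also have "\<dots> = (\<Sum>i<k. u (b i, y) * E (b i) x)"
      by (rule sum.reindex_bij_betw[OF b, symmetric])
    finally show ?thesis by (simp add: slice_def mult.commute)
  qed
  then have "u = (\<lambda>(x, y). \<Sum>i<k. E (b i) x * slice u (b i) y)" by (simp add: fun_eq_iff)
  moreover have "\<forall>i<k. E (b i) \<in> ideal la \<and> slice u (b i) \<in> hspace GNS"
    using b u E by (auto simp: bij_betw_def)
  ultimately show "u \<in> hspace TR"
    unfolding tensor_rep_def urep.simps mem_Collect_eq
    by (intro exI[of _ k] exI[of _ "\<lambda>i. E (b i)"] exI[of _ "\<lambda>i. slice u (b i)"]) simp
qed

lemma inprod_TR: "inprod TR u v = (\<Sum>x\<in>Sfin n. inprod GNS (slice u x) (slice v x))"
  by (simp add: tensor_rep_def slice_def)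

lemma TR_l2: "u \<in> hspace TR \<Longrightarrow> u \<in> l2_space (Sfin n) (hspace GNS) (inprod GNS)"
proof -
  assume u: "u \<in> hspace TR"
  have "u (x, y) = 0" if "x \<notin> Sfin n" for x y
    using u that ideal_vanish[of "\<lambda>x. u (x, y)" x] by (simp add: mem_TR)
  then show ?thesis
    using u finite_Sfin by (simp add: mem_TR l2_space_def)
qed

text \<open>Membership amounts to the finite identity that expands \<open>f\<close> in the
  \<open>E x\<close> with its own values as coefficients, and pointwise limits preserve this
  identity.\<close>

lemma ideal_pointwise_closed:
  assumes X: "\<And>m. X m \<in> ideal la" and lim: "\<And>x. (\<lambda>m. X m x) \<longlonglongrightarrow> f x"
  shows "f \<in> ideal la"
proof -
  obtain E where E: "\<And>x. x \<in> Sfin n \<Longrightarrow> E x \<in> ideal la"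
    "\<And>f. f \<in> ideal la \<Longrightarrow> f = (\<Sum>x\<in>Sfin n. smul (f x) (E x))"
    using ideal_basis by blast
  have eq: "f z = (\<Sum>x\<in>Sfin n. f x * E x z)" for z
  proof -
    have "(\<lambda>m. \<Sum>x\<in>Sfin n. X m x * E x z) \<longlonglongrightarrow> (\<Sum>x\<in>Sfin n. f x * E x z)"
      by (intro tendsto_sum tendsto_mult_right lim)
    moreover have "(\<Sum>x\<in>Sfin n. X m x * E x z) = X m z" for m
      using fun_cong[OF E(2)[OF X, of m], of z] by (simp add: sum_fun_apply)
    ultimately have "(\<lambda>m. X m z) \<longlonglongrightarrow> (\<Sum>x\<in>Sfin n. f x * E x z)" by simp
    then show ?thesis by (rule LIMSEQ_unique[OF lim])
  qed
  have "f = (\<Sum>x\<in>Sfin n. smul (f x) (E x))"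
    by (rule ext) (unfold sum_fun_apply smul_apply, rule eq)
  moreover have "(\<Sum>x\<in>Sfin n. smul (f x) (E x)) \<in> ideal la"
    by (intro ideal_sum ideal_smul E(1))
  ultimately show ?thesis by simp
qed

lemma TR_hfs: "hfs (hspace TR) (inprod TR)"
proof -
  interpret L: hfs "l2_space (Sfin n) (hspace GNS) (inprod GNS)" "l2_ip (Sfin n) (inprod GNS)"
    by (rule U.l2_hfs)
  show ?thesis
  proof (rule L.hfs_pullback[where j = "\<lambda>u. u"])
    show "0 \<in> hspace TR" using ideal_zero by (simp add: mem_TR zero_fun_def[symmetric])
  next
    fix u v assume uv: "u \<in> hspace TR" "v \<in> hspace TR"
    have "(\<lambda>x. (u + v) (x, y)) = (\<lambda>x. u (x, y)) + (\<lambda>x. v (x, y))" for y by (simp add: fun_eq_iff)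
    then show "u + v \<in> hspace TR" using uv ideal_add by (auto simp: mem_TR)
  next
    fix u c assume u: "u \<in> hspace TR"
    have "(\<lambda>x. smul c u (x, y)) = smul c (\<lambda>x. u (x, y))" for y by (simp add: fun_eq_iff)
    then show "smul c u \<in> hspace TR" using u ideal_smul by (auto simp: mem_TR)
  next
    fix u v
    show "inprod TR u v = l2_ip (Sfin n) (inprod GNS) u v"
      by (simp add: inprod_TR l2_ip_def finite_Sfin)
  next
    fix X z assume X: "\<And>m. X m \<in> hspace TR" and z: "z \<in> l2_space (Sfin n) (hspace GNS) (inprod GNS)"
      and lim: "(\<lambda>m. L.nrm (X m - z)) \<longlonglongrightarrow> 0"
    have sz: "slice z x \<in> hspace GNS" for x
    proof (cases "x \<in> Sfin n")
      case False
      then have "slice z x = 0" using z by (simp add: l2_space_def slice_def fun_eq_iff)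
      then show ?thesis by simp
    qed (use z in \<open>simp add: l2_space_def\<close>)
    have sX: "slice (X m) x \<in> hspace GNS" for m x using X by (simp add: mem_TR)
    have limx: "(\<lambda>m. U.nrm (slice (X m) x - slice z x)) \<longlonglongrightarrow> 0" for x
    proof (cases "x \<in> Sfin n")
      case True
      show ?thesis
      proof (rule Lim_null_comparison[OF always_eventually lim], rule allI)
        fix m
        have "X m - z \<in> l2_space (Sfin n) (hspace GNS) (inprod GNS)" using TR_l2[OF X] z by auto
        from U.l2_slice_le[OF this True]
        have "U.nrm (slice (X m - z) x) \<le> L.nrm (X m - z)"
          by (simp add: U.nrm_def L.nrm_def)
        then show "norm (U.nrm (slice (X m) x - slice z x)) \<le> L.nrm (X m - z)"
          using sX sz by simp
      qed
    next
      case False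
      then have "slice z x = 0" using z by (simp add: l2_space_def slice_def fun_eq_iff)
      moreover have "slice (X m) x = 0" for m
        using TR_l2[OF X[of m]] False by (simp add: l2_space_def slice_def fun_eq_iff)
      ultimately show ?thesis by simp
    qed
    have pt: "(\<lambda>m. X m (x, y)) \<longlonglongrightarrow> z (x, y)" for x y
    proof (cases "y \<in> Scofin n")
      case True
      have "(\<lambda>m. inprod GNS (slice (X m) x) (vec y)) \<longlonglongrightarrow> inprod GNS (slice z x) (vec y)"
        by (rule U.ip_tendsto[OF sX sz limx vec_mem[OF True]])
      then show ?thesis
        using eval[OF sX True] eval[OF sz True] by (simp add: slice_def)
    next
      case False
      then show ?thesis
        using eval_out[OF sX False] eval_out[OF sz False] by (simp add: slice_def)
    qed
    have "(\<lambda>x. z (x, y)) \<in> ideal la" for y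
      by (rule ideal_pointwise_closed[of "\<lambda>m x. X m (x, y)"]) (use X pt in \<open>auto simp: mem_TR\<close>)
    then have "z \<in> hspace TR" using sz by (simp add: mem_TR)
    then show "\<exists>u\<in>hspace TR. u = z" by blast
  qed (use TR_l2 in auto)
qed

abbreviation "K \<equiv> young_subgroup n"

lemma act_TR: "act TR k u (x, y) = u (inv (perm_part {1..n} k) \<circ> x, inv (perm_part {n<..} k) \<circ> y)"
  by (simp add: tensor_rep_def young_rep_def gns_rep_def Let_def)

lemma slice_act_TR: "slice (act TR k u) x = act GNS (perm_part {n<..} k) (slice u (inv (perm_part {1..n} k) \<circ> x))"
  by (simp add: slice_def act_TR act_gns translate_def fun_eq_iff)

lemma act_TR_mem:
  assumes k: "k \<in> K" and u: "u \<in> hspace TR"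
  shows "act TR k u \<in> hspace TR"
  unfolding mem_TR
proof (intro conjI allI)
  fix x show "slice (act TR k u) x \<in> hspace GNS"
    unfolding slice_act_TR using u k by (intro U.act_mem perm_part_Scofin) (auto simp: mem_TR)
next
  fix y
  have "(\<lambda>x. u (x, inv (perm_part {n<..} k) \<circ> y)) \<in> ideal la" using u by (simp add: mem_TR)
  moreover have "inv (perm_part {1..n} k) \<in> Sfin (sum_list la)"
    using fs.inv_mem[OF perm_part_Sfin[OF k]] by (simp only: n_def)
  ultimately show "(\<lambda>x. act TR k u (x, y)) \<in> ideal la"
    unfolding act_TR by (rule ideal_translate)
qed

sublocale T: unitary_rep K TR
proof (intro unitary_rep.intro unitary_rep_axioms.intro TR_hfs young_perm_group act_TR_mem)
  fix k u v assume k: "k \<in> K" and uv: "u \<in> hspace TR" "v \<in> hspace TR"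
  let ?r = "inv (perm_part {1..n} k)"
  have r: "?r \<in> Sfin n" using k by (intro fs.inv_mem perm_part_Sfin)
  have bij: "bij_betw ((\<circ>) ?r) (Sfin n) (Sfin n)"
    by (rule bij_betw_byWitness[where f' = "(\<circ>) (inv ?r)"]) (use r in auto)
  have "inprod TR (act TR k u) (act TR k v) = (\<Sum>x\<in>Sfin n. inprod GNS (slice u (?r \<circ> x)) (slice v (?r \<circ> x)))"
    unfolding inprod_TR slice_act_TR
    using uv k by (intro sum.cong refl U.act_ip perm_part_Scofin) (auto simp: mem_TR)
  also have "\<dots> = inprod TR u v"
    unfolding inprod_TR by (rule sum.reindex_bij_betw[OF bij])
  finally show "inprod TR (act TR k u) (act TR k v) = inprod TR u v" .
next
  fix k l u assume k: "k \<in> K" and l: "l \<in> K"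
  show "act TR (k \<circ> l) u = act TR k (act TR l u)"
  proof
    fix p
    have "inv (perm_part {1..n} k \<circ> perm_part {1..n} l) = inv (perm_part {1..n} l) \<circ> inv (perm_part {1..n} k)"
      using k l by (intro fs.inv_distrib[where X = "{1..n}"] perm_part_Sfin)
    moreover have "inv (perm_part {n<..} k \<circ> perm_part {n<..} l) = inv (perm_part {n<..} l) \<circ> inv (perm_part {n<..} k)"
      using k l by (intro fs.inv_distrib[where X = "{n<..}"] perm_part_Scofin)
    ultimately show "act TR (k \<circ> l) u p = act TR k (act TR l u) p"
      using k l by (cases p) (simp add: act_TR perm_part_comp o_assoc)
  qed
next
  fix u
  have "perm_part X id = id" for X by (auto simp: perm_part_def fun_eq_iff)
  then show "act TR id u = u"
    by (intro ext) (auto simp: act_TR inv_id)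
qed (auto simp: act_TR fun_eq_iff)

lemma young_sub_SN: "K \<subseteq> SN"
  by (auto simp: young_subgroup_iff)

sublocale Ind: induction_data SN K TR
  by (intro induction_data.intro induction_data_axioms.intro T.unitary_rep_axioms finsym_perm_group young_sub_SN)

lemma Pi_unitary: "unitary_rep SN (induced_rep SN K TR)"
  by (rule Ind.U.unitary_rep_axioms)

text \<open>The coordinate of \<open>F\<close> at the group element \<open>g\<close> and the first
  tensor variable \<open>x\<close>. It lies in the GNS space, which reduces limits in the induced
  representation to limits there.\<close>

definition component :: "((nat \<Rightarrow> nat) \<times> (nat \<Rightarrow> nat) \<times> (nat \<Rightarrow> nat) \<Rightarrow> complex) \<Rightarrow> (nat \<Rightarrow> nat) \<Rightarrow>
    (nat \<Rightarrow> nat) \<Rightarrow> (nat \<Rightarrow> nat) \<Rightarrow> complex" where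
  "component F g x = slice (slice F g) x"

abbreviation "PI \<equiv> induced_rep SN K TR"

lemma component_mem: "F \<in> hspace PI \<Longrightarrow> g \<in> SN \<Longrightarrow> component F g x \<in> hspace GNS"
  using Ind.slice_H[of F g] by (simp add: component_def mem_TR)

lemma component_nrm_le:
  assumes "F \<in> hspace PI" "g \<in> SN"
  shows "hnorm GNS (component F g x) \<le> hnorm PI F"
proof -
  have s: "slice F g \<in> hspace TR" using assms by (rule Ind.slice_H)
  have "U.nrm (slice (slice F g) x) \<le> T.nrm (slice F g)"
  proof (cases "x \<in> Sfin n")
    case True
    have "Re (inprod GNS (slice (slice F g) x) (slice (slice F g) x))
      \<le> (\<Sum>x\<in>Sfin n. Re (inprod GNS (slice (slice F g) x) (slice (slice F g) x)))"
      using True finite_Sfin s by (intro member_le_sum) (auto simp: mem_TR)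
    then show ?thesis by (simp add: U.nrm_def T.nrm_def inprod_TR)
  next
    case False
    then have "slice (slice F g) x = 0"
      using ideal_vanish[of "\<lambda>x. slice F g (x, _)" x] s by (simp add: mem_TR fun_eq_iff) (simp add: slice_def)
    then show ?thesis using s by simp
  qed
  also have "\<dots> \<le> Ind.U.nrm F" using assms by (rule Ind.slice_nrm_le)
  finally show ?thesis by (simp add: component_def U.hnorm_nrm Ind.U.hnorm_nrm)
qed

text \<open>If the conjugate of \<open>s\<close> by \<open>g\<close> lies in
  \<open>Scofin n\<close>, then \<open>s\<close> keeps the coset of \<open>g\<close> and acts on the
  value at \<open>g\<close> through the second tensor factor alone.\<close>

lemma component_act:
  assumes F: "F \<in> hspace PI" and g: "g \<in> SN" and s: "s \<in> SN" and t: "inv g \<circ> s \<circ> g \<in> Scofin n"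
  shows "component (act PI s F) g x = act GNS (inv g \<circ> s \<circ> g) (component F g x)"
proof -
  let ?t = "inv g \<circ> s \<circ> g"
  have tK: "?t \<in> K" using t by (rule Scofin_young)
  have itK: "inv ?t \<in> K" using tK by (rule T.inv_mem)
  have it: "inv ?t = inv g \<circ> inv s \<circ> g"
    using g s by (simp add: fs.inv_distrib[where X = "{1..}"] o_assoc)
  have "g \<circ> inv ?t = inv s \<circ> g"
    unfolding it using g by (simp add: o_assoc)
  then have "slice (act PI s F) g = slice F (g \<circ> inv ?t)"
    by (simp only: Ind.slice_act)
  also have "\<dots> = act TR (inv (inv ?t)) (slice F g)"
    by (rule Ind.equivariant[OF F g itK])
  also have "inv (inv ?t) = ?t" using tK by (rule T.inv_inv)
  finally have "component (act PI s F) g x = slice (act TR ?t (slice F g)) x"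
    by (simp only: component_def)
  also have "\<dots> = act GNS ?t (slice (slice F g) x)"
    unfolding slice_act_TR perm_part_of_Scofin[OF t] by (simp add: inv_id)
  finally show ?thesis by (simp only: component_def)
qed

lemma component_nonzero:
  assumes "F \<in> hspace PI" "F \<noteq> 0"
  obtains g x where "g \<in> SN" "component F g x \<noteq> 0"
proof -
  obtain g x y where gxy: "F (g, x, y) \<noteq> 0" using assms(2) by (auto simp: fun_eq_iff)
  then have "g \<in> SN" using assms(1) Ind.mem_I by blast
  moreover have "component F g x y \<noteq> 0" using gxy by (simp add: component_def slice_def)
  then have "component F g x \<noteq> 0" by (auto simp: fun_eq_iff)
  ultimately show ?thesis using that by blast
qed

definition vacuum :: "(nat \<Rightarrow> nat) \<times> (nat \<Rightarrow> nat) \<times> (nat \<Rightarrow> nat) \<Rightarrow> complex" where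
  "vacuum = Ind.ind_vec (\<lambda>(x, y). young_symmetrizer la x * vec id y)"

lemma vacuum_TR: "(\<lambda>(x, y). young_symmetrizer la x * vec id y) \<in> hspace TR"
proof -
  have "slice (\<lambda>(x, y). young_symmetrizer la x * vec id y) x = smul (young_symmetrizer la x) (vec id)" for x
    by (simp add: slice_def fun_eq_iff)
  moreover have "(\<lambda>x. (\<lambda>(x, y). young_symmetrizer la x * vec id y) (x, y)) = smul (vec id y) (young_symmetrizer la)" for y
    by (simp add: fun_eq_iff)
  ultimately show ?thesis
    using vec_mem[of id] symmetrizer_ideal ideal_smul by (auto simp: mem_TR)
qed

lemma vacuum_mem: "vacuum \<in> hspace PI"
  unfolding vacuum_def by (rule Ind.ind_vec_mem[OF vacuum_TR])

lemma vacuum_ip_out: "s \<in> SN \<Longrightarrow> s \<notin> K \<Longrightarrow> inprod PI (act PI s vacuum) vacuum = 0"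
  unfolding vacuum_def by (subst Ind.ind_vec_ip[OF vacuum_TR]) auto

lemma vacuum_ip:
  assumes s: "s \<in> Scofin n"
  shows "inprod PI (act PI s vacuum) vacuum = of_real (\<Sum>x\<in>Sfin n. (cmod (young_symmetrizer la x))\<^sup>2) * \<phi> s"
proof -
  let ?v = "\<lambda>(x, y). young_symmetrizer la x * vec id y"
  have sl: "slice ?v x = smul (young_symmetrizer la x) (vec id)" for x
    by (simp add: slice_def fun_eq_iff)
  have sK: "s \<in> K" using s by (rule Scofin_young)
  have "inprod PI (act PI s vacuum) vacuum = inprod TR (act TR s ?v) ?v"
    unfolding vacuum_def using sK young_sub_SN by (subst Ind.ind_vec_ip[OF vacuum_TR]) auto
  also have "\<dots> = (\<Sum>x\<in>Sfin n. of_real ((cmod (young_symmetrizer la x))\<^sup>2) * \<phi> s)"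
    unfolding inprod_TR slice_act_TR perm_part_of_Scofin[OF s] sl
  proof (intro sum.cong refl)
    fix x
    have "inprod GNS (act GNS s (smul (young_symmetrizer la (inv id \<circ> x)) (vec id))) (smul (young_symmetrizer la x) (vec id))
      = young_symmetrizer la x * cnj (young_symmetrizer la x) * inprod GNS (act GNS s (vec id)) (vec id)"
      using s vec_mem[of id] by (simp add: inv_id U.act_smul U.ip_smul_left U.ip_smul_right)
    also have "inprod GNS (act GNS s (vec id)) (vec id) = \<phi> s"
      using s by (simp add: act_vec ip_vec inv_id)
    also have "young_symmetrizer la x * cnj (young_symmetrizer la x) = of_real ((cmod (young_symmetrizer la x))\<^sup>2)"
      by (simp only: complex_norm_square)
    finally show "inprod GNS (act GNS s (smul (young_symmetrizer la (inv id \<circ> x)) (vec id))) (smul (young_symmetrizer la x) (vec id))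
      = of_real ((cmod (young_symmetrizer la x))\<^sup>2) * \<phi> s" .
  qed
  finally show ?thesis by (simp add: sum_distrib_right)
qed

lemma vacuum_invariant:
  assumes r: "r \<in> Sfin n" and inv: "\<And>t. young_symmetrizer la (inv r \<circ> t) = young_symmetrizer la t"
  shows "act PI r vacuum = vacuum"
proof -
  let ?v = "\<lambda>(x, y). young_symmetrizer la x * vec id y"
  have "act TR r ?v = ?v"
  proof
    fix p
    show "act TR r ?v p = ?v p"
      by (cases p) (simp only: act_TR prod.case perm_part_of_Sfin[OF r] inv inv_id id_comp)
  qed
  then show ?thesis
    unfolding vacuum_def using Ind.act_ind_vec[OF vacuum_TR Sfin_young[OF r]] by simp
qed

end

section \<open>Row invariants in Young representations\<close>

lemma row_group_comp:
  assumes "p \<in> row_group la" "q \<in> row_group la" shows "p \<circ> q \<in> row_group la"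
proof -
  have "\<exists>c'. (r, c') \<in> boxes la \<and> (p \<circ> q) (entry la (r, c)) = entry la (r, c')"
    if rc: "(r, c) \<in> boxes la" for r c
  proof -
    obtain c1 where c1: "(r, c1) \<in> boxes la" "q (entry la (r, c)) = entry la (r, c1)"
      using assms(2) rc by (auto simp: row_group_def)
    obtain c2 where "(r, c2) \<in> boxes la" "p (entry la (r, c1)) = entry la (r, c2)"
      using assms(1) c1(1) by (auto simp: row_group_def)
    then show ?thesis using c1 by (intro exI[of _ c2]) simp
  qed
  moreover have "p \<circ> q \<in> Sfin (sum_list la)"
    using assms by (intro fs.comp_mem) (simp_all add: row_group_def)
  ultimately show ?thesis by (auto simp: row_group_def)
qed

lemma column_group_comp:
  assumes "p \<in> column_group la" "q \<in> column_group la" shows "p \<circ> q \<in> column_group la"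
proof -
  have "\<exists>r'. (r', c) \<in> boxes la \<and> (p \<circ> q) (entry la (r, c)) = entry la (r', c)"
    if rc: "(r, c) \<in> boxes la" for r c
  proof -
    obtain r1 where r1: "(r1, c) \<in> boxes la" "q (entry la (r, c)) = entry la (r1, c)"
      using assms(2) rc by (auto simp: column_group_def)
    obtain r2 where "(r2, c) \<in> boxes la" "p (entry la (r1, c)) = entry la (r2, c)"
      using assms(1) r1(1) by (auto simp: column_group_def)
    then show ?thesis using r1 by (intro exI[of _ r2]) simp
  qed
  moreover have "p \<circ> q \<in> Sfin (sum_list la)"
    using assms by (intro fs.comp_mem) (simp_all add: column_group_def)
  ultimately show ?thesis by (auto simp: column_group_def)
qed

lemma row_group_Sfin: "p \<in> row_group la \<Longrightarrow> p \<in> Sfin (sum_list la)"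
  and column_group_Sfin: "p \<in> column_group la \<Longrightarrow> p \<in> Sfin (sum_list la)"
  by (auto simp: row_group_def column_group_def)

lemma finite_row_group: "finite (row_group la)" and finite_column_group: "finite (column_group la)"
  by (rule finite_subset[OF _ finite_Sfin[of "sum_list la"]], use row_group_Sfin column_group_Sfin in blast)+

lemma id_row_group: "id \<in> row_group la"
  unfolding row_group_def using fs.id_mem by auto

lemma id_column_group: "id \<in> column_group la"
  unfolding column_group_def using fs.id_mem by auto

lemma bij_betw_left_comp: "finite A \<Longrightarrow> bij r \<Longrightarrow> (\<And>p. p \<in> A \<Longrightarrow> r \<circ> p \<in> A) \<Longrightarrow> bij_betw ((\<circ>) r) A A"
proof -
  assume fin: "finite A" and r: "bij r" and A: "\<And>p. p \<in> A \<Longrightarrow> r \<circ> p \<in> A"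
  have inj: "inj_on ((\<circ>) r) A"
    using fun.inj_map[OF bij_is_inj[OF r]] by (rule inj_on_subset) simp
  moreover have "(\<circ>) r ` A = A"
    using A by (intro card_subset_eq fin) (auto simp: card_image[OF inj])
  ultimately show ?thesis by (simp add: bij_betw_def)
qed

lemma bij_betw_right_comp: "finite A \<Longrightarrow> bij r \<Longrightarrow> (\<And>p. p \<in> A \<Longrightarrow> p \<circ> r \<in> A) \<Longrightarrow> bij_betw (\<lambda>p. p \<circ> r) A A"
proof -
  assume fin: "finite A" and r: "bij r" and A: "\<And>p. p \<in> A \<Longrightarrow> p \<circ> r \<in> A"
  have inj: "inj_on (\<lambda>p. p \<circ> r) A"
  proof (rule inj_onI)
    fix p q assume "p \<circ> r = q \<circ> r"
    then show "p = q" using bij_is_surj[OF r] by (metis surj_fun_eq)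
  qed
  moreover have "(\<lambda>p. p \<circ> r) ` A = A"
    using A by (intro card_subset_eq fin) (auto simp: card_image[OF inj])
  ultimately show ?thesis by (simp add: bij_betw_def)
qed

lemma symmetrizer_sum: "young_symmetrizer la t = (\<Sum>p\<in>row_group la. \<Sum>q\<in>column_group la.
    if t = p \<circ> q then of_int (sign q) else 0)"
  by (simp add: young_symmetrizer_def sum.cartesian_product)

lemma symmetrizer_left:
  assumes r: "r \<in> row_group la"
  shows "young_symmetrizer la (inv r \<circ> t) = young_symmetrizer la t"
proof -
  have rS: "r \<in> Sfin (sum_list la)" using r by (rule row_group_Sfin)
  have eq: "inv r \<circ> t = p \<circ> q \<longleftrightarrow> t = (r \<circ> p) \<circ> q" for p q
    unfolding o_assoc[symmetric] using fs.inv_comp_assoc[OF rS] by metis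
  have bij: "bij_betw ((\<circ>) r) (row_group la) (row_group la)"
    by (intro bij_betw_left_comp finite_row_group fs.bij_mem[OF rS] row_group_comp r)
  show ?thesis
    unfolding symmetrizer_sum eq
    by (rule sum.reindex_bij_betw[OF bij, of "\<lambda>p. \<Sum>q\<in>column_group la. if t = p \<circ> q then of_int (sign q) else 0"])
qed

lemma symmetrizer_right:
  assumes r: "r \<in> column_group la"
  shows "young_symmetrizer la (t \<circ> r) = of_int (sign r) * young_symmetrizer la t"
proof -
  have rS: "r \<in> Sfin (sum_list la)" using r by (rule column_group_Sfin)
  have bij: "bij_betw (\<lambda>q. q \<circ> r) (column_group la) (column_group la)"
    by (intro bij_betw_right_comp finite_column_group fs.bij_mem[OF rS] column_group_comp r)
  have eq: "t \<circ> r = p \<circ> (q \<circ> r) \<longleftrightarrow> t = p \<circ> q" for p q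
  proof
    assume "t \<circ> r = p \<circ> (q \<circ> r)"
    then have "t \<circ> r = (p \<circ> q) \<circ> r" by (simp add: o_assoc)
    then show "t = p \<circ> q" using bij_is_surj[OF fs.bij_mem[OF rS]] by (metis surj_fun_eq)
  qed (simp add: o_assoc)
  have sgn: "sign (q \<circ> r) = sign r * sign q" if "q \<in> column_group la" for q
    using finsym_permutation[OF rS] finsym_permutation[OF column_group_Sfin[OF that]]
    by (simp add: sign_compose)
  have "young_symmetrizer la (t \<circ> r) = (\<Sum>p\<in>row_group la. \<Sum>q\<in>column_group la.
      if t \<circ> r = p \<circ> (q \<circ> r) then of_int (sign (q \<circ> r)) else 0)"
    unfolding symmetrizer_sum
    by (intro sum.cong refl sum.reindex_bij_betw[OF bij, symmetric])
  also have "\<dots> = (\<Sum>p\<in>row_group la. \<Sum>q\<in>column_group la.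
      of_int (sign r) * (if t = p \<circ> q then of_int (sign q) else 0))"
    unfolding eq by (intro sum.cong refl) (simp add: sgn)
  finally show ?thesis by (simp add: symmetrizer_sum sum_distrib_left)
qed

text \<open>Convolution from the left does not disturb the behaviour under right multiplication, so
  the whole ideal inherits the sign rule of the symmetrizer.\<close>

lemma ideal_right:
  assumes u: "u \<in> ideal la" and r: "r \<in> column_group la"
  shows "u (t \<circ> r) = of_int (sign r) * u t"
proof -
  obtain f where f: "u = convolution (sum_list la) f (young_symmetrizer la)"
    using u unfolding ideal_eq by auto
  have "young_symmetrizer la (inv s \<circ> (t \<circ> r)) = of_int (sign r) * young_symmetrizer la (inv s \<circ> t)" for s
    unfolding o_assoc by (rule symmetrizer_right[OF r])
  then show ?thesis
    unfolding f convolution_def by (simp add: sum_distrib_left mult_ac)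
qed

section \<open>Boxes, tableaux and the dominance order\<close>

abbreviation row_sum :: "nat list \<Rightarrow> nat \<Rightarrow> nat" where
  "row_sum la k \<equiv> sum_list (take k la)"

lemma row_sum_Suc: "r < length la \<Longrightarrow> row_sum la (Suc r) = row_sum la r + la ! r"
  by (simp add: take_Suc_conv_app_nth)

lemma row_sum_mono: "r \<le> r' \<Longrightarrow> row_sum la r \<le> row_sum la r'"
proof -
  assume "r \<le> r'"
  then have "take r' la = take r la @ take (r' - r) (drop r la)"
    by (metis le_add_diff_inverse take_add)
  then show ?thesis by simp
qed

lemma entry_bounds:
  assumes "(r, c) \<in> boxes la"
  shows "row_sum la r < entry la (r, c)" "entry la (r, c) \<le> row_sum la (Suc r)"
  using assms by (auto simp: entry_def boxes_def row_sum_Suc)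

lemma entry_inj: "inj_on (entry la) (boxes la)"
proof (rule inj_onI, clarify)
  fix r c r' c' assume b: "(r, c) \<in> boxes la" "(r', c') \<in> boxes la" "entry la (r, c) = entry la (r', c')"
  have "\<not> r < r'" "\<not> r' < r"
    using entry_bounds[OF b(1)] entry_bounds[OF b(2)] b(3)
      row_sum_mono[of "Suc r" r' la] row_sum_mono[of "Suc r'" r la] by auto
  then have "r = r'" by simp
  then show "r = r' \<and> c = c'" using b(3) by (simp add: entry_def)
qed

lemma entry_surj:
  assumes "x \<in> {1..row_sum la k}"
  shows "\<exists>r c. r < k \<and> (r, c) \<in> boxes la \<and> entry la (r, c) = x"
  using assms
proof (induction k)
  case (Suc k)
  show ?case
  proof (cases "x \<le> row_sum la k")
    case True
    then show ?thesis using Suc by (auto intro: less_SucI)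
  next
    case False
    have kl: "k < length la"
    proof (rule ccontr)
      assume "\<not> k < length la"
      then have "row_sum la (Suc k) = row_sum la k" by simp
      then show False using Suc.prems False by simp
    qed
    define c where "c = x - row_sum la k - 1"
    have "c < la ! k" "entry la (k, c) = x"
      using Suc.prems False row_sum_Suc[OF kl] by (auto simp: c_def entry_def)
    then show ?thesis using kl by (intro exI[of _ k] exI[of _ c]) (simp add: boxes_def)
  qed
qed simp

lemma entry_image: "entry la ` {b \<in> boxes la. fst b < k} = {1..row_sum la k}"
proof
  show "entry la ` {b \<in> boxes la. fst b < k} \<subseteq> {1..row_sum la k}"
  proof clarify
    fix r c assume b: "(r, c) \<in> boxes la" "fst (r, c) < k"
    then show "entry la (r, c) \<in> {1..row_sum la k}"
      using entry_bounds[OF b(1)] row_sum_mono[of "Suc r" k la] by auto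
  qed
  show "{1..row_sum la k} \<subseteq> entry la ` {b \<in> boxes la. fst b < k}"
    using entry_surj[of _ k la] by force
qed

lemma boxes_image: "entry la ` boxes la = {1..sum_list la}"
proof -
  have "{b \<in> boxes la. fst b < length la} = boxes la" by (auto simp: boxes_def)
  then show ?thesis using entry_image[of la "length la"] by simp
qed

lemma card_rows: "card {b \<in> boxes la. fst b < k} = row_sum la k"
proof -
  have "card (entry la ` {b \<in> boxes la. fst b < k}) = card {b \<in> boxes la. fst b < k}"
    by (intro card_image inj_on_subset[OF entry_inj]) auto
  then show ?thesis by (simp add: entry_image)
qed

lemma finite_boxes: "finite (boxes la)"
  using finite_imageD[OF _ entry_inj[of la]] by (simp add: boxes_image)

lemma boxes_down:
  assumes y: "is_young la" and b: "(r, c) \<in> boxes la" and le: "r' \<le> r"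
  shows "(r', c) \<in> boxes la"
proof -
  have "la ! r \<le> la ! r'"
    using y b le by (cases "r = r'") (auto simp: is_young_def boxes_def sorted_wrt_iff_nth_less)
  then show ?thesis using b le by (auto simp: boxes_def)
qed

text \<open>If \<open>p \<circ> q\<close> is the identity, then \<open>q\<close> moves an entry
  within its column and \<open>p\<close> moves it back within a row, so it never left its box. The
  value 1 shows that the symmetrizer is nonzero, whence \<open>mass_pos\<close>.\<close>

lemma symmetrizer_id: "young_symmetrizer la id = 1"
proof -
  have triv: "p = id \<and> q = id" if pq: "p \<in> row_group la" "q \<in> column_group la" "id = p \<circ> q" for p q
  proof -
    have q_fix: "q x = x" if x: "x \<in> {1..sum_list la}" for x
    proof -
      have "x \<in> entry la ` boxes la" using x by (simp only: boxes_image)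
      then obtain b where b: "b \<in> boxes la" "x = entry la b" by blast
      obtain r c where "b = (r, c)" by (cases b)
      then have rc: "(r, c) \<in> boxes la" "x = entry la (r, c)" using b by simp_all
      obtain r' where r': "(r', c) \<in> boxes la" "q x = entry la (r', c)"
        using pq(2) rc by (auto simp: column_group_def)
      obtain c' where c': "(r', c') \<in> boxes la" "p (q x) = entry la (r', c')"
        using pq(1) r' by (auto simp: row_group_def)
      have "p (q x) = x" using fun_cong[OF pq(3), of x] by simp
      then have "(r, c) = (r', c')"
        using inj_onD[OF entry_inj _ rc(1) c'(1)] rc c' by simp
      then show ?thesis using rc r' by simp
    qed
    have q: "q permutes {1..sum_list la}"
      using column_group_Sfin[OF pq(2)] by (simp add: Sfin_eq)
    have "q x = x" for x using q_fix permutes_not_in[OF q, of x] by blast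
    then have "q = id" by auto
    then show ?thesis using pq by simp
  qed
  have "young_symmetrizer la id = (\<Sum>p\<in>row_group la. \<Sum>q\<in>column_group la. if p = id \<and> q = id then 1 else 0)"
    unfolding symmetrizer_sum using triv by (intro sum.cong refl) auto
  also have "\<dots> = (\<Sum>p\<in>row_group la. if p = id then 1 else 0)"
    using finite_column_group id_column_group
    by (intro sum.cong refl) (auto simp: sum.delta)
  also have "\<dots> = 1"
    using finite_row_group id_row_group by (simp add: sum.delta)
  finally show ?thesis .
qed

lemma swap_row_group:
  assumes b: "(r, c1) \<in> boxes la" "(r, c2) \<in> boxes la"
  shows "swp (entry la (r, c1)) (entry la (r, c2)) \<in> row_group la"
proof -
  have m: "entry la (r, c1) \<in> {1..sum_list la}" "entry la (r, c2) \<in> {1..sum_list la}"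
    unfolding boxes_image[symmetric] using b by auto
  have "\<exists>c'. (r', c') \<in> boxes la \<and> swp (entry la (r, c1)) (entry la (r, c2)) (entry la (r', c)) = entry la (r', c')"
    if rc: "(r', c) \<in> boxes la" for r' c
  proof -
    consider "entry la (r', c) = entry la (r, c1)" | "entry la (r', c) = entry la (r, c2)"
      | "entry la (r', c) \<noteq> entry la (r, c1)" "entry la (r', c) \<noteq> entry la (r, c2)" by blast
    then show ?thesis
    proof cases
      case 1
      then have "r' = r" using inj_onD[OF entry_inj _ rc b(1)] by blast
      then show ?thesis using 1 b by auto
    next
      case 2
      then have "r' = r" using inj_onD[OF entry_inj _ rc b(2)] by blast
      then show ?thesis using 2 b by auto
    qed (use rc in auto)
  qed
  then show ?thesis
    using m by (auto simp: row_group_def Sfin_eq permutes_swap_id)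
qed

lemma swap_column_group:
  assumes b: "(r1, c) \<in> boxes la" "(r2, c) \<in> boxes la"
  shows "swp (entry la (r1, c)) (entry la (r2, c)) \<in> column_group la"
proof -
  have m: "entry la (r1, c) \<in> {1..sum_list la}" "entry la (r2, c) \<in> {1..sum_list la}"
    unfolding boxes_image[symmetric] using b by auto
  have "\<exists>r'. (r', c') \<in> boxes la \<and> swp (entry la (r1, c)) (entry la (r2, c)) (entry la (r, c')) = entry la (r', c')"
    if rc: "(r, c') \<in> boxes la" for r c'
  proof -
    consider "entry la (r, c') = entry la (r1, c)" | "entry la (r, c') = entry la (r2, c)"
      | "entry la (r, c') \<noteq> entry la (r1, c)" "entry la (r, c') \<noteq> entry la (r2, c)" by blast
    then show ?thesis
    proof cases
      case 1
      then have "c' = c" using inj_onD[OF entry_inj _ rc b(1)] by blast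
      then show ?thesis using 1 b by auto
    next
      case 2
      then have "c' = c" using inj_onD[OF entry_inj _ rc b(2)] by blast
      then show ?thesis using 2 b by auto
    qed (use rc in auto)
  qed
  then show ?thesis
    using m by (auto simp: column_group_def Sfin_eq permutes_swap_id)
qed

text \<open>Suppose that no two entries from one row of \<open>la\<close> land in one column of
  \<open>mu\<close>. Then a column of \<open>mu\<close> receives at most \<open>k\<close> entries
  from the first \<open>k\<close> rows of \<open>la\<close>, and at most as many as its height. This
  minimum is the number of its boxes in the first \<open>k\<close> rows of \<open>mu\<close>;
  summing over the columns contradicts \<open>k\<close>.\<close>

lemma young_pigeonhole:
  assumes mu: "is_young mu" and n: "sum_list la = sum_list mu" and t: "t permutes {1..sum_list la}"
    and k: "row_sum la k > row_sum mu k"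
  shows "\<exists>r c1 c2 r1 r2 c. (r, c1) \<in> boxes la \<and> (r, c2) \<in> boxes la \<and> c1 \<noteq> c2 \<and>
    (r1, c) \<in> boxes mu \<and> (r2, c) \<in> boxes mu \<and>
    t (entry la (r, c1)) = entry mu (r1, c) \<and> t (entry la (r, c2)) = entry mu (r2, c)"
proof (rule ccontr)
  assume no: "\<not> ?thesis"
  define B where "B = {b \<in> boxes la. fst b < k}"
  have "\<exists>b'\<in>boxes mu. t (entry la b) = entry mu b'" if "b \<in> boxes la" for b
  proof -
    have "entry la b \<in> {1..sum_list la}" using that boxes_image by blast
    then have "t (entry la b) \<in> {1..sum_list mu}"
      using permutes_in_image[OF t, of "entry la b"] n by simp
    then show ?thesis unfolding boxes_image[symmetric] by auto
  qed
  then obtain F where F: "\<And>b. b \<in> boxes la \<Longrightarrow> F b \<in> boxes mu"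
    "\<And>b. b \<in> boxes la \<Longrightarrow> t (entry la b) = entry mu (F b)" by metis
  have F_inj: "b = b'" if "b \<in> boxes la" "b' \<in> boxes la" "F b = F b'" for b b'
  proof -
    have "t (entry la b) = t (entry la b')" using F that by simp
    then have "entry la b = entry la b'" using permutes_inj[OF t] by (auto dest: injD)
    then show ?thesis using inj_onD[OF entry_inj] that by blast
  qed
  have finB: "finite B" using finite_boxes by (simp add: B_def)
  define X where "X c = {b \<in> B. snd (F b) = c}" for c
  define Y where "Y c = {b \<in> boxes mu. fst b < k \<and> snd b = c}" for c
  define N where "N = Suc (Max (insert 0 (snd ` boxes mu)))"
  have N: "snd b < N" if "b \<in> boxes mu" for b
    using that finite_boxes unfolding N_def by (auto simp: less_Suc_eq_le intro!: Max_ge)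
  have XY: "card (X c) \<le> card (Y c)" for c
  proof -
    define h where "h = card {b \<in> boxes mu. snd b = c}"
    \<comment> \<open>A column of a Young diagram is filled from the top without gaps, so its rows
      are determined by its height \<open>h\<close>.\<close>
    have rows: "fst ` {b \<in> boxes mu. snd b = c} = {..<h}"
    proof -
      let ?Z = "fst ` {b \<in> boxes mu. snd b = c}"
      have fin: "finite ?Z" using finite_boxes by simp
      have inj: "inj_on fst {b \<in> boxes mu. snd b = c}" by (auto simp: inj_on_def prod_eq_iff)
      have cd: "card ?Z = h" unfolding h_def by (rule card_image[OF inj])
      have down: "r' \<in> ?Z" if r: "r \<in> ?Z" and le: "r' \<le> r" for r r'
      proof -
        have "(r, c) \<in> boxes mu" using r by auto
        then have "(r', c) \<in> boxes mu" by (rule boxes_down[OF mu _ le])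
        then show ?thesis by (force intro: image_eqI[of _ _ "(r', c)"])
      qed
      have "r < h" if r: "r \<in> ?Z" for r
      proof -
        have "{..r} \<subseteq> ?Z" using down[OF r] by auto
        then have "card {..r} \<le> h" using card_mono[OF fin] cd by metis
        then show ?thesis by simp
      qed
      then have "?Z \<subseteq> {..<h}" by auto
      then show ?thesis using cd by (intro card_subset_eq) auto
    qed
    have "card (X c) \<le> k"
    proof -
      have "inj_on fst (X c)"
      proof (rule inj_onI)
        fix b b' assume b: "b \<in> X c" "b' \<in> X c" "fst b = fst b'"
        obtain r c1 where b1: "b = (r, c1)" by (cases b)
        obtain c2 where b2: "b' = (r, c2)" using b(3) b1 by (cases b') auto
        have bm: "(r, c1) \<in> boxes la" "(r, c2) \<in> boxes la" "snd (F (r, c1)) = c" "snd (F (r, c2)) = c"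
          using b b1 b2 by (auto simp: X_def B_def)
        then have "F (r, c1) = (fst (F (r, c1)), c)" "F (r, c2) = (fst (F (r, c2)), c)"
          by (simp_all add: prod_eq_iff)
        then have "c1 = c2" using no bm F by metis
        then show "b = b'" using b1 b2 by simp
      qed
      moreover have "fst ` X c \<subseteq> {..<k}" by (auto simp: X_def B_def)
      ultimately show ?thesis using card_inj_on_le[of fst "X c" "{..<k}"] by simp
    qed
    moreover have "card (X c) \<le> h"
    proof -
      have "inj_on F (X c)"
      proof (rule inj_onI)
        fix b b' assume "b \<in> X c" "b' \<in> X c" "F b = F b'"
        then show "b = b'" using F_inj[of b b'] by (simp add: X_def B_def)
      qed
      moreover have "F ` X c \<subseteq> {b \<in> boxes mu. snd b = c}" using F by (auto simp: X_def B_def)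
      ultimately show ?thesis unfolding h_def using finite_boxes by (intro card_inj_on_le[of F]) auto
    qed
    moreover have "card (Y c) = min k h"
    proof -
      have "inj_on fst (Y c)" by (auto simp: Y_def inj_on_def prod_eq_iff)
      then have "card (Y c) = card (fst ` Y c)" by (simp add: card_image)
      also have "fst ` Y c = {..<k} \<inter> fst ` {b \<in> boxes mu. snd b = c}" by (force simp: Y_def)
      also have "\<dots> = {..<min k h}" unfolding rows by auto
      finally show ?thesis by simp
    qed
    ultimately show ?thesis by simp
  qed
  have "snd (F b) < N" if "b \<in> B" for b using N[OF F(1)] that by (simp add: B_def)
  then have "B = (\<Union>c<N. X c)" by (auto simp: X_def)
  then have "card B = (\<Sum>c<N. card (X c))"
    using finB by (simp only:) (subst card_UN_disjoint; auto simp: X_def)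
  also have "\<dots> \<le> (\<Sum>c<N. card (Y c))" by (intro sum_mono XY)
  also have "\<dots> = card (\<Union>c<N. Y c)"
    using finite_boxes[of mu] by (subst card_UN_disjoint) (auto simp: Y_def)
  also have "(\<Union>c<N. Y c) = {b \<in> boxes mu. fst b < k}" using N by (auto simp: Y_def)
  also have "card \<dots> = row_sum mu k" by (rule card_rows)
  also have "card B = row_sum la k" unfolding B_def by (rule card_rows)
  finally show False using k by simp
qed

lemma swap_conj: "bij t \<Longrightarrow> swp x y \<circ> t = t \<circ> swp (inv t x) (inv t y)"
proof
  fix z assume t: "bij t"
  have "t z = x \<longleftrightarrow> z = inv t x" "t z = y \<longleftrightarrow> z = inv t y"
    using t by (metis bij_inv_eq_iff)+
  moreover have "t (inv t x) = x" "t (inv t y) = y" using t by (metis bij_inv_eq_iff)+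
  ultimately show "(swp x y \<circ> t) z = (t \<circ> swp (inv t x) (inv t y)) z"
    by (auto simp: Transposition.transpose_def)
qed

text \<open>A transposition in the row group that is conjugate to one in the column group forces both
  \<open>u t = u t'\<close> and \<open>u t' = - u t\<close>.\<close>

lemma ideal_row_invariant_zero:
  assumes mu: "is_young mu" and n: "sum_list la = sum_list mu" and k: "row_sum la k > row_sum mu k"
    and u: "u \<in> ideal mu" and inv: "\<And>r t. r \<in> row_group la \<Longrightarrow> u (r \<circ> t) = u t"
  shows "u = 0"
proof
  fix t
  show "u t = 0 t"
  proof (cases "t \<in> Sfin (sum_list mu)")
    case True
    then have tp: "t permutes {1..sum_list la}" using n by (simp add: Sfin_eq)
    have it: "inv t permutes {1..sum_list la}" using tp by (rule permutes_inv)
    obtain r c1 c2 r1 r2 c where b: "(r, c1) \<in> boxes la" "(r, c2) \<in> boxes la" "c1 \<noteq> c2"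
      "(r1, c) \<in> boxes mu" "(r2, c) \<in> boxes mu"
      "inv t (entry la (r, c1)) = entry mu (r1, c)" "inv t (entry la (r, c2)) = entry mu (r2, c)"
      using young_pigeonhole[OF mu n it k] by blast
    let ?x = "entry la (r, c1)" and ?y = "entry la (r, c2)"
    have "?x \<noteq> ?y" using inj_onD[OF entry_inj _ b(1,2)] b(3) by blast
    then have ne: "inv t ?x \<noteq> inv t ?y" using permutes_inj[OF it] by (auto dest: injD)
    have "u t = u (swp ?x ?y \<circ> t)"
      by (rule inv[OF swap_row_group[OF b(1,2)], symmetric])
    also have "swp ?x ?y \<circ> t = t \<circ> swp (inv t ?x) (inv t ?y)"
      by (rule swap_conj[OF permutes_bij[OF tp]])
    also have "u \<dots> = of_int (sign (swp (inv t ?x) (inv t ?y))) * u t"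
      unfolding b(6,7) by (rule ideal_right[OF u swap_column_group[OF b(4,5)]])
    also have "\<dots> = - u t" using ne by (simp add: sign_swap_id)
    finally show ?thesis by simp
  next
    case False
    then show ?thesis using ideal_out[OF u] by simp
  qed
qed

text \<open>Partial sums grow strictly as long as there are parts and are constant afterwards, so
  they reveal the number of parts; their differences are the parts.\<close>

lemma row_sums_determine:
  assumes la: "is_young la" and mu: "is_young mu" and eq: "\<And>k. row_sum la k = row_sum mu k"
  shows "la = mu"
proof -
  have pos: "row_sum xs (Suc r) > row_sum xs r" if "is_young xs" "r < length xs" for xs r
  proof -
    have "xs ! r \<noteq> 0" using that by (metis is_young_def nth_mem)
    then show ?thesis using row_sum_Suc[OF that(2)] by simp
  qed
  have stop: "row_sum xs (Suc (length xs)) = row_sum xs (length xs)" for xs by simp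
  have len: "length la = length mu"
  proof (rule ccontr)
    assume "length la \<noteq> length mu"
    then consider "length la < length mu" | "length mu < length la" by linarith
    then show False
    proof cases
      case 1
      then show False using pos[OF mu 1] stop[of la] eq[of "length la"] eq[of "Suc (length la)"] by linarith
    next
      case 2
      then show False using pos[OF la 2] stop[of mu] eq[of "length mu"] eq[of "Suc (length mu)"] by linarith
    qed
  qed
  show ?thesis
  proof (rule nth_equalityI[OF len])
    fix i assume i: "i < length la"
    then show "la ! i = mu ! i"
      using row_sum_Suc[OF i] row_sum_Suc[of i mu] eq[of i] eq[of "Suc i"] len by linarith
  qed
qed

section \<open>The moments determine the Thoma parameters\<close>

text \<open>Each summand tends to 1 or 0 according to whether \<open>b i\<close> attains the bound
  \<open>M\<close>, and for \<open>k \<ge> 1\<close> all are dominated by the summable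
  \<open>b i / M\<close>. The limit therefore counts how often \<open>M\<close> is attained.\<close>

lemma power_quotient_sum_tendsto:
  fixes b :: "nat \<Rightarrow> real"
  assumes b: "summable b" "\<And>i. 0 \<le> b i" "\<And>i. b i \<le> M" and M: "M > 0"
  shows "(\<lambda>k. (\<Sum>i. (b i / M) ^ k)) \<longlonglongrightarrow> (\<Sum>i. if b i = M then 1 else 0)"
    "summable (\<lambda>i. if b i = M then 1 else 0 :: real)"
proof -
  have le1: "b i / M \<le> 1" for i using b M by simp
  have s: "summable (\<lambda>i. b i / M)" using b by (intro summable_divide)
  have lim: "((\<lambda>k. (b i / M) ^ k) \<longlongrightarrow> (if b i = M then 1 else 0)) sequentially" for i
  proof (cases "b i = M")
    case False
    then have "b i / M < 1" using b(3)[of i] M by simp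
    then show ?thesis using False b(2)[of i] M by (simp add: LIMSEQ_realpow_zero)
  qed (use M in simp)
  have bound: "\<forall>\<^sub>F (i, k) in at_top \<times>\<^sub>F sequentially. norm ((b i / M) ^ k) \<le> b i / M"
    unfolding eventually_prod_sequentially
  proof (intro exI[of _ 1] allI impI, clarify)
    fix i k :: nat assume "1 \<le> k"
    then have "(b i / M) ^ k \<le> (b i / M) ^ 1"
      using b(2)[of i] le1[of i] M by (intro power_decreasing) auto
    then show "norm ((b i / M) ^ k) \<le> b i / M" using b(2)[of i] M by simp
  qed
  have "((\<lambda>k. (\<Sum>i. (b i / M) ^ k)) \<longlongrightarrow> (\<Sum>i. if b i = M then 1 else 0)) sequentially"
    using tannerys_theorem[OF lim bound s] by simp
  then show "(\<lambda>k. (\<Sum>i. (b i / M) ^ k)) \<longlonglongrightarrow> (\<Sum>i. if b i = M then 1 else 0)" .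
  show "summable (\<lambda>i. if b i = M then 1 else 0 :: real)"
    by (rule summable_comparison_test'[OF s]) (use b M in auto)
qed

text \<open>After the common initial segment cancels, \<open>m\<close> is the larger of the first
  differing terms. It is attained in only one of the two remaining sequences, and \<open>D\<close>
  is its multiplicity there up to sign. All \<open>M \<ge> m\<close> are covered so that two such
  differences can be compared on a common scale.\<close>

lemma power_sum_difference:
  fixes a a' :: "nat \<Rightarrow> real"
  assumes a: "summable a" "\<And>i. 0 \<le> a i" "decseq a" "\<And>i. a i \<le> 1"
    and a': "summable a'" "\<And>i. 0 \<le> a' i" "decseq a'" "\<And>i. a' i \<le> 1"
    and ne: "a \<noteq> a'"
  shows "\<exists>m>0. \<exists>D. D \<noteq> 0 \<and> (\<forall>M\<ge>m. (\<lambda>k. ((\<Sum>i. a i ^ k) - (\<Sum>i. a' i ^ k)) / M ^ k) \<longlonglongrightarrow> (if M = m then D else 0))"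
proof -
  define i0 where "i0 = (LEAST i. a i \<noteq> a' i)"
  have ex: "\<exists>i. a i \<noteq> a' i" using ne by (simp add: fun_eq_iff)
  have i0: "a i0 \<noteq> a' i0" unfolding i0_def by (rule LeastI_ex[OF ex])
  have before: "a i = a' i" if "i < i0" for i
    using not_less_Least[OF that[unfolded i0_def]] by simp
  define m where "m = max (a i0) (a' i0)"
  have m: "m > 0" using i0 a(2)[of i0] a'(2)[of i0] by (auto simp: m_def)
  define b where "b i = a (i + i0)" for i
  define b' where "b' i = a' (i + i0)" for i
  have sb: "summable b" "summable b'" 
    using a(1) a'(1) summable_iff_shift[of a i0] summable_iff_shift[of a' i0]
    by (simp_all add: b_def[abs_def] b'_def[abs_def])
  have nb: "0 \<le> b i" "0 \<le> b' i" for i using a a' by (auto simp: b_def b'_def)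
  have bm: "b i \<le> m" "b' i \<le> m" for i
    using decseqD[OF a(3), of i0 "i + i0"] decseqD[OF a'(3), of i0 "i + i0"] by (auto simp: b_def b'_def m_def)
  define cnt where "cnt f M = (\<Sum>i. if f i = M then 1 else 0 :: real)" for f :: "nat \<Rightarrow> real" and M
  have diff: "((\<Sum>i. a i ^ k) - (\<Sum>i. a' i ^ k)) / M ^ k = (\<Sum>i. (b i / M) ^ k) - (\<Sum>i. (b' i / M) ^ k)"
    if "k \<ge> 1" for k M
  proof -
    have s: "summable (\<lambda>i. a i ^ k)" "summable (\<lambda>i. a' i ^ k)"
      using a a' that by (intro summable_power_le_1; simp)+
    have sbk: "summable (\<lambda>i. b i ^ k)" "summable (\<lambda>i. b' i ^ k)"
      using s by (simp_all add: b_def b'_def summable_iff_shift[of "\<lambda>i. a i ^ k"] summable_iff_shift[of "\<lambda>i. a' i ^ k"])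
    have "(\<Sum>i. a i ^ k) = (\<Sum>i. b i ^ k) + (\<Sum>i<i0. a i ^ k)"
      "(\<Sum>i. a' i ^ k) = (\<Sum>i. b' i ^ k) + (\<Sum>i<i0. a' i ^ k)"
      unfolding b_def b'_def using s by (auto intro: suminf_split_initial_segment)
    moreover have "(\<Sum>i<i0. a i ^ k) = (\<Sum>i<i0. a' i ^ k)" using before by simp
    ultimately have "(\<Sum>i. a i ^ k) - (\<Sum>i. a' i ^ k) = (\<Sum>i. b i ^ k) - (\<Sum>i. b' i ^ k)" by simp
    then show ?thesis
      using sbk by (simp add: power_divide suminf_divide diff_divide_distrib)
  qed
  have lim: "(\<lambda>k. ((\<Sum>i. a i ^ k) - (\<Sum>i. a' i ^ k)) / M ^ k) \<longlonglongrightarrow> cnt b M - cnt b' M" if M: "M \<ge> m" for M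
  proof -
    have "M > 0" and "b i \<le> M" and "b' i \<le> M" for i using M m order_trans[OF bm(1)] order_trans[OF bm(2)] by auto
    then have "(\<lambda>k. (\<Sum>i. (b i / M) ^ k) - (\<Sum>i. (b' i / M) ^ k)) \<longlonglongrightarrow> cnt b M - cnt b' M"
      unfolding cnt_def using sb nb by (intro tendsto_diff power_quotient_sum_tendsto(1)) auto
    moreover have "\<forall>\<^sub>F k in sequentially. (\<Sum>i. (b i / M) ^ k) - (\<Sum>i. (b' i / M) ^ k)
      = ((\<Sum>i. a i ^ k) - (\<Sum>i. a' i ^ k)) / M ^ k"
      using eventually_ge_at_top[of 1] by eventually_elim (simp add: diff)
    ultimately show ?thesis by (rule Lim_transform_eventually)
  qed
  have cnt0: "cnt f M = 0" if "\<And>i. f i < M" for f M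
  proof -
    have "(if f i = M then 1 else 0 :: real) = 0" for i using that[of i] by simp
    then show ?thesis by (simp add: cnt_def)
  qed
  have cnt1: "cnt f m \<ge> 1" if f: "summable f" "\<And>i. 0 \<le> f i" "\<And>i. f i \<le> m" "f 0 = m" for f
  proof -
    have "(\<Sum>i\<in>{0}. if f i = m then 1 else 0 :: real) \<le> cnt f m"
      unfolding cnt_def using f m by (intro sum_le_suminf power_quotient_sum_tendsto(2)) auto
    then show ?thesis using f by simp
  qed
  have far: "cnt b M - cnt b' M = 0" if "M \<ge> m" "M \<noteq> m" for M
  proof -
    have "b i < M" "b' i < M" for i using that bm[of i] by auto
    then show ?thesis by (simp add: cnt0)
  qed
  have D: "cnt b m - cnt b' m \<noteq> 0"
  proof (cases "a i0 < a' i0")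
    case True
    have "b i < m" for i
      using True decseqD[OF a(3), of i0 "i + i0"] by (auto simp: b_def m_def)
    moreover have "cnt b' m \<ge> 1"
      using sb nb bm True by (intro cnt1) (auto simp: b'_def m_def)
    ultimately show ?thesis by (simp add: cnt0)
  next
    case False
    then have lt: "a' i0 < a i0" using i0 by simp
    have "b' i < m" for i
      using lt decseqD[OF a'(3), of i0 "i + i0"] by (auto simp: b'_def m_def)
    moreover have "cnt b m \<ge> 1"
      using sb nb bm lt by (intro cnt1) (auto simp: b_def m_def)
    ultimately show ?thesis by (simp add: cnt0)
  qed
  have "\<forall>M\<ge>m. (\<lambda>k. ((\<Sum>i. a i ^ k) - (\<Sum>i. a' i ^ k)) / M ^ k)
      \<longlonglongrightarrow> (if M = m then cnt b m - cnt b' m else 0)"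
  proof (intro allI impI)
    fix M assume "m \<le> M"
    then show "(\<lambda>k. ((\<Sum>i. a i ^ k) - (\<Sum>i. a' i ^ k)) / M ^ k)
        \<longlonglongrightarrow> (if M = m then cnt b m - cnt b' m else 0)"
      using lim[of M] far[of M] by (cases "M = m") simp_all
  qed
  then show ?thesis using m D by blast
qed

text \<open>Equality of the moments reads \<open>d k = (-1)^k * e k\<close>. On the larger of the
  two scales both \<open>d k / M^k\<close> and \<open>e k / M^k\<close> converge and the limits are
  not both 0; but even exponents give \<open>A = B\<close> and odd ones
  \<open>A = - B\<close>.\<close>

lemma moments_determine:
  assumes T: "thoma_params \<alpha> \<beta>" and T': "thoma_params \<alpha>' \<beta>'"
    and eq: "\<And>k. k \<ge> 2 \<Longrightarrow> thoma_moment \<alpha> \<beta> k = thoma_moment \<alpha>' \<beta>' k"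
  shows "\<alpha> = \<alpha>' \<and> \<beta> = \<beta>'"
proof (rule ccontr)
  assume ne: "\<not> (\<alpha> = \<alpha>' \<and> \<beta> = \<beta>')"
  define d where "d k = (\<Sum>i. \<alpha> i ^ k) - (\<Sum>i. \<alpha>' i ^ k)" for k
  define e where "e k = (\<Sum>i. \<beta> i ^ k) - (\<Sum>i. \<beta>' i ^ k)" for k
  have D: "\<exists>m>0. \<exists>D. D \<noteq> 0 \<and> (\<forall>M\<ge>m. (\<lambda>k. d k / M ^ k) \<longlonglongrightarrow> (if M = m then D else 0))" if "\<alpha> \<noteq> \<alpha>'"
    unfolding d_def using T T' that thoma_params_le_1[OF T] thoma_params_le_1[OF T']
    by (intro power_sum_difference) (auto simp: thoma_params_def)
  have E: "\<exists>m>0. \<exists>D. D \<noteq> 0 \<and> (\<forall>M\<ge>m. (\<lambda>k. e k / M ^ k) \<longlonglongrightarrow> (if M = m then D else 0))" if "\<beta> \<noteq> \<beta>'"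
    unfolding e_def using T T' that thoma_params_le_1[OF T] thoma_params_le_1[OF T']
    by (intro power_sum_difference) (auto simp: thoma_params_def)
  have "\<exists>M>0. \<exists>A B. (\<lambda>k. d k / M ^ k) \<longlonglongrightarrow> A \<and> (\<lambda>k. e k / M ^ k) \<longlonglongrightarrow> B \<and> (A \<noteq> 0 \<or> B \<noteq> 0)"
  proof (cases "\<alpha> = \<alpha>'")
    case True
    then have "\<beta> \<noteq> \<beta>'" using ne by simp
    from E[OF this] obtain m D where "m > 0" "D \<noteq> 0" "(\<lambda>k. e k / m ^ k) \<longlonglongrightarrow> D" by fastforce
    moreover have "(\<lambda>k. d k / m ^ k) \<longlonglongrightarrow> 0" using True by (simp add: d_def)
    ultimately show ?thesis by blast
  next
    case a: False
    from D[OF a] obtain m D where m: "m > 0" "D \<noteq> 0"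
      "\<And>M. M \<ge> m \<Longrightarrow> (\<lambda>k. d k / M ^ k) \<longlonglongrightarrow> (if M = m then D else 0)" by blast
    show ?thesis
    proof (cases "\<beta> = \<beta>'")
      case True
      then have "(\<lambda>k. e k / m ^ k) \<longlonglongrightarrow> 0" by (simp add: e_def)
      then show ?thesis using m(1,2) m(3)[of m] by auto
    next
      case False
      from E[OF this] obtain m' D' where m': "m' > 0" "D' \<noteq> 0"
        "\<And>M. M \<ge> m' \<Longrightarrow> (\<lambda>k. e k / M ^ k) \<longlonglongrightarrow> (if M = m' then D' else 0)" by blast
      define M where "M = max m m'"
      have "(if M = m then D else 0) \<noteq> 0 \<or> (if M = m' then D' else 0) \<noteq> 0"
        using m m' by (auto simp: M_def)
      moreover have "M > 0" "M \<ge> m" "M \<ge> m'" using m by (auto simp: M_def)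
      ultimately show ?thesis using m(3)[of M] m'(3)[of M] by blast
    qed
  qed
  then obtain M A B where M: "M > 0" and A: "(\<lambda>k. d k / M ^ k) \<longlonglongrightarrow> A"
    and B: "(\<lambda>k. e k / M ^ k) \<longlonglongrightarrow> B" and AB: "A \<noteq> 0 \<or> B \<noteq> 0" by blast
  have de: "d k = (- 1) ^ k * e k" if "k \<ge> 2" for k
  proof -
    have "d k + (- 1) ^ (k - 1) * e k = 0"
      using eq[OF that] by (simp add: thoma_moment_def d_def e_def algebra_simps)
    moreover have "(- 1) ^ k = - ((- 1) ^ (k - 1) :: real)"
      using that by (cases k) auto
    ultimately show ?thesis by simp
  qed
  \<comment> \<open>Even and odd exponents, starting at 2 and 3 because the moments are only
    compared from \<open>k = 2\<close> on.\<close>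
  have "strict_mono (\<lambda>k::nat. 2 * k + 2)" "strict_mono (\<lambda>k::nat. 2 * k + 3)"
    by (simp_all add: strict_mono_def)
  note sub = LIMSEQ_subseq_LIMSEQ[OF A this(1)] LIMSEQ_subseq_LIMSEQ[OF A this(2)]
    LIMSEQ_subseq_LIMSEQ[OF B this(1)] LIMSEQ_subseq_LIMSEQ[OF B this(2)]
  have "(\<lambda>k. e (2 * k + 2) / M ^ (2 * k + 2)) \<longlonglongrightarrow> A"
    using sub(1) by (simp add: o_def de)
  then have "A = B" using sub(3) LIMSEQ_unique by (auto simp: o_def)
  have "(\<lambda>k. - (e (2 * k + 3) / M ^ (2 * k + 3))) \<longlonglongrightarrow> A"
    using sub(2) by (simp add: o_def de)
  moreover have "(\<lambda>k. - (e (2 * k + 3) / M ^ (2 * k + 3))) \<longlonglongrightarrow> - B"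
    using tendsto_minus[OF sub(4)] by (simp add: o_def)
  ultimately have "A = - B" using LIMSEQ_unique by blast
  then show False using \<open>A = B\<close> AB by simp
qed

section \<open>Averaged operators\<close>

context semi_ip
begin

lemma average_nrm_le:
  assumes h: "\<And>i. i \<in> I \<Longrightarrow> h i \<in> H" "\<And>i. i \<in> I \<Longrightarrow> nrm (h i) \<le> b" and I: "finite I" "card I > 0"
  shows "nrm (smul (1 / of_nat (card I)) (\<Sum>i\<in>I. h i)) \<le> b"
proof -
  have "nrm (\<Sum>i\<in>I. h i) \<le> (\<Sum>i\<in>I. nrm (h i))" by (rule nrm_sum[OF h(1)])
  also have "\<dots> \<le> (\<Sum>i\<in>I. b)" by (intro sum_mono h(2))
  finally have *: "nrm (\<Sum>i\<in>I. h i) \<le> real (card I) * b" by simp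
  have "nrm (smul (1 / of_nat (card I)) (\<Sum>i\<in>I. h i)) = 1 / real (card I) * nrm (\<Sum>i\<in>I. h i)"
    using nrm_smul[OF sum_mem[of I h, OF h(1)], of "1 / of_nat (card I)"] by (simp add: norm_divide)
  then show ?thesis using * I by (simp add: field_simps)
qed

lemma average_orthogonal:
  assumes h: "\<And>i. i \<in> I \<Longrightarrow> h i \<in> H" "\<And>i. i \<in> I \<Longrightarrow> (nrm (h i))\<^sup>2 \<le> b"
    and orth: "\<And>i j. i \<in> I \<Longrightarrow> j \<in> I \<Longrightarrow> i \<noteq> j \<Longrightarrow> ip (h i) (h j) = 0"
    and I: "finite I" "card I > 0"
  shows "(nrm (smul (1 / of_nat (card I)) (\<Sum>i\<in>I. h i)))\<^sup>2 \<le> b / real (card I)"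
proof -
  have m: "(\<Sum>i\<in>I. h i) \<in> H" by (rule sum_mem[OF h(1)])
  have "ip (\<Sum>i\<in>I. h i) (\<Sum>i\<in>I. h i) = (\<Sum>i\<in>I. ip (h i) (\<Sum>i\<in>I. h i))"
    by (rule ip_sum_left[OF h(1) m])
  also have "\<dots> = (\<Sum>i\<in>I. \<Sum>j\<in>I. ip (h i) (h j))"
    by (intro sum.cong refl ip_sum_right h(1))
  also have "\<dots> = (\<Sum>i\<in>I. \<Sum>j\<in>I. if j = i then ip (h i) (h i) else 0)"
    using orth by (intro sum.cong refl) auto
  also have "\<dots> = (\<Sum>i\<in>I. ip (h i) (h i))"
    using I by (simp add: sum.delta)
  finally have "(nrm (\<Sum>i\<in>I. h i))\<^sup>2 = (\<Sum>i\<in>I. (nrm (h i))\<^sup>2)"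
    using m h(1) by (simp add: nrm_sq)
  also have "\<dots> \<le> (\<Sum>i\<in>I. b)" by (intro sum_mono h(2))
  finally have *: "(nrm (\<Sum>i\<in>I. h i))\<^sup>2 \<le> real (card I) * b" by simp
  have "nrm (smul (1 / of_nat (card I)) (\<Sum>i\<in>I. h i)) = 1 / real (card I) * nrm (\<Sum>i\<in>I. h i)"
    using nrm_smul[OF m, of "1 / of_nat (card I)"] by (simp add: norm_divide)
  then have "(nrm (smul (1 / of_nat (card I)) (\<Sum>i\<in>I. h i)))\<^sup>2 = (nrm (\<Sum>i\<in>I. h i))\<^sup>2 / (real (card I))\<^sup>2"
    by (simp add: power_divide)
  also have "\<dots> \<le> (real (card I) * b) / (real (card I))\<^sup>2"
    by (intro divide_right_mono *) simp
  also have "\<dots> = b / real (card I)"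
    using I by (simp add: power2_eq_square)
  finally show ?thesis .
qed

text \<open>A weak law of large numbers: the differences of the \<open>f i\<close> and
  \<open>p\<close> times \<open>e\<close> are pairwise orthogonal, since the covariance
  \<open>p^2 * b\<close> is exactly that of the mean, so averaging divides the variance by the
  number of terms.\<close>

lemma average_correlated:
  assumes f: "\<And>i. i \<in> I \<Longrightarrow> f i \<in> H" "\<And>i. i \<in> I \<Longrightarrow> ip (f i) (f i) = of_real b" and e: "e \<in> H" "ip e e = of_real b"
    and fe: "\<And>i. i \<in> I \<Longrightarrow> ip (f i) e = of_real (p * b)"
    and ff: "\<And>i j. i \<in> I \<Longrightarrow> j \<in> I \<Longrightarrow> i \<noteq> j \<Longrightarrow> ip (f i) (f j) = of_real (p\<^sup>2 * b)"
    and I: "finite I" "card I > 0"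
  shows "(nrm (smul (1 / of_nat (card I)) (\<Sum>i\<in>I. f i) - smul (of_real p) e))\<^sup>2 \<le> b / real (card I)"
proof -
  define h where "h i = f i - smul (of_real p) e" for i
  have ef: "ip e (f i) = of_real (p * b)" if "i \<in> I" for i
    using ip_sym[OF f(1)[OF that] e(1)] fe[OF that] by simp
  have b: "b \<ge> 0" using ip_nonneg[OF e(1)] e(2) by simp
  have hip: "ip (h i) (h j) = ip (f i) (f j) - of_real (p\<^sup>2 * b)" if "i \<in> I" "j \<in> I" for i j
    using that f(1) e fe ef
    by (simp add: h_def ip_diff_left ip_diff_right ip_smul_left ip_smul_right power2_eq_square)
  have "(\<Sum>i\<in>I. h i) = (\<Sum>i\<in>I. f i) - smul (of_nat (card I) * of_real p) e"
    by (simp add: h_def sum_subtractf fun_eq_iff sum_fun_apply)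
  then have eq: "smul (1 / of_nat (card I)) (\<Sum>i\<in>I. f i) - smul (of_real p) e = smul (1 / of_nat (card I)) (\<Sum>i\<in>I. h i)"
    using I by (auto simp: smul_diff)
  show ?thesis
    unfolding eq
  proof (rule average_orthogonal)
    fix i assume i: "i \<in> I"
    then show hi: "h i \<in> H" using f e by (auto simp: h_def)
    have "(nrm (h i))\<^sup>2 = b - p\<^sup>2 * b"
      using hip[OF i i] f(2)[OF i] nrm_sq[OF hi] by simp
    then show "(nrm (h i))\<^sup>2 \<le> b" using b by simp
  qed (use hip ff I in auto)
qed

end

section \<open>Vectors annihilated in the limit\<close>

lemma thoma_moment_le_1:
  assumes T: "thoma_params \<alpha> \<beta>" and k: "k \<ge> 1"
  shows "\<bar>thoma_moment \<alpha> \<beta> k\<bar> \<le> 1"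
proof -
  have s: "summable \<alpha>" "summable \<beta>" "\<And>i. 0 \<le> \<alpha> i" "\<And>i. 0 \<le> \<beta> i" "(\<Sum>i. \<alpha> i) + (\<Sum>i. \<beta> i) \<le> 1"
    using T by (auto simp: thoma_params_def)
  have pw: "x ^ k \<le> x" if "0 \<le> x" "x \<le> 1" for x :: real
    using power_decreasing[of 1 k x] that k by simp
  have sk: "summable (\<lambda>i. \<alpha> i ^ k)" "summable (\<lambda>i. \<beta> i ^ k)"
    using s k thoma_params_le_1[OF T] by (intro summable_power_le_1; simp)+
  have "(\<Sum>i. \<alpha> i ^ k) \<le> (\<Sum>i. \<alpha> i)" "(\<Sum>i. \<beta> i ^ k) \<le> (\<Sum>i. \<beta> i)"
    using s sk pw thoma_params_le_1[OF T] by (intro suminf_le; simp)+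
  moreover have "0 \<le> (\<Sum>i. \<alpha> i ^ k)" "0 \<le> (\<Sum>i. \<beta> i ^ k)"
    using s sk by (intro suminf_nonneg; simp)+
  moreover have "\<bar>(- 1) ^ (k - 1) * (\<Sum>i. \<beta> i ^ k)\<bar> = \<bar>\<Sum>i. \<beta> i ^ k\<bar>"
    by (simp add: abs_mult power_abs)
  ultimately show ?thesis
    using s(5) abs_triangle_ineq[of "\<Sum>i. \<alpha> i ^ k" "(- 1) ^ (k - 1) * (\<Sum>i. \<beta> i ^ k)"]
    unfolding thoma_moment_def by linarith
qed

locale thoma_gns =
  fixes \<alpha> \<beta> :: "nat \<Rightarrow> real" and n :: nat
  assumes T: "thoma_params \<alpha> \<beta>"

sublocale thoma_gns \<subseteq> gns_data "Scofin n" "thoma_character \<alpha> \<beta>"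
proof (intro gns_data.intro gns_data_axioms.intro finsym_perm_group)
  fix F and f :: "(nat \<Rightarrow> nat) \<Rightarrow> complex" assume "finite F" "F \<subseteq> Scofin n"
  then show "0 \<le> Re (\<Sum>s\<in>F. \<Sum>t\<in>F. f s * cnj (f t) * thoma_character \<alpha> \<beta> (inv t \<circ> s))"
    by (rule thoma_posdef[OF T])
next
  fix s assume "s \<in> Scofin n"
  then show "thoma_character \<alpha> \<beta> (inv s) = cnj (thoma_character \<alpha> \<beta> s)"
    by (simp add: thoma_inv finsym_permutation thoma_cnj)
qed

context thoma_gns
begin

abbreviation "H \<equiv> hspace R"
abbreviation "ip \<equiv> inprod R"
abbreviation "chi \<equiv> thoma_character \<alpha> \<beta>"

text \<open>The character is a class function, so \<open>g\<close> drops out: group elements acting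
  from the left are correlated at every \<open>vec g\<close> in the same way as at the cyclic
  vector.\<close>

lemma ip_left_vec:
  assumes "s \<in> Scofin n" "t \<in> Scofin n" "g \<in> Scofin n"
  shows "ip (vec (s \<circ> g)) (vec (t \<circ> g)) = chi (inv t \<circ> s)"
proof -
  have "ip (vec (s \<circ> g)) (vec (t \<circ> g)) = chi (inv (t \<circ> g) \<circ> (s \<circ> g))"
    using assms by (intro ip_vec) auto
  also have "inv (t \<circ> g) \<circ> (s \<circ> g) = inv g \<circ> (inv t \<circ> s) \<circ> inv (inv g)"
    using assms by (simp add: inv_distrib o_assoc)
  also have "chi \<dots> = chi (inv t \<circ> s)"
    using assms by (intro thoma_conj bij_mem inv_mem)
  finally show ?thesis .
qed

lemma ip_left_vec_id:
  assumes "s \<in> Scofin n" "g \<in> Scofin n"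
  shows "ip (vec (s \<circ> g)) (vec g) = chi s"
  using ip_left_vec[OF assms(1) id_mem assms(2)] by (simp add: inv_id)

lemma vec_unit: "g \<in> Scofin n \<Longrightarrow> ip (vec g) (vec g) = 1"
  using ip_left_vec_id[of id g] by (simp add: thoma_id)

lemma eq_0I: "u \<in> H \<Longrightarrow> (\<And>g. g \<in> Scofin n \<Longrightarrow> ip u (vec g) = 0) \<Longrightarrow> u = 0"
  using eval[of u] eval_out[of u] by (auto simp: fun_eq_iff)

lemma chi_disjoint_cycles:
  assumes s: "cyclic_on s D" "s permutes D" "card D = l" and t: "cyclic_on t D'" "t permutes D'" "card D' = l"
    and l: "l \<ge> 2" and disj: "D \<inter> D' = {}"
  shows "chi (s \<circ> t) = of_real ((thoma_moment \<alpha> \<beta> l)\<^sup>2)"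
proof -
  have fin: "finite D" "finite D'" using s t l by (auto intro: card_ge_0_finite)
  have "chi (s \<circ> t) = chi s * chi t"
    using s t fin disj by (intro thoma_comp[of _ D _ D'])
  also have "chi s = of_real (thoma_moment \<alpha> \<beta> l)" using thoma_cyclic[OF s(1,2)] s(3) l by simp
  also have "chi t = of_real (thoma_moment \<alpha> \<beta> l)" using thoma_cyclic[OF t(1,2)] t(3) l by simp
  finally show ?thesis by (simp only: power2_eq_square of_real_mult)
qed

lemma cyclic_on_inv:
  fixes s :: "nat \<Rightarrow> nat"
  assumes "cyclic_on s D" "s permutes D" "finite D"
  shows "cyclic_on (inv s) D" "inv s permutes D"
proof -
  have "permutation s" using assms permutation_permutes by blast
  then show "cyclic_on (inv s) D"
    using assms(1) orbit_inv_eq[of s] by (simp add: cyclic_on_def)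
  show "inv s permutes D" using assms(2) by (rule permutes_inv)
qed

text \<open>The adjoint averages tend in norm to \<open>p\<close> at every \<open>vec g\<close>, so
  the averages of \<open>u\<close> tend weakly to \<open>p\<close> times \<open>u\<close>. They also
  tend in norm to \<open>z\<close> times \<open>u\<close>, and some \<open>vec g\<close> detects a
  nonzero \<open>u\<close>.\<close>

lemma cycle_average_limit:
  fixes s :: "nat \<Rightarrow> nat \<Rightarrow> nat \<Rightarrow> nat"
  assumes s: "\<And>k i. s k i \<in> Scofin n" "\<And>k i. cyclic_on (s k i) (D k i)" "\<And>k i. s k i permutes D k i"
    "\<And>k i. card (D k i) = l" and l: "l \<ge> 2" and disj: "\<And>k i j. i \<noteq> j \<Longrightarrow> D k i \<inter> D k j = {}"
    and N: "filterlim N at_top sequentially"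
    and u: "u \<in> H" "u \<noteq> 0"
    and lim: "(\<lambda>k. U.nrm (smul (1 / of_nat (N k)) (\<Sum>i<N k. act R (s k i) u) - smul z u)) \<longlonglongrightarrow> 0"
  shows "z = of_real (thoma_moment \<alpha> \<beta> l)"
proof -
  define p where "p = thoma_moment \<alpha> \<beta> l"
  have finD: "finite (D k i)" for k i using s(4)[of k i] l by (intro card_ge_0_finite) auto
  have su: "act R (s k i) u \<in> H" for k i using s u by auto
  have "\<exists>g\<in>Scofin n. ip u (vec g) \<noteq> 0" using eq_0I u by blast
  then obtain g where g: "g \<in> Scofin n" "ip u (vec g) \<noteq> 0" by blast
  \<comment> \<open>Inverses of the cycles appear because the average is moved to the other side of
    the inner product.\<close>
  define f where "f k i = vec (inv (s k i) \<circ> g)" for k i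
  have fH: "f k i \<in> H" for k i unfolding f_def using s g by (intro vec_mem) auto
  have cyc: "cyclic_on (inv (s k i)) (D k i)" "inv (s k i) permutes D k i" for k i
    using cyclic_on_inv[OF s(2,3) finD] by auto
  have near: "(U.nrm (smul (1 / of_nat (N k)) (\<Sum>i<N k. f k i) - smul (of_real p) (vec g)))\<^sup>2 \<le> 1 / real (N k)"
    if k: "N k > 0" for k
  proof -
    have "(U.nrm (smul (1 / of_nat (card {..<N k})) (\<Sum>i\<in>{..<N k}. f k i) - smul (of_real p) (vec g)))\<^sup>2
      \<le> 1 / real (card {..<N k})"
    proof (rule U.average_correlated)
      fix i
      show "f k i \<in> H" by (rule fH)
      show "ip (f k i) (f k i) = of_real 1"
        unfolding f_def using s g by (simp add: vec_unit)
      have "ip (f k i) (vec g) = chi (inv (s k i))"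
        unfolding f_def using s g by (intro ip_left_vec_id) auto
      also have "\<dots> = of_real p" using thoma_cyclic[OF cyc] s(4) l by (simp add: p_def)
      finally show "ip (f k i) (vec g) = of_real (p * 1)" by simp
      fix j assume ij: "i \<noteq> j"
      have "ip (f k i) (f k j) = chi (inv (inv (s k j)) \<circ> inv (s k i))"
        unfolding f_def using s g by (intro ip_left_vec) auto
      also have "inv (inv (s k j)) = s k j" using s by simp
      also have "chi (s k j \<circ> inv (s k i)) = of_real (p\<^sup>2)"
        unfolding p_def using s cyc l disj[of j i k] ij
        by (intro chi_disjoint_cycles[of _ "D k j" _ _ "D k i"]) auto
      finally show "ip (f k i) (f k j) = of_real (p\<^sup>2 * 1)" by simp
    qed (use g k in \<open>auto simp: vec_unit vec_mem\<close>)
    then show ?thesis by simp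
  qed
  define A where "A k = smul (1 / of_nat (N k)) (\<Sum>i<N k. act R (s k i) u) - smul z u" for k
  define B where "B k = smul (1 / of_nat (N k)) (\<Sum>i<N k. f k i) - smul (of_real p) (vec g)" for k
  have vg: "vec g \<in> H" using g by (simp add: vec_mem)
  have sumH: "(\<Sum>i<N k. act R (s k i) u) \<in> H" "(\<Sum>i<N k. f k i) \<in> H" for k
    using su fH by (auto intro: U.sum_mem)
  have AH: "A k \<in> H" and BH: "B k \<in> H" for k
    unfolding A_def B_def using u vg sumH by auto
  \<comment> \<open>Moving the average across leaves a constant on the left, while both terms on the
    right tend to 0 with the norms of \<open>A k\<close> and \<open>B k\<close>.\<close>
  have key: "(of_real p - z) * ip u (vec g) = ip (A k) (vec g) - ip u (B k)" for k
  proof -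
    have "ip (act R (s k i) u) (vec g) = ip u (f k i)" for i
      using s u vg g by (simp add: U.act_inv act_vec f_def)
    then have "ip (\<Sum>i<N k. act R (s k i) u) (vec g) = ip u (\<Sum>i<N k. f k i)"
      using su fH u vg by (simp add: U.ip_sum_left U.ip_sum_right)
    then have "ip (A k) (vec g) - ip u (B k) = - z * ip u (vec g) + of_real p * ip u (vec g)"
      using sumH u vg by (simp add: A_def B_def U.ip_diff_left U.ip_diff_right U.ip_smul_left U.ip_smul_right)
    then show ?thesis by (simp add: algebra_simps)
  qed
  have "(\<lambda>k. U.nrm (A k) * U.nrm (vec g) + U.nrm u * sqrt (1 / real (N k))) \<longlonglongrightarrow> 0 * U.nrm (vec g) + U.nrm u * sqrt 0"
  proof (intro tendsto_add tendsto_mult tendsto_const tendsto_real_sqrt)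
    show "(\<lambda>k. U.nrm (A k)) \<longlonglongrightarrow> 0" using lim by (simp add: A_def)
    have "filterlim (\<lambda>k. real (N k)) at_top sequentially"
      using N filterlim_real_sequentially by (rule filterlim_compose[rotated])
    then show "(\<lambda>k. 1 / real (N k)) \<longlonglongrightarrow> 0"
      by (intro tendsto_divide_0[OF tendsto_const] filterlim_at_top_imp_at_infinity)
  qed
  then have "(\<lambda>k. U.nrm (A k) * U.nrm (vec g) + U.nrm u * sqrt (1 / real (N k))) \<longlonglongrightarrow> 0" by simp
  moreover have "\<forall>\<^sub>F k in sequentially. cmod ((of_real p - z) * ip u (vec g))
      \<le> U.nrm (A k) * U.nrm (vec g) + U.nrm u * sqrt (1 / real (N k))"
    using filterlim_at_top[THEN iffD1, OF N, rule_format, of 1]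
  proof eventually_elim
    case (elim k)
    have "U.nrm (B k) \<le> sqrt (1 / real (N k))"
      using near[of k] elim by (intro real_le_rsqrt) (simp add: B_def)
    then have "U.nrm u * U.nrm (B k) \<le> U.nrm u * sqrt (1 / real (N k))"
      using u by (intro mult_left_mono) auto
    moreover have "cmod (ip (A k) (vec g)) \<le> U.nrm (A k) * U.nrm (vec g)"
      by (rule U.cauchy_schwarz[OF AH vg])
    moreover have "cmod (ip u (B k)) \<le> U.nrm u * U.nrm (B k)"
      by (rule U.cauchy_schwarz[OF u(1) BH])
    ultimately show ?case
      unfolding key[of k] using norm_triangle_ineq4[of "ip (A k) (vec g)" "ip u (B k)"] by linarith
  qed
  ultimately have "cmod ((of_real p - z) * ip u (vec g)) \<le> 0"
    by (intro tendsto_lowerbound) auto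
  then show ?thesis using g by (simp add: p_def)
qed

end

section \<open>Averaged stars of transpositions\<close>

text \<open>\<open>Y\<close> is a finite approximation of the Okounkov operator of the point \<open>b\<close>, whose spectral measure at
  the cyclic vector is \<open>\<Sum>i. \<alpha> i \<cdot> \<delta>(\<alpha> i) + \<beta> i \<cdot> \<delta>(-\<beta> i)\<close>. It has no atom at 0 exactly if the parameters
  sum to 1, which makes the limit operator injective.\<close>

locale star_average = thoma_gns +
  fixes b :: nat and B :: "nat set"
  assumes b: "n < b" and B: "finite B" "B \<subseteq> {n<..}" "b \<notin> B" "B \<noteq> {}"
    and full: "(\<Sum>i. \<alpha> i) + (\<Sum>i. \<beta> i) = 1"
begin

definition Y :: "((nat \<Rightarrow> nat) \<Rightarrow> complex) \<Rightarrow> (nat \<Rightarrow> nat) \<Rightarrow> complex" where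
  "Y v = smul (1 / of_nat (card B)) (\<Sum>j\<in>B. act R (swp b j) v)"

lemma card_pos: "card B > 0"
  using B by (simp add: card_gt_0_iff)

lemma swp_mem: "j \<in> B \<Longrightarrow> swp b j \<in> Scofin n"
proof -
  assume "j \<in> B"
  then have "swp b j permutes {n<..}" using b B by (intro permutes_swap_id) auto
  moreover have "finite {i. swp b j i \<noteq> i}"
    by (rule finite_subset[of _ "{b, j}"]) (auto simp: Transposition.transpose_def)
  ultimately show ?thesis by (simp add: finsym_def)
qed

lemma sum_act_mem: "v \<in> H \<Longrightarrow> (\<Sum>j\<in>B. act R (swp b j) v) \<in> H"
  by (intro U.sum_mem U.act_mem swp_mem)

lemma Y_mem: "v \<in> H \<Longrightarrow> Y v \<in> H"
  unfolding Y_def by (intro U.smul_mem sum_act_mem)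

lemma Y_add: "u \<in> H \<Longrightarrow> v \<in> H \<Longrightarrow> Y (u + v) = Y u + Y v"
  by (simp add: Y_def U.act_add swp_mem sum.distrib smul_add)

lemma smul_sum: "smul c (\<Sum>i\<in>I. f i) = (\<Sum>i\<in>I. smul c (f i))"
  by (simp add: fun_eq_iff sum_fun_apply sum_distrib_left)

lemma Y_smul: "v \<in> H \<Longrightarrow> Y (smul c v) = smul c (Y v)"
proof -
  assume v: "v \<in> H"
  have "(\<Sum>j\<in>B. act R (swp b j) (smul c v)) = (\<Sum>j\<in>B. smul c (act R (swp b j) v))"
    using v by (intro sum.cong refl U.act_smul swp_mem)
  then show ?thesis by (simp add: Y_def smul_sum[symmetric] mult.commute)
qed

lemma Y_diff: "u \<in> H \<Longrightarrow> v \<in> H \<Longrightarrow> Y (u - v) = Y u - Y v"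
  using Y_add[of u "smul (-1) v"] Y_smul[of v "-1"] by (simp add: smul_minus_one)

lemma Y_adj: "u \<in> H \<Longrightarrow> v \<in> H \<Longrightarrow> ip (Y u) v = ip u (Y v)"
proof -
  assume u: "u \<in> H" and v: "v \<in> H"
  have m: "act R (swp b j) u \<in> H" "act R (swp b j) v \<in> H" if "j \<in> B" for j
    using u v swp_mem[OF that] by auto
  have "ip (\<Sum>j\<in>B. act R (swp b j) u) v = (\<Sum>j\<in>B. ip (act R (swp b j) u) v)"
    by (rule U.ip_sum_left[OF m(1) v])
  also have "\<dots> = (\<Sum>j\<in>B. ip u (act R (swp b j) v))"
    using u v by (intro sum.cong refl) (simp add: U.act_inv swp_mem)
  also have "\<dots> = ip u (\<Sum>j\<in>B. act R (swp b j) v)"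
    by (rule U.ip_sum_right[OF m(2) u, symmetric])
  finally show ?thesis
    using u v sum_act_mem by (simp add: Y_def U.ip_smul_left U.ip_smul_right)
qed

lemma Y_contr: "v \<in> H \<Longrightarrow> U.nrm (Y v) \<le> U.nrm v"
  unfolding Y_def using B card_pos by (intro U.average_nrm_le) (auto simp: swp_mem U.act_nrm)

lemma Ypow_mem: "v \<in> H \<Longrightarrow> (Y ^^ m) v \<in> H"
  by (induction m) (auto simp: Y_mem)

lemma Ypow_smul: "v \<in> H \<Longrightarrow> (Y ^^ m) (smul c v) = smul c ((Y ^^ m) v)"
  by (induction m) (auto simp: Y_smul Ypow_mem)

lemma Ypow_add: "u \<in> H \<Longrightarrow> v \<in> H \<Longrightarrow> (Y ^^ m) (u + v) = (Y ^^ m) u + (Y ^^ m) v"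
proof (induction m)
  case (Suc m)
  then have e: "(Y ^^ m) (u + v) = (Y ^^ m) u + (Y ^^ m) v" by blast
  show ?case
    unfolding funpow.simps o_apply e using Suc.prems by (intro Y_add Ypow_mem)
qed simp

lemma Ypow_zero: "(Y ^^ m) 0 = 0"
  using Ypow_smul[of 0 m 0] by simp

lemma Ypow_sum:
  assumes "finite I" "\<And>i. i \<in> I \<Longrightarrow> f i \<in> H"
  shows "(Y ^^ m) (\<Sum>i\<in>I. f i) = (\<Sum>i\<in>I. (Y ^^ m) (f i))"
  using assms
proof (induction I rule: finite_induct)
  case (insert i I)
  have "(Y ^^ m) (f i + (\<Sum>i\<in>I. f i)) = (Y ^^ m) (f i) + (Y ^^ m) (\<Sum>i\<in>I. f i)"
    using insert by (intro Ypow_add U.sum_mem) auto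
  also have "(Y ^^ m) (\<Sum>i\<in>I. f i) = (\<Sum>i\<in>I. (Y ^^ m) (f i))"
    using insert by simp
  finally show ?case by (simp only: sum.insert[OF insert(1,2)])
qed (simp add: Ypow_zero)

lemma Ypow_contr: "v \<in> H \<Longrightarrow> U.nrm ((Y ^^ m) v) \<le> U.nrm v"
proof (induction m)
  case (Suc m)
  then show ?case using Y_contr[OF Ypow_mem[OF Suc.prems, of m]] by simp
qed simp

abbreviation "p \<equiv> thoma_moment \<alpha> \<beta>"

text \<open>For a single point the equation says \<open>p 1 = 1\<close>, which is the assumption
  \<open>full\<close>.\<close>

lemma chi_cycle:
  assumes "cyclic_on c D" "c permutes D"
  shows "chi c = of_real (p (card D))"
proof (cases "card D \<ge> 2")
  case True
  then show ?thesis using thoma_cyclic assms by blast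
next
  case False
  have "D \<noteq> {}" using assms(1) by (auto simp: cyclic_on_alldef)
  moreover have "finite D" using assms(1) by (rule finite_cyclic_on)
  ultimately have "card D \<noteq> 0" by simp
  then have c1: "card D = 1" using False by linarith
  then obtain x where "D = {x}" by (rule card_1_singletonE)
  then have "c = id" using assms(2) by simp
  then show ?thesis using full c1 by (simp add: thoma_id thoma_moment_def)
qed

lemma nrm_vec: "g \<in> Scofin n \<Longrightarrow> U.nrm (vec g) = 1"
  using vec_unit[of g] by (simp add: U.nrm_def)

lemma finsym_finite_permutes: "c permutes D \<Longrightarrow> finite D \<Longrightarrow> D \<subseteq> {n<..} \<Longrightarrow> c \<in> Scofin n"
  by (auto simp: finsym_def intro: permutes_subset finite_moved)

text \<open>Multiplying the cycle \<open>c\<close> by \<open>(b j)\<close> yields a cycle with one more point, except for the few \<open>j\<close>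
  that already lie on \<open>c\<close>.\<close>

lemma star_moment:
  assumes "cyclic_on c (insert b J)" "c permutes insert b J" "J \<subseteq> B" "g \<in> Scofin n"
  shows "cmod (ip ((Y ^^ m) (vec (c \<circ> g))) (vec g) - of_real (p (m + Suc (card J))))
    \<le> real (2 * m * (card J + m)) / real (card B)"
  using assms
proof (induction m arbitrary: c J)
  case 0
  have fin: "finite J" using 0 B finite_subset by blast
  have "b \<notin> J" using 0 B by auto
  have "c \<in> Scofin n" using 0 fin B b by (intro finsym_finite_permutes[of c "insert b J"]) auto
  then have "ip (vec (c \<circ> g)) (vec g) = chi c" using 0 by (intro ip_left_vec_id)
  also have "\<dots> = of_real (p (card (insert b J)))" by (rule chi_cycle[OF 0(1,2)])
  finally have e: "ip (vec (c \<circ> g)) (vec g) = of_real (p (card (insert b J)))" .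
  show ?case
    unfolding funpow_0 e using fin \<open>b \<notin> J\<close> by simp
next
  case (Suc m)
  let ?N = "real (card B)"
  have fin: "finite J" using Suc B finite_subset by blast
  have bJ: "b \<notin> J" using Suc B by auto
  have cS: "c \<in> Scofin n" using Suc fin B b by (intro finsym_finite_permutes[of c "insert b J"]) auto
  have cg: "c \<circ> g \<in> Scofin n" using cS Suc by auto
  have vecj: "vec ((swp b j \<circ> c) \<circ> g) \<in> H" if "j \<in> B" for j
    using swp_mem[OF that] cS Suc by (intro vec_mem) auto
  define q where "q = p (Suc m + Suc (card J))"
  define t where "t j = ip ((Y ^^ m) (vec ((swp b j \<circ> c) \<circ> g))) (vec g)" for j
  have "Y (vec (c \<circ> g)) = smul (1 / of_nat (card B)) (\<Sum>j\<in>B. vec ((swp b j \<circ> c) \<circ> g))"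
    unfolding Y_def o_assoc[symmetric] using cg swp_mem
    by (intro arg_cong[where f = "smul _"] sum.cong refl act_vec)
  then have "(Y ^^ Suc m) (vec (c \<circ> g)) = smul (1 / of_nat (card B)) (\<Sum>j\<in>B. (Y ^^ m) (vec ((swp b j \<circ> c) \<circ> g)))"
    using B vecj by (simp only: funpow_Suc_right o_apply Ypow_smul U.sum_mem Ypow_sum)
  then have ipt: "ip ((Y ^^ Suc m) (vec (c \<circ> g))) (vec g) = (1 / of_nat (card B)) * (\<Sum>j\<in>B. t j)"
    using vecj Suc.prems(4) unfolding t_def
    by (simp only: U.ip_smul_left U.ip_sum_left Ypow_mem U.sum_mem vec_mem)
  have bound: "cmod (t j - of_real q) \<le> real (2 * m * (Suc (card J) + m)) / ?N + (if j \<in> J then 2 else 0)"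
    if j: "j \<in> B" for j
  proof (cases "j \<in> J")
    case False
    then have jn: "j \<notin> insert b J" using j B by auto
    have cyc: "cyclic_on (swp b j \<circ> c) (insert b (insert j J))"
      using cyclic_on_transpose_insert[OF Suc.prems(1,2) _ jn, of b] by (simp add: insert_commute)
    have perm: "(swp b j \<circ> c) permutes (insert b (insert j J))"
      using Suc.prems(2) by (intro permutes_compose permutes_swap_id) (auto intro: permutes_subset)
    have "cmod (ip ((Y ^^ m) (vec ((swp b j \<circ> c) \<circ> g))) (vec g) - of_real (p (m + Suc (card (insert j J)))))
      \<le> real (2 * m * (card (insert j J) + m)) / ?N"
      by (rule Suc.IH[OF cyc perm]) (use j Suc.prems in auto)
    then show ?thesis using False fin by (simp add: t_def q_def)
  next
    case True
    have "cmod (t j) \<le> U.nrm ((Y ^^ m) (vec ((swp b j \<circ> c) \<circ> g))) * U.nrm (vec g)"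
      unfolding t_def by (intro U.cauchy_schwarz Ypow_mem vecj[OF j] vec_mem[OF Suc.prems(4)])
    also have "\<dots> \<le> U.nrm (vec ((swp b j \<circ> c) \<circ> g)) * 1"
      using Ypow_contr[OF vecj[OF j]] Suc.prems by (simp add: nrm_vec)
    also have "U.nrm (vec ((swp b j \<circ> c) \<circ> g)) = 1"
      using swp_mem[OF j] cS Suc.prems(4) by (intro nrm_vec comp_mem)
    finally have "cmod (t j) \<le> 1" by simp
    moreover have "cmod (of_real q) \<le> 1"
      using thoma_moment_le_1[OF T, of "Suc m + Suc (card J)"] unfolding norm_of_real q_def by simp
    ultimately have "cmod (t j - of_real q) \<le> 2"
      using norm_triangle_ineq4[of "t j" "of_real q"] by linarith
    then show ?thesis using True by (simp add: add_increasing)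
  qed
  have "(1 / of_nat (card B)) * (\<Sum>j\<in>B. t j) - of_real q = (1 / of_nat (card B)) * (\<Sum>j\<in>B. t j - of_real q)"
    using card_pos by (simp add: sum_subtractf field_simps)
  then have "cmod ((1 / of_nat (card B)) * (\<Sum>j\<in>B. t j) - of_real q) = cmod (\<Sum>j\<in>B. t j - of_real q) / ?N"
    by (simp add: norm_mult norm_divide)
  also have "\<dots> \<le> (\<Sum>j\<in>B. cmod (t j - of_real q)) / ?N"
    by (intro divide_right_mono norm_sum) simp
  also have "\<dots> \<le> (\<Sum>j\<in>B. real (2 * m * (Suc (card J) + m)) / ?N + (if j \<in> J then 2 else 0)) / ?N"
    using bound by (intro divide_right_mono sum_mono) auto
  also have "(\<Sum>j\<in>B. real (2 * m * (Suc (card J) + m)) / ?N + (if j \<in> J then 2 else 0))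
    = real (2 * m * (Suc (card J) + m)) + 2 * real (card J)"
    using card_pos B Suc.prems(3) by (simp add: sum.distrib sum.If_cases Int_absorb1)
  \<comment> \<open>The induction closes since
    \<open>2 m (|J| + 1 + m) + 2 |J| \<le> 2 (m + 1) (|J| + m + 1)\<close>.\<close>
  also have "\<dots> / ?N \<le> real (2 * Suc m * (card J + Suc m)) / ?N"
    by (intro divide_right_mono) (simp_all add: algebra_simps)
  finally show ?case unfolding ipt q_def .
qed

text \<open>On the spectrum \<open>Q ^^ M\<close> is \<open>(1 - x\<^sup>2) ^ M\<close>: it almost fixes the vectors that \<open>Y\<close> almost kills, but
  tends to 0 at the cyclic vector.\<close>

definition Q :: "((nat \<Rightarrow> nat) \<Rightarrow> complex) \<Rightarrow> (nat \<Rightarrow> nat) \<Rightarrow> complex" where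
  "Q v = v - Y (Y v)"

lemma Q_mem: "v \<in> H \<Longrightarrow> Q v \<in> H"
  unfolding Q_def by (intro U.diff_mem Y_mem)

lemma Qpow_mem: "v \<in> H \<Longrightarrow> (Q ^^ M) v \<in> H"
  by (induction M) (auto simp: Q_mem)

lemma Q_diff: "u \<in> H \<Longrightarrow> v \<in> H \<Longrightarrow> Q (u - v) = Q u - Q v"
  by (simp add: Q_def Y_diff Y_mem)

lemma Qpow_diff: "u \<in> H \<Longrightarrow> v \<in> H \<Longrightarrow> (Q ^^ M) (u - v) = (Q ^^ M) u - (Q ^^ M) v"
proof (induction M)
  case (Suc M)
  then have e: "(Q ^^ M) (u - v) = (Q ^^ M) u - (Q ^^ M) v" by blast
  show ?case
    unfolding funpow.simps o_apply e using Suc.prems by (intro Q_diff Qpow_mem)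
qed simp

lemma Q_adj: "u \<in> H \<Longrightarrow> v \<in> H \<Longrightarrow> ip (Q u) v = ip u (Q v)"
  by (simp add: Q_def U.ip_diff_left U.ip_diff_right Y_mem Y_adj)

lemma Qpow_adj: "u \<in> H \<Longrightarrow> v \<in> H \<Longrightarrow> ip ((Q ^^ M) u) v = ip u ((Q ^^ M) v)"
proof (induction M arbitrary: v)
  case (Suc M)
  have "ip ((Q ^^ Suc M) u) v = ip ((Q ^^ M) u) (Q v)"
    using Suc.prems by (simp add: Q_adj Qpow_mem)
  also have "\<dots> = ip u ((Q ^^ M) (Q v))" using Suc by (simp add: Q_mem)
  finally show ?case by (simp only: funpow_Suc_right o_apply)
qed simp

lemma Q_contr: "v \<in> H \<Longrightarrow> U.nrm (Q v) \<le> U.nrm v"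
proof -
  assume v: "v \<in> H"
  have "ip v (Y (Y v)) = ip (Y v) (Y v)" using v by (simp add: Y_adj Y_mem)
  then have "(U.nrm (Q v))\<^sup>2 = (U.nrm v)\<^sup>2 - 2 * (U.nrm (Y v))\<^sup>2 + (U.nrm (Y (Y v)))\<^sup>2"
    unfolding Q_def using U.nrm_sq_diff[of v "Y (Y v)"] v by (simp add: Y_mem U.nrm_sq[of "Y v"])
  moreover have "(U.nrm (Y (Y v)))\<^sup>2 \<le> (U.nrm (Y v))\<^sup>2"
    using v by (intro power_mono Y_contr Y_mem U.nrm_nonneg)
  moreover have "0 \<le> (U.nrm (Y v))\<^sup>2" by simp
  ultimately have "(U.nrm (Q v))\<^sup>2 \<le> (U.nrm v)\<^sup>2" by linarith
  then show ?thesis by (rule power2_le_imp_le) (use v in simp)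
qed

lemma Qpow_contr: "v \<in> H \<Longrightarrow> U.nrm ((Q ^^ M) v) \<le> U.nrm v"
proof (induction M)
  case (Suc M)
  then show ?case using Q_contr[OF Qpow_mem[OF Suc.prems, of M]] by simp
qed simp

lemma Y_Qpow: "v \<in> H \<Longrightarrow> Y ((Q ^^ M) v) = (Q ^^ M) (Y v)"
proof (induction M)
  case (Suc M)
  have "Y (Q ((Q ^^ M) v)) = Q (Y ((Q ^^ M) v))"
    using Suc.prems by (simp add: Q_def Y_diff Y_mem Qpow_mem)
  then show ?case using Suc by simp
qed simp

text \<open>Each further factor \<open>Q\<close> changes the vector by
  \<open>Y (Y ((Q ^^ M) v))\<close>. As \<open>Y\<close> commutes with \<open>Q\<close> and both are
  contractions, this change is at most \<open>U.nrm (Y v)\<close>.\<close>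

lemma Qpow_close: "v \<in> H \<Longrightarrow> U.nrm (v - (Q ^^ M) v) \<le> real M * U.nrm (Y v)"
proof (induction M)
  case (Suc M)
  have m: "(Q ^^ M) v \<in> H" using Suc.prems by (rule Qpow_mem)
  have e: "v - (Q ^^ Suc M) v = (v - (Q ^^ M) v) + Y (Y ((Q ^^ M) v))" by (simp add: Q_def)
  have "U.nrm (v - (Q ^^ Suc M) v) \<le> U.nrm (v - (Q ^^ M) v) + U.nrm (Y (Y ((Q ^^ M) v)))"
    unfolding e using Suc.prems m by (intro U.nrm_triangle U.diff_mem Y_mem)
  also have "U.nrm (Y (Y ((Q ^^ M) v))) \<le> U.nrm (Y ((Q ^^ M) v))" using m by (intro Y_contr Y_mem)
  also have "\<dots> = U.nrm ((Q ^^ M) (Y v))" using Suc.prems by (simp add: Y_Qpow)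
  also have "\<dots> \<le> U.nrm (Y v)" using Suc.prems by (intro Qpow_contr Y_mem)
  finally show ?case using Suc by (simp add: algebra_simps)
qed simp

lemma Q_Ypow: "v \<in> H \<Longrightarrow> Q ((Y ^^ m) v) = (Y ^^ m) v - (Y ^^ (m + 2)) v"
  by (simp add: Q_def)

end

section \<open>Limits of the moments and injectivity of the limit operator\<close>

context thoma_gns
begin

text \<open>The integral of \<open>x^m (1 - x^2)^M\<close> against the measure with mass
  \<open>\<alpha> i\<close> at \<open>\<alpha> i\<close> and mass \<open>\<beta> i\<close> at
  \<open>- \<beta> i\<close>.\<close>

definition moment_integral :: "nat \<Rightarrow> nat \<Rightarrow> real" where
  "moment_integral m M = (\<Sum>i. \<alpha> i ^ Suc m * (1 - (\<alpha> i)\<^sup>2) ^ M) + (- 1) ^ m * (\<Sum>i. \<beta> i ^ Suc m * (1 - (\<beta> i)\<^sup>2) ^ M)"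

lemma unit_power_bounds:
  fixes x :: real assumes "0 \<le> x" "x \<le> 1"
  shows "0 \<le> (1 - x\<^sup>2) ^ M" "(1 - x\<^sup>2) ^ M \<le> 1" "x ^ Suc m * (1 - x\<^sup>2) ^ M \<le> x"
proof -
  have x2: "0 \<le> 1 - x\<^sup>2" "1 - x\<^sup>2 \<le> 1" using assms by (auto simp: power_le_one)
  then show 1: "0 \<le> (1 - x\<^sup>2) ^ M" "(1 - x\<^sup>2) ^ M \<le> 1" by (auto intro: power_le_one)
  have "x ^ Suc m * (1 - x\<^sup>2) ^ M \<le> x ^ Suc m * 1" using 1 assms by (intro mult_left_mono) auto
  also have "\<dots> \<le> x" using power_decreasing[of 1 "Suc m" x] assms by simp
  finally show "x ^ Suc m * (1 - x\<^sup>2) ^ M \<le> x" .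
qed

lemma summable_moment:
  fixes a :: "nat \<Rightarrow> real"
  assumes "summable a" "\<And>i. 0 \<le> a i" "\<And>i. a i \<le> 1"
  shows "summable (\<lambda>i. a i ^ Suc m * (1 - (a i)\<^sup>2) ^ M)"
proof (rule summable_comparison_test'[OF assms(1)])
  fix i
  have "0 \<le> a i ^ Suc m * (1 - (a i)\<^sup>2) ^ M"
    using assms unit_power_bounds(1)[of "a i" M] by (intro mult_nonneg_nonneg) auto
  then show "norm (a i ^ Suc m * (1 - (a i)\<^sup>2) ^ M) \<le> a i"
    using unit_power_bounds(3)[where x = "a i" and m = m and M = M, OF assms(2,3)] by simp
qed

lemma moment_integral_0: "moment_integral m 0 = thoma_moment \<alpha> \<beta> (Suc m)"
  by (simp add: moment_integral_def thoma_moment_def)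

text \<open>The counterpart of \<open>Q_Ypow\<close>: the integrals and the inner products obey the
  same recursion in \<open>M\<close>.\<close>

lemma moment_integral_Suc: "moment_integral m (Suc M) = moment_integral m M - moment_integral (m + 2) M"
proof -
  have *: "(\<Sum>i. a i ^ Suc m * (1 - (a i)\<^sup>2) ^ Suc M)
    = (\<Sum>i. a i ^ Suc m * (1 - (a i)\<^sup>2) ^ M) - (\<Sum>i. a i ^ Suc (m + 2) * (1 - (a i)\<^sup>2) ^ M)"
    if "summable a" "\<And>i. 0 \<le> a i" "\<And>i. a i \<le> 1" for a :: "nat \<Rightarrow> real"
    by (subst suminf_diff[OF summable_moment[OF that] summable_moment[OF that]])
      (simp add: algebra_simps power2_eq_square power_add)
  have a: "summable \<alpha>" "summable \<beta>" "\<And>i. 0 \<le> \<alpha> i" "\<And>i. 0 \<le> \<beta> i"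
    using T by (auto simp: thoma_params_def)
  show ?thesis
    unfolding moment_integral_def *[OF a(1,3) thoma_params_le_1(1)[OF T]] *[OF a(2,4) thoma_params_le_1(2)[OF T]]
    by (simp add: algebra_simps)
qed

text \<open>Terms with \<open>a i = 0\<close> vanish through the factor \<open>a i\<close>, the
  others decay geometrically, and the summable sequence \<open>a\<close> dominates all of
  them.\<close>

lemma power_decay:
  fixes a :: "nat \<Rightarrow> real"
  assumes "summable a" "\<And>i. 0 \<le> a i" "\<And>i. a i \<le> 1"
  shows "(\<lambda>M. \<Sum>i. a i ^ Suc 0 * (1 - (a i)\<^sup>2) ^ M) \<longlonglongrightarrow> 0"
proof -
  have lim: "((\<lambda>M. a i ^ Suc 0 * (1 - (a i)\<^sup>2) ^ M) \<longlongrightarrow> 0) sequentially" for i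
  proof (cases "a i = 0")
    case False
    then have "0 < a i" using assms(2)[of i] by simp
    then have "0 < (a i)\<^sup>2" "(a i)\<^sup>2 \<le> 1" using assms(3)[of i] by (auto simp: power_le_one)
    then have "(\<lambda>M. (1 - (a i)\<^sup>2) ^ M) \<longlonglongrightarrow> 0" by (intro LIMSEQ_realpow_zero) auto
    then show ?thesis using tendsto_mult_right_zero by auto
  qed simp
  have bound: "\<forall>\<^sub>F (i, M) in at_top \<times>\<^sub>F sequentially. norm (a i ^ Suc 0 * (1 - (a i)\<^sup>2) ^ M) \<le> a i"
  proof (intro always_eventually, clarify)
    fix i M
    have "0 \<le> a i ^ Suc 0 * (1 - (a i)\<^sup>2) ^ M"
      using assms unit_power_bounds(1)[of "a i" M] by (intro mult_nonneg_nonneg) auto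
    then show "norm (a i ^ Suc 0 * (1 - (a i)\<^sup>2) ^ M) \<le> a i"
      using unit_power_bounds(3)[where x = "a i" and m = 0 and M = M, OF assms(2,3)] by simp
  qed
  show ?thesis using tannerys_theorem[OF lim bound assms(1)] by simp
qed

lemma moment_integral_decay: "(\<lambda>M. moment_integral 0 M) \<longlonglongrightarrow> 0"
proof -
  have a: "summable \<alpha>" "summable \<beta>" "\<And>i. 0 \<le> \<alpha> i" "\<And>i. 0 \<le> \<beta> i"
    using T by (auto simp: thoma_params_def)
  show ?thesis
    unfolding moment_integral_def
    using tendsto_add[OF power_decay[OF a(1,3) thoma_params_le_1(1)[OF T]] power_decay[OF a(2,4) thoma_params_le_1(2)[OF T]]]
    by simp
qed

text \<open>For fixed \<open>M\<close> the vector \<open>u\<close> is nearly fixed by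
  \<open>Q ^^ M\<close> as \<open>k\<close> grows, because \<open>Y u\<close> tends to 0.
  Self-adjointness moves \<open>Q ^^ M\<close> to \<open>vec g\<close>, where its norm has a limit
  that tends to 0 with growing \<open>M\<close>. So \<open>k\<close> goes to infinity first and
  \<open>M\<close> afterwards.\<close>

lemma star_kernel_trivial:
  assumes full: "(\<Sum>i. \<alpha> i) + (\<Sum>i. \<beta> i) = 1"
    and b: "n < b" and B: "\<And>k. finite (B k)" "\<And>k. B k \<subseteq> {n<..}" "\<And>k. b \<notin> B k" "\<And>k. B k \<noteq> {}"
    and N: "filterlim (\<lambda>k. card (B k)) at_top sequentially"
    and u: "u \<in> H"
    and lim: "(\<lambda>k. U.nrm (smul (1 / of_nat (card (B k))) (\<Sum>j\<in>B k. act R (swp b j) u))) \<longlonglongrightarrow> 0"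
  shows "u = 0"
proof (rule eq_0I[OF u])
  fix g assume g: "g \<in> Scofin n"
  have S: "star_average \<alpha> \<beta> n b (B k)" for k
    by unfold_locales (use full b B in auto)
  define Y where "Y k = star_average.Y \<alpha> \<beta> n b (B k)" for k
  define Q where "Q k = star_average.Q \<alpha> \<beta> n b (B k)" for k
  have vg: "vec g \<in> H" using g by (rule vec_mem)
  have Yg: "(Y k ^^ m) (vec g) \<in> H" for k m unfolding Y_def using star_average.Ypow_mem[OF S vg] .
  have Nlim: "filterlim (\<lambda>k. real (card (B k))) at_top sequentially"
    using N filterlim_real_sequentially by (rule filterlim_compose[rotated])
  have mom: "(\<lambda>k. ip ((Y k ^^ m) (vec g)) (vec g)) \<longlonglongrightarrow> of_real (thoma_moment \<alpha> \<beta> (Suc m))" for m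
  proof (rule LIM_zero_cancel, rule Lim_null_comparison[OF always_eventually], rule allI)
    fix k
    have "orbit id b = {b}" by (simp add: orbit_eq_singleton_iff)
    then have "cyclic_on id (insert b {})" by (auto simp: cyclic_on_def)
    from star_average.star_moment[OF S this _ _ g, of k m]
    show "cmod (ip ((Y k ^^ m) (vec g)) (vec g) - of_real (thoma_moment \<alpha> \<beta> (Suc m)))
      \<le> real (2 * m * m) / real (card (B k))"
      by (simp add: Y_def permutes_id)
  next
    show "(\<lambda>k. real (2 * m * m) / real (card (B k))) \<longlonglongrightarrow> 0"
      by (intro tendsto_divide_0[OF tendsto_const] filterlim_at_top_imp_at_infinity Nlim)
  qed
  have momQ: "(\<lambda>k. ip ((Q k ^^ M) ((Y k ^^ m) (vec g))) (vec g)) \<longlonglongrightarrow> of_real (moment_integral m M)" for m M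
  proof (induction M arbitrary: m)
    case 0
    then show ?case using mom[of m] by (simp add: moment_integral_0)
  next
    case (Suc M)
    have "ip ((Q k ^^ Suc M) ((Y k ^^ m) (vec g))) (vec g)
      = ip ((Q k ^^ M) ((Y k ^^ m) (vec g))) (vec g) - ip ((Q k ^^ M) ((Y k ^^ (m + 2)) (vec g))) (vec g)" for k
    proof -
      have "Q k ((Y k ^^ m) (vec g)) = (Y k ^^ m) (vec g) - (Y k ^^ (m + 2)) (vec g)"
        unfolding Q_def Y_def by (rule star_average.Q_Ypow[OF S vg])
      then have "(Q k ^^ Suc M) ((Y k ^^ m) (vec g)) = (Q k ^^ M) ((Y k ^^ m) (vec g) - (Y k ^^ (m + 2)) (vec g))"
        by (simp only: funpow_Suc_right o_apply)
      also have "\<dots> = (Q k ^^ M) ((Y k ^^ m) (vec g)) - (Q k ^^ M) ((Y k ^^ (m + 2)) (vec g))"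
        unfolding Q_def by (rule star_average.Qpow_diff[OF S Yg Yg])
      finally have e: "(Q k ^^ Suc M) ((Y k ^^ m) (vec g)) = (Q k ^^ M) ((Y k ^^ m) (vec g)) - (Q k ^^ M) ((Y k ^^ (m + 2)) (vec g))" .
      have "(Q k ^^ M) ((Y k ^^ l) (vec g)) \<in> H" for l
        unfolding Q_def by (rule star_average.Qpow_mem[OF S Yg])
      then show ?thesis unfolding e using vg by (intro U.ip_diff_left)
    qed
    then show ?case
      unfolding moment_integral_Suc of_real_diff using tendsto_diff[OF Suc[of m] Suc[of "m + 2"]] by simp
  qed
  have Qg: "(Q k ^^ M) (vec g) \<in> H" for k M unfolding Q_def by (rule star_average.Qpow_mem[OF S vg])
  \<comment> \<open>The exponent \<open>M + M\<close> is shared between the two arguments of the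
    inner product, which turns the moment into a squared norm.\<close>
  have Qn: "(\<lambda>k. (U.nrm ((Q k ^^ M) (vec g)))\<^sup>2) \<longlonglongrightarrow> moment_integral 0 (M + M)" for M
  proof -
    have "(\<lambda>k. Re (ip ((Q k ^^ (M + M)) (vec g)) (vec g))) \<longlonglongrightarrow> moment_integral 0 (M + M)"
      using tendsto_Re[OF momQ[of "M + M" 0]] by simp
    moreover have "Re (ip ((Q k ^^ (M + M)) (vec g)) (vec g)) = (U.nrm ((Q k ^^ M) (vec g)))\<^sup>2" for k
    proof -
      have "ip ((Q k ^^ (M + M)) (vec g)) (vec g) = ip ((Q k ^^ M) ((Q k ^^ M) (vec g))) (vec g)"
        by (simp only: funpow_add o_apply)
      also have "\<dots> = ip ((Q k ^^ M) (vec g)) ((Q k ^^ M) (vec g))"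
        unfolding Q_def by (rule star_average.Qpow_adj[OF S star_average.Qpow_mem[OF S vg] vg])
      finally show ?thesis using U.nrm_sq[OF Qg] by simp
    qed
    ultimately show ?thesis by simp
  qed
  have bound: "cmod (ip u (vec g)) \<le> U.nrm u * sqrt (moment_integral 0 (M + M))" for M
  proof (rule tendsto_lowerbound)
    have Ylim: "(\<lambda>k. U.nrm (Y k u)) \<longlonglongrightarrow> 0"
      using lim by (simp add: Y_def star_average.Y_def[OF S])
    have "(\<lambda>k. real M * U.nrm (Y k u) * U.nrm (vec g) + U.nrm u * sqrt ((U.nrm ((Q k ^^ M) (vec g)))\<^sup>2))
      \<longlonglongrightarrow> real M * 0 * U.nrm (vec g) + U.nrm u * sqrt (moment_integral 0 (M + M))"
      by (intro tendsto_add tendsto_mult tendsto_const tendsto_real_sqrt Ylim Qn)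
    then show "(\<lambda>k. real M * U.nrm (Y k u) * U.nrm (vec g) + U.nrm u * U.nrm ((Q k ^^ M) (vec g)))
      \<longlonglongrightarrow> U.nrm u * sqrt (moment_integral 0 (M + M))"
      using Qg by simp
    show "\<forall>\<^sub>F k in sequentially. cmod (ip u (vec g))
      \<le> real M * U.nrm (Y k u) * U.nrm (vec g) + U.nrm u * U.nrm ((Q k ^^ M) (vec g))"
    proof (intro always_eventually allI)
      fix k
      have Qu: "(Q k ^^ M) u \<in> H" unfolding Q_def by (rule star_average.Qpow_mem[OF S u])
      have "ip ((Q k ^^ M) u) (vec g) = ip u ((Q k ^^ M) (vec g))"
        unfolding Q_def by (rule star_average.Qpow_adj[OF S u vg])
      then have "ip u (vec g) = ip (u - (Q k ^^ M) u) (vec g) + ip u ((Q k ^^ M) (vec g))"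
        using u vg Qu by (simp add: U.ip_diff_left)
      then have "cmod (ip u (vec g)) \<le> cmod (ip (u - (Q k ^^ M) u) (vec g)) + cmod (ip u ((Q k ^^ M) (vec g)))"
        by (metis norm_triangle_ineq)
      also have "cmod (ip u ((Q k ^^ M) (vec g))) \<le> U.nrm u * U.nrm ((Q k ^^ M) (vec g))"
        by (rule U.cauchy_schwarz[OF u Qg])
      also have "cmod (ip (u - (Q k ^^ M) u) (vec g)) \<le> U.nrm (u - (Q k ^^ M) u) * U.nrm (vec g)"
        by (rule U.cauchy_schwarz[OF U.diff_mem[OF u Qu] vg])
      also have "U.nrm (u - (Q k ^^ M) u) * U.nrm (vec g) \<le> real M * U.nrm (Y k u) * U.nrm (vec g)"
        unfolding Q_def Y_def
        by (rule mult_right_mono[OF star_average.Qpow_close[OF S u] U.nrm_nonneg[OF vg]])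
      finally show "cmod (ip u (vec g))
        \<le> real M * U.nrm (Y k u) * U.nrm (vec g) + U.nrm u * U.nrm ((Q k ^^ M) (vec g))" by simp
    qed
  qed simp
  have "strict_mono (\<lambda>M::nat. M + M)" by (simp add: strict_mono_def)
  from LIMSEQ_subseq_LIMSEQ[OF moment_integral_decay this]
  have "(\<lambda>M. U.nrm u * sqrt (moment_integral 0 (M + M))) \<longlonglongrightarrow> U.nrm u * sqrt 0"
    by (intro tendsto_mult tendsto_const tendsto_real_sqrt) (simp add: o_def)
  then have "cmod (ip u (vec g)) \<le> U.nrm u * sqrt 0"
    by (rule LIMSEQ_le_const) (use bound in auto)
  then show "ip u (vec g) = 0" by simp
qed

end

section \<open>Amplified deviations of averages\<close>

text \<open>The group algebra element \<open>2 ^ k\<close> times the mean of the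
  \<open>s k i\<close> minus \<open>z\<close>, where the last entry carries the scalar on the
  identity. The squared weight \<open>4 ^ k\<close> is smaller than the number \<open>8 ^ k\<close>
  of terms by a geometric factor.\<close>

definition deviation :: "complex \<Rightarrow> (nat \<Rightarrow> nat \<Rightarrow> 'a \<Rightarrow> 'a) \<Rightarrow> nat \<Rightarrow> (complex \<times> ('a \<Rightarrow> 'a)) list" where
  "deviation z s k = map (\<lambda>i. (2 ^ k / 8 ^ k, s k i)) [0..<8 ^ k] @ [(- (2 ^ k * z), id)]"

definition dev :: "('a \<Rightarrow> 'a, 'x) urep \<Rightarrow> complex \<Rightarrow> (nat \<Rightarrow> nat \<Rightarrow> 'a \<Rightarrow> 'a) \<Rightarrow> nat \<Rightarrow>
    ('x \<Rightarrow> complex) \<Rightarrow> 'x \<Rightarrow> complex" where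
  "dev R z s k v = smul (1 / of_nat (8 ^ k)) (\<Sum>i<8 ^ k. act R (s k i) v) - smul z v"

lemma gact_append: "gact R (xs @ ys) v = gact R xs v + gact R ys v"
  by (induction xs) (auto simp: add.assoc)

lemma gact_map_upt: "gact R (map (\<lambda>i. (c, s i)) [0..<N]) v = smul c (\<Sum>i<N. act R (s i) v)"
  by (induction N) (simp_all add: gact_append fun_eq_iff algebra_simps)

lemma (in unitary_rep) gact_deviation: "v \<in> H \<Longrightarrow> gact R (deviation z s k) v = smul (2 ^ k) (dev R z s k v)"
  by (simp add: deviation_def dev_def gact_append gact_map_upt act_id fun_eq_iff algebra_simps)

lemma (in unitary_rep) dev_mem:
  assumes "v \<in> H" "\<And>k i. s k i \<in> G" shows "dev R z s k v \<in> H"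
  unfolding dev_def using assms by (intro diff_mem smul_mem sum_mem act_mem)

lemma (in unitary_rep) hnorm_gact_deviation:
  assumes "v \<in> H" "\<And>k i. s k i \<in> G"
  shows "hnorm R (gact R (deviation z s k) v) = 2 ^ k * hnorm R (dev R z s k v)"
proof -
  have "dev R z s k v \<in> H" using assms by (rule dev_mem)
  from nrm_smul[OF this, of "2 ^ k"] show ?thesis
    by (simp add: gact_deviation[OF assms(1)] hnorm_nrm norm_power)
qed

lemma (in unitary_rep) ip_act_act:
  "g \<in> G \<Longrightarrow> h \<in> G \<Longrightarrow> u \<in> H \<Longrightarrow> v \<in> H \<Longrightarrow> ip (act R g u) (act R h v) = ip (act R (inv h \<circ> g) u) v"
proof -
  assume a: "g \<in> G" "h \<in> G" "u \<in> H" "v \<in> H"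
  have "ip (act R (inv h) (act R g u)) v = ip (act R g u) (act R (inv (inv h)) v)"
    using a by (intro act_inv) auto
  then show ?thesis using a act_comp[of "inv h" g u] by simp
qed

text \<open>With a constant family the deviation measures invariance under \<open>r\<close>, so
  exact invariance and limits of averages go through one and the same transport.\<close>

lemma dev_const: "dev R 1 (\<lambda>k i. r) k v = act R r v - v"
proof
  fix x
  have "(\<Sum>i<(8::nat) ^ k. act R r v) x = 8 ^ k * act R r v x" unfolding sum_fun_apply by simp
  then show "dev R 1 (\<lambda>k i. r) k v x = (act R r v - v) x"
    by (simp add: dev_def del: sum_constant)
qed

text \<open>The weights \<open>2 ^ k\<close> grow slowly enough for the squared norms to be summable at \<open>v0\<close>, while their
  boundedness at \<open>w\<close> forces the deviations to tend to 0.\<close>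

lemma deviation_transport:
  fixes s :: "'i \<Rightarrow> nat \<Rightarrow> nat \<Rightarrow> 'a \<Rightarrow> 'a"
  assumes R: "unitary_rep G R" and R': "unitary_rep G R'" and qe: "quasi_equivalent G R R'"
    and A: "finite A" and s: "\<And>a k i. a \<in> A \<Longrightarrow> s a k i \<in> G"
    and v0: "v0 \<in> hspace R" "v0 \<noteq> 0"
    and dev: "\<And>a k. a \<in> A \<Longrightarrow> (hnorm R (dev R (z a) (s a) k v0))\<^sup>2 \<le> b / 8 ^ k"
  obtains w where "w \<in> hspace R'" "w \<noteq> 0"
    "\<And>a. a \<in> A \<Longrightarrow> (\<lambda>k. hnorm R' (dev R' (z a) (s a) k w)) \<longlonglongrightarrow> 0"
proof -
  interpret R: unitary_rep G R by fact
  interpret R': unitary_rep G R' by fact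
  define Y where "Y = (\<lambda>(a, k). deviation (z a) (s a) k)"
  \<comment> \<open>All families are indexed together by \<open>A \<times> UNIV\<close>, so that a
    single \<open>w\<close> serves every \<open>a\<close>.\<close>
  have "\<exists>w\<in>hspace R'. w \<noteq> 0 \<and> (\<exists>K. \<forall>i\<in>A \<times> UNIV. hnorm R' (gact R' (Y i) w) \<le> K)"
  proof (rule quasi_equivalent_transport[OF R R' qe _ v0])
    fix i assume "i \<in> A \<times> (UNIV :: nat set)"
    then obtain a k where i: "i = (a, k)" "a \<in> A" by auto
    have "snd ` set (Y i) \<subseteq> insert id (range (s a k))" by (auto simp: Y_def deviation_def i)
    also have "\<dots> \<subseteq> G" by (intro insert_subsetI image_subsetI R.id_mem s i)
    finally show "snd ` set (Y i) \<subseteq> G" .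
  next
    have sum: "(\<lambda>k. b * (1 / 2) ^ k) summable_on UNIV"
      by (intro norm_summable_imp_summable_on)
        (simp add: abs_mult power_abs summable_mult summable_geometric)
    have "(hnorm R (gact R (Y (a, k)) v0))\<^sup>2 \<le> b * (1 / 2) ^ k" if a: "a \<in> A" for a k
    proof -
      have pow: "((2::real) ^ k)\<^sup>2 = 4 ^ k" "(8::real) ^ k = 4 ^ k * 2 ^ k"
        by (simp_all add: power2_eq_square flip: power_mult_distrib)
      have "(hnorm R (gact R (Y (a, k)) v0))\<^sup>2 = 4 ^ k * (hnorm R (dev R (z a) (s a) k v0))\<^sup>2"
        using R.hnorm_gact_deviation[OF v0(1) s[OF a], where z = "z a" and k = k]
        by (simp add: Y_def power_mult_distrib pow)
      also have "\<dots> \<le> 4 ^ k * (b / 8 ^ k)" by (intro mult_left_mono dev a) simp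
      also have "\<dots> = b * (1 / 2) ^ k" by (simp add: pow power_divide)
      finally show ?thesis .
    qed
    then have "(\<lambda>k. (hnorm R (gact R (Y (a, k)) v0))\<^sup>2) summable_on UNIV" if "a \<in> A" for a
      using that by (intro summable_on_comparison_test[OF sum]) auto
    then have "((\<lambda>k. (hnorm R (gact R (Y (a, k)) v0))\<^sup>2) has_sum (\<Sum>\<^sub>\<infinity>k. (hnorm R (gact R (Y (a, k)) v0))\<^sup>2)) UNIV"
      if "a \<in> A" for a
      using that by (intro has_sum_infsum) auto
    then show "(\<lambda>i. (hnorm R (gact R (Y i) v0))\<^sup>2) summable_on A \<times> UNIV"
      by (rule summable_on_SigmaI) (use A in auto)
  qed
  then obtain w K where w: "w \<in> hspace R'" "w \<noteq> 0"
    and K: "\<And>a k. a \<in> A \<Longrightarrow> hnorm R' (gact R' (Y (a, k)) w) \<le> K" by blast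
  have "(\<lambda>k. hnorm R' (dev R' (z a) (s a) k w)) \<longlonglongrightarrow> 0" if a: "a \<in> A" for a
  proof (rule Lim_null_comparison[OF always_eventually], rule allI)
    fix k
    have "2 ^ k * hnorm R' (dev R' (z a) (s a) k w) \<le> K"
      using K[OF a, of k] R'.hnorm_gact_deviation[OF w(1) s[OF a], where z = "z a" and k = k] by (simp add: Y_def)
    moreover have "0 \<le> hnorm R' (dev R' (z a) (s a) k w)"
      unfolding R'.hnorm_nrm using R'.dev_mem[OF w(1) s[OF a]] by simp
    ultimately show "norm (hnorm R' (dev R' (z a) (s a) k w)) \<le> K * (1 / 2) ^ k"
      by (simp add: power_divide field_simps)
  next
    show "(\<lambda>k. K * (1 / 2) ^ k) \<longlonglongrightarrow> 0"
      by (intro tendsto_mult_right_zero LIMSEQ_realpow_zero) auto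
  qed
  with w that show thesis by blast
qed

section \<open>Vectors of the induced representations\<close>

locale thoma_pi = thoma_gns \<alpha> \<beta> n + tensor_data n "thoma_character \<alpha> \<beta>" la
  for \<alpha> \<beta> :: "nat \<Rightarrow> real" and n and la :: "nat list"

lemma thoma_piI: "thoma_params \<alpha> \<beta> \<Longrightarrow> thoma_pi \<alpha> \<beta> (sum_list la) la"
proof -
  assume "thoma_params \<alpha> \<beta>"
  then interpret thoma_gns \<alpha> \<beta> "sum_list la" by unfold_locales
  show ?thesis by unfold_locales simp
qed

context thoma_pi
begin

lemma Pi_eq: "PI = Pi_rep la \<alpha> \<beta>"
  by (simp add: Pi_rep_def Let_def n_def)

abbreviation "mass \<equiv> (\<Sum>x\<in>Sfin n. (cmod (young_symmetrizer la x))\<^sup>2)"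

lemma mass_pos: "mass > 0"
proof -
  have "0 < (cmod (young_symmetrizer la id))\<^sup>2" by (simp add: symmetrizer_id)
  also have "\<dots> \<le> mass" by (rule member_le_sum[OF fs.id_mem]) (simp_all add: finite_Sfin)
  finally show ?thesis .
qed

lemma Scofin_SN: "s \<in> Scofin n \<Longrightarrow> s \<in> SN"
proof -
  have "{n<..} \<subseteq> {1..}" by auto
  then show "s \<in> Scofin n \<Longrightarrow> s \<in> SN" using finsym_mono by blast
qed

lemma vacuum_ip_Scofin:
  assumes "s \<in> Scofin n" "t \<in> Scofin n"
  shows "inprod PI (act PI s vacuum) (act PI t vacuum) = of_real mass * chi (inv t \<circ> s)"
proof -
  have "inprod PI (act PI s vacuum) (act PI t vacuum) = inprod PI (act PI (inv t \<circ> s) vacuum) vacuum"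
    using assms by (intro Ind.U.ip_act_act Scofin_SN vacuum_mem)
  also have "\<dots> = of_real mass * chi (inv t \<circ> s)" using assms by (intro vacuum_ip) auto
  finally show ?thesis .
qed

lemma vacuum_ip_self: "inprod PI vacuum vacuum = of_real mass"
  using vacuum_ip[of id] Ind.U.act_id[OF vacuum_mem] by (simp add: thoma_id)

lemma vacuum_nonzero: "vacuum \<noteq> 0"
proof
  assume v: "vacuum = 0"
  have "inprod PI vacuum vacuum = 0"
    unfolding v using Ind.U.ip_zero_left[of 0] vacuum_mem v by simp
  then have "mass = 0" by (simp only: vacuum_ip_self of_real_eq_0_iff)
  then show False using mass_pos by simp
qed

text \<open>Up to the factor \<open>mass\<close>, inner products of translates of the vacuum are
  values of the character: \<open>p\<close> at one cycle and \<open>p^2\<close> at two disjoint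
  ones, which is the correlation required by \<open>average_correlated\<close>.\<close>

lemma cycle_deviation:
  assumes s: "\<And>k i. s k i \<in> Scofin n" "\<And>k i. cyclic_on (s k i) (D k i)" "\<And>k i. s k i permutes D k i"
    "\<And>k i. card (D k i) = l" and l: "l \<ge> 2" and disj: "\<And>k i j. i \<noteq> j \<Longrightarrow> D k i \<inter> D k j = {}"
  shows "(hnorm PI (dev PI (of_real (thoma_moment \<alpha> \<beta> l)) s k vacuum))\<^sup>2 \<le> mass / 8 ^ k"
proof -
  define p where "p = thoma_moment \<alpha> \<beta> l"
  have finD: "finite (D k i)" for k i using s(4)[of k i] l by (intro card_ge_0_finite) auto
  have chi1: "chi (s k i) = of_real p" for i
    using thoma_cyclic[OF s(2,3)] s(4) l by (simp add: p_def)
  have "(Ind.U.nrm (smul (1 / of_nat (card {..<(8::nat) ^ k})) (\<Sum>i\<in>{..<8 ^ k}. act PI (s k i) vacuum)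
      - smul (of_real p) vacuum))\<^sup>2 \<le> mass / real (card {..<(8::nat) ^ k})"
  proof (rule Ind.U.average_correlated)
    fix i
    show "act PI (s k i) vacuum \<in> hspace PI" by (intro Ind.U.act_mem Scofin_SN s vacuum_mem)
    show "inprod PI (act PI (s k i) vacuum) (act PI (s k i) vacuum) = of_real mass"
      using vacuum_ip_self Ind.U.act_ip[OF Scofin_SN[OF s(1)] vacuum_mem vacuum_mem] by simp
    show "inprod PI (act PI (s k i) vacuum) vacuum = of_real (p * mass)"
      using vacuum_ip[OF s(1)] chi1 by simp
    fix j assume ij: "i \<noteq> j"
    have "inprod PI (act PI (s k i) vacuum) (act PI (s k j) vacuum) = of_real mass * chi (inv (s k j) \<circ> s k i)"
      by (intro vacuum_ip_Scofin s)
    also have "chi (inv (s k j) \<circ> s k i) = of_real (p\<^sup>2)"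
      unfolding p_def using s l disj[of j i k] ij cyclic_on_inv[OF s(2,3) finD]
      by (intro chi_disjoint_cycles[of _ "D k j" _ _ "D k i"]) auto
    finally show "inprod PI (act PI (s k i) vacuum) (act PI (s k j) vacuum) = of_real (p\<^sup>2 * mass)"
      by simp
  qed (simp_all add: vacuum_mem vacuum_ip_self)
  then show ?thesis by (simp add: Ind.U.hnorm_nrm dev_def p_def)
qed

lemma swp_SN: "1 \<le> a \<Longrightarrow> 1 \<le> j \<Longrightarrow> swp a j \<in> SN"
proof -
  assume "1 \<le> a" "1 \<le> j"
  then have "swp a j permutes {1..}" by (intro permutes_swap_id) auto
  moreover have "finite {i. swp a j i \<noteq> i}"
    by (rule finite_subset[of _ "{a, j}"]) (auto simp: Transposition.transpose_def)
  ultimately show ?thesis by (simp add: finsym_def)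
qed

text \<open>The product of two different transpositions \<open>(a j)\<close> sends \<open>a\<close>
  beyond \<open>n\<close> and hence leaves the Young subgroup, so the translates of the vacuum are
  pairwise orthogonal.\<close>

lemma star_deviation:
  assumes a: "a \<in> {1..n}" and t: "\<And>k i. t k i > n" "\<And>k. inj (t k)"
  shows "(hnorm PI (dev PI 0 (\<lambda>k i. swp a (t k i)) k vacuum))\<^sup>2 \<le> mass / 8 ^ k"
proof -
  have sS: "swp a (t k i) \<in> SN" for i using a t(1)[of k i] by (intro swp_SN) auto
  have "(Ind.U.nrm (smul (1 / of_nat (card {..<(8::nat) ^ k})) (\<Sum>i\<in>{..<8 ^ k}. act PI (swp a (t k i)) vacuum)))\<^sup>2
    \<le> mass / real (card {..<(8::nat) ^ k})"
  proof (rule Ind.U.average_orthogonal)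
    fix i
    show m: "act PI (swp a (t k i)) vacuum \<in> hspace PI" by (intro Ind.U.act_mem sS vacuum_mem)
    show "(Ind.U.nrm (act PI (swp a (t k i)) vacuum))\<^sup>2 \<le> mass"
      using vacuum_ip_self Ind.U.nrm_sq[OF vacuum_mem] by (simp add: Ind.U.act_nrm sS vacuum_mem)
    fix j assume ij: "i \<noteq> j"
    let ?s = "swp a (t k j) \<circ> swp a (t k i)"
    have "inprod PI (act PI (swp a (t k i)) vacuum) (act PI (swp a (t k j)) vacuum)
      = inprod PI (act PI (inv (swp a (t k j)) \<circ> swp a (t k i)) vacuum) vacuum"
      by (intro Ind.U.ip_act_act sS vacuum_mem)
    also have "\<dots> = 0"
      unfolding inv_transpose_eq
    proof (rule vacuum_ip_out)
      show "?s \<in> SN" by (intro fs.comp_mem sS)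
      have "t k i \<noteq> t k j" using t(2)[of k] ij by (auto dest: injD)
      then have "?s a = t k i" using a t(1)[of k i] by (auto simp: Transposition.transpose_def)
      then have "?s a \<notin> {1..n}" using t(1)[of k i] by simp
      then show "?s \<notin> K" using a unfolding young_subgroup_iff by blast
    qed
    finally show "inprod PI (act PI (swp a (t k i)) vacuum) (act PI (swp a (t k j)) vacuum) = 0" .
  qed simp_all
  then show ?thesis by (simp add: Ind.U.hnorm_nrm dev_def)
qed

lemma row_deviation:
  assumes r: "r \<in> row_group la"
  shows "(hnorm PI (dev PI 1 (\<lambda>k i. r) k vacuum))\<^sup>2 \<le> mass / 8 ^ k"
proof -
  have "act PI r vacuum = vacuum"
    using row_group_Sfin[OF r] symmetrizer_left[OF r] n_def by (intro vacuum_invariant) auto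
  then have "dev PI 1 (\<lambda>k i. r) k vacuum = 0"
    by (simp add: dev_const)
  then show ?thesis using mass_pos by (simp add: Ind.U.hnorm_nrm)
qed

lemma component_linear:
  "component (u - v) g x = component u g x - component v g x"
  "component (smul c u) g x = smul c (component u g x)"
  "component (\<Sum>i\<in>I. f i) g x = (\<Sum>i\<in>I. component (f i) g x)"
  by (simp_all add: component_def slice_def fun_eq_iff sum_fun_apply)

text \<open>From \<open>k = m\<close> on the conjugates by \<open>g\<close> lie in
  \<open>Scofin n\<close>, where \<open>component_act\<close> applies; the shift by \<open>m\<close>
  drops the earlier terms.\<close>

lemma component_dev_tendsto:
  assumes w: "w \<in> hspace PI" and s: "\<And>k i. s k i \<in> SN" and lim: "(\<lambda>k. hnorm PI (dev PI z s k w)) \<longlonglongrightarrow> 0"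
    and g: "g \<in> SN" and t: "\<And>k i. k \<ge> m \<Longrightarrow> inv g \<circ> s k i \<circ> g = t k i" "\<And>k i. k \<ge> m \<Longrightarrow> t k i \<in> Scofin n"
  shows "(\<lambda>k. U.nrm (dev GNS z t (k + m) (component w g x))) \<longlonglongrightarrow> 0"
proof (rule Lim_null_comparison[OF always_eventually], rule allI)
  fix k
  have "component (act PI (s (k + m) i) w) g x = act GNS (t (k + m) i) (component w g x)" for i
    using component_act[OF w g s] t[of "k + m"] by simp
  then have e: "component (dev PI z s (k + m) w) g x = dev GNS z t (k + m) (component w g x)"
    unfolding dev_def component_linear by simp
  have d: "dev PI z s (k + m) w \<in> hspace PI" by (intro Ind.U.dev_mem w s)
  have "hnorm GNS (component (dev PI z s (k + m) w) g x) \<le> hnorm PI (dev PI z s (k + m) w)"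
    by (rule component_nrm_le[OF d g])
  moreover have "U.nrm (dev GNS z t (k + m) (component w g x)) \<ge> 0"
    unfolding e[symmetric] by (intro U.nrm_nonneg component_mem d g)
  ultimately show "norm (U.nrm (dev GNS z t (k + m) (component w g x))) \<le> hnorm PI (dev PI z s (k + m) w)"
    unfolding e U.hnorm_nrm by simp
next
  show "(\<lambda>k. hnorm PI (dev PI z s (k + m) w)) \<longlonglongrightarrow> 0"
    using lim by (rule LIMSEQ_ignore_initial_segment)
qed

lemma SN_finite_support:
  assumes "g \<in> SN" obtains m where "\<And>i. i > m \<Longrightarrow> g i = i"
proof -
  have "finite {i. g i \<noteq> i}" using assms by (simp add: finsym_def)
  then obtain m where "\<forall>i\<in>{i. g i \<noteq> i}. i \<le> m" using finite_nat_set_iff_bounded_le by blast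
  then show thesis using that by (meson mem_Collect_eq not_le)
qed

lemma pow8_at_top: "filterlim (\<lambda>k. (8::nat) ^ (k + m)) at_top sequentially"
proof (rule filterlim_at_top_mono[OF filterlim_ident always_eventually], rule allI)
  fix k :: nat
  have "k \<le> k + m" by simp
  also have "\<dots> \<le> 8 ^ (k + m)" using less_exp[of "k + m"] power_mono[of "2::nat" 8 "k + m"] by linarith
  finally show "k \<le> 8 ^ (k + m)" .
qed

text \<open>Cycles beyond the support of \<open>g\<close> commute with \<open>g\<close>, so a
  nonzero component of \<open>w\<close> at \<open>g\<close> sees the very same cycles, and
  \<open>cycle_average_limit\<close> applies to it.\<close>

lemma cycle_limit:
  assumes w: "w \<in> hspace PI" "w \<noteq> 0"
    and s: "\<And>k i. s k i \<in> SN" "\<And>k i. cyclic_on (s k i) (D k i)" "\<And>k i. s k i permutes D k i"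
      "\<And>k i. card (D k i) = l" "\<And>k i. D k i \<subseteq> {k<..}"
    and l: "l \<ge> 2" and disj: "\<And>k i j. i \<noteq> j \<Longrightarrow> D k i \<inter> D k j = {}"
    and lim: "(\<lambda>k. hnorm PI (dev PI z s k w)) \<longlonglongrightarrow> 0"
  shows "z = of_real (thoma_moment \<alpha> \<beta> l)"
proof -
  obtain g x where g: "g \<in> SN" and c: "component w g x \<noteq> 0" using component_nonzero[OF w] .
  obtain m where m: "\<And>i. i > m \<Longrightarrow> g i = i" using SN_finite_support[OF g] by blast
  have conj: "inv g \<circ> s k i \<circ> g = s k i" if k: "k \<ge> m + n" for k i
  proof -
    have gD: "g y = y" if "y \<in> D k i" for y using that s(5)[of k i] k by (intro m) auto
    have "s k i (g y) = g (s k i y)" for y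
    proof (cases "y \<in> D k i")
      case True
      then show ?thesis using gD permutes_in_image[OF s(3)] by simp
    next
      case False
      have "g y \<notin> D k i"
        using gD[of "g y"] False bij_is_inj[OF fs.bij_mem[OF g]] by (metis injD)
      then show ?thesis using False s(3)[of k i] by (simp add: permutes_not_in)
    qed
    then have "s k i \<circ> g = g \<circ> s k i" by auto
    then show ?thesis unfolding o_assoc[symmetric] by (simp only: fs.inv_comp_assoc[OF g])
  qed
  have S: "s k i \<in> Scofin n" if "k \<ge> m + n" for k i
  proof -
    have "D k i \<subseteq> {n<..}" using s(5)[of k i] that by auto
    then show ?thesis using s(1)[of k i] s(3)[of k i] by (auto simp: finsym_def intro: permutes_subset)
  qed
  have cm: "component w g x \<in> hspace GNS" by (rule component_mem[OF w(1) g])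
  have "(\<lambda>k. U.nrm (dev GNS z s (k + (m + n)) (component w g x))) \<longlonglongrightarrow> 0"
    by (rule component_dev_tendsto[OF w(1) s(1) lim g conj S])
  then have "(\<lambda>k. U.nrm (smul (1 / of_nat (8 ^ (k + (m + n)))) (\<Sum>i<8 ^ (k + (m + n)). act GNS (s (k + (m + n)) i) (component w g x))
      - smul z (component w g x))) \<longlonglongrightarrow> 0"
    unfolding dev_def .
  from cycle_average_limit[OF S[OF le_add2] s(2) s(3) s(4) l disj pow8_at_top cm c this]
  show ?thesis .
qed

text \<open>Conjugation by \<open>g\<close> turns \<open>(a j)\<close> with \<open>j\<close> far
  away into \<open>(b j)\<close> with \<open>b = inv g a\<close>. If \<open>b\<close> exceeded
  \<open>n\<close>, these transpositions would act on the component inside the GNS space, and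
  \<open>star_kernel_trivial\<close> would make it 0.\<close>

lemma star_limit:
  assumes full: "(\<Sum>i. \<alpha> i) + (\<Sum>i. \<beta> i) = 1"
    and w: "w \<in> hspace PI" and g: "g \<in> SN" and c: "component w g x \<noteq> 0"
    and a: "1 \<le> a" and t: "\<And>k i. t k i > k" "\<And>k. inj (t k)"
    and lim: "(\<lambda>k. hnorm PI (dev PI 0 (\<lambda>k i. swp a (t k i)) k w)) \<longlonglongrightarrow> 0"
  shows "inv g a \<in> {1..n}"
proof (rule ccontr)
  define b where "b = inv g a"
  assume "inv g a \<notin> {1..n}"
  moreover have "inv g permutes {1..}" using fs.inv_mem[OF g] by (simp add: finsym_def)
  then have "inv g a \<ge> 1" using a permutes_in_image[of "inv g" "{1..}" a] by simp
  ultimately have b: "n < b" by (auto simp: b_def)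
  obtain m where m: "\<And>i. i > m \<Longrightarrow> g i = i" using SN_finite_support[OF g] by blast
  \<comment> \<open>Past \<open>q\<close> the points \<open>t k i\<close> lie beyond the support of
    \<open>g\<close>, beyond \<open>n\<close> and beyond \<open>b\<close>.\<close>
  define q where "q = m + n + b"
  have gb: "bij g" using g by (rule fs.bij_mem)
  have tb: "t k i > b" "t k i > n" if "k \<ge> q" for k i
    using t(1)[of k i] that by (auto simp: q_def)
  have conj: "inv g \<circ> swp a (t k i) \<circ> g = swp b (t k i)" if k: "k \<ge> q" for k i
  proof -
    have "g (t k i) = t k i" using t(1)[of k i] k by (intro m) (auto simp: q_def)
    then have "inv g (t k i) = t k i" using bij_inv_eq_iff[OF gb] by metis
    then have "swp a (t k i) \<circ> g = g \<circ> swp b (t k i)"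
      using transpose_comp_eq[OF gb, of a "t k i"] by (simp only: b_def)
    then show ?thesis unfolding o_assoc[symmetric] by (simp only: fs.inv_comp_assoc[OF g])
  qed
  have S: "swp b (t k i) \<in> Scofin n" if "k \<ge> q" for k i
  proof -
    have "swp b (t k i) permutes {n<..}" using b tb[OF that] by (intro permutes_swap_id) auto
    moreover have "finite {y. swp b (t k i) y \<noteq> y}"
      by (rule finite_subset[of _ "{b, t k i}"]) (auto simp: Transposition.transpose_def)
    ultimately show ?thesis by (simp add: finsym_def)
  qed
  have sS: "swp a (t k i) \<in> SN" for k i using a t(1)[of k i] by (intro swp_SN) auto
  have cm: "component w g x \<in> hspace GNS" by (rule component_mem[OF w g])
  have "(\<lambda>k. U.nrm (dev GNS 0 (\<lambda>k i. swp b (t k i)) (k + q) (component w g x))) \<longlonglongrightarrow> 0"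
    by (rule component_dev_tendsto[OF w sS lim g conj S])
  moreover have "dev GNS 0 (\<lambda>k i. swp b (t k i)) (k + q) (component w g x)
    = smul (1 / of_nat (card (t (k + q) ` {..<8 ^ (k + q)}))) (\<Sum>j\<in>t (k + q) ` {..<8 ^ (k + q)}. act GNS (swp b j) (component w g x))" for k
    using t(2)[of "k + q"] by (simp add: dev_def sum.reindex card_image inj_on_subset[OF _ subset_UNIV])
  ultimately have lim': "(\<lambda>k. U.nrm (smul (1 / of_nat (card (t (k + q) ` {..<8 ^ (k + q)})))
      (\<Sum>j\<in>t (k + q) ` {..<8 ^ (k + q)}. act GNS (swp b j) (component w g x)))) \<longlonglongrightarrow> 0" by simp
  have "component w g x = 0"
  proof (rule star_kernel_trivial[OF full b _ _ _ _ _ cm lim'])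
    fix k
    show "finite (t (k + q) ` {..<8 ^ (k + q)})" by simp
    show "t (k + q) ` {..<8 ^ (k + q)} \<subseteq> {n<..}" using tb[of "k + q"] by auto
    show "b \<notin> t (k + q) ` {..<8 ^ (k + q)}" using tb(1)[of "k + q"] by force
    show "t (k + q) ` {..<8 ^ (k + q)} \<noteq> {}" by (simp add: lessThan_empty_iff)
  next
    have "card (t (k + q) ` {..<8 ^ (k + q)}) = 8 ^ (k + q)" for k
      using t(2)[of "k + q"] by (simp add: card_image inj_on_subset[OF _ subset_UNIV])
    then show "filterlim (\<lambda>k. card (t (k + q) ` {..<8 ^ (k + q)})) at_top sequentially"
      using pow8_at_top[of q] by simp
  qed
  then show False using c by simp
qed

text \<open>The deviation does not depend on \<open>k\<close>, so it tends to 0 only by being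
  0.\<close>

lemma row_limit:
  assumes w: "w \<in> hspace PI" and r: "r \<in> SN" and lim: "(\<lambda>k. hnorm PI (dev PI 1 (\<lambda>k i. r) k w)) \<longlonglongrightarrow> 0"
  shows "act PI r w = w"
proof -
  have "hnorm PI (act PI r w - w) = 0" using lim unfolding dev_const by (simp add: LIMSEQ_const_iff)
  then have "act PI r w - w = 0"
    using Ind.U.nrm_eq_0_iff[of "act PI r w - w"] w r by (simp add: Ind.U.hnorm_nrm)
  then show ?thesis by simp
qed

text \<open>Elements of \<open>Sfin n\<close> keep the identity coset and act there by left
  translation of the Young variable, so invariance can be read off at the identity.\<close>

lemma invariant_base:
  assumes w: "w \<in> hspace PI" and r: "r \<in> Sfin n" and inv: "act PI r w = w"
  shows "w (id, r \<circ> x, y) = w (id, x, y)"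
proof -
  have rK: "inv r \<in> K" using r by (intro Sfin_young fs.inv_mem)
  have "slice w (id \<circ> inv r) = act TR (inv (inv r)) (slice w id)"
    by (rule Ind.equivariant[OF w fs.id_mem rK])
  moreover have "slice w (id \<circ> inv r) = slice (act PI r w) id"
    by (simp only: Ind.slice_act id_comp comp_id)
  ultimately have "slice w id (r \<circ> x, y) = act TR r (slice w id) (r \<circ> x, y)"
    using inv fs.inv_inv[OF r] by simp
  also have "\<dots> = slice w id (inv r \<circ> (r \<circ> x), inv id \<circ> y)"
    by (simp only: act_TR perm_part_of_Sfin[OF r])
  also have "\<dots> = slice w id (x, y)"
    by (simp only: fs.inv_comp_assoc[OF r] inv_id id_comp)
  finally show ?thesis by (simp only: slice_def)
qed

text \<open>Equivariance ties the value at any \<open>g\<close> in \<open>K\<close> to the value at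
  the identity, where a nonzero element of the Young representation can be extracted.\<close>

lemma base_nonzero:
  assumes w: "w \<in> hspace PI" and g: "g \<in> K" and c: "component w g x \<noteq> 0"
  obtains y where "(\<lambda>x. w (id, x, y)) \<noteq> 0" "(\<lambda>x. w (id, x, y)) \<in> ideal la"
proof -
  have "slice w (id \<circ> g) = act TR (inv g) (slice w id)"
    by (rule Ind.equivariant[OF w fs.id_mem g])
  then have e: "slice w g = act TR (inv g) (slice w id)" by (simp only: id_comp)
  obtain y where "component w g x y \<noteq> 0" using c by (auto simp: fun_eq_iff)
  then have "slice w g (x, y) \<noteq> 0" by (simp add: component_def slice_def)
  then have "slice w id (inv (perm_part {1..n} (inv g)) \<circ> x, inv (perm_part {n<..} (inv g)) \<circ> y) \<noteq> 0"
    unfolding e act_TR .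
  then have "w (id, inv (perm_part {1..n} (inv g)) \<circ> x, inv (perm_part {n<..} (inv g)) \<circ> y) \<noteq> 0"
    by (simp only: slice_def not_False_eq_True)
  then have "(\<lambda>x. w (id, x, inv (perm_part {n<..} (inv g)) \<circ> y)) \<noteq> 0" by (auto simp: fun_eq_iff)
  moreover have "slice w id \<in> hspace TR" by (rule Ind.slice_H[OF w fs.id_mem])
  then have "(\<lambda>x. w (id, x, inv (perm_part {n<..} (inv g)) \<circ> y)) \<in> ideal la"
    unfolding mem_TR by (simp add: slice_def)
  ultimately show thesis by (rule that)
qed

end

section \<open>The parameters and the diagram are determined\<close>

lemma exists_cycle_on:
  fixes D :: "'a set"
  assumes "finite D" "D \<noteq> {}"
  shows "\<exists>c. cyclic_on c D \<and> c permutes D"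
  using assms
proof (induction D rule: finite_ne_induct)
  case (singleton x)
  have "orbit id x = {x}" by (simp add: orbit_eq_singleton_iff)
  then have "cyclic_on id {x}" by (auto simp: cyclic_on_def)
  then show ?case using permutes_id by blast
next
  case (insert x D)
  then obtain c where c: "cyclic_on c D" "c permutes D" by blast
  obtain a where a: "a \<in> D" using insert by blast
  have "cyclic_on (swp a x \<circ> c) (insert x D)" using c a insert by (intro cyclic_on_transpose_insert)
  moreover have "(swp a x \<circ> c) permutes insert x D"
    using c a by (intro permutes_compose permutes_swap_id) (auto intro: permutes_subset)
  ultimately show ?case by blast
qed

lemma quasi_equivalent_moments:
  assumes T: "thoma_params \<alpha> \<beta>" and T': "thoma_params \<alpha>' \<beta>'"
    and qe: "quasi_equivalent SN (Pi_rep la \<alpha> \<beta>) (Pi_rep la' \<alpha>' \<beta>')" and l: "l \<ge> 2"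
  shows "thoma_moment \<alpha> \<beta> l = thoma_moment \<alpha>' \<beta>' l"
proof -
  interpret P: thoma_pi \<alpha> \<beta> "sum_list la" la by (rule thoma_piI[OF T])
  interpret P': thoma_pi \<alpha>' \<beta>' "sum_list la'" la' by (rule thoma_piI[OF T'])
  \<comment> \<open>Consecutive blocks of length \<open>l\<close>, shifted past
    \<open>sum_list la\<close> so that the cycles lie in \<open>Scofin\<close>, and past
    \<open>k\<close> so that they leave every finite set.\<close>
  define D where "D k i = {Suc (k + sum_list la + i * l) ..< Suc (k + sum_list la + i * l) + l}" for k i
  define s where "s k i = (SOME c. cyclic_on c (D k i) \<and> c permutes D k i)" for k i
  have cD: "card (D k i) = l" and fD: "finite (D k i)" for k i by (simp_all add: D_def)
  have "D k i \<noteq> {}" for k i using cD[of k i] l by auto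
  then have s: "cyclic_on (s k i) (D k i)" "s k i permutes D k i" for k i
    using someI_ex[OF exists_cycle_on[OF fD]] by (auto simp: s_def)
  have sub: "D k i \<subseteq> {sum_list la<..}" "D k i \<subseteq> {k<..}" for k i by (auto simp: D_def)
  have sS: "s k i \<in> Scofin (sum_list la)" for k i
    using s(2)[of k i] sub(1)[of k i] fD[of k i]
    by (auto simp: finsym_def intro: permutes_subset finite_moved)
  have disj: "D k i \<inter> D k j = {}" if "i \<noteq> j" for k i j
  proof -
    have *: "D k i \<inter> D k j = {}" if "i < j" for i j
    proof -
      have "i * l + l \<le> j * l" using mult_le_mono1[of "Suc i" j l] that by simp
      then show ?thesis by (auto simp: D_def)
    qed
    show ?thesis using that *[of i j] *[of j i] by (cases "i < j") auto
  qed
  define z where "z = complex_of_real (thoma_moment \<alpha> \<beta> l)"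
  have dev: "(hnorm P.PI (dev P.PI z s k P.vacuum))\<^sup>2 \<le> P.mass / 8 ^ k" for k
    unfolding z_def by (rule P.cycle_deviation[OF sS s cD l disj])
  have qe': "quasi_equivalent SN P.PI P'.PI" using qe by (simp only: P.Pi_eq P'.Pi_eq)
  obtain w where w: "w \<in> hspace P'.PI" "w \<noteq> 0" "(\<lambda>k. hnorm P'.PI (dev P'.PI z s k w)) \<longlonglongrightarrow> 0"
  proof (rule deviation_transport[OF P.Pi_unitary P'.Pi_unitary qe', of "{()}" "\<lambda>_. s" P.vacuum "\<lambda>_. z" P.mass])
    show "s k i \<in> SN" for k i by (rule P.Scofin_SN[OF sS])
  qed (use P.vacuum_mem P.vacuum_nonzero dev in auto)
  have "z = of_real (thoma_moment \<alpha>' \<beta>' l)"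
    by (rule P'.cycle_limit[OF w(1,2) P.Scofin_SN[OF sS] s cD sub(2) l disj w(3)])
  then show ?thesis by (simp add: z_def)
qed

lemma quasi_equivalent_diagram_le:
  assumes T: "thoma_params \<alpha> \<beta>" and full: "(\<Sum>i. \<alpha> i) + (\<Sum>i. \<beta> i) = 1" and la': "is_young la'"
    and qe: "quasi_equivalent SN (Pi_rep la \<alpha> \<beta>) (Pi_rep la' \<alpha> \<beta>)"
  shows "sum_list la \<le> sum_list la' \<and> (sum_list la = sum_list la' \<longrightarrow> (\<forall>k. row_sum la k \<le> row_sum la' k))"
proof -
  interpret P: thoma_pi \<alpha> \<beta> "sum_list la" la by (rule thoma_piI[OF T])
  interpret P': thoma_pi \<alpha> \<beta> "sum_list la'" la' by (rule thoma_piI[OF T])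
  let ?n = "sum_list la" and ?n' = "sum_list la'"
  define t where "t k i = Suc (?n + k + i)" for k i
  have t: "t k i > ?n" "t k i > k" "inj (t k)" for k i
    by (auto simp: t_def inj_def)
  \<comment> \<open>The stars of the points up to \<open>n\<close> and the row permutations are put
    into one finite index set, because the same \<open>w\<close> has to satisfy both kinds of
    conditions.\<close>
  define A where "A = Inl ` {1..?n} \<union> Inr ` row_group la"
  define s where "s = case_sum (\<lambda>a k i. swp a (t k i)) (\<lambda>r (k::nat) (i::nat). r)"
  define z where "z = case_sum (\<lambda>a::nat. 0) (\<lambda>r::nat \<Rightarrow> nat. 1 :: complex)"
  have rS: "r \<in> SN" if "r \<in> row_group la" for r
  proof -
    have "{1..?n} \<subseteq> {1..}" by auto
    then show ?thesis using row_group_Sfin[OF that] finsym_mono by blast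
  qed
  have sS: "s a k i \<in> SN" if "a \<in> A" for a k i
  proof -
    have "swp b (t k i) \<in> SN" if "b \<in> {1..?n}" for b
      using that t(1)[of k i] by (intro P.swp_SN) auto
    then show ?thesis using that rS by (auto simp: A_def s_def)
  qed
  have dev: "(hnorm P.PI (dev P.PI (z a) (s a) k P.vacuum))\<^sup>2 \<le> P.mass / 8 ^ k" if "a \<in> A" for a k
  proof -
    have "(hnorm P.PI (dev P.PI 0 (\<lambda>k i. swp b (t k i)) k P.vacuum))\<^sup>2 \<le> P.mass / 8 ^ k"
      if "b \<in> {1..?n}" for b
      using that t(1,3) by (rule P.star_deviation)
    moreover have "(hnorm P.PI (dev P.PI 1 (\<lambda>k i. r) k P.vacuum))\<^sup>2 \<le> P.mass / 8 ^ k"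
      if "r \<in> row_group la" for r
      using that by (rule P.row_deviation)
    ultimately show ?thesis using that unfolding A_def s_def z_def by (elim UnE imageE) simp_all
  qed
  have qe': "quasi_equivalent SN P.PI P'.PI" using qe by (simp only: P.Pi_eq P'.Pi_eq)
  have finA: "finite A" by (simp add: A_def finite_row_group)
  obtain w where w: "w \<in> hspace P'.PI" "w \<noteq> 0"
    and lim: "\<And>a. a \<in> A \<Longrightarrow> (\<lambda>k. hnorm P'.PI (dev P'.PI (z a) (s a) k w)) \<longlonglongrightarrow> 0"
  proof (rule deviation_transport[OF P.Pi_unitary P'.Pi_unitary qe' finA sS P.vacuum_mem P.vacuum_nonzero dev])
    fix w
    assume "w \<in> hspace P'.PI" "w \<noteq> 0" "\<And>a. a \<in> A \<Longrightarrow> (\<lambda>k. hnorm P'.PI (dev P'.PI (z a) (s a) k w)) \<longlonglongrightarrow> 0"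
    then show thesis by (rule that)
  qed
  obtain g x where g: "g \<in> SN" and c: "P'.component w g x \<noteq> 0" using P'.component_nonzero[OF w] .
  have in_n': "inv g a \<in> {1..?n'}" if a: "a \<in> {1..?n}" for a
  proof -
    have "(\<lambda>k. hnorm P'.PI (dev P'.PI 0 (\<lambda>k i. swp a (t k i)) k w)) \<longlonglongrightarrow> 0"
      using lim[of "Inl a"] a by (simp add: A_def s_def z_def)
    then show ?thesis
      using a t(2,3) by (intro P'.star_limit[OF full w(1) g c, of a t]) auto
  qed
  have "inj_on (inv g) {1..?n}"
    using bij_is_inj[OF fs.bij_mem[OF fs.inv_mem[OF g]]] by (rule inj_on_subset) simp
  then have "card {1..?n} \<le> card {1..?n'}" using in_n' by (intro card_inj_on_le) auto
  then have le: "?n \<le> ?n'" by simp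
  moreover have "row_sum la k \<le> row_sum la' k" if eq: "?n = ?n'" for k
  proof (rule ccontr)
    assume k: "\<not> row_sum la k \<le> row_sum la' k"
    \<comment> \<open>For equal sizes \<open>inv g\<close> maps \<open>{1..n}\<close> into itself.
      Hence \<open>g\<close> lies in the Young subgroup, and the nonzero component belongs to the
      identity coset, where the row group acts by translation.\<close>
    have "inv g \<in> young_subgroup ?n'"
      using in_n' eq fs.inv_mem[OF g] by (auto simp: young_subgroup_iff)
    then have "inv (inv g) \<in> young_subgroup ?n'" by (rule P'.T.inv_mem)
    then have gK: "g \<in> young_subgroup ?n'" by (simp only: fs.inv_inv[OF g])
    obtain y where y: "(\<lambda>x. w (id, x, y)) \<noteq> 0" "(\<lambda>x. w (id, x, y)) \<in> ideal la'"
      using P'.base_nonzero[OF w(1) gK c] .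
    have "(\<lambda>x. w (id, x, y)) = 0"
    proof (rule ideal_row_invariant_zero[OF la' eq _ y(2)])
      show "row_sum la k > row_sum la' k" using k by simp
      fix r u assume r: "r \<in> row_group la"
      have "(\<lambda>k. hnorm P'.PI (dev P'.PI 1 (\<lambda>k i. r) k w)) \<longlonglongrightarrow> 0"
        using lim[of "Inr r"] r by (simp add: A_def s_def z_def)
      then have "act P'.PI r w = w" by (rule P'.row_limit[OF w(1) rS[OF r]])
      moreover have "r \<in> Sfin ?n'" using row_group_Sfin[OF r] eq by simp
      ultimately show "w (id, r \<circ> u, y) = w (id, u, y)" by (intro P'.invariant_base[OF w(1)])
    qed
    then show False using y(1) by contradiction
  qed
  ultimately show ?thesis by blast
qed

theorem theorem5:
  fixes \<alpha> \<beta> \<alpha>' \<beta>' :: "nat \<Rightarrow> real" and la la' :: "nat list"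
  assumes "thoma_params \<alpha> \<beta>" and "thoma_params \<alpha>' \<beta>'"
    and "is_young la" and "is_young la'"
    and "(\<Sum>i. \<alpha> i) + (\<Sum>i. \<beta> i) = 1"
  shows "quasi_equivalent SN (Pi_rep la \<alpha> \<beta>) (Pi_rep la' \<alpha>' \<beta>') \<longleftrightarrow>
    (\<forall>i. \<alpha> i = \<alpha>' i) \<and> (\<forall>i. \<beta> i = \<beta>' i) \<and> la = la'"
proof
  assume qe: "quasi_equivalent SN (Pi_rep la \<alpha> \<beta>) (Pi_rep la' \<alpha>' \<beta>')"
  have eq: "\<alpha> = \<alpha>' \<and> \<beta> = \<beta>'"
    by (rule moments_determine[OF assms(1,2) quasi_equivalent_moments[OF assms(1,2) qe]])
  have U: "unitary_rep SN (Pi_rep xs \<alpha> \<beta>)" for xs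
  proof -
    interpret P: thoma_pi \<alpha> \<beta> "sum_list xs" xs by (rule thoma_piI[OF assms(1)])
    show ?thesis using P.Pi_unitary by (simp only: P.Pi_eq)
  qed
  \<comment> \<open>With the parameters identified, the condition on their sum holds on both sides,
    so the comparison of the diagrams can be run in both directions.\<close>
  have qe1: "quasi_equivalent SN (Pi_rep la \<alpha> \<beta>) (Pi_rep la' \<alpha> \<beta>)" using qe eq by simp
  have qe2: "quasi_equivalent SN (Pi_rep la' \<alpha> \<beta>) (Pi_rep la \<alpha> \<beta>)"
    by (rule quasi_equivalent_sym[OF U U qe1])
  note le = quasi_equivalent_diagram_le[OF assms(1,5,4) qe1] quasi_equivalent_diagram_le[OF assms(1,5,3) qe2]
  then have n: "sum_list la = sum_list la'" by simp
  then have "row_sum la k = row_sum la' k" for k using le by (simp add: le_antisym)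
  then have "la = la'" by (rule row_sums_determine[OF assms(3,4)])
  then show "(\<forall>i. \<alpha> i = \<alpha>' i) \<and> (\<forall>i. \<beta> i = \<beta>' i) \<and> la = la'" using eq by simp
next
  assume "(\<forall>i. \<alpha> i = \<alpha>' i) \<and> (\<forall>i. \<beta> i = \<beta>' i) \<and> la = la'"
  then have "\<alpha> = \<alpha>'" "\<beta> = \<beta>'" "la = la'" by auto
  then show "quasi_equivalent SN (Pi_rep la \<alpha> \<beta>) (Pi_rep la' \<alpha>' \<beta>')"
    using quasi_equivalent_refl by simp
qed

end
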